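(* Let $u\in W^{2k+2,\infty}(\Omega)$ be the solution of $u_t=u_{xx}$, $u(x,0)=u_0(x)$, with periodic or mixed boundary conditions, let $q=u_x$, and let $u_h,q_h$ be the solution of the LDG scheme with flux choice (I) or (II). Suppose the initial solution is $u_h(\cdot,0)=u_I^k(\cdot,0)$, with $u_I^k$ the interpolation function (with $l=k$) corresponding to the flux choice used. For $(e,e_h)=(u,u_h)$ or $(q,q_h)$ define the domain average and the cell average $$\|e_u\|_d=\left|\frac1{2\pi}\int_0^{2\pi}(u-u_h)(x,t)\,dx\right|,\qquad \|e_u\|_c=\left(\frac1N\sum_{j=1}^N\Big(\frac1{h_j}\int_{x_{j-\frac12}}^{x_{j+\frac12}}(u-u_h)(x,t)\,dx\Big)^2\right)^{\frac12},$$ and $\|e_q\|_d,\|e_q\|_c$ in the same way with $q-q_h$ in place of $u-u_h$. Then $$\|e_u\|_c\lesssim(h+t^{\frac32}+t)h^{2k}\|u\|_{2k+2,\infty},\qquad \|e_q\|_c\lesssim(1+t)h^{2k}\|u\|_{2k+2,\infty}.$$ In addition, for the periodic boundary condition, $$\|e_u\|_d\lesssim h^{2k+1}\|u\|_{2k+2,\infty},\qquad \|e_q\|_d=0,$$ and for the mixed boundary conditions, $$\|e_u\|_d\lesssim(h^{\frac12}+t^{\frac32}+t)h^{2k+\frac12}\|u\|_{2k+2,\infty},\qquad \|e_q\|_d\lesssim(1+t)h^{2k+\frac12}\|u\|_{2k+2,\infty}.$$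
   Context: Equation: $u_t=u_{xx}$, $(x,t)\in[0,2\pi]\times(0,T]$, $u(x,0)=u_0(x)$, with $u_0$ sufficiently smooth; $\Omega=[0,2\pi]$. Boundary conditions: periodic, $u(0,t)=u(2\pi,t)$; or mixed, $u(0,t)=g_0(t),\,u_x(2\pi,t)=g_1(t)$, or $u_x(0,t)=g_0(t),\,u(2\pi,t)=g_1(t)$. Norms: $\|\cdot\|_{m,\infty}$ is the $W^{m,\infty}(\Omega)$ norm in $x$, with $\|u\|_{m,\infty}$ taken uniformly in time (supremum over $[0,T]$). $A\lesssim B$ means $A\le CB$ with $C$ independent of the mesh size $h$ (and of $t\in[0,T]$). Mesh: $0=x_{\frac12}<\cdots<x_{N+\frac12}=2\pi$, $\tau_j=(x_{j-\frac12},x_{j+\frac12})$, $x_j$ the midpoint, $h_j=x_{j+\frac12}-x_{j-\frac12}$, $\bar h_j=h_j/2$, $h=\max_jh_j$, quasi-uniform ($h\le ch_j$ for all $j$). $V_h=\{v: v|_{\tau_j}\in P_k(\tau_j),\ 1\le j\le N\}$, $P_k$ the polynomials in $x$ of degree at most $k$ with coefficients that may depend on $t$ (here $k\ge1$); $(u,v)_j=\int_{\tau_j}uv\,dx$; $v^\mp|_{j+\frac12}$ are the left/right limits at $x_{j+\frac12}$. LDG scheme: find $u_h,q_h\in V_h$ such that for all $v,w\in V_h$ and all $j$, $(u_{ht},v)_j=-(q_h,v_x)_j+\hat q_hv^-|_{j+\frac12}-\hat q_hv^+|_{j-\frac12}$, $\ (q_h,w)_j=-(u_h,w_x)_j+\hat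 u_hw^-|_{j+\frac12}-\hat u_hw^+|_{j-\frac12}$. Flux choice (I): $\hat u_h=u_h^-$, $\hat q_h=q_h^+$. Flux choice (II): $\hat u_h=u_h^+$, $\hat q_h=q_h^-$. Both are used for the periodic condition (with periodic identification of one-sided limits at $x_{\frac12}$ and $x_{N+\frac12}$); (I) is used for $u(0,t)=g_0,u_x(2\pi,t)=g_1$ (with $u_h^-|_{\frac12}=g_0$, $q_h^+|_{N+\frac12}=g_1$); (II) is used for $u_x(0,t)=g_0,u(2\pi,t)=g_1$ (with $q_h^-|_{\frac12}=g_0$, $u_h^+|_{N+\frac12}=g_1$). Legendre polynomials: $L_{j,m}(x)=L_m((x-x_j)/\bar h_j)$ on $\tau_j$, $L_m$ standard Legendre. Gauss-Radau projections onto $V_h$: $(P_h^\mp v,w)_j=(v,w)_j$ for all $w\in P_{k-1}(\tau_j)$, with $P_h^-v(x_{j+\frac12}^-)=v(x_{j+\frac12}^-)$ and $P_h^+v(x_{j-\frac12}^+)=v(x_{j-\frac12}^+)$. $D_s^{-1}v(x)=\frac1{\bar h_j}\int_{x_{j-\frac12}}^xv(x')\,dx'$, $x\in\tau_j$. On each $\tau_j$: $F_{1,1}=P_h^+D_s^{-1}L_{j,k}$, $F_{2,1}=P_h^-D_s^{-1}L_{j,k}$, $F_{1,i+1}=P_h^+D_s^{-1}P_h^-D_s^{-1}F_{1,i}$, $F_{2,i+1}=P_h^-D_s^{-1}P_h^+D_s^{-1}F_{2,i}$ ($i\ge1$), $\bar F_{1,i}=P_h^-D_s^{-1}F_{1,i}$,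 $\bar F_{2,i}=P_h^+D_s^{-1}F_{2,i}$ ($1\le i\le\lfloor k/2\rfloor$). Coefficients: $\bar v_{j,k}(t)=-v(x^-_{j+\frac12},t)+\frac1{h_j}\int_{\tau_j}v\sum_{m=0}^k(2m+1)L_{j,m}\,dx$, $\ \tilde v_{j,k}(t)=(-1)^{k+1}v(x^+_{j-\frac12},t)+\frac1{h_j}\int_{\tau_j}v\sum_{m=0}^k(-1)^{k+m}(2m+1)L_{j,m}\,dx$. Interpolation function $u_I^l$ ($1\le l\le k$) for choice (I): on $\tau_j$, $G_i=\frac{d^i}{dt^i}\bar u_{j,k}$, $Q_i=\frac{d^i}{dt^i}\tilde q_{j,k}$; $\bar w_{1,i}=\bar h_j^{2i}G_i\bar F_{1,i}$, $w_{2,i}=\bar h_j^{2i-1}Q_{i-1}F_{2,i}$; $W_2^l=\sum_{i=1}^{\lfloor l/2\rfloor}\bar w_{1,i}+\sum_{i=1}^{\lceil l/2\rceil}w_{2,i}$ in each $\tau_j$; $u_I^l=P_h^-u-W_2^l$. Interpolation function $u_I^l$ for choice (II): on $\tau_j$, $G_i=\frac{d^i}{dt^i}\tilde u_{j,k}$, $Q_i=\frac{d^i}{dt^i}\bar q_{j,k}$; $w_{1,i}=\bar h_j^{2i-1}Q_{i-1}F_{1,i}$, $\bar w_{2,i}=\bar h_j^{2i}G_i\bar F_{2,i}$; $W_2^l=\sum_{i=1}^{\lceil l/2\rceil}w_{1,i}+\sum_{i=1}^{\lfloor l/2\rfloor}\bar w_{2,i}$ in each $\tau_j$; $u_I^l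=P_h^+u-W_2^l$.
   Formalization: The periodic boundary condition is taken to mean that both u and u_x agree at 0 and 2π; with only u(0,t)=u(2π,t) the claim fails, e.g. for u=(x−π)²+2t. *)

theory Defs
  imports
    "HOL-Analysis.Analysis"
    "HOL-Probability.Essential_Supremum"
    "HOL-Computational_Algebra.Polynomial"
begin

text \<open>Functions of space and time are curried, space first: \<open>u x t\<close>.\<close>

abbreviation Omega :: "real set" where
  "Omega \<equiv> {0..2 * pi}"

subsection \<open>Sobolev spaces $W^{m,\infty}(\Omega)$\<close>

definition test_function :: "(real \<Rightarrow> real) \<Rightarrow> bool" where
  "test_function \<phi> \<longleftrightarrow>
     (\<forall>n x. ((deriv ^^ n) \<phi>) differentiable (at x)) \<and>
     closure {x. \<phi> x \<noteq> 0} \<subseteq> interior Omega"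

definition is_weak_deriv :: "nat \<Rightarrow> (real \<Rightarrow> real) \<Rightarrow> (real \<Rightarrow> real) \<Rightarrow> bool" where
  "is_weak_deriv i v g \<longleftrightarrow>
     v absolutely_integrable_on Omega \<and> g absolutely_integrable_on Omega \<and>
     (\<forall>\<phi>. test_function \<phi> \<longrightarrow>
        integral Omega (\<lambda>x. v x * (deriv ^^ i) \<phi> x)
          = (- 1) ^ i * integral Omega (\<lambda>x. g x * \<phi> x))"

text \<open>Weak derivatives are unique up to null sets only, so this is an arbitrary representative.\<close>

definition weak_deriv :: "nat \<Rightarrow> (real \<Rightarrow> real) \<Rightarrow> real \<Rightarrow> real" where
  "weak_deriv i v = (SOME g. is_weak_deriv i v g)"

definition in_Linf :: "(real \<Rightarrow> real) \<Rightarrow> bool" where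
  "in_Linf g \<longleftrightarrow> g \<in> borel_measurable (lebesgue_on Omega) \<and>
     esssup (lebesgue_on Omega) (\<lambda>x. ereal \<bar>g x\<bar>) < \<infinity>"

definition Linf_norm :: "(real \<Rightarrow> real) \<Rightarrow> real" where
  "Linf_norm g = real_of_ereal (esssup (lebesgue_on Omega) (\<lambda>x. ereal \<bar>g x\<bar>))"

definition in_Wminf :: "nat \<Rightarrow> (real \<Rightarrow> real) \<Rightarrow> bool" where
  "in_Wminf m v \<longleftrightarrow> (\<forall>i\<le>m. \<exists>g. is_weak_deriv i v g \<and> in_Linf g)"

definition Wminf_norm :: "nat \<Rightarrow> (real \<Rightarrow> real) \<Rightarrow> real" where
  "Wminf_norm m v = Max ((\<lambda>i. Linf_norm (weak_deriv i v)) ` {..m})"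

definition in_Wminf_unif :: "real \<Rightarrow> nat \<Rightarrow> (real \<Rightarrow> real \<Rightarrow> real) \<Rightarrow> bool" where
  "in_Wminf_unif T m u \<longleftrightarrow>
     (\<forall>t\<in>{0..T}. in_Wminf m (\<lambda>x. u x t)) \<and>
     bdd_above ((\<lambda>t. Wminf_norm m (\<lambda>x. u x t)) ` {0..T})"

definition Wminf_norm_unif :: "real \<Rightarrow> nat \<Rightarrow> (real \<Rightarrow> real \<Rightarrow> real) \<Rightarrow> real" where
  "Wminf_norm_unif T m u = (SUP t\<in>{0..T}. Wminf_norm m (\<lambda>x. u x t))"

subsection \<open>The heat equation and its boundary conditions\<close>

text \<open>\<open>Dirichlet_Neumann g0 g1\<close> is $u(0,t)=g_0(t)$, $u_x(2\pi,t)=g_1(t)$, and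
  \<open>Neumann_Dirichlet g0 g1\<close> is $u_x(0,t)=g_0(t)$, $u(2\pi,t)=g_1(t)$.\<close>

datatype bdry =
    Periodic
  | Dirichlet_Neumann "real \<Rightarrow> real" "real \<Rightarrow> real"
  | Neumann_Dirichlet "real \<Rightarrow> real" "real \<Rightarrow> real"

text \<open>Here \<open>q\<close> is the spatial derivative of \<open>u\<close>. Periodicity means that the values of both
  \<open>u\<close> and \<open>u\<^sub>x\<close> agree at the two end points, as is required for the periodic
  problem (second order in space) to be well posed.\<close>

fun satisfies_bdry :: "real \<Rightarrow> bdry \<Rightarrow> (real \<Rightarrow> real \<Rightarrow> real) \<Rightarrow> (real \<Rightarrow> real \<Rightarrow> real) \<Rightarrow> bool" where
  "satisfies_bdry T Periodic u q \<longleftrightarrow>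
     (\<forall>t\<in>{0..T}. u 0 t = u (2 * pi) t \<and> q 0 t = q (2 * pi) t)"
| "satisfies_bdry T (Dirichlet_Neumann g0 g1) u q \<longleftrightarrow>
     (\<forall>t\<in>{0..T}. u 0 t = g0 t \<and> q (2 * pi) t = g1 t)"
| "satisfies_bdry T (Neumann_Dirichlet g0 g1) u q \<longleftrightarrow>
     (\<forall>t\<in>{0..T}. q 0 t = g0 t \<and> u (2 * pi) t = g1 t)"

definition is_x_deriv :: "real \<Rightarrow> (real \<Rightarrow> real \<Rightarrow> real) \<Rightarrow> (real \<Rightarrow> real \<Rightarrow> real) \<Rightarrow> bool" where
  "is_x_deriv T u q \<longleftrightarrow>
     (\<forall>t\<in>{0..T}. \<forall>x\<in>Omega. ((\<lambda>y. u y t) has_real_derivative q x t) (at x within Omega))"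

definition heat_solution ::
  "real \<Rightarrow> (real \<Rightarrow> real) \<Rightarrow> (real \<Rightarrow> real \<Rightarrow> real) \<Rightarrow> (real \<Rightarrow> real \<Rightarrow> real) \<Rightarrow> bool" where
  "heat_solution T u0 u q \<longleftrightarrow>
     continuous_on (Omega \<times> {0..T}) (\<lambda>(x, t). u x t) \<and>
     is_x_deriv T u q \<and>
     (\<forall>x\<in>Omega. \<forall>t\<in>{0<..T}. \<exists>d.
        ((\<lambda>s. u x s) has_real_derivative d) (at t within {0..T}) \<and>
        ((\<lambda>y. q y t) has_real_derivative d) (at x within Omega)) \<and>
     (\<forall>x\<in>Omega. u x 0 = u0 x)"

subsection \<open>Mesh and finite element space\<close>

text \<open>The mesh point $x_{j+\frac12}$ is \<open>X j\<close>, \<open>0 \<le> j \<le> N\<close>, so the cell $\tau_j$ is the open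
  interval from \<open>X (j - 1)\<close> to \<open>X j\<close>, \<open>1 \<le> j \<le> N\<close>.\<close>

definition is_mesh :: "nat \<Rightarrow> (nat \<Rightarrow> real) \<Rightarrow> bool" where
  "is_mesh N X \<longleftrightarrow> N \<ge> 1 \<and> X 0 = 0 \<and> X N = 2 * pi \<and> (\<forall>j\<in>{1..N}. X (j - 1) < X j)"

definition cell :: "(nat \<Rightarrow> real) \<Rightarrow> nat \<Rightarrow> real set" where
  "cell X j = {X (j - 1) <..< X j}"

definition cell_size :: "(nat \<Rightarrow> real) \<Rightarrow> nat \<Rightarrow> real" where
  "cell_size X j = X j - X (j - 1)"

definition mesh_size :: "nat \<Rightarrow> (nat \<Rightarrow> real) \<Rightarrow> real" where
  "mesh_size N X = Max (cell_size X ` {1..N})"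

definition quasi_uniform :: "real \<Rightarrow> nat \<Rightarrow> (nat \<Rightarrow> real) \<Rightarrow> bool" where
  "quasi_uniform c N X \<longleftrightarrow> (\<forall>j\<in>{1..N}. mesh_size N X \<le> c * cell_size X j)"

text \<open>Elements of $V_h$ are unconstrained at the mesh points; only their one-sided limits
  there are ever used.\<close>

definition Vh :: "nat \<Rightarrow> nat \<Rightarrow> (nat \<Rightarrow> real) \<Rightarrow> (real \<Rightarrow> real) set" where
  "Vh k N X = {v. \<forall>j\<in>{1..N}. \<exists>p :: real poly. degree p \<le> k \<and> (\<forall>x\<in>cell X j. v x = poly p x)}"

abbreviation lim_left :: "(real \<Rightarrow> real) \<Rightarrow> real \<Rightarrow> real" where
  "lim_left v x \<equiv> Lim (at_left x) v"

abbreviation lim_right :: "(real \<Rightarrow> real) \<Rightarrow> real \<Rightarrow> real" where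
  "lim_right v x \<equiv> Lim (at_right x) v"

definition cell_inner :: "(nat \<Rightarrow> real) \<Rightarrow> nat \<Rightarrow> (real \<Rightarrow> real) \<Rightarrow> (real \<Rightarrow> real) \<Rightarrow> real" where
  "cell_inner X j v w = integral (cell X j) (\<lambda>x. v x * w x)"

subsection \<open>The LDG scheme\<close>

text \<open>Time derivatives are one-sided at the end points of \<open>[0, T]\<close>.\<close>

definition time_deriv :: "real \<Rightarrow> (real \<Rightarrow> real) \<Rightarrow> real \<Rightarrow> real" where
  "time_deriv T f t = vector_derivative f (at t within {0..T})"

datatype flux = Flux_I | Flux_II

fun compatible :: "bdry \<Rightarrow> flux \<Rightarrow> bool" where
  "compatible Periodic fl \<longleftrightarrow> True"
| "compatible (Dirichlet_Neumann g0 g1) fl \<longleftrightarrow> fl = Flux_I"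
| "compatible (Neumann_Dirichlet g0 g1) fl \<longleftrightarrow> fl = Flux_II"

text \<open>One-sided limits at the mesh point with index \<open>j\<close>; \<open>b\<close> replaces the limit that would be
  taken from outside the domain.\<close>

definition trace_left :: "(nat \<Rightarrow> real) \<Rightarrow> real \<Rightarrow> (real \<Rightarrow> real) \<Rightarrow> nat \<Rightarrow> real" where
  "trace_left X b v j = (if j = 0 then b else lim_left v (X j))"

definition trace_right :: "nat \<Rightarrow> (nat \<Rightarrow> real) \<Rightarrow> real \<Rightarrow> (real \<Rightarrow> real) \<Rightarrow> nat \<Rightarrow> real" where
  "trace_right N X b v j = (if j = N then b else lim_right v (X j))"

text \<open>The fluxes at time \<open>t\<close>, where \<open>v\<close> is \<open>u\<^sub>h(\<cdot>,t)\<close> for \<open>u_hat\<close> and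
  \<open>q\<^sub>h(\<cdot>,t)\<close> for \<open>q_hat\<close>; left unspecified for pairs that are not \<open>compatible\<close>.\<close>

fun u_hat :: "flux \<Rightarrow> bdry \<Rightarrow> nat \<Rightarrow> (nat \<Rightarrow> real) \<Rightarrow> real \<Rightarrow> (real \<Rightarrow> real) \<Rightarrow> nat \<Rightarrow> real" where
  "u_hat Flux_I Periodic N X t v j = trace_left X (lim_left v (X N)) v j"
| "u_hat Flux_I (Dirichlet_Neumann g0 g1) N X t v j = trace_left X (g0 t) v j"
| "u_hat Flux_II Periodic N X t v j = trace_right N X (lim_right v (X 0)) v j"
| "u_hat Flux_II (Neumann_Dirichlet g0 g1) N X t v j = trace_right N X (g1 t) v j"

fun q_hat :: "flux \<Rightarrow> bdry \<Rightarrow> nat \<Rightarrow> (nat \<Rightarrow> real) \<Rightarrow> real \<Rightarrow> (real \<Rightarrow> real) \<Rightarrow> nat \<Rightarrow> real" where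
  "q_hat Flux_I Periodic N X t v j = trace_right N X (lim_right v (X 0)) v j"
| "q_hat Flux_I (Dirichlet_Neumann g0 g1) N X t v j = trace_right N X (g1 t) v j"
| "q_hat Flux_II Periodic N X t v j = trace_left X (lim_left v (X N)) v j"
| "q_hat Flux_II (Neumann_Dirichlet g0 g1) N X t v j = trace_left X (g0 t) v j"

definition ldg_solution ::
  "nat \<Rightarrow> real \<Rightarrow> flux \<Rightarrow> bdry \<Rightarrow> nat \<Rightarrow> (nat \<Rightarrow> real) \<Rightarrow>
   (real \<Rightarrow> real \<Rightarrow> real) \<Rightarrow> (real \<Rightarrow> real \<Rightarrow> real) \<Rightarrow> bool" where
  "ldg_solution k T fl bc N X uh qh \<longleftrightarrow>
     (\<forall>t\<in>{0..T}. (\<lambda>x. uh x t) \<in> Vh k N X \<and> (\<lambda>x. qh x t) \<in> Vh k N X) \<and>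
     (\<forall>j\<in>{1..N}. \<forall>x\<in>cell X j. (\<lambda>t. uh x t) differentiable_on {0..T}) \<and>
     (\<forall>t\<in>{0..T}. \<forall>v\<in>Vh k N X. \<forall>w\<in>Vh k N X. \<forall>j\<in>{1..N}.
        cell_inner X j (\<lambda>x. time_deriv T (\<lambda>s. uh x s) t) v
          = - cell_inner X j (\<lambda>x. qh x t) (deriv v)
            + q_hat fl bc N X t (\<lambda>x. qh x t) j * lim_left v (X j)
            - q_hat fl bc N X t (\<lambda>x. qh x t) (j - 1) * lim_right v (X (j - 1)) \<and>
        cell_inner X j (\<lambda>x. qh x t) w
          = - cell_inner X j (\<lambda>x. uh x t) (deriv w)
            + u_hat fl bc N X t (\<lambda>x. uh x t) j * lim_left w (X j)
            - u_hat fl bc N X t (\<lambda>x. uh x t) (j - 1) * lim_right w (X (j - 1)))"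

subsection \<open>The interpolation functions\<close>

text \<open>Everything in this section lives on a single cell \<open>(a, b)\<close> of length \<open>b - a\<close>.\<close>

text \<open>Rodrigues' formula.\<close>

definition legendre :: "nat \<Rightarrow> real poly" where
  "legendre m = smult (1 / (2 ^ m * fact m)) ((pderiv ^^ m) ([:-1, 0, 1:] ^ m))"

definition cell_legendre :: "real \<Rightarrow> real \<Rightarrow> nat \<Rightarrow> real \<Rightarrow> real" where
  "cell_legendre a b m x = poly (legendre m) ((x - (a + b) / 2) / ((b - a) / 2))"

definition radau_minus :: "nat \<Rightarrow> real \<Rightarrow> real \<Rightarrow> (real \<Rightarrow> real) \<Rightarrow> real \<Rightarrow> real" where
  "radau_minus k a b v = poly (THE p. degree p \<le> k \<and>
     (\<forall>r :: real poly. degree r \<le> k - 1 \<longrightarrow>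
        integral {a<..<b} (\<lambda>x. poly p x * poly r x) = integral {a<..<b} (\<lambda>x. v x * poly r x)) \<and>
     poly p b = lim_left v b)"

definition radau_plus :: "nat \<Rightarrow> real \<Rightarrow> real \<Rightarrow> (real \<Rightarrow> real) \<Rightarrow> real \<Rightarrow> real" where
  "radau_plus k a b v = poly (THE p. degree p \<le> k \<and>
     (\<forall>r :: real poly. degree r \<le> k - 1 \<longrightarrow>
        integral {a<..<b} (\<lambda>x. poly p x * poly r x) = integral {a<..<b} (\<lambda>x. v x * poly r x)) \<and>
     poly p a = lim_right v a)"

definition Ds_inv :: "real \<Rightarrow> real \<Rightarrow> (real \<Rightarrow> real) \<Rightarrow> real \<Rightarrow> real" where
  "Ds_inv a b v x = 1 / ((b - a) / 2) * integral {a..x} v"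

text \<open>The indices \<open>i\<close> of the following four families start at \<open>1\<close>.\<close>

definition F1 :: "nat \<Rightarrow> real \<Rightarrow> real \<Rightarrow> nat \<Rightarrow> real \<Rightarrow> real" where
  "F1 k a b i =
     ((\<lambda>f. radau_plus k a b (Ds_inv a b (radau_minus k a b (Ds_inv a b f)))) ^^ (i - 1))
       (radau_plus k a b (Ds_inv a b (cell_legendre a b k)))"

definition F2 :: "nat \<Rightarrow> real \<Rightarrow> real \<Rightarrow> nat \<Rightarrow> real \<Rightarrow> real" where
  "F2 k a b i =
     ((\<lambda>f. radau_minus k a b (Ds_inv a b (radau_plus k a b (Ds_inv a b f)))) ^^ (i - 1))
       (radau_minus k a b (Ds_inv a b (cell_legendre a b k)))"

definition F1_bar :: "nat \<Rightarrow> real \<Rightarrow> real \<Rightarrow> nat \<Rightarrow> real \<Rightarrow> real" where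
  "F1_bar k a b i = radau_minus k a b (Ds_inv a b (F1 k a b i))"

definition F2_bar :: "nat \<Rightarrow> real \<Rightarrow> real \<Rightarrow> nat \<Rightarrow> real \<Rightarrow> real" where
  "F2_bar k a b i = radau_plus k a b (Ds_inv a b (F2 k a b i))"

definition coef_bar :: "nat \<Rightarrow> real \<Rightarrow> real \<Rightarrow> (real \<Rightarrow> real) \<Rightarrow> real" where
  "coef_bar k a b v = - lim_left v b
     + 1 / (b - a) * integral {a<..<b}
         (\<lambda>x. v x * (\<Sum>m=0..k. (2 * real m + 1) * cell_legendre a b m x))"

definition coef_tilde :: "nat \<Rightarrow> real \<Rightarrow> real \<Rightarrow> (real \<Rightarrow> real) \<Rightarrow> real" where
  "coef_tilde k a b v = (- 1) ^ (k + 1) * lim_right v a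
     + 1 / (b - a) * integral {a<..<b}
         (\<lambda>x. v x * (\<Sum>m=0..k. (- 1) ^ (k + m) * (2 * real m + 1) * cell_legendre a b m x))"

text \<open>\<open>u_interp fl l k T a b u q x t\<close> is $u_I^l(x,t)$ for \<open>x\<close> in the cell \<open>(a, b)\<close>.\<close>

fun u_interp ::
  "flux \<Rightarrow> nat \<Rightarrow> nat \<Rightarrow> real \<Rightarrow> real \<Rightarrow> real \<Rightarrow>
   (real \<Rightarrow> real \<Rightarrow> real) \<Rightarrow> (real \<Rightarrow> real \<Rightarrow> real) \<Rightarrow> real \<Rightarrow> real \<Rightarrow> real" where
  "u_interp Flux_I l k T a b u q x t =
     (let G = (\<lambda>i. (time_deriv T ^^ i) (\<lambda>s. coef_bar k a b (\<lambda>y. u y s)) t);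
          Q = (\<lambda>i. (time_deriv T ^^ i) (\<lambda>s. coef_tilde k a b (\<lambda>y. q y s)) t);
          hb = (b - a) / 2
      in radau_minus k a b (\<lambda>y. u y t) x
         - ((\<Sum>i = 1..l div 2. hb ^ (2 * i) * G i * F1_bar k a b i x)
            + (\<Sum>i = 1..(l + 1) div 2. hb ^ (2 * i - 1) * Q (i - 1) * F2 k a b i x)))"
| "u_interp Flux_II l k T a b u q x t =
     (let G = (\<lambda>i. (time_deriv T ^^ i) (\<lambda>s. coef_tilde k a b (\<lambda>y. u y s)) t);
          Q = (\<lambda>i. (time_deriv T ^^ i) (\<lambda>s. coef_bar k a b (\<lambda>y. q y s)) t);
          hb = (b - a) / 2
      in radau_plus k a b (\<lambda>y. u y t) x
         - ((\<Sum>i = 1..(l + 1) div 2. hb ^ (2 * i - 1) * Q (i - 1) * F1 k a b i x)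
            + (\<Sum>i = 1..l div 2. hb ^ (2 * i) * G i * F2_bar k a b i x)))"

subsection \<open>Error averages\<close>

definition domain_average :: "(real \<Rightarrow> real) \<Rightarrow> real" where
  "domain_average e = \<bar>1 / (2 * pi) * integral Omega e\<bar>"

definition cell_average :: "nat \<Rightarrow> (nat \<Rightarrow> real) \<Rightarrow> (real \<Rightarrow> real) \<Rightarrow> real" where
  "cell_average N X e =
     sqrt (1 / real N * (\<Sum>j=1..N. (1 / cell_size X j * integral (cell X j) e) ^ 2))"

end

theory Submission
  imports Defs
begin

text \<open>Let \<open>\<xi>\<close> and \<open>\<zeta>\<close> be the differences between the numerical solution and the corrected projections
  of \<open>u\<close> and \<open>q\<close>. Each correction term cancels the residual left by the previous one, so \<open>\<xi>\<close> and
  \<open>\<zeta>\<close> satisfy the scheme up to residuals that stem from the last correction term alone. The two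
  discrete derivatives of the scheme are negative adjoints of each other, hence in an orthonormal
  basis the coordinates \<open>\<alpha>\<close> of \<open>\<xi>\<close> satisfy \<open>\<alpha>' = - B (B\<^sup>T \<alpha> - r\<^sub>2) - r\<^sub>1\<close>. Energy estimates for
  \<open>\<alpha>\<close> and \<open>B\<^sup>T \<alpha>\<close> bound the averages of the errors of \<open>u\<close> and \<open>q\<close>, because all corrections
  but the last one have mean zero on every cell.

  For mixed boundary conditions the mean of the error of \<open>q\<close> is a boundary trace of \<open>\<xi>\<close>. It is bounded
  by splitting \<open>\<alpha>\<close> into a time average on the scale \<open>h\<close> and a remainder. The extra half power of
  \<open>h\<close> in both mixed estimates is due to a parabolic energy estimate for difference quotients of
  \<open>u\<close>: the residual \<open>r\<^sub>1\<close> is smaller in the mean over time than pointwise. For periodic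
  boundary conditions both means are preserved by the scheme.\<close>

subsection \<open>Legendre polynomials and Gauss-Radau projections\<close>

text \<open>The regularity is one derivative short of what pointwise estimates would need. For
  \<open>u\<close> in W^(2k+2,inf) only the derivatives up to order K = 2k + 1 are classical, the
  last one being Lipschitz. The residual \<open>r1\<close> contains a projection coefficient of the
  derivative of order k + 2 and is only O(h^(2k)), while \<open>r2\<close> is O(h^(2k+1)); only the
  latter can be multiplied by the inverse-inequality constant of order 1/h. This deficit is why a
  bound on \<open>r1\<close> in the mean over time is needed at all, and why it is extracted from
  difference quotients: the derivative of order 2k + 2 exists only in the weak sense. The final
  constant may depend on \<open>k\<close> and \<open>c\<close> but not on the final time. Hence the
  Gronwall weight is scaled by the time at which the estimate is read off, which costs a factor e
  instead of an exponential in T. The data are given in a weak form: norms through arbitrary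
  representatives of weak derivatives, one time at a time, and the heat equation only for positive
  times. Jointly continuous classical derivatives have to be rebuilt first, by mollification and an
  interpolation inequality of Landau type.\<close>

lemma has_integral_pderiv:
  fixes P :: "real poly"
  assumes "a \<le> b"
  shows "(poly (pderiv P) has_integral (poly P b - poly P a)) {a..b}"
  using assms
  by (intro fundamental_theorem_of_calculus)
     (auto simp: has_real_derivative_iff_has_vector_derivative[symmetric] intro!: DERIV_subset[OF poly_DERIV])

lemma integrable_poly [simp, intro]: "(\<lambda>x. poly (p :: real poly) x) integrable_on {a..b}"
  by (intro integrable_continuous_interval continuous_intros)

lemma integrable_continuous_poly:
  fixes v :: "real \<Rightarrow> real"
  assumes "continuous_on {a..b} v"
  shows "(\<lambda>x. v x * poly p x) integrable_on {a..b}"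
  by (intro integrable_continuous_interval continuous_intros assms)

lemma integral_poly_parts:
  fixes p r :: "real poly"
  assumes "a \<le> b"
  shows "integral {a..b} (\<lambda>x. poly (pderiv p) x * poly r x) =
    poly p b * poly r b - poly p a * poly r a - integral {a..b} (\<lambda>x. poly p x * poly (pderiv r) x)"
proof -
  have "integral {a..b} (poly (pderiv (p * r))) = poly (p * r) b - poly (p * r) a"
    using has_integral_pderiv[OF assms] by (rule integral_unique)
  moreover have "integral {a..b} (poly (pderiv (p * r))) =
     integral {a..b} (\<lambda>x. poly (p * pderiv r) x + poly (pderiv p * r) x)"
    by (rule integral_cong) (simp add: pderiv_mult algebra_simps)
  also have "\<dots> = integral {a..b} (\<lambda>x. poly (p * pderiv r) x) + integral {a..b} (\<lambda>x. poly (pderiv p * r) x)"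
    by (rule integral_add) (rule integrable_poly)+
  ultimately show ?thesis by simp
qed

section \<open>Legendre polynomials on the reference interval\<close>

text \<open>One differentiation turns (x - a)^m g into (x - a)^(m-1) times the cofactor m g + (x -
  a) g', so the induction has to keep \<open>g\<close> arbitrary. At \<open>a\<close> the new
  cofactor is m times the old one, which builds up the factorial.\<close>

lemma poly_higher_pderiv_root:
  fixes g :: "real poly"
  assumes "j \<le> m"
  shows "poly ((pderiv ^^ j) ([:- a, 1:] ^ m * g)) a = (if j = m then fact m * poly g a else 0)"
  using assms
proof (induction j arbitrary: m g)
  case 0
  show ?case by (cases m) auto
next
  case (Suc j)
  then obtain n where m: "m = Suc n" by (cases m) auto
  have "pderiv (L ^ m * g) = L ^ n * (of_nat (Suc n) * g + L * pderiv g)" if "pderiv L = 1" for L :: "real poly"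
    unfolding m pderiv_mult pderiv_power_Suc that by (simp add: of_nat_poly smult_add_left algebra_simps)
  hence *: "pderiv ([:- a, 1:] ^ m * g) = [:- a, 1:] ^ n * (of_nat (Suc n) * g + [:- a, 1:] * pderiv g)"
    by (simp add: pderiv_pCons)
  have "(pderiv ^^ Suc j) ([:- a, 1:] ^ m * g) = (pderiv ^^ j) (pderiv ([:- a, 1:] ^ m * g))"
    by (simp only: funpow_Suc_right o_apply)
  also have "\<dots> = (pderiv ^^ j) ([:- a, 1:] ^ n * (of_nat (Suc n) * g + [:- a, 1:] * pderiv g))"
    by (simp only: *)
  finally have "poly ((pderiv ^^ Suc j) ([:- a, 1:] ^ m * g)) a =
      (if j = n then fact n * poly (of_nat (Suc n) * g + [:- a, 1:] * pderiv g) a else 0)"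
    using Suc.IH[of n "of_nat (Suc n) * g + [:- a, 1:] * pderiv g"] Suc.prems m by simp
  thus ?case by (simp add: m algebra_simps)
qed

definition rodrigues :: "nat \<Rightarrow> real poly" where "rodrigues m = [:-1, 0, 1:] ^ m"

lemma rodrigues_factor:
  "rodrigues m = [:- 1, 1:] ^ m * [:1, 1:] ^ m" "rodrigues m = [:- (- 1), 1:] ^ m * [:-1, 1:] ^ m"
  unfolding rodrigues_def power_mult_distrib[symmetric] by simp_all

lemma legendre_rodrigues: "legendre m = smult (1 / (2 ^ m * fact m)) ((pderiv ^^ m) (rodrigues m))"
  by (simp add: legendre_def rodrigues_def)

lemma rodrigues_vanish:
  assumes "j < m"
  shows "poly ((pderiv ^^ j) (rodrigues m)) 1 = 0" "poly ((pderiv ^^ j) (rodrigues m)) (- 1) = 0"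
  using poly_higher_pderiv_root[of j m 1 "[:1, 1:] ^ m"]
        poly_higher_pderiv_root[of j m "- 1" "[:-1, 1:] ^ m"] assms
  by (simp_all add: rodrigues_factor(1)) (metis less_imp_le_nat rodrigues_factor(1,2) add.inverse_inverse less_irrefl)

lemma legendre_at_1 [simp]: "poly (legendre m) 1 = 1"
  using poly_higher_pderiv_root[of m m 1 "[:1, 1:] ^ m"]
  by (simp add: legendre_rodrigues rodrigues_factor(1))

lemma legendre_at_minus_1 [simp]: "poly (legendre m) (- 1) = (- 1) ^ m"
proof -
  have "poly ((pderiv ^^ m) (rodrigues m)) (- 1) = fact m * (- 2) ^ m"
    using poly_higher_pderiv_root[of m m "- 1" "[:-1, 1:] ^ m"]
    unfolding rodrigues_factor(2) by (simp add: poly_power)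
  thus ?thesis by (simp add: legendre_rodrigues power_minus[of 2] field_simps)
qed

lemma degree_legendre [simp]: "degree (legendre m) = m"
proof -
  have "degree (rodrigues m) = 2 * m" by (simp add: rodrigues_def degree_power_eq)
  thus ?thesis by (simp add: legendre_rodrigues degree_higher_pderiv)
qed

lemma coeff_zero_higher_pderiv:
  fixes r :: "real poly"
  assumes "\<And>i. i \<ge> m \<Longrightarrow> coeff r i = 0"
  shows "(pderiv ^^ m) r = 0"
  by (rule poly_eqI) (simp add: coeff_higher_pderiv assms)

text \<open>In Rodrigues' formula all m derivatives can be moved to \<open>r\<close>, since the
  lower derivatives of (x^2 - 1)^m vanish at both ends. The hypothesis speaks of coefficients rather
  than of the degree so that m = 0 forces r = 0; \<open>legendre_norm\<close> relies on
  this.\<close>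

lemma legendre_orthogonal:
  fixes r :: "real poly"
  assumes "\<And>i. i \<ge> m \<Longrightarrow> coeff r i = 0"
  shows "integral {-1..1} (\<lambda>x. poly (legendre m) x * poly r x) = 0"
proof -
  have *: "integral {-1..1} (\<lambda>x. poly ((pderiv ^^ m) (rodrigues m)) x * poly r x) =
      (- 1) ^ i * integral {-1..1} (\<lambda>x. poly ((pderiv ^^ (m - i)) (rodrigues m)) x * poly ((pderiv ^^ i) r) x)"
    if "i \<le> m" for i
    using that
  proof (induction i)
    case 0
    thus ?case by simp
  next
    case (Suc i)
    have "pderiv ((pderiv ^^ (m - Suc i)) (rodrigues m)) = (pderiv ^^ (m - i)) (rodrigues m)"
      using Suc.prems by (metis Suc_diff_Suc Suc_le_lessD funpow.simps(2) o_apply)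
    with integral_poly_parts[of "-1" 1 "(pderiv ^^ (m - Suc i)) (rodrigues m)" "(pderiv ^^ i) r"]
      Suc rodrigues_vanish[of "m - Suc i" m]
    show ?case by simp
  qed
  have "integral {-1..1} (\<lambda>x. poly ((pderiv ^^ m) (rodrigues m)) x * poly r x) = 0"
    using *[of m] coeff_zero_higher_pderiv[of m r] assms by auto
  moreover have "(\<lambda>x. poly (legendre m) x * poly r x) =
      (\<lambda>x. 1 / (2 ^ m * fact m) * (poly ((pderiv ^^ m) (rodrigues m)) x * poly r x))"
    by (auto simp: legendre_rodrigues)
  ultimately show ?thesis by (simp only: integral_mult_right mult_zero_right)
qed

text \<open>The derivative of x L^2 integrates to 2 by the end point values, and it equals (2m + 1)
  L^2 + 2 L (x L' - m L). In the bracket the leading terms cancel, so it is orthogonal to L.\<close>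

lemma legendre_norm:
  "integral {-1..1} (\<lambda>x. poly (legendre m) x * poly (legendre m) x) = 2 / (2 * real m + 1)"
proof -
  let ?L = "legendre m" and ?x = "[:0, 1:] :: real poly"
  define r where "r = ?x * pderiv ?L - of_nat m * ?L"
  have r: "coeff r i = 0" if "i \<ge> m" for i
  proof (cases "i = m")
    case True
    thus ?thesis by (cases m) (simp_all add: r_def coeff_pderiv of_nat_poly)
  next
    case False
    with that have "i > m" by simp
    hence "coeff ?L i = 0" by (simp add: coeff_eq_0)
    thus ?thesis using \<open>i > m\<close> by (cases i) (simp_all add: r_def coeff_pderiv of_nat_poly)
  qed
  let ?I = "\<lambda>p. integral {-1..1} (poly p)"
  have "integral {-1..1} (\<lambda>x. poly ?L x * poly r x) = 0" by (rule legendre_orthogonal[OF r])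
  hence 1: "?I (?L * r) = 0" by (simp add: poly_mult[abs_def])
  have 2: "?I (pderiv (?x * (?L * ?L))) = 2"
    using has_integral_pderiv[of "-1" 1 "?x * (?L * ?L)"]
    by (auto dest!: integral_unique simp: power2_eq_square[symmetric] power_mult[symmetric])
  have "pderiv (?x * (?L * ?L)) = smult 2 (?L * r) + smult (2 * real m + 1) (?L * ?L)"
    by (intro poly_eqI) (simp add: r_def pderiv_mult pderiv_pCons of_nat_poly algebra_simps
        smult_add_left smult_diff_right coeff_pCons numeral_poly split: nat.splits)
  hence "?I (pderiv (?x * (?L * ?L))) = integral {-1..1} (\<lambda>x. 2 * poly (?L * r) x + (2 * real m + 1) * poly (?L * ?L) x)"
    by (intro integral_cong) simp
  also have "\<dots> = 2 * ?I (?L * r) + (2 * real m + 1) * ?I (?L * ?L)"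
    by (subst integral_add) (auto simp del: poly_mult intro!: integrable_on_mult_right)
  finally have "(2 * real m + 1) * ?I (?L * ?L) = 2" using 1 2 by simp
  moreover have "2 * real m + 1 \<noteq> 0" by linarith
  ultimately have "?I (?L * ?L) = 2 / (2 * real m + 1)" by (simp add: field_simps)
  thus ?thesis by (simp add: poly_mult[abs_def])
qed

lemma legendre_bound:
  obtains B where "B \<ge> 1"
    "\<And>m y. m \<le> k \<Longrightarrow> \<bar>y\<bar> \<le> 1 \<Longrightarrow> \<bar>poly (legendre m) y\<bar> \<le> B"
    "\<And>m y. m \<le> k \<Longrightarrow> \<bar>y\<bar> \<le> 1 \<Longrightarrow> \<bar>poly (pderiv (legendre m)) y\<bar> \<le> B"
proof -
  have ex: "\<exists>B\<ge>0. \<forall>y. \<bar>y\<bar> \<le> 1 \<longrightarrow> \<bar>poly p y\<bar> \<le> B" for p :: "real poly"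
  proof -
    have "compact (poly p ` {-1..1})"
      by (intro compact_continuous_image continuous_intros compact_Icc)
    hence "bounded (poly p ` {-1..1})" by (rule compact_imp_bounded)
    then obtain B where B: "\<forall>x\<in>{-1..1}. \<bar>poly p x\<bar> \<le> B" by (auto simp: bounded_iff)
    have "0 \<le> B" using B[rule_format, of 0] by auto
    thus ?thesis using B by (intro exI[of _ B]) (auto simp: abs_le_iff)
  qed
  obtain B1 where B1: "\<And>p::real poly. B1 p \<ge> 0 \<and> (\<forall>y. \<bar>y\<bar> \<le> 1 \<longrightarrow> \<bar>poly p y\<bar> \<le> B1 p)"
    using ex by metis
  define B where "B = 1 + (\<Sum>m\<le>k. B1 (legendre m) + B1 (pderiv (legendre m)))"
  have le: "B1 (legendre m) + B1 (pderiv (legendre m)) \<le> B" if "m \<le> k" for m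
    using member_le_sum[of m "{..k}" "\<lambda>m. B1 (legendre m) + B1 (pderiv (legendre m))"] B1 that
    unfolding B_def by fastforce
  show ?thesis
  proof
    show "B \<ge> 1" unfolding B_def using B1 by (auto intro!: sum_nonneg add_nonneg_nonneg)
    show "\<bar>poly (legendre m) y\<bar> \<le> B" if "m \<le> k" "\<bar>y\<bar> \<le> 1" for m y
      using le[OF that(1)] B1[of "legendre m"] B1[of "pderiv (legendre m)"] that by (smt (verit))
    show "\<bar>poly (pderiv (legendre m)) y\<bar> \<le> B" if "m \<le> k" "\<bar>y\<bar> \<le> 1" for m y
      using le[OF that(1)] B1[of "legendre m"] B1[of "pderiv (legendre m)"] that by (smt (verit))
  qed
qed

section \<open>Legendre polynomials on a cell\<close>

definition Lc :: "real \<Rightarrow> real \<Rightarrow> nat \<Rightarrow> real poly" where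
  "Lc a b m = pcompose (legendre m) [:- (a + b) / (b - a), 2 / (b - a):]"

lemma cell_arg:
  fixes a b x :: real
  assumes "a < b" shows "(x - (a + b) / 2) / ((b - a) / 2) = - (a + b) / (b - a) + x * (2 / (b - a))"
proof -
  obtain d where "b = a + d" "d > 0" using assms by (metis add.commute diff_add_cancel diff_gt_0_iff_gt)
  thus ?thesis by (simp add: field_simps)
qed

lemma poly_Lc: "a < b \<Longrightarrow> poly (Lc a b m) x = cell_legendre a b m x"
  unfolding Lc_def cell_legendre_def poly_pcompose by (subst cell_arg) auto

lemma cell_legendre_eq: "a < b \<Longrightarrow> cell_legendre a b m = poly (Lc a b m)"
  by (rule ext) (simp add: poly_Lc)

lemma degree_Lc: "a < b \<Longrightarrow> degree (Lc a b m) = m"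
  by (simp add: Lc_def degree_pcompose)

lemma Lc_arg_ends:
  fixes a b :: real
  assumes "a < b"
  shows "(a - (a + b) / 2) / ((b - a) / 2) = - 1" "(b - (a + b) / 2) / ((b - a) / 2) = 1"
  using assms by (subst divide_eq_eq, simp add: field_simps)+

lemma Lc_right: "a < b \<Longrightarrow> poly (Lc a b m) b = 1"
  by (simp only: poly_Lc cell_legendre_def Lc_arg_ends legendre_at_1 legendre_at_minus_1)

lemma Lc_left: "a < b \<Longrightarrow> poly (Lc a b m) a = (- 1) ^ m"
  by (simp only: poly_Lc cell_legendre_def Lc_arg_ends legendre_at_1 legendre_at_minus_1)

lemma poly_antideriv: "\<exists>P. pderiv P = (p :: real poly)"
proof -
  define P where "P = Poly (0 # map (\<lambda>i. coeff p i / real (Suc i)) [0..<Suc (degree p)])"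
  have "coeff (pderiv P) n = coeff p n" for n
    unfolding P_def coeff_pderiv coeff_Poly_eq nth_default_def
    by (simp add: coeff_eq_0 del: upt_Suc)
  thus ?thesis using poly_eqI by blast
qed

text \<open>The substitution rule for an affine map, reduced to the fundamental theorem by composing
  an antiderivative of \<open>p\<close> with the map; everything stays inside the
  polynomials.\<close>

lemma integral_pcompose_cell:
  fixes p :: "real poly"
  assumes "a < b"
  shows "integral {a..b} (poly (pcompose p [:- (a + b) / (b - a), 2 / (b - a):])) =
    (b - a) / 2 * integral {-1..1} (poly p)"
proof -
  let ?l = "[:- (a + b) / (b - a), 2 / (b - a):] :: real poly"
  obtain P where P: "pderiv P = p" using poly_antideriv by blast
  have l: "poly ?l a = - 1" "poly ?l b = 1"
    using cell_arg[OF assms, of a] cell_arg[OF assms, of b] Lc_arg_ends[OF assms] by simp_all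
  have "poly (pderiv (pcompose P ?l)) = (\<lambda>x. (2 / (b - a)) * poly (pcompose p ?l) x)"
    by (rule ext) (simp add: pderiv_pcompose P pderiv_pCons)
  hence "integral {a..b} (poly (pderiv (pcompose P ?l))) = (2 / (b - a)) * integral {a..b} (poly (pcompose p ?l))"
    by simp
  moreover have "integral {a..b} (poly (pderiv (pcompose P ?l))) = poly P 1 - poly P (- 1)"
    using has_integral_pderiv[of a b "pcompose P ?l"] assms l by (simp add: poly_pcompose integral_unique)
  moreover have "integral {-1..1} (poly p) = poly P 1 - poly P (- 1)"
    using has_integral_pderiv[of "-1" 1 P] P by (simp add: integral_unique)
  ultimately have "2 / (b - a) * integral {a..b} (poly (pcompose p ?l)) = integral {-1..1} (poly p)"
    by linarith
  moreover have "(b - a) / 2 * (2 / (b - a) * z) = z" for z :: real using assms by simp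
  ultimately show ?thesis by metis
qed

lemma Lc_norm:
  assumes "a < b"
  shows "integral {a..b} (\<lambda>x. poly (Lc a b m) x * poly (Lc a b m) x) = (b - a) / (2 * real m + 1)"
proof -
  have "(\<lambda>x. poly (Lc a b m) x * poly (Lc a b m) x) =
     poly (pcompose (legendre m * legendre m) [:- (a + b) / (b - a), 2 / (b - a):])"
    by (rule ext) (simp add: Lc_def poly_pcompose)
  hence "integral {a..b} (\<lambda>x. poly (Lc a b m) x * poly (Lc a b m) x) =
     (b - a) / 2 * integral {-1..1} (poly (legendre m * legendre m))"
    using integral_pcompose_cell[OF assms] by simp
  also have "integral {-1..1} (poly (legendre m * legendre m)) = 2 / (2 * real m + 1)"
    using legendre_norm[of m] by (simp add: poly_mult[abs_def])
  also have "(b - a) / 2 * (2 / (2 * real m + 1)) = (b - a) / (2 * real m + 1)"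
    by (simp add: times_divide_eq_right divide_divide_eq_left divide_eq_eq eq_divide_eq) (simp add: field_simps)
  finally show ?thesis .
qed

lemma Lc_orthogonal:
  assumes ab: "a < b" and r: "degree r < m"
  shows "integral {a..b} (\<lambda>x. poly (Lc a b m) x * poly r x) = 0"
proof -
  let ?l = "[:- (a + b) / (b - a), 2 / (b - a):] :: real poly"
  let ?s = "pcompose r [:(a + b) / 2, (b - a) / 2:]"
  have "pcompose [:(a + b) / 2, (b - a) / 2:] ?l = [:0, 1:]"
    using ab by (simp add: pcompose_pCons field_simps)
  hence rs: "pcompose ?s ?l = r"
    by (simp add: pcompose_assoc[symmetric])
  have "(\<lambda>x. poly (Lc a b m) x * poly r x) = poly (pcompose (legendre m * ?s) ?l)"
    by (rule ext) (subst rs[symmetric], simp add: Lc_def poly_pcompose)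
  hence "integral {a..b} (\<lambda>x. poly (Lc a b m) x * poly r x) = (b - a) / 2 * integral {-1..1} (poly (legendre m * ?s))"
    using integral_pcompose_cell[OF ab] by simp
  also have "integral {-1..1} (poly (legendre m * ?s)) = integral {-1..1} (\<lambda>x. poly (legendre m) x * poly ?s x)"
    by (simp add: poly_mult[abs_def])
  also have "\<dots> = 0"
  proof (rule legendre_orthogonal)
    have "degree ?s \<le> degree r" by (auto simp: degree_pcompose)
    thus "coeff ?s i = 0" if "i \<ge> m" for i using r that by (intro coeff_eq_0) linarith
  qed
  finally show ?thesis by simp
qed

lemma Lc_orthogonal':
  assumes "a < b" "m \<noteq> n"
  shows "integral {a..b} (\<lambda>x. poly (Lc a b m) x * poly (Lc a b n) x) = 0"
proof (cases "n < m")
  case True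
  thus ?thesis using Lc_orthogonal[OF assms(1)] degree_Lc[OF assms(1)] by simp
next
  case False
  hence "integral {a..b} (\<lambda>x. poly (Lc a b n) x * poly (Lc a b m) x) = 0"
    using Lc_orthogonal[OF assms(1)] degree_Lc[OF assms(1)] assms(2) by simp
  thus ?thesis by (simp add: mult.commute)
qed

lemma Lc_bound:
  obtains B where "B \<ge> 1"
    "\<And>a b m x. a < b \<Longrightarrow> m \<le> k \<Longrightarrow> a \<le> x \<Longrightarrow> x \<le> b \<Longrightarrow> \<bar>poly (Lc a b m) x\<bar> \<le> B"
    "\<And>a b m x. a < b \<Longrightarrow> m \<le> k \<Longrightarrow> a \<le> x \<Longrightarrow> x \<le> b \<Longrightarrow> \<bar>poly (pderiv (Lc a b m)) x\<bar> \<le> 2 / (b - a) * B"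
proof -
  obtain B where B: "B \<ge> 1"
    "\<And>m y. m \<le> k \<Longrightarrow> \<bar>y\<bar> \<le> 1 \<Longrightarrow> \<bar>poly (legendre m) y\<bar> \<le> B"
    "\<And>m y. m \<le> k \<Longrightarrow> \<bar>y\<bar> \<le> 1 \<Longrightarrow> \<bar>poly (pderiv (legendre m)) y\<bar> \<le> B"
    using legendre_bound by metis
  have y: "\<bar>- (a + b) / (b - a) + x * (2 / (b - a))\<bar> \<le> 1" if "a < b" "a \<le> x" "x \<le> b" for a b x :: real
    using that unfolding cell_arg[OF that(1), symmetric] by (simp add: abs_le_iff field_simps)
  show ?thesis
  proof
    show "B \<ge> 1" by fact
    fix a b x :: real and m assume h: "a < b" "m \<le> k" "a \<le> x" "x \<le> b"
    show "\<bar>poly (Lc a b m) x\<bar> \<le> B"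
      using B(2)[OF h(2) y[OF h(1,3,4)]] by (simp add: Lc_def poly_pcompose)
    show "\<bar>poly (pderiv (Lc a b m)) x\<bar> \<le> 2 / (b - a) * B"
      using B(3)[OF h(2) y[OF h(1,3,4)]] h(1)
      by (simp add: Lc_def pderiv_pcompose poly_pcompose pderiv_pCons abs_mult divide_right_mono mult_left_mono mult.commute)
  qed
qed

lemma Lc_expansion:
  assumes ab: "a < b" and "degree p \<le> k"
  shows "\<exists>c. p = (\<Sum>m\<le>k. smult (c m) (Lc a b m))"
  using assms(2)
proof (induction k arbitrary: p)
  case 0
  then obtain c where "p = [:c:]" by (metis degree_0_id le_zero_eq degree_eq_zeroE)
  moreover obtain d where d: "Lc a b 0 = [:d:]" using degree_Lc[OF ab, of 0] degree_eq_zeroE by blast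
  moreover have "d = 1" using Lc_right[OF ab, of 0] d by simp
  ultimately show ?case by (intro exI[of _ "\<lambda>_. c"]) simp
next
  case (Suc k)
  let ?c = "coeff p (Suc k) / lead_coeff (Lc a b (Suc k))"
  let ?q = "p - smult ?c (Lc a b (Suc k))"
  have lc: "lead_coeff (Lc a b (Suc k)) \<noteq> 0"
    using degree_Lc[OF ab, of "Suc k"] by (metis degree_0 leading_coeff_0_iff nat.distinct(1))
  have "degree ?q \<le> Suc k"
    using Suc.prems degree_Lc[OF ab, of "Suc k"] by (intro degree_diff_le) (auto intro: order.trans[OF degree_smult_le])
  moreover have "coeff ?q (Suc k) = 0" using lc degree_Lc[OF ab, of "Suc k"] by simp
  ultimately have "degree ?q \<le> k"
    by (metis degree_0 le_SucE leading_coeff_0_iff zero_le)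
  then obtain c where c: "?q = (\<Sum>m\<le>k. smult (c m) (Lc a b m))" using Suc.IH by blast
  show ?case
  proof (intro exI[of _ "c(Suc k := ?c)"])
    have "(\<Sum>m\<le>Suc k. smult ((c(Suc k := ?c)) m) (Lc a b m)) = (\<Sum>m\<le>k. smult (c m) (Lc a b m)) + smult ?c (Lc a b (Suc k))"
      by simp
    thus "p = (\<Sum>m\<le>Suc k. smult ((c(Suc k := ?c)) m) (Lc a b m))" unfolding c[symmetric] by simp
  qed
qed

section \<open>The orthogonal projection and the Gauss-Radau projections\<close>

definition mom :: "real \<Rightarrow> real \<Rightarrow> nat \<Rightarrow> (real \<Rightarrow> real) \<Rightarrow> real" where
  "mom a b m v = (2 * real m + 1) / (b - a) * integral {a..b} (\<lambda>x. v x * poly (Lc a b m) x)"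

definition proj :: "nat \<Rightarrow> real \<Rightarrow> real \<Rightarrow> (real \<Rightarrow> real) \<Rightarrow> real poly" where
  "proj k a b v = (\<Sum>m\<le>k. smult (mom a b m v) (Lc a b m))"

definition endp :: "bool \<Rightarrow> real \<Rightarrow> real \<Rightarrow> real" where
  "endp e a b = (if e then b else a)"

text \<open>The Gauss-Radau projection differs from the orthogonal one by a multiple of the top
  Legendre polynomial, which does not affect moments of lower degree and only adjusts the end point
  value. \<open>coef\<close> is that multiple; the sign compensates for the value of the polynomial
  at the left end. \<open>e\<close> is true for the right end point.\<close>

definition coef :: "bool \<Rightarrow> nat \<Rightarrow> real \<Rightarrow> real \<Rightarrow> (real \<Rightarrow> real) \<Rightarrow> real" where
  "coef e k a b v = (if e then 1 else (- 1) ^ k) * (poly (proj k a b v) (endp e a b) - v (endp e a b))"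

definition rad :: "bool \<Rightarrow> nat \<Rightarrow> real \<Rightarrow> real \<Rightarrow> (real \<Rightarrow> real) \<Rightarrow> real poly" where
  "rad e k a b v = proj k a b v - smult (coef e k a b v) (Lc a b k)"

lemma Lc_endp: "a < b \<Longrightarrow> poly (Lc a b m) (endp e a b) = (if e then 1 else (- 1) ^ m)"
  by (simp add: endp_def Lc_left Lc_right)

lemma degree_proj: "a < b \<Longrightarrow> degree (proj k a b v) \<le> k"
  unfolding proj_def by (intro degree_sum_le) (auto simp: degree_Lc intro: order.trans[OF degree_smult_le])

lemma integral_poly_sum:
  "finite S \<Longrightarrow> integral {a..b} (\<lambda>x. \<Sum>m\<in>S. c m * poly (q m) x) = (\<Sum>m\<in>S. c m * integral {a..b} (poly (q m :: real poly)))"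
  by (subst integral_sum) (auto intro!: integrable_on_mult_right)

lemma proj_moment:
  assumes "a < b" "n \<le> k"
  shows "integral {a..b} (\<lambda>x. poly (proj k a b v) x * poly (Lc a b n) x) =
         integral {a..b} (\<lambda>x. v x * poly (Lc a b n) x)"
proof -
  have "integral {a..b} (\<lambda>x. poly (proj k a b v) x * poly (Lc a b n) x) =
      integral {a..b} (\<lambda>x. \<Sum>m\<le>k. mom a b m v * poly (Lc a b m * Lc a b n) x)"
    by (intro integral_cong) (simp add: proj_def poly_sum sum_distrib_right mult.assoc)
  also have "\<dots> = (\<Sum>m\<le>k. mom a b m v * integral {a..b} (poly (Lc a b m * Lc a b n)))"
    by (rule integral_poly_sum) simp
  also have "\<dots> = (\<Sum>m\<le>k. if m = n then mom a b n v * ((b - a) / (2 * real n + 1)) else 0)"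
    using assms by (intro sum.cong refl) (auto simp: poly_mult[abs_def] Lc_norm Lc_orthogonal')
  also have "\<dots> = mom a b n v * ((b - a) / (2 * real n + 1))" using assms by simp
  also have "\<dots> = integral {a..b} (\<lambda>x. v x * poly (Lc a b n) x)"
  proof -
    have "2 * real n + 1 \<noteq> 0" by linarith
    thus ?thesis using assms by (simp add: mom_def)
  qed
  finally show ?thesis .
qed

lemma proj_inner:
  assumes "a < b" "continuous_on {a..b} v" "degree r \<le> k"
  shows "integral {a..b} (\<lambda>x. poly (proj k a b v) x * poly r x) = integral {a..b} (\<lambda>x. v x * poly r x)"
proof -
  obtain c where c: "r = (\<Sum>m\<le>k. smult (c m) (Lc a b m))" using Lc_expansion[OF assms(1,3)] by blast
  have *: "integral {a..b} (\<lambda>x. w x * poly r x) = (\<Sum>m\<le>k. c m * integral {a..b} (\<lambda>x. w x * poly (Lc a b m) x))"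
    if "continuous_on {a..b} w" for w :: "real \<Rightarrow> real"
  proof -
    have "integral {a..b} (\<lambda>x. w x * poly r x) = integral {a..b} (\<lambda>x. \<Sum>m\<le>k. c m * (w x * poly (Lc a b m) x))"
      by (intro integral_cong) (simp add: c poly_sum sum_distrib_left algebra_simps)
    also have "\<dots> = (\<Sum>m\<le>k. integral {a..b} (\<lambda>x. c m * (w x * poly (Lc a b m) x)))"
      by (intro integral_sum integrable_on_mult_right integrable_continuous_poly that) auto
    finally show ?thesis by simp
  qed
  show ?thesis using assms by (simp add: * proj_moment continuous_intros)
qed

lemma integral_square_poly_zero:
  fixes p :: "real poly"
  assumes "a < b" "integral {a..b} (\<lambda>x. poly p x * poly p x) = 0"
  shows "p = 0"
proof -
  have "((\<lambda>x. poly p x * poly p x) has_integral 0) (cbox a b)"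
    using assms integrable_poly[of "p * p"] by (simp add: has_integral_integral poly_mult[abs_def])
       (metis assms(2) has_integral_integral)
  hence "poly p x * poly p x = 0" if "x \<in> cbox a b" for x
    using that assms(1)
    by (intro has_integral_0_cbox_imp_0[of a b "\<lambda>x. poly p x * poly p x"]) (auto intro!: continuous_intros)
  hence "\<forall>x\<in>{a..b}. poly p x = 0" by simp
  hence "{a..b} \<subseteq> {x. poly p x = 0}" by auto
  moreover have "infinite {a..b}" using assms by (rule_tac infinite_Icc)
  ultimately show ?thesis using poly_roots_finite[of p] finite_subset by blast
qed

lemma poly_eq_by_inner:
  fixes p q :: "real poly"
  assumes "a < b" "degree p \<le> k" "degree q \<le> k"
    "\<And>r. degree r \<le> k \<Longrightarrow> integral {a..b} (\<lambda>x. poly p x * poly r x) = integral {a..b} (\<lambda>x. poly q x * poly r x)"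
  shows "p = q"
proof -
  have d: "degree (p - q) \<le> k" using assms by (intro degree_diff_le)
  have "integral {a..b} (\<lambda>x. poly (p - q) x * poly (p - q) x) =
      integral {a..b} (\<lambda>x. poly (p * (p - q)) x - poly (q * (p - q)) x)"
    by (intro integral_cong) (simp add: algebra_simps)
  also have "\<dots> = integral {a..b} (poly (p * (p - q))) - integral {a..b} (poly (q * (p - q)))"
    by (rule integral_diff) (rule integrable_poly)+
  also have "\<dots> = 0" using assms(4)[OF d] by (simp add: poly_mult[abs_def])
  finally have "p - q = 0" by (rule integral_square_poly_zero[OF assms(1)])
  thus ?thesis by simp
qed

lemma proj_poly:
  assumes "a < b" "degree p \<le> k"
  shows "proj k a b (poly p) = p"
  using assms by (intro poly_eq_by_inner[OF assms(1) degree_proj] proj_inner continuous_intros)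

lemma degree_rad: "a < b \<Longrightarrow> degree (rad e k a b v) \<le> k"
  unfolding rad_def by (intro degree_diff_le degree_proj order.trans[OF degree_smult_le]) (auto simp: degree_Lc)

lemma rad_endp: "a < b \<Longrightarrow> poly (rad e k a b v) (endp e a b) = v (endp e a b)"
  by (simp add: rad_def coef_def Lc_endp algebra_simps power_mult_distrib[symmetric])

lemma rad_inner:
  assumes "a < b" "continuous_on {a..b} v" "degree r < k"
  shows "integral {a..b} (\<lambda>x. poly (rad e k a b v) x * poly r x) = integral {a..b} (\<lambda>x. v x * poly r x)"
proof -
  have "integral {a..b} (\<lambda>x. poly (rad e k a b v) x * poly r x) =
     integral {a..b} (\<lambda>x. poly (proj k a b v * r) x - coef e k a b v * poly (Lc a b k * r) x)"
    by (intro integral_cong) (simp add: rad_def algebra_simps)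
  also have "\<dots> = integral {a..b} (poly (proj k a b v * r)) - coef e k a b v * integral {a..b} (poly (Lc a b k * r))"
    by (subst integral_diff) (auto intro!: integrable_on_mult_right simp del: poly_mult)
  also have "\<dots> = integral {a..b} (\<lambda>x. v x * poly r x)"
    using Lc_orthogonal[OF assms(1,3)] proj_inner[OF assms(1,2), of r k] assms(3)
    by (simp add: poly_mult[abs_def])
  finally show ?thesis .
qed

text \<open>The difference of two candidates is orthogonal to all Legendre polynomials below degree
  k, hence a multiple of the one of degree k, and that one does not vanish at an end point.\<close>

lemma rad_unique:
  assumes "a < b" "k \<ge> 1" "degree p \<le> k" "degree q \<le> k"
    "\<And>r. degree r \<le> k - 1 \<Longrightarrow> integral {a..b} (\<lambda>x. poly p x * poly r x) = integral {a..b} (\<lambda>x. poly q x * poly r x)"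
    "poly p (endp e a b) = poly q (endp e a b)"
  shows "p = q"
proof -
  have d: "degree (p - q) \<le> k" using assms by (intro degree_diff_le)
  obtain c where c: "p - q = (\<Sum>m\<le>k. smult (c m) (Lc a b m))" using Lc_expansion[OF assms(1) d] by blast
  have "c n = 0" if "n < k" for n
  proof -
    have "degree (Lc a b n) \<le> k - 1" using that assms(1) by (simp add: degree_Lc)
    hence "integral {a..b} (\<lambda>x. poly p x * poly (Lc a b n) x) = integral {a..b} (\<lambda>x. poly q x * poly (Lc a b n) x)"
      by (rule assms(5))
    hence 0: "0 = integral {a..b} (\<lambda>x. poly (p * Lc a b n) x) - integral {a..b} (\<lambda>x. poly (q * Lc a b n) x)" by simp
    also have "\<dots> = integral {a..b} (\<lambda>x. poly (p * Lc a b n) x - poly (q * Lc a b n) x)"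
      by (rule integral_diff[symmetric]) (rule integrable_poly)+
    also have "\<dots> = integral {a..b} (\<lambda>x. poly (p - q) x * poly (Lc a b n) x)"
      by (intro integral_cong) (simp add: algebra_simps)
    also have "\<dots> = integral {a..b} (\<lambda>x. \<Sum>m\<le>k. c m * poly (Lc a b m * Lc a b n) x)"
      by (intro integral_cong) (simp add: c poly_sum sum_distrib_right mult.assoc)
    also have "\<dots> = (\<Sum>m\<le>k. c m * integral {a..b} (poly (Lc a b m * Lc a b n)))"
      by (rule integral_poly_sum) simp
    also have "\<dots> = (\<Sum>m\<le>k. if m = n then c n * ((b - a) / (2 * real n + 1)) else 0)"
      using assms by (intro sum.cong refl) (auto simp: poly_mult[abs_def] Lc_norm Lc_orthogonal')
    also have "\<dots> = c n * ((b - a) / (2 * real n + 1))" using that by simp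
    finally show ?thesis using assms(1) by (simp add: field_simps)
  qed
  hence "(\<Sum>m\<le>k. smult (c m) (Lc a b m)) = (\<Sum>m\<le>k. if m = k then smult (c k) (Lc a b k) else 0)"
    by (intro sum.cong) auto
  hence pq: "p - q = smult (c k) (Lc a b k)" using c by simp
  moreover have "poly (p - q) (endp e a b) = 0" using assms(6) by simp
  ultimately have "c k = 0" using Lc_endp[OF assms(1), of k e] by (auto split: if_splits)
  thus ?thesis using pq by simp
qed

lemma the_rad:
  assumes "a < b" "k \<ge> 1" "continuous_on {a..b} v"
  shows "(THE p. degree p \<le> k \<and>
     (\<forall>r :: real poly. degree r \<le> k - 1 \<longrightarrow>
        integral {a<..<b} (\<lambda>x. poly p x * poly r x) = integral {a<..<b} (\<lambda>x. v x * poly r x)) \<and>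
     poly p (endp e a b) = v (endp e a b)) = rad e k a b v"
proof (rule the_equality)
  show "degree (rad e k a b v) \<le> k \<and>
     (\<forall>r :: real poly. degree r \<le> k - 1 \<longrightarrow>
        integral {a<..<b} (\<lambda>x. poly (rad e k a b v) x * poly r x) = integral {a<..<b} (\<lambda>x. v x * poly r x)) \<and>
     poly (rad e k a b v) (endp e a b) = v (endp e a b)"
    using assms by (auto simp: degree_rad rad_endp integral_open_interval_real[symmetric] simp del: One_nat_def intro!: rad_inner)
next
  fix p :: "real poly"
  assume p: "degree p \<le> k \<and>
     (\<forall>r :: real poly. degree r \<le> k - 1 \<longrightarrow>
        integral {a<..<b} (\<lambda>x. poly p x * poly r x) = integral {a<..<b} (\<lambda>x. v x * poly r x)) \<and>
     poly p (endp e a b) = v (endp e a b)"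
  show "p = rad e k a b v"
  proof (rule rad_unique[OF assms(1,2), where e = e])
    fix r :: "real poly" assume r: "degree r \<le> k - 1"
    hence "degree r < k" using assms(2) by linarith
    thus "integral {a..b} (\<lambda>x. poly p x * poly r x) = integral {a..b} (\<lambda>x. poly (rad e k a b v) x * poly r x)"
      using p r rad_inner[OF assms(1,3)] by (simp add: integral_open_interval_real[symmetric])
  qed (use p assms in \<open>auto simp: degree_rad rad_endp\<close>)
qed

lemma Lim_at_left_Icc:
  fixes v :: "real \<Rightarrow> real"
  assumes "a < b" "continuous_on {a..b} v" shows "Lim (at_left b) v = v b"
proof -
  have "(v \<longlongrightarrow> v b) (at b within {a..b})" using assms by (auto simp: continuous_on_def)
  hence "(v \<longlongrightarrow> v b) (at_left b)"
    using assms(1) by (metis at_within_Icc_at_left)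
  thus ?thesis by (intro tendsto_Lim) auto
qed

lemma Lim_at_right_Icc:
  fixes v :: "real \<Rightarrow> real"
  assumes "a < b" "continuous_on {a..b} v" shows "Lim (at_right a) v = v a"
proof -
  have "(v \<longlongrightarrow> v a) (at a within {a..b})" using assms by (auto simp: continuous_on_def)
  hence "(v \<longlongrightarrow> v a) (at_right a)"
    using assms(1) by (metis at_within_Icc_at_right)
  thus ?thesis by (intro tendsto_Lim) auto
qed

lemma radau_minus_eq:
  assumes "a < b" "k \<ge> 1" "continuous_on {a..b} v"
  shows "radau_minus k a b v = poly (rad True k a b v)"
  using the_rad[OF assms, of True] Lim_at_left_Icc[OF assms(1,3)]
  by (simp add: radau_minus_def endp_def)

lemma radau_plus_eq:
  assumes "a < b" "k \<ge> 1" "continuous_on {a..b} v"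
  shows "radau_plus k a b v = poly (rad False k a b v)"
  using the_rad[OF assms, of False] Lim_at_right_Icc[OF assms(1,3)]
  by (simp add: radau_plus_def endp_def)

text \<open>With \<open>s m = 1\<close> the sum is the value of the projection at the right end;
  with \<open>s m = (-1)^(k + m)\<close> it is (-1)^k times the value at the left end. This
  identifies both prescribed coefficient formulas with \<open>coef\<close>.\<close>

lemma proj_sum_eq:
  assumes "a < b" "continuous_on {a..b} v"
  shows "1 / (b - a) * integral {a<..<b} (\<lambda>x. v x * (\<Sum>m=0..k. s m * (2 * real m + 1) * cell_legendre a b m x))
     = (\<Sum>m\<le>k. s m * mom a b m v)"
proof -
  have "integral {a<..<b} (\<lambda>x. v x * (\<Sum>m=0..k. s m * (2 * real m + 1) * cell_legendre a b m x)) =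
    integral {a..b} (\<lambda>x. \<Sum>m\<le>k. s m * (2 * real m + 1) * (v x * poly (Lc a b m) x))"
    unfolding integral_open_interval_real[symmetric] using assms(1)
    by (intro integral_cong) (simp add: cell_legendre_eq sum_distrib_left atLeast0AtMost algebra_simps)
  also have "\<dots> = (\<Sum>m\<le>k. s m * (2 * real m + 1) * integral {a..b} (\<lambda>x. v x * poly (Lc a b m) x))"
    by (subst integral_sum) (auto intro!: integrable_on_mult_right integrable_continuous_poly assms)
  finally have "1 / (b - a) * integral {a<..<b} (\<lambda>x. v x * (\<Sum>m=0..k. s m * (2 * real m + 1) * cell_legendre a b m x))
     = (\<Sum>m\<le>k. 1 / (b - a) * (s m * (2 * real m + 1) * integral {a..b} (\<lambda>x. v x * poly (Lc a b m) x)))"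
    by (simp only: sum_distrib_left)
  thus ?thesis by (simp add: mom_def mult_ac)
qed

lemma coef_bar_eq:
  assumes "a < b" "continuous_on {a..b} v"
  shows "coef_bar k a b v = coef True k a b v"
  using proj_sum_eq[OF assms, of "\<lambda>_. 1" k] Lim_at_left_Icc[OF assms]
  by (simp add: coef_bar_def coef_def endp_def proj_def poly_sum Lc_right[OF assms(1)])

lemma coef_tilde_eq:
  assumes "a < b" "continuous_on {a..b} v"
  shows "coef_tilde k a b v = coef False k a b v"
  using proj_sum_eq[OF assms, of "\<lambda>m. (- 1) ^ (k + m)" k] Lim_at_right_Icc[OF assms]
  by (simp add: coef_tilde_def coef_def endp_def proj_def poly_sum Lc_left[OF assms(1)] right_diff_distrib
      sum_distrib_left power_add algebra_simps)

lemma proj_cong: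
  assumes "\<And>x. x \<in> {a..b} \<Longrightarrow> v x = w x"
  shows "proj k a b v = proj k a b w"
proof -
  have "mom a b m v = mom a b m w" for m
    unfolding mom_def using assms by (intro arg_cong2[of _ _ _ _ "(*)"] refl integral_cong) simp
  thus ?thesis by (simp add: proj_def)
qed

lemma endp_in: "a < b \<Longrightarrow> endp e a b \<in> {a..b}"
  by (auto simp: endp_def)

lemma coef_cong:
  assumes "a < b" "\<And>x. x \<in> {a..b} \<Longrightarrow> v x = w x"
  shows "coef e k a b v = coef e k a b w"
  using proj_cong[where k = k, OF assms(2)] assms(2)[OF endp_in[OF assms(1)]] by (simp add: coef_def)

section \<open>Scaled primitives and the chain of correction functions\<close>

lemma Ds_inv_poly:
  fixes P :: "real poly"
  assumes "x \<ge> a" "pderiv P = p"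
  shows "Ds_inv a b (poly p) x = 2 / (b - a) * (poly P x - poly P a)"
  using has_integral_pderiv[OF assms(1), of P] assms(2) by (simp add: Ds_inv_def integral_unique)

text \<open>The agreement is claimed for x >= a only: left of \<open>a\<close> the integral in
  \<open>Ds_inv\<close> runs over an empty interval and is 0.\<close>

lemma Ds_inv_as_poly: "\<exists>q. pderiv q = smult (2 / (b - a)) p \<and> (\<forall>x\<ge>a. Ds_inv a b (poly p) x = poly q x)"
proof -
  obtain P where P: "pderiv P = p" using poly_antideriv by blast
  show ?thesis
    by (intro exI[of _ "smult (2 / (b - a)) (P - [:poly P a:])"])
       (auto simp: Ds_inv_poly[OF _ P] P pderiv_diff pderiv_smult pderiv_pCons)
qed

lemma Ds_inv_left: "Ds_inv a b f a = 0"
  by (simp add: Ds_inv_def)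

lemma Ds_inv_right: "Ds_inv a b f b = 2 / (b - a) * integral {a..b} f"
  by (simp add: Ds_inv_def)

lemma continuous_Ds_inv: "continuous_on {a..b} (Ds_inv a b (poly p))"
proof -
  obtain q where "\<forall>x\<ge>a. Ds_inv a b (poly p) x = poly q x" using Ds_inv_as_poly by blast
  hence "continuous_on {a..b} (Ds_inv a b (poly p)) \<longleftrightarrow> continuous_on {a..b} (poly q)"
    by (intro continuous_on_cong) auto
  thus ?thesis by (simp add: continuous_intros)
qed

lemma Ds_inv_parts:
  assumes "a \<le> b" "integral {a..b} (poly p) = 0 \<or> poly w b = 0"
  shows "integral {a..b} (\<lambda>x. Ds_inv a b (poly p) x * poly (pderiv w) x) =
    - (2 / (b - a)) * integral {a..b} (\<lambda>x. poly p x * poly w x)"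
proof -
  obtain q where q: "pderiv q = smult (2 / (b - a)) p" "\<And>x. x \<ge> a \<Longrightarrow> Ds_inv a b (poly p) x = poly q x"
    using Ds_inv_as_poly by metis
  have "integral {a..b} (\<lambda>x. Ds_inv a b (poly p) x * poly (pderiv w) x) =
     integral {a..b} (\<lambda>x. poly (pderiv w) x * poly q x)"
    using q by (intro integral_cong) simp
  also have "\<dots> = poly w b * poly q b - poly w a * poly q a - integral {a..b} (\<lambda>x. poly w x * poly (pderiv q) x)"
    by (rule integral_poly_parts[OF assms(1)])
  also have "poly q a = 0" using q(2)[of a] by (simp add: Ds_inv_left)
  also have "poly w b * poly q b = 0"
    using q(2)[of b] assms by (auto simp: Ds_inv_right)
  also have "integral {a..b} (\<lambda>x. poly w x * poly (pderiv q) x) = integral {a..b} (\<lambda>x. 2 / (b - a) * (poly p x * poly w x))"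
    by (intro integral_cong) (simp add: q)
  finally show ?thesis by simp
qed

text \<open>\<open>F\<^sub>1\<close>, \<open>F\<^sub>2\<close> and their barred versions are the members of one recursion with alternating
  end points; \<open>EP k a b n True\<close> is \<open>F\<^sub>2\<close> for odd \<open>n\<close> and the barred \<open>F\<^sub>1\<close> for even \<open>n\<close>.\<close>

primrec EP :: "nat \<Rightarrow> real \<Rightarrow> real \<Rightarrow> nat \<Rightarrow> bool \<Rightarrow> real poly" where
  "EP k a b 0 = (\<lambda>e. Lc a b k)"
| "EP k a b (Suc n) = (\<lambda>e. rad e k a b (Ds_inv a b (poly (EP k a b n (\<not> e)))))"

lemma degree_EP: "a < b \<Longrightarrow> degree (EP k a b n e) \<le> k"
  by (cases n) (simp_all add: degree_Lc degree_rad)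

text \<open>Every integration in the recursion costs one degree of orthogonality: integrating by
  parts against an antiderivative \<open>R\<close> of \<open>r\<close> leads back to the previous
  member, tested with a polynomial of one degree more. The boundary term at \<open>b\<close>
  vanishes because the previous member has mean zero, an instance of the same induction
  hypothesis.\<close>

lemma EP_orthogonal:
  assumes "a < b" "degree r + n < k"
  shows "integral {a..b} (\<lambda>x. poly (EP k a b n e) x * poly r x) = 0"
  using assms(2)
proof (induction n arbitrary: e r)
  case 0
  thus ?case using Lc_orthogonal[OF assms(1)] by simp
next
  case (Suc n)
  obtain R where R: "pderiv R = r" using poly_antideriv by blast
  have dR: "degree R + n < k" using Suc.prems R degree_pderiv[of R] by auto
  have "integral {a..b} (\<lambda>x. poly (EP k a b n (\<not> e)) x * poly 1 x) = 0"
    using Suc.prems by (intro Suc.IH) simp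
  hence i: "integral {a..b} (poly (EP k a b n (\<not> e))) = 0" by simp
  have "integral {a..b} (\<lambda>x. poly (EP k a b (Suc n) e) x * poly r x) =
    integral {a..b} (\<lambda>x. Ds_inv a b (poly (EP k a b n (\<not> e))) x * poly (pderiv R) x)"
    using rad_inner[OF assms(1) continuous_Ds_inv, of r k e] Suc.prems R by simp
  also have "\<dots> = - (2 / (b - a)) * integral {a..b} (\<lambda>x. poly (EP k a b n (\<not> e)) x * poly R x)"
    using i assms(1) by (intro Ds_inv_parts) auto
  also have "\<dots> = 0" using Suc.IH[OF dR] by simp
  finally show ?case .
qed

lemma EP_mean_zero:
  assumes "a < b" "n < k"
  shows "integral {a..b} (poly (EP k a b n e)) = 0"
  using EP_orthogonal[OF assms(1), of 1 n k e] assms(2) by simp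

text \<open>The cancellation mechanism of the corrections: a member tested with a derivative
  reproduces its predecessor. The factor 2/(b - a) is later absorbed by the powers of half the cell
  length in front of the corrections.\<close>

lemma EP_Suc_pderiv:
  assumes "a < b" "n < k" "degree w \<le> k"
  shows "integral {a..b} (\<lambda>x. poly (EP k a b (Suc n) e) x * poly (pderiv w) x) =
    - (2 / (b - a)) * integral {a..b} (\<lambda>x. poly (EP k a b n (\<not> e)) x * poly w x)"
proof -
  have "degree (pderiv w) < k" using assms degree_pderiv[of w] by auto
  hence "integral {a..b} (\<lambda>x. poly (EP k a b (Suc n) e) x * poly (pderiv w) x) =
     integral {a..b} (\<lambda>x. Ds_inv a b (poly (EP k a b n (\<not> e))) x * poly (pderiv w) x)"
    using rad_inner[OF assms(1) continuous_Ds_inv] by simp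
  also have "\<dots> = - (2 / (b - a)) * integral {a..b} (\<lambda>x. poly (EP k a b n (\<not> e)) x * poly w x)"
    using EP_mean_zero[OF assms(1,2)] assms(1) by (intro Ds_inv_parts) auto
  finally show ?thesis .
qed

text \<open>The predecessor has mean zero, so its primitive vanishes at both ends and the Radau
  projection preserves this at its own end point. Consequently the corrections leave the numerical
  fluxes untouched.\<close>

lemma EP_endp:
  assumes "a < b" "n < k"
  shows "poly (EP k a b (Suc n) e) (endp e a b) = 0"
  using assms EP_mean_zero[OF assms] by (simp add: rad_endp) (simp add: endp_def Ds_inv_left Ds_inv_right)

section \<open>Stability bounds that depend on the polynomial degree only\<close>

lemma abs_integral_le:
  fixes f :: "real \<Rightarrow> real"
  assumes "a \<le> b" "continuous_on {a..b} f" "\<And>x. x \<in> {a..b} \<Longrightarrow> \<bar>f x\<bar> \<le> S"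
  shows "\<bar>integral {a..b} f\<bar> \<le> S * (b - a)"
  using integral_bound[OF assms(1,2), of S] assms(3) by auto

lemma proj_bound:
  obtains B where "B \<ge> 1"
    "\<And>a b v S x. a < b \<Longrightarrow> continuous_on {a..b} v \<Longrightarrow> (\<And>x. x \<in> {a..b} \<Longrightarrow> \<bar>v x\<bar> \<le> S) \<Longrightarrow> x \<in> {a..b} \<Longrightarrow>
       \<bar>poly (proj k a b v) x\<bar> \<le> B * S"
    "\<And>a b v S e. a < b \<Longrightarrow> continuous_on {a..b} v \<Longrightarrow> (\<And>x. x \<in> {a..b} \<Longrightarrow> \<bar>v x\<bar> \<le> S) \<Longrightarrow>
       \<bar>coef e k a b v\<bar> \<le> B * S"
    "\<And>a b v S x e. a < b \<Longrightarrow> continuous_on {a..b} v \<Longrightarrow> (\<And>x. x \<in> {a..b} \<Longrightarrow> \<bar>v x\<bar> \<le> S) \<Longrightarrow> x \<in> {a..b} \<Longrightarrow>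
       \<bar>poly (rad e k a b v) x\<bar> \<le> B * S"
proof -
  obtain L where L: "L \<ge> 1"
    "\<And>a b m x. a < b \<Longrightarrow> m \<le> k \<Longrightarrow> a \<le> x \<Longrightarrow> x \<le> b \<Longrightarrow> \<bar>poly (Lc a b m) x\<bar> \<le> L"
    using Lc_bound[of k] by metis
  define A where "A = (\<Sum>m\<le>k. (2 * real m + 1) * L * L)"
  have A: "A \<ge> 0" unfolding A_def using L(1) by (intro sum_nonneg) auto
  define B where "B = A + (A + 1) * L + 1"
  have P: "\<bar>poly (proj k a b v) x\<bar> \<le> A * S"
    if "a < b" "continuous_on {a..b} v" "\<And>x. x \<in> {a..b} \<Longrightarrow> \<bar>v x\<bar> \<le> S" "x \<in> {a..b}" for a b S x :: real and v
  proof -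
    have S0: "S \<ge> 0" using that(3)[OF that(4)] by linarith
    have m: "\<bar>mom a b m v\<bar> \<le> (2 * real m + 1) * (S * L)" if "m \<le> k" for m
    proof -
      have "\<bar>integral {a..b} (\<lambda>x. v x * poly (Lc a b m) x)\<bar> \<le> S * L * (b - a)"
        using \<open>a < b\<close> \<open>continuous_on {a..b} v\<close> L(2)[of a b m] \<open>m \<le> k\<close> \<open>\<And>x. x \<in> {a..b} \<Longrightarrow> \<bar>v x\<bar> \<le> S\<close> S0
        by (intro abs_integral_le) (auto simp: abs_mult intro!: mult_mono continuous_intros)
      hence "(2 * real m + 1) / (b - a) * \<bar>integral {a..b} (\<lambda>x. v x * poly (Lc a b m) x)\<bar> \<le> (2 * real m + 1) / (b - a) * (S * L * (b - a))"
        using \<open>a < b\<close> by (intro mult_left_mono) auto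
      thus ?thesis using \<open>a < b\<close> by (simp add: mom_def abs_mult)
    qed
    have "\<bar>poly (proj k a b v) x\<bar> \<le> (\<Sum>m\<le>k. \<bar>mom a b m v * poly (Lc a b m) x\<bar>)"
      unfolding proj_def poly_sum poly_smult by (rule sum_abs)
    also have "\<dots> \<le> (\<Sum>m\<le>k. ((2 * real m + 1) * (S * L)) * L)"
      using m L that(1,4) S0 by (intro sum_mono) (auto simp: abs_mult intro!: mult_mono)
    also have "\<dots> = A * S" unfolding A_def sum_distrib_right by (intro sum.cong) (auto simp: mult_ac)
    finally show ?thesis .
  qed
  have C: "\<bar>coef e k a b v\<bar> \<le> (A + 1) * S"
    if "a < b" "continuous_on {a..b} v" "\<And>x. x \<in> {a..b} \<Longrightarrow> \<bar>v x\<bar> \<le> S" for a b S :: real and v e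
  proof -
    have "\<bar>coef e k a b v\<bar> = \<bar>poly (proj k a b v) (endp e a b) - v (endp e a b)\<bar>"
      by (simp add: coef_def abs_mult power_abs)
    also have "\<dots> \<le> A * S + S"
      using P[OF that endp_in[OF that(1), of e]] that(3)[OF endp_in[OF that(1), of e]] by linarith
    finally show ?thesis by (simp add: algebra_simps)
  qed
  have R: "\<bar>poly (rad e k a b v) x\<bar> \<le> A * S + (A + 1) * S * L"
    if "a < b" "continuous_on {a..b} v" "\<And>x. x \<in> {a..b} \<Longrightarrow> \<bar>v x\<bar> \<le> S" "x \<in> {a..b}" for a b S x :: real and v e
  proof -
    have S0: "S \<ge> 0" using that(3)[OF that(4)] by linarith
    have "\<bar>coef e k a b v * poly (Lc a b k) x\<bar> \<le> (A + 1) * S * L"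
      unfolding abs_mult using C[OF that(1-3), of e] L(2)[of a b k x] that A S0 by (intro mult_mono) auto
    thus ?thesis using P[OF that] unfolding rad_def by simp
  qed
  show ?thesis
  proof (rule that[of B])
    show "B \<ge> 1" using A L(1) by (simp add: B_def)
    fix a b S :: real and v e assume h: "a < b" "continuous_on {a..b} v" "\<And>x. x \<in> {a..b} \<Longrightarrow> \<bar>v x\<bar> \<le> S"
    have S0: "S \<ge> 0" using h(3)[OF endp_in[OF h(1), of True]] by linarith
    have AL: "(A + 1) * S * L \<ge> (A + 1) * S" using mult_left_mono[OF L(1), of "(A + 1) * S"] A S0 by simp
    have BS: "B * S = A * S + (A + 1) * S * L + S" by (simp add: B_def algebra_simps)
    have nn: "0 \<le> A * S" "0 \<le> (A + 1) * S" using A S0 by auto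
    show "\<bar>coef e k a b v\<bar> \<le> B * S" using C[OF h, of e] AL BS nn S0 by linarith
    fix x assume "x \<in> {a..b}"
    show "\<bar>poly (proj k a b v) x\<bar> \<le> B * S" using P[OF h \<open>x \<in> {a..b}\<close>] AL BS nn S0 by linarith
    show "\<bar>poly (rad e k a b v) x\<bar> \<le> B * S" using R[OF h \<open>x \<in> {a..b}\<close>, of e] AL BS nn S0 by linarith
  qed
qed

text \<open>The scaling of \<open>Ds_inv\<close> by half the cell length makes it bounded by 2 in
  the maximum norm on every cell, so each step of the recursion costs at most 2R, independently of
  the cell.\<close>

lemma EP_bound:
  obtains B where "B \<ge> 1"
    "\<And>a b e n x. a < b \<Longrightarrow> n \<le> k \<Longrightarrow> x \<in> {a..b} \<Longrightarrow> \<bar>poly (EP k a b n e) x\<bar> \<le> B"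
proof -
  obtain L where L: "L \<ge> 1"
    "\<And>a b m x. a < b \<Longrightarrow> m \<le> k \<Longrightarrow> a \<le> x \<Longrightarrow> x \<le> b \<Longrightarrow> \<bar>poly (Lc a b m) x\<bar> \<le> L"
    using Lc_bound[of k] by metis
  obtain R where R: "R \<ge> 1" "\<And>a b v S x e. a < b \<Longrightarrow> continuous_on {a..b} v \<Longrightarrow> (\<And>x. x \<in> {a..b} \<Longrightarrow> \<bar>v x\<bar> \<le> S) \<Longrightarrow> x \<in> {a..b} \<Longrightarrow>
       \<bar>poly (rad e k a b v) x\<bar> \<le> R * S" using proj_bound[of k] by metis
  have *: "\<bar>poly (EP k a b n e) x\<bar> \<le> L * (2 * R) ^ n" if "a < b" "x \<in> {a..b}" for a b x :: real and n e
    using that(2)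
  proof (induction n arbitrary: e x)
    case 0
    thus ?case using L(2)[of a b k x] that(1) by simp
  next
    case (Suc n)
    have "\<bar>Ds_inv a b (poly (EP k a b n (\<not> e))) y\<bar> \<le> 2 * (L * (2 * R) ^ n)" if y: "y \<in> {a..b}" for y
    proof -
      have "\<bar>integral {a..y} (poly (EP k a b n (\<not> e)))\<bar> \<le> L * (2 * R) ^ n * (y - a)"
        using y Suc.IH by (intro abs_integral_le continuous_intros) auto
      also have "\<dots> \<le> L * (2 * R) ^ n * (b - a)" using y L(1) R(1) by (intro mult_left_mono) auto
      finally have "2 / (b - a) * \<bar>integral {a..y} (poly (EP k a b n (\<not> e)))\<bar> \<le> 2 / (b - a) * (L * (2 * R) ^ n * (b - a))"
        using \<open>a < b\<close> by (intro mult_left_mono) auto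
      thus ?thesis using \<open>a < b\<close> by (simp add: Ds_inv_def abs_mult)
    qed
    from R(2)[OF \<open>a < b\<close> continuous_Ds_inv this Suc.prems] show ?case by (simp add: mult_ac)
  qed
  show ?thesis
  proof (rule that[of "L * (2 * R) ^ k"])
    show "1 \<le> L * (2 * R) ^ k" using mult_mono[OF L(1) one_le_power[of "2 * R" k]] L(1) R(1) by simp
    fix a b x :: real and e n assume "a < b" "n \<le> k" "x \<in> {a..b}"
    have "\<bar>poly (EP k a b n e) x\<bar> \<le> L * (2 * R) ^ n" by (rule *) fact+
    also have "\<dots> \<le> L * (2 * R) ^ k" using L(1) R(1) \<open>n \<le> k\<close> by (intro mult_left_mono power_increasing) auto
    finally show "\<bar>poly (EP k a b n e) x\<bar> \<le> L * (2 * R) ^ k" .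
  qed
qed

subsection \<open>Energy estimates for skew evolutions\<close>

lemma within_nonpos_deriv_le:
  fixes G :: "real \<Rightarrow> real"
  assumes "\<And>t. t \<in> {a..b} \<Longrightarrow> (G has_real_derivative G' t) (at t within {a..b})"
    and "\<And>t. t \<in> {a..b} \<Longrightarrow> G' t \<le> 0" and "s \<in> {a..b}"
  shows "G s \<le> G a"
proof (rule DERIV_nonpos_imp_decreasing_open[of a s G])
  show "a \<le> s" using assms by simp
  show "continuous_on {a..s} G"
    using assms by (intro DERIV_continuous_on[of _ _ G'] DERIV_subset[OF assms(1)]) auto
  fix x assume "a < x" "x < s"
  hence "(G has_real_derivative G' x) (at x)" using assms(1)[of x] assms(3) by (simp add: at_within_Icc_at)
  thus "\<exists>y. (G has_real_derivative y) (at x) \<and> y \<le> 0" using assms(2)[of x] \<open>a < x\<close> \<open>x < s\<close> assms(3) by auto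
qed

text \<open>Variation of constants: \<open>g\<close> is \<open>f\<close> averaged over the past with
  an exponential kernel of width \<open>h\<close>, hence one time derivative smoother than
  \<open>f\<close>.\<close>

lemma low_pass_filter:
  fixes f :: "real \<Rightarrow> real"
  assumes "h > 0" "continuous_on {0..T} f"
  shows "\<exists>g. g 0 = 0 \<and> (\<forall>t\<in>{0..T}. (g has_real_derivative (f t - g t) / h) (at t within {0..T}))"
proof -
  define J where "J t = integral {0..t} (\<lambda>s. exp (s / h) * f s)" for t
  define g where "g t = exp (- t / h) / h * J t" for t
  have J: "(J has_real_derivative exp (t / h) * f t) (at t within {0..T})" if "t \<in> {0..T}" for t
    unfolding J_def using that assms
    by (intro integral_has_real_derivative[of 0 T "\<lambda>s. exp (s / h) * f s" t] continuous_intros) auto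
  show ?thesis
  proof (intro exI[of _ g] conjI ballI)
    show "g 0 = 0" by (simp add: g_def J_def)
    fix t assume t: "t \<in> {0..T}"
    have "(g has_real_derivative (- 1 / h * exp (- t / h) / h * J t + exp (- t / h) / h * (exp (t / h) * f t))) (at t within {0..T})"
      unfolding g_def using J[OF t] assms(1) by (auto intro!: derivative_eq_intros simp: field_simps)
    also have "- 1 / h * exp (- t / h) / h * J t + exp (- t / h) / h * (exp (t / h) * f t) = (f t - g t) / h"
      using assms(1) by (simp add: g_def field_simps exp_minus)
    finally show "(g has_real_derivative (f t - g t) / h) (at t within {0..T})" .
  qed
qed

lemma double_product_le:
  fixes x y w :: real
  assumes "w > 0"
  shows "2 * x * y \<le> w * x\<^sup>2 + y\<^sup>2 / w"
proof -
  have "0 \<le> w * (x - y / w)\<^sup>2" using assms by simp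
  also have "\<dots> = w * x\<^sup>2 + y\<^sup>2 / w - 2 * x * y"
    using assms by (simp add: power2_eq_square field_simps)
  finally show ?thesis by simp
qed

text \<open>\<open>A\<close> is the time integral of the squared norm of \<open>r1\<close>. It is
  kept as a datum of its own next to the pointwise bound \<open>\<rho>1\<close>, since in the
  application it is smaller than what \<open>\<rho>1\<close> alone would give. \<open>K\<close> is
  the constant of the inverse inequality for the discrete derivative.\<close>

locale skew_evolution =
  fixes I :: "'i set" and b :: "'i \<Rightarrow> 'i \<Rightarrow> real" and K T \<rho>1 \<rho>2 :: real
    and \<alpha> r1 r2 :: "real \<Rightarrow> 'i \<Rightarrow> real" and A :: "real \<Rightarrow> real"
  assumes fin: "finite I" and K: "K > 0"
    and b_bound: "\<And>v. (\<Sum>j\<in>I. (\<Sum>i\<in>I. v i * b i j)\<^sup>2) \<le> K\<^sup>2 * (\<Sum>i\<in>I. (v i)\<^sup>2)"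
    and deriv: "\<And>t i. t \<in> {0..T} \<Longrightarrow> i \<in> I \<Longrightarrow>
      ((\<lambda>s. \<alpha> s i) has_real_derivative
         (- (\<Sum>j\<in>I. b i j * ((\<Sum>l\<in>I. \<alpha> t l * b l j) - r2 t j)) - r1 t i)) (at t within {0..T})"
    and init: "\<And>i. i \<in> I \<Longrightarrow> \<alpha> 0 i = 0"
    and A_deriv: "\<And>t. t \<in> {0..T} \<Longrightarrow> (A has_real_derivative (\<Sum>i\<in>I. (r1 t i)\<^sup>2)) (at t within {0..T})"
    and A0: "A 0 = 0"
    and r1: "\<And>t. t \<in> {0..T} \<Longrightarrow> (\<Sum>i\<in>I. (r1 t i)\<^sup>2) \<le> \<rho>1"
    and r2: "\<And>t. t \<in> {0..T} \<Longrightarrow> (\<Sum>i\<in>I. (r2 t i)\<^sup>2) \<le> \<rho>2"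
begin

definition D :: "('i \<Rightarrow> real) \<Rightarrow> 'i \<Rightarrow> real" where "D v j = (\<Sum>i\<in>I. v i * b i j)"
definition \<alpha>' where "\<alpha>' t i = - (\<Sum>j\<in>I. b i j * (D (\<alpha> t) j - r2 t j)) - r1 t i"
definition ip :: "('i \<Rightarrow> real) \<Rightarrow> ('i \<Rightarrow> real) \<Rightarrow> real" where "ip v w = (\<Sum>i\<in>I. v i * w i)"

lemma ip_self: "ip v v = (\<Sum>i\<in>I. (v i)\<^sup>2)"
  by (simp add: ip_def power2_eq_square)

lemma alpha_deriv: "t \<in> {0..T} \<Longrightarrow> i \<in> I \<Longrightarrow> ((\<lambda>s. \<alpha> s i) has_real_derivative \<alpha>' t i) (at t within {0..T})"
  using deriv[of t i] by (simp add: \<alpha>'_def D_def)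

lemma ip_deriv:
  assumes "\<And>i. i \<in> I \<Longrightarrow> ((\<lambda>s. v s i) has_real_derivative v' i) (at t within S)"
  shows "((\<lambda>s. ip (v s) (v s)) has_real_derivative 2 * ip (v t) v') (at t within S)"
  unfolding ip_def sum_distrib_left
  by (rule derivative_eq_intros DERIV_sum assms | assumption | simp)+

lemma D_deriv:
  assumes "\<And>i. i \<in> I \<Longrightarrow> ((\<lambda>s. v s i) has_real_derivative v' i) (at t within S)"
  shows "((\<lambda>s. D (v s) j) has_real_derivative D v' j) (at t within S)"
  unfolding D_def by (intro DERIV_sum DERIV_cmult_right assms)

lemma ip_alpha':
  "ip v (\<alpha>' t) = - ip (D v) (D (\<alpha> t)) + ip (D v) (r2 t) - ip v (r1 t)"
proof -
  have "(\<Sum>i\<in>I. v i * (\<Sum>j\<in>I. b i j * w j)) = (\<Sum>j\<in>I. D v j * w j)" for w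
  proof -
    have "(\<Sum>i\<in>I. v i * (\<Sum>j\<in>I. b i j * w j)) = (\<Sum>i\<in>I. \<Sum>j\<in>I. v i * b i j * w j)"
      by (simp add: sum_distrib_left mult.assoc)
    also have "\<dots> = (\<Sum>j\<in>I. \<Sum>i\<in>I. v i * b i j * w j)" by (rule sum.swap)
    also have "\<dots> = (\<Sum>j\<in>I. D v j * w j)" by (simp add: D_def sum_distrib_right)
    finally show ?thesis .
  qed
  note * = this[of "\<lambda>j. D (\<alpha> t) j - r2 t j"]
  have "ip v (\<alpha>' t) = - (\<Sum>i\<in>I. v i * (\<Sum>j\<in>I. b i j * (D (\<alpha> t) j - r2 t j))) - ip v (r1 t)"
    by (simp add: ip_def \<alpha>'_def right_diff_distrib sum_subtractf sum_negf)
  also have "(\<Sum>i\<in>I. v i * (\<Sum>j\<in>I. b i j * (D (\<alpha> t) j - r2 t j))) = ip (D v) (D (\<alpha> t)) - ip (D v) (r2 t)"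
    unfolding * ip_def by (simp add: right_diff_distrib sum_subtractf)
  finally show ?thesis by simp
qed

lemma ip_young: "w > 0 \<Longrightarrow> 2 * ip v u \<le> w * ip v v + ip u u / w"
proof -
  assume w: "w > 0"
  have "2 * ip v u = (\<Sum>i\<in>I. 2 * v i * u i)" by (simp add: ip_def sum_distrib_left mult.assoc)
  also have "\<dots> \<le> (\<Sum>i\<in>I. w * (v i)\<^sup>2 + (u i)\<^sup>2 / w)" by (intro sum_mono double_product_le w)
  also have "\<dots> = w * ip v v + ip u u / w"
    by (simp add: ip_self sum.distrib sum_distrib_left sum_divide_distrib)
  finally show ?thesis .
qed

lemma ip_uminus: "ip (\<lambda>i. - v i) u = - ip v u" "ip v (\<lambda>i. - u i) = - ip v u"
  by (simp_all add: ip_def sum_negf)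

lemma ip_nonneg: "ip v v \<ge> 0"
  unfolding ip_self by (intro sum_nonneg) simp

lemma ip_young': "w > 0 \<Longrightarrow> - (2 * ip v u) \<le> w * ip v v + ip u u / w"
  using ip_young[of w "\<lambda>i. - v i" u] by (simp add: ip_uminus)

lemma ip_D_le: "ip (D v) (D v) \<le> K\<^sup>2 * ip v v"
  unfolding ip_self D_def by (rule b_bound)

text \<open>Testing with \<open>\<alpha>\<close> itself: the dissipation absorbs the term with
  \<open>r2\<close> completely. The term with \<open>r1\<close> is split with weight 1/\<tau>, and
  the resulting growth rate 1/\<tau> is removed by the weight exp(-s/\<tau>). As \<tau> is the final
  time, this weight never falls below 1/e.\<close>

lemma energy_bound:
  assumes "0 < \<tau>" "\<tau> \<le> T"
  shows "ip (\<alpha> \<tau>) (\<alpha> \<tau>) \<le> exp 1 * (\<tau> * \<rho>2 / 2 + \<tau> * A \<tau>)"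
proof -
  let ?E = "\<lambda>s. ip (\<alpha> s) (\<alpha> s)"
  let ?G = "\<lambda>s. ?E s * exp (- s / \<tau>) - \<rho>2 / 2 * s - \<tau> * A s"
  let ?G' = "\<lambda>s. 2 * ip (\<alpha> s) (\<alpha>' s) * exp (- s / \<tau>) + ?E s * (- 1 / \<tau> * exp (- s / \<tau>)) - \<rho>2 / 2 - \<tau> * ip (r1 s) (r1 s)"
  have "?G \<tau> \<le> ?G 0"
  proof (rule within_nonpos_deriv_le[of 0 \<tau> ?G ?G'])
    fix t assume t: "t \<in> {0..\<tau>}"
    hence tT: "t \<in> {0..T}" using assms by auto
    have 1: "(?E has_real_derivative 2 * ip (\<alpha> t) (\<alpha>' t)) (at t within {0..\<tau>})"
      using tT assms by (intro ip_deriv DERIV_subset[OF alpha_deriv]) auto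
    have 2: "(A has_real_derivative ip (r1 t) (r1 t)) (at t within {0..\<tau>})"
      unfolding ip_self using tT assms by (intro DERIV_subset[OF A_deriv]) auto
    show "(?G has_real_derivative ?G' t) (at t within {0..\<tau>})"
      using assms by (auto intro!: derivative_eq_intros 1 2)
    have y1: "2 * ip (D (\<alpha> t)) (r2 t) \<le> 2 * ip (D (\<alpha> t)) (D (\<alpha> t)) + \<rho>2 / 2"
      using ip_young[of 2 "D (\<alpha> t)" "r2 t"] r2[OF tT] by (simp add: ip_self)
    have y2: "- (2 * ip (\<alpha> t) (r1 t)) \<le> ?E t / \<tau> + \<tau> * ip (r1 t) (r1 t)"
      using ip_young'[of "1 / \<tau>" "\<alpha> t" "r1 t"] assms by (simp add: mult.commute)
    have rho: "\<rho>2 / 2 + \<tau> * ip (r1 t) (r1 t) \<ge> 0"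
      using r2[OF tT] ip_nonneg[of "r2 t"] ip_nonneg[of "r1 t"] assms by (simp add: ip_self)
    have "2 * ip (\<alpha> t) (\<alpha>' t) - ?E t / \<tau> \<le> \<rho>2 / 2 + \<tau> * ip (r1 t) (r1 t)"
      unfolding ip_alpha' using y1 y2 by argo
    hence "exp (- t / \<tau>) * (2 * ip (\<alpha> t) (\<alpha>' t) - ?E t / \<tau>) \<le> exp (- t / \<tau>) * (\<rho>2 / 2 + \<tau> * ip (r1 t) (r1 t))"
      by (intro mult_left_mono) auto
    also have "\<dots> \<le> 1 * (\<rho>2 / 2 + \<tau> * ip (r1 t) (r1 t))"
      using assms t rho by (intro mult_right_mono) auto
    finally show "?G' t \<le> 0" by (simp add: algebra_simps)
  qed (use assms in auto)
  also have "?G 0 = 0" using init A0 by (simp add: ip_def)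
  finally have "?E \<tau> * exp (- 1) \<le> \<tau> * \<rho>2 / 2 + \<tau> * A \<tau>" using assms by (simp add: mult.commute)
  hence "exp 1 * (?E \<tau> * exp (- 1)) \<le> exp 1 * (\<tau> * \<rho>2 / 2 + \<tau> * A \<tau>)" by (intro mult_left_mono) auto
  moreover have "exp 1 * (?E \<tau> * exp (- 1)) = ?E \<tau>" by (simp add: exp_minus)
  ultimately show ?thesis by simp
qed

text \<open>Testing with the time derivative of \<open>\<alpha>\<close>. It makes the discrete
  gradient fall on the time derivative in the \<open>r2\<close> term; the inverse inequality
  \<open>ip_D_le\<close> removes it again, and two Young inequalities spend the available 2
  |\<alpha>'|^2 in equal halves.\<close>

lemma gradient_bound:
  assumes "0 \<le> \<tau>" "\<tau> \<le> T"
  shows "ip (D (\<alpha> \<tau>)) (D (\<alpha> \<tau>)) \<le> \<tau> * (\<rho>1 + K\<^sup>2 * \<rho>2)"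
proof -
  let ?F = "\<lambda>s. ip (D (\<alpha> s)) (D (\<alpha> s))"
  let ?G = "\<lambda>s. ?F s - s * (\<rho>1 + K\<^sup>2 * \<rho>2)"
  let ?G' = "\<lambda>s. 2 * ip (D (\<alpha> s)) (D (\<alpha>' s)) - (\<rho>1 + K\<^sup>2 * \<rho>2)"
  have "?G \<tau> \<le> ?G 0"
  proof (rule within_nonpos_deriv_le[of 0 T ?G ?G'])
    fix t assume t: "t \<in> {0..T}"
    have 1: "(?F has_real_derivative 2 * ip (D (\<alpha> t)) (D (\<alpha>' t))) (at t within {0..T})"
      using t by (intro ip_deriv D_deriv alpha_deriv) auto
    show "(?G has_real_derivative ?G' t) (at t within {0..T})"
      by (auto intro!: derivative_eq_intros 1)
    have comm: "ip (D (\<alpha> t)) (D (\<alpha>' t)) = ip (D (\<alpha>' t)) (D (\<alpha> t))" by (simp add: ip_def mult.commute)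
    have e: "ip (D (\<alpha>' t)) (D (\<alpha> t)) = - ip (\<alpha>' t) (\<alpha>' t) + ip (D (\<alpha>' t)) (r2 t) - ip (\<alpha>' t) (r1 t)"
      using ip_alpha'[of "\<alpha>' t" t] by linarith
    have "2 * ip (D (\<alpha>' t)) (r2 t) \<le> 1 / K\<^sup>2 * ip (D (\<alpha>' t)) (D (\<alpha>' t)) + K\<^sup>2 * ip (r2 t) (r2 t)"
      using ip_young[of "1 / K\<^sup>2" "D (\<alpha>' t)" "r2 t"] K by (simp add: mult.commute)
    also have "1 / K\<^sup>2 * ip (D (\<alpha>' t)) (D (\<alpha>' t)) \<le> 1 / K\<^sup>2 * (K\<^sup>2 * ip (\<alpha>' t) (\<alpha>' t))"
      using K by (intro mult_left_mono ip_D_le) auto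
    also have "1 / K\<^sup>2 * (K\<^sup>2 * ip (\<alpha>' t) (\<alpha>' t)) = ip (\<alpha>' t) (\<alpha>' t)" using K by simp
    also have "K\<^sup>2 * ip (r2 t) (r2 t) \<le> K\<^sup>2 * \<rho>2" using r2[OF t] by (intro mult_left_mono) (auto simp: ip_self)
    finally have y1: "2 * ip (D (\<alpha>' t)) (r2 t) \<le> ip (\<alpha>' t) (\<alpha>' t) + K\<^sup>2 * \<rho>2" by simp
    have y2: "- (2 * ip (\<alpha>' t) (r1 t)) \<le> ip (\<alpha>' t) (\<alpha>' t) + \<rho>1"
      using ip_young'[of 1 "\<alpha>' t" "r1 t"] r1[OF t] by (simp add: ip_self)
    show "?G' t \<le> 0" unfolding comm e using y1 y2 by argo
  qed (use assms in auto)
  also have "?G 0 = 0" using init by (simp add: ip_def D_def)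
  finally show ?thesis by simp
qed

(* The time average a, solving h a' = alpha - a, is smoother than alpha; the functional
   below is an interpolation norm adapted to the length scale h. *)
lemma splitting_bound:
  assumes "h > 0" "0 \<le> \<tau>" "\<tau> \<le> T"
  shows "\<exists>a. ip (D a) (D a) + ip (\<lambda>i. \<alpha> \<tau> i - a i) (\<lambda>i. \<alpha> \<tau> i - a i) / h \<le> (\<tau> * \<rho>2 / h + A \<tau>) / 2"
proof -
  have "\<exists>g. g 0 = 0 \<and> (\<forall>t\<in>{0..T}. (g has_real_derivative (\<alpha> t i - g t) / h) (at t within {0..T}))" if "i \<in> I" for i
    using that by (intro low_pass_filter[OF assms(1)] DERIV_continuous_on[OF alpha_deriv]) auto
  then obtain a where a0: "\<And>i. i \<in> I \<Longrightarrow> a i 0 = 0" and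
    a: "\<And>i t. i \<in> I \<Longrightarrow> t \<in> {0..T} \<Longrightarrow> (a i has_real_derivative (\<alpha> t i - a i t) / h) (at t within {0..T})"
    by metis
  define aa where "aa t i = a i t" for t i
  define \<beta> where "\<beta> t i = \<alpha> t i - aa t i" for t i
  have a': "((\<lambda>s. aa s i) has_real_derivative \<beta> t i / h) (at t within {0..T})" if "i \<in> I" "t \<in> {0..T}" for i t
    unfolding aa_def \<beta>_def using a[OF that] by simp
  have \<beta>': "((\<lambda>s. \<beta> s i) has_real_derivative \<alpha>' t i - \<beta> t i / h) (at t within {0..T})" if "i \<in> I" "t \<in> {0..T}" for i t
    unfolding \<beta>_def using a'[OF that] that unfolding \<beta>_def by (intro DERIV_diff alpha_deriv) auto
  have Dh: "D (\<lambda>i. v i / h) = (\<lambda>j. D v j / h)" for v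
    by (rule ext) (simp add: D_def sum_divide_distrib)
  have Dab: "D (\<alpha> t) j = D (aa t) j + D (\<beta> t) j" for t j
    unfolding D_def \<beta>_def by (simp add: sum.distrib[symmetric] algebra_simps)
  \<comment> \<open>The weight 1/h is forced by the filter: differentiating the first term gives
    (2/h) times the product of the gradients of \<open>aa\<close> and \<open>\<beta>\<close>, and
    the equation for \<open>\<beta>\<close> gives the same product with the opposite sign. The
    remaining relaxation term of \<open>\<beta>\<close> is exactly what Young's inequality for
    \<open>r1\<close> consumes.\<close>
  let ?F = "\<lambda>s. ip (D (aa s)) (D (aa s)) + ip (\<beta> s) (\<beta> s) / h"
  let ?G = "\<lambda>s. ?F s - (s * \<rho>2 / h + A s) / 2"
  let ?G' = "\<lambda>s. 2 * ip (D (aa s)) (D (\<lambda>i. \<beta> s i / h)) + 2 * ip (\<beta> s) (\<lambda>i. \<alpha>' s i - \<beta> s i / h) / h - (\<rho>2 / h + ip (r1 s) (r1 s)) / 2"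
  have "?G \<tau> \<le> ?G 0"
  proof (rule within_nonpos_deriv_le[of 0 T ?G ?G'])
    fix t assume t: "t \<in> {0..T}"
    have 1: "((\<lambda>s. ip (D (aa s)) (D (aa s))) has_real_derivative 2 * ip (D (aa t)) (D (\<lambda>i. \<beta> t i / h))) (at t within {0..T})"
      using t by (intro ip_deriv D_deriv a') auto
    have 2: "((\<lambda>s. ip (\<beta> s) (\<beta> s)) has_real_derivative 2 * ip (\<beta> t) (\<lambda>i. \<alpha>' t i - \<beta> t i / h)) (at t within {0..T})"
      using t by (intro ip_deriv \<beta>') auto
    have 3: "(A has_real_derivative ip (r1 t) (r1 t)) (at t within {0..T})"
      unfolding ip_self by (rule A_deriv[OF t])
    show "(?G has_real_derivative ?G' t) (at t within {0..T})"
      using assms(1) by (auto intro!: derivative_eq_intros 1 2 3 simp: field_simps)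
    have e1: "ip (D (aa t)) (D (\<lambda>i. \<beta> t i / h)) = ip (D (\<beta> t)) (D (aa t)) / h"
      unfolding Dh by (simp add: ip_def sum_divide_distrib mult.commute)
    have e2: "ip (D (\<beta> t)) (D (\<alpha> t)) = ip (D (\<beta> t)) (D (aa t)) + ip (D (\<beta> t)) (D (\<beta> t))"
      unfolding ip_def Dab by (simp add: distrib_left sum.distrib)
    have e3: "ip (\<beta> t) (\<lambda>i. \<alpha>' t i - \<beta> t i / h) = ip (\<beta> t) (\<alpha>' t) - ip (\<beta> t) (\<beta> t) / h"
      by (simp add: ip_def right_diff_distrib sum_subtractf sum_divide_distrib)
    have y1: "2 * ip (D (\<beta> t)) (r2 t) \<le> 2 * ip (D (\<beta> t)) (D (\<beta> t)) + \<rho>2 / 2"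
      using ip_young[of 2 "D (\<beta> t)" "r2 t"] r2[OF t] by (simp add: ip_self)
    have y2: "- (2 * ip (\<beta> t) (r1 t)) \<le> 2 / h * ip (\<beta> t) (\<beta> t) + h / 2 * ip (r1 t) (r1 t)"
      using ip_young'[of "2 / h" "\<beta> t" "r1 t"] assms(1) by (simp add: mult.commute)
    have "2 * ip (\<beta> t) (\<lambda>i. \<alpha>' t i - \<beta> t i / h) + 2 * ip (D (\<beta> t)) (D (aa t)) \<le> \<rho>2 / 2 + h / 2 * ip (r1 t) (r1 t)"
      unfolding e3 ip_alpha' e2 using y1 y2 by (simp add: algebra_simps)
    hence "(2 * ip (\<beta> t) (\<lambda>i. \<alpha>' t i - \<beta> t i / h) + 2 * ip (D (\<beta> t)) (D (aa t))) / h \<le> (\<rho>2 / 2 + h / 2 * ip (r1 t) (r1 t)) / h"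
      using assms(1) by (intro divide_right_mono) auto
    also have "\<dots> = (\<rho>2 / h + ip (r1 t) (r1 t)) / 2" using assms(1) by (simp add: field_simps)
    finally show "?G' t \<le> 0" unfolding e1 by (simp add: add_divide_distrib)
  qed (use assms in auto)
  also have "?G 0 = 0" using init a0 A0 by (simp add: ip_def D_def \<beta>_def aa_def)
  finally have "?F \<tau> \<le> (\<tau> * \<rho>2 / h + A \<tau>) / 2" by simp
  thus ?thesis unfolding \<beta>_def by (intro exI[of _ "aa \<tau>"])
qed

end

subsection \<open>Classical regularity of the solution\<close>

lemma quadratic_tangency:
  fixes f :: "real \<Rightarrow> real"
  assumes "f x0 = 0" "\<And>y. \<bar>f y\<bar> \<le> C * (y - x0)\<^sup>2"
  shows "(f has_real_derivative 0) (at x0)"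
  unfolding has_field_derivative_iff
proof (rule Lim_null_comparison)
  show "\<forall>\<^sub>F y in at x0. norm ((f y - f x0) / (y - x0)) \<le> C * \<bar>y - x0\<bar>"
    using assms by (intro always_eventually allI) (auto simp: abs_divide divide_simps power2_eq_square mult.assoc)
  show "((\<lambda>y. C * \<bar>y - x0\<bar>) \<longlongrightarrow> 0) (at x0)"
    by (auto intro!: tendsto_eq_intros)
qed

text \<open>A family closed under differentiation that contains the standard bump exp(-1/(1 - x^2)):
  a polynomial over a power of 1 - x^2, times the bump. \<open>bump_step\<close> is the numerator of
  the derivative, and the power in the denominator grows by two.\<close>

definition bump_gen :: "real poly \<Rightarrow> nat \<Rightarrow> real \<Rightarrow> real" where
  "bump_gen P m x = (if \<bar>x\<bar> < 1 then poly P x / (1 - x\<^sup>2) ^ m * exp (- (1 / (1 - x\<^sup>2))) else 0)"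

definition bump_step :: "real poly \<Rightarrow> nat \<Rightarrow> real poly" where
  "bump_step P m = pderiv P * [:1, 0, -1:]\<^sup>2 + of_nat (2 * m) * [:0, 1:] * P * [:1, 0, -1:] - [:0, 2:] * P"

text \<open>A single term of the exponential series, the one of order m + 2, is at most exp(1/s).
  Two powers more than the denominator asks for leave the factor s^2 that
  \<open>quadratic_tangency\<close> needs.\<close>

lemma power_exp_le:
  fixes s :: real
  assumes "s > 0"
  shows "exp (- (1 / s)) / s ^ m \<le> fact (m + 2) * s\<^sup>2"
proof -
  have "(\<lambda>n. (1 / s) ^ n /\<^sub>R fact n) sums exp (1 / s)" by (rule exp_converges)
  hence "(\<Sum>n\<in>{m + 2}. (1 / s) ^ n /\<^sub>R fact n) \<le> exp (1 / s)"
    using assms by (intro sum_le_suminf[THEN order.trans, OF _ _ _ eq_refl[OF sums_unique[symmetric]]]) (auto simp: sums_iff)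
  hence "inverse (fact (m + 2)) * (1 / s) ^ (m + 2) \<le> exp (1 / s)" by (simp del: fact_Suc power_Suc add_2_eq_Suc')
  moreover have "x \<le> c * y" if "inverse c * x \<le> y" "c > 0" for c x y :: real using that by (simp add: field_simps)
  ultimately have "(1 / s) ^ (m + 2) \<le> fact (m + 2) * exp (1 / s)" using fact_gt_zero by blast
  hence "s ^ (m + 2) * (1 / s) ^ (m + 2) \<le> s ^ (m + 2) * (fact (m + 2) * exp (1 / s))"
    using assms by (intro mult_left_mono) auto
  hence le: "1 \<le> s ^ (m + 2) * (fact (m + 2) * exp (1 / s))"
    using assms by (simp add: power_mult_distrib[symmetric] del: fact_Suc)
  have "exp (- (1 / s)) / s ^ m = exp (- (1 / s)) / s ^ m * 1" by simp
  also have "\<dots> \<le> exp (- (1 / s)) / s ^ m * (s ^ (m + 2) * (fact (m + 2) * exp (1 / s)))"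
    using assms by (intro mult_left_mono le) auto
  also have "\<dots> = fact (m + 2) * s\<^sup>2 * (exp (- (1 / s)) * exp (1 / s))"
    using assms by (simp add: power_add power2_eq_square del: fact_Suc)
  also have "exp (- (1 / s)) * exp (1 / s) = 1" by (simp add: exp_minus)
  finally show ?thesis by simp
qed

lemma bump_gen_deriv:
  "(bump_gen P m has_real_derivative bump_gen (bump_step P m) (m + 2) x) (at x)"
proof -
  consider "\<bar>x\<bar> < 1" | "\<bar>x\<bar> = 1" | "\<bar>x\<bar> > 1" by linarith
  thus ?thesis
  proof cases
    case 1
    let ?f = "\<lambda>x. poly P x / (1 - x\<^sup>2) ^ m * exp (- (1 / (1 - x\<^sup>2)))"
    have s: "1 - x\<^sup>2 > 0" using 1 by (simp add: abs_square_less_1)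
    define s where "s = 1 - x\<^sup>2"
    have D: "(?f has_real_derivative
       ((poly (pderiv P) x * s ^ m - poly P x * (real m * s ^ (m - 1) * (- 2 * x))) / (s ^ m * s ^ m)) * exp (- (1 / s))
        + poly P x / s ^ m * (exp (- (1 / s)) * (- 2 * x / (s * s)))) (at x)"
      using s unfolding s_def by (auto intro!: derivative_eq_intros simp: divide_simps) (simp add: algebra_simps)
    have "((poly (pderiv P) x * s ^ m - poly P x * (real m * s ^ (m - 1) * (- 2 * x))) / (s ^ m * s ^ m)) * exp (- (1 / s))
        + poly P x / s ^ m * (exp (- (1 / s)) * (- 2 * x / (s * s))) =
       poly (bump_step P m) x / s ^ (m + 2) * exp (- (1 / s))"
    proof -
      have q: "poly (bump_step P m) x = poly (pderiv P) x * s\<^sup>2 + 2 * real m * x * poly P x * s - 2 * x * poly P x"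
        by (simp add: bump_step_def s_def power2_eq_square algebra_simps)
      have "s > 0" using s by (simp add: s_def)
      have m: "real m * s ^ (m - 1) = real m * s ^ m / s" using \<open>s > 0\<close> by (cases m) auto
      show ?thesis unfolding q m using \<open>s > 0\<close> by (simp add: field_simps power2_eq_square)
    qed
    hence "(?f has_real_derivative bump_gen (bump_step P m) (m + 2) x) (at x)"
      using D 1 by (simp add: bump_gen_def s_def)
    moreover have "\<forall>\<^sub>F y in nhds x. bump_gen P m y = ?f y"
      using 1 by (intro eventually_nhds_in_open[of "{-1<..<1}", THEN eventually_mono]) (auto simp: bump_gen_def abs_less_iff)
    ultimately show ?thesis by (subst DERIV_cong_ev) auto
  next
    case 2
    have "compact (poly P ` {-1..1})" by (intro compact_continuous_image continuous_intros compact_Icc)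
    hence "bounded (poly P ` {-1..1})" by (rule compact_imp_bounded)
    then obtain C where "\<forall>y\<in>{-1..1}. \<bar>poly P y\<bar> \<le> C" by (auto simp: bounded_iff)
    hence C: "\<And>y. y \<in> {-1..1} \<Longrightarrow> \<bar>poly P y\<bar> \<le> C" by blast
    have C0: "C \<ge> 0" using C[of 0] by auto
    \<comment> \<open>At a point with |x| = 1 one has 1 - y^2 = (x + y)(x - y), so this quantity is
      at most 2 |y - x| inside the support, and \<open>power_exp_le\<close> turns it into a
      quadratic bound for the function.\<close>
    have "(bump_gen P m has_real_derivative 0) (at x)"
    proof (rule quadratic_tangency[where C = "C * (fact (m + 2) * 4)"])
      show "bump_gen P m x = 0" using 2 by (simp add: bump_gen_def)
      fix y
      show "\<bar>bump_gen P m y\<bar> \<le> C * (fact (m + 2) * 4) * (y - x)\<^sup>2"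
      proof (cases "\<bar>y\<bar> < 1")
        case True
        define s where "s = 1 - y\<^sup>2"
        have s: "s > 0" using True by (simp add: s_def abs_square_less_1)
        have "s = x\<^sup>2 - y\<^sup>2" using 2 by (metis s_def power2_abs one_power2)
        hence "s = (x + y) * (x - y)" by (simp add: power2_eq_square algebra_simps)
        hence "\<bar>s\<bar> = \<bar>x + y\<bar> * \<bar>y - x\<bar>" by (simp only: abs_mult abs_minus_commute)
        also have "\<dots> \<le> 2 * \<bar>y - x\<bar>" using True 2 by (intro mult_right_mono) auto
        finally have "\<bar>s\<bar>\<^sup>2 \<le> (2 * \<bar>y - x\<bar>)\<^sup>2" by (intro power_mono) auto
        hence s2: "s\<^sup>2 \<le> 4 * (y - x)\<^sup>2" by (simp add: power_mult_distrib)
        have "\<bar>bump_gen P m y\<bar> = \<bar>poly P y\<bar> * (exp (- (1 / s)) / s ^ m)"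
          using True s by (simp add: bump_gen_def s_def[symmetric] abs_mult)
        also have "\<dots> \<le> C * (fact (m + 2) * s\<^sup>2)"
          using C[of y] True power_exp_le[OF s, of m] s C0 by (intro mult_mono) (auto simp: abs_less_iff)
        also have "\<dots> \<le> C * (fact (m + 2) * (4 * (y - x)\<^sup>2))"
          using s2 C0 by (intro mult_left_mono) auto
        finally show ?thesis by (simp only: mult.assoc)
      next
        case False
        thus ?thesis using C0 by (simp add: bump_gen_def)
      qed
    qed
    thus ?thesis using 2 by (simp add: bump_gen_def)
  next
    case 3
    have "((\<lambda>_. 0) has_real_derivative 0) (at x)" by simp
    moreover have "\<forall>\<^sub>F y in nhds x. bump_gen P m y = 0"
      using 3 by (intro eventually_nhds_in_open[of "- {-1..1}", THEN eventually_mono]) (auto simp: bump_gen_def)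
    ultimately have "(bump_gen P m has_real_derivative 0) (at x)" by (subst DERIV_cong_ev) auto
    thus ?thesis using 3 by (simp add: bump_gen_def)
  qed
qed

text \<open>All derivatives are carried along explicitly, so that smoothness of affine images and
  differences needs no computation with iterated \<open>deriv\<close>.\<close>

definition smooth_family :: "(nat \<Rightarrow> real \<Rightarrow> real) \<Rightarrow> bool" where
  "smooth_family F \<longleftrightarrow> (\<forall>n x. (F n has_real_derivative F (Suc n) x) (at x))"

lemma smooth_familyD: "smooth_family F \<Longrightarrow> (F n has_real_derivative F (Suc n) x) (at x)"
  by (simp add: smooth_family_def)

lemma smooth_family_affine:
  assumes "smooth_family F"
  shows "smooth_family (\<lambda>n y. A * c ^ n * F n (c * y + d))"
  unfolding smooth_family_def
proof (intro allI)
  fix n x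
  have "((\<lambda>y. F n (c * y + d)) has_real_derivative F (Suc n) (c * x + d) * c) (at x)"
    by (rule DERIV_chain2[OF smooth_familyD[OF assms]]) (auto intro!: derivative_eq_intros)
  hence "((\<lambda>y. A * c ^ n * F n (c * y + d)) has_real_derivative A * c ^ n * (F (Suc n) (c * x + d) * c)) (at x)"
    by (intro DERIV_cmult)
  thus "((\<lambda>y. A * c ^ n * F n (c * y + d)) has_real_derivative A * c ^ Suc n * F (Suc n) (c * x + d)) (at x)"
    by (simp add: mult_ac)
qed

lemma smooth_family_diff:
  "smooth_family F \<Longrightarrow> smooth_family G \<Longrightarrow> smooth_family (\<lambda>n y. F n y - G n y)"
  unfolding smooth_family_def by (intro allI DERIV_diff) auto

lemma smooth_family_continuous: "smooth_family F \<Longrightarrow> continuous_on S (F n)"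
  using smooth_familyD by (blast intro: DERIV_continuous_on has_field_derivative_at_within)

lemma smooth_family_higher_deriv: "smooth_family F \<Longrightarrow> (deriv ^^ n) (F 0) = F n"
proof (induction n)
  case (Suc n)
  have "deriv (F n) = F (Suc n)" using smooth_familyD[OF Suc.prems] DERIV_imp_deriv by blast
  thus ?case using Suc by simp
qed simp

lemma test_functionI:
  assumes "smooth_family F" "\<And>y. y \<notin> {a..b} \<Longrightarrow> F 0 y = 0" "0 < a" "b < 2 * pi"
  shows "test_function (F 0)"
  unfolding test_function_def
proof (intro conjI allI)
  fix n x
  show "(deriv ^^ n) (F 0) differentiable at x"
    using smooth_familyD[OF assms(1), of n x] smooth_family_higher_deriv[OF assms(1)]
    by (auto simp: real_differentiable_def)
next
  have "closure {x. F 0 x \<noteq> 0} \<subseteq> {a..b}" using assms(2) by (intro closure_minimal) (blast, simp)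
  also have "\<dots> \<subseteq> interior Omega" using assms by auto
  finally show "closure {x. F 0 x \<noteq> 0} \<subseteq> interior Omega" .
qed

primrec bump_poly :: "nat \<Rightarrow> real poly" where
  "bump_poly 0 = 1" | "bump_poly (Suc n) = bump_step (bump_poly n) (2 * n)"

definition bump :: "nat \<Rightarrow> real \<Rightarrow> real" where "bump n = bump_gen (bump_poly n) (2 * n)"

lemma smooth_family_bump: "smooth_family bump"
  unfolding smooth_family_def bump_def using bump_gen_deriv by (auto simp: numeral_2_eq_2)

lemma bump_outside: "\<bar>x\<bar> \<ge> 1 \<Longrightarrow> bump n x = 0"
  by (simp add: bump_def bump_gen_def)

lemma bump_nonneg: "bump 0 x \<ge> 0"
  by (simp add: bump_def bump_gen_def)

definition bump_mass :: real where "bump_mass = integral {-1..1} (bump 0)"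

lemma bump_mass_pos: "bump_mass > 0"
proof -
  have c: "continuous_on {-1..1} (bump 0)" by (rule smooth_family_continuous[OF smooth_family_bump])
  have "bump_mass \<ge> 0" unfolding bump_mass_def by (intro integral_nonneg integrable_continuous_interval c bump_nonneg)
  moreover have "bump_mass \<noteq> 0"
  proof
    assume "bump_mass = 0"
    hence "(bump 0 has_integral 0) (cbox (-1) 1)"
      unfolding bump_mass_def using integrable_continuous_interval[OF c] by (metis box_real(2) has_integral_integral)
    hence "bump 0 0 = 0" by (intro has_integral_0_cbox_imp_0[of "-1" 1 "bump 0"]) (use c bump_nonneg in auto)
    thus False by (simp add: bump_def bump_gen_def)
  qed
  ultimately show ?thesis by simp
qed

text \<open>The integral starts at -2, strictly left of the support, so that the two cases in the
  proof of differentiability overlap and no one-sided argument at -1 arises.\<close>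

definition smooth_step :: "real \<Rightarrow> real" where
  "smooth_step x = integral {-2..x} (bump 0) / bump_mass"

lemma bump_integral_zero: "b \<le> -1 \<or> a \<ge> 1 \<Longrightarrow> integral {a..b} (bump 0) = 0"
  by (subst integral_cong[of _ "bump 0" "\<lambda>_. 0"]) (auto simp: bump_outside)

lemma bump_integrable: "bump 0 integrable_on {a..b}"
  by (intro integrable_continuous_interval smooth_family_continuous[OF smooth_family_bump])

lemma smooth_step_deriv: "(smooth_step has_real_derivative bump 0 x / bump_mass) (at x)"
proof (cases "x > - 2")
  case True
  have "((\<lambda>y. integral {-2..y} (bump 0)) has_real_derivative bump 0 x) (at x within {-2..x + 1})"
    using True by (intro integral_has_real_derivative smooth_family_continuous[OF smooth_family_bump]) auto
  hence "((\<lambda>y. integral {-2..y} (bump 0)) has_real_derivative bump 0 x) (at x)"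
    using True by (simp add: at_within_Icc_at)
  thus ?thesis unfolding smooth_step_def[abs_def] by (rule DERIV_cdivide)
next
  case False
  have "\<forall>\<^sub>F y in nhds x. smooth_step y = 0"
    using False by (intro eventually_nhds_in_open[of "{..<-1}", THEN eventually_mono])
      (auto simp: smooth_step_def bump_integral_zero)
  moreover have "((\<lambda>_. 0) has_real_derivative 0) (at x)" by simp
  ultimately have "(smooth_step has_real_derivative 0) (at x)" by (subst DERIV_cong_ev) auto
  thus ?thesis using False by (simp add: bump_outside)
qed

lemma smooth_step_low: "x \<le> -1 \<Longrightarrow> smooth_step x = 0"
  by (simp add: smooth_step_def bump_integral_zero)

lemma smooth_step_high: "x \<ge> 1 \<Longrightarrow> smooth_step x = 1"
proof -
  assume x: "x \<ge> 1"
  have "integral {-2..x} (bump 0) = integral {-2..-1} (bump 0) + integral {-1..x} (bump 0)"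
    using x by (intro Henstock_Kurzweil_Integration.integral_combine[symmetric] bump_integrable) auto
  also have "integral {-1..x} (bump 0) = integral {-1..1} (bump 0) + integral {1..x} (bump 0)"
    using x by (intro Henstock_Kurzweil_Integration.integral_combine[symmetric] bump_integrable) auto
  finally show ?thesis using bump_mass_pos by (simp add: smooth_step_def bump_integral_zero bump_mass_def)
qed

lemma smooth_step_mono: "x \<le> y \<Longrightarrow> smooth_step x \<le> smooth_step y"
  by (rule DERIV_nonneg_imp_nondecreasing)
     (auto intro!: exI smooth_step_deriv divide_nonneg_pos bump_nonneg bump_mass_pos)

lemma smooth_step_range: "0 \<le> smooth_step x" "smooth_step x \<le> 1"
  using smooth_step_mono[of "min x (-1)" x] smooth_step_low[of "min x (-1)"]
    smooth_step_mono[of x "max x 1"] smooth_step_high[of "max x 1"] by auto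

lemma smooth_family_step:
  "smooth_family (\<lambda>n. case n of 0 \<Rightarrow> smooth_step | Suc m \<Rightarrow> (\<lambda>x. bump m x / bump_mass))"
  unfolding smooth_family_def using smooth_step_deriv
  by (auto split: nat.splits intro!: DERIV_cdivide smooth_familyD[OF smooth_family_bump])

text \<open>A smooth version of the indicator function of [a, b]: the shifts by 1 keep both
  transitions, each of width 2\<epsilon>, inside the interval.\<close>

definition plateau :: "real \<Rightarrow> real \<Rightarrow> real \<Rightarrow> real \<Rightarrow> real" where
  "plateau a b \<epsilon> y = smooth_step ((y - a) / \<epsilon> - 1) - smooth_step ((y - b) / \<epsilon> + 1)"

lemma plateau_outside:
  assumes "0 < \<epsilon>" "2 * \<epsilon> \<le> b - a" "y \<notin> {a<..<b}"
  shows "plateau a b \<epsilon> y = 0"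
proof (cases "y \<le> a")
  case True
  hence "(y - a) / \<epsilon> - 1 \<le> - 1" "(y - b) / \<epsilon> + 1 \<le> - 1"
    using assms by (auto simp: divide_simps)
  thus ?thesis by (simp add: plateau_def smooth_step_low)
next
  case False
  hence "(y - a) / \<epsilon> - 1 \<ge> 1" "(y - b) / \<epsilon> + 1 \<ge> 1"
    using assms by (auto simp: divide_simps)
  thus ?thesis by (simp add: plateau_def smooth_step_high)
qed

lemma plateau_le_1: "\<bar>plateau a b \<epsilon> y\<bar> \<le> 1"
  using smooth_step_range[of "(y - a) / \<epsilon> - 1"] smooth_step_range[of "(y - b) / \<epsilon> + 1"]
  by (simp add: plateau_def abs_le_iff)

lemma plateau_tendsto:
  assumes "y \<in> {a<..<b}"
  shows "((\<lambda>\<epsilon>. plateau a b \<epsilon> y) \<longlongrightarrow> 1) (at_right 0)"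
proof (rule tendsto_eventually)
  have "\<forall>\<^sub>F \<epsilon> in at_right 0. 0 < \<epsilon> \<and> \<epsilon> < min ((y - a) / 2) ((b - y) / 2)"
    using assms by (auto simp: eventually_at_right_field intro!: exI[of _ "min ((y - a) / 2) ((b - y) / 2)"])
  thus "\<forall>\<^sub>F \<epsilon> in at_right 0. plateau a b \<epsilon> y = 1"
  proof (rule eventually_mono)
    fix \<epsilon> assume e: "0 < \<epsilon> \<and> \<epsilon> < min ((y - a) / 2) ((b - y) / 2)"
    hence "(y - a) / \<epsilon> - 1 \<ge> 1" "(y - b) / \<epsilon> + 1 \<le> - 1"
      by (auto simp: divide_simps)
    thus "plateau a b \<epsilon> y = 1" by (simp add: plateau_def smooth_step_high smooth_step_low)
  qed
qed

lemma test_function_plateau: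
  assumes "0 < \<epsilon>" "2 * \<epsilon> \<le> b - a" "0 < a" "b < 2 * pi"
  shows "test_function (plateau a b \<epsilon>)"
proof -
  define F where "F = (\<lambda>n. case n of 0 \<Rightarrow> smooth_step | Suc m \<Rightarrow> (\<lambda>x. bump m x / bump_mass))"
  define G where "G = (\<lambda>n y. 1 * (1 / \<epsilon>) ^ n * F n (1 / \<epsilon> * y + (- a / \<epsilon> - 1)) - 1 * (1 / \<epsilon>) ^ n * F n (1 / \<epsilon> * y + (- b / \<epsilon> + 1)))"
  have "smooth_family G"
    unfolding G_def F_def by (intro smooth_family_diff smooth_family_affine smooth_family_step)
  moreover have G0: "G 0 = plateau a b \<epsilon>"
    by (rule ext) (simp add: G_def F_def plateau_def diff_divide_distrib algebra_simps)
  moreover have "G 0 y = 0" if "y \<notin> {a..b}" for y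
    unfolding G0 using that by (intro plateau_outside[OF assms(1,2)]) auto
  ultimately have "test_function (G 0)" using assms(3,4) by (intro test_functionI[of G a b])
  thus ?thesis by (simp add: G0)
qed

section \<open>The fundamental lemma of the calculus of variations\<close>

lemma continuous_imp_test_integrable:
  assumes "w absolutely_integrable_on {a..b}" "continuous_on {a..b} (\<phi> :: real \<Rightarrow> real)"
  shows "(\<lambda>x. w x * \<phi> x) absolutely_integrable_on {a..b}"
proof -
  have "bounded (\<phi> ` {a..b})"
    by (intro compact_imp_bounded compact_continuous_image assms compact_Icc)
  moreover have "\<phi> \<in> borel_measurable (lebesgue_on {a..b})"
    by (intro continuous_imp_measurable_on_sets_lebesgue assms) auto
  ultimately have "(\<lambda>x. \<phi> x * w x) absolutely_integrable_on {a..b}"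
    by (intro absolutely_integrable_bounded_measurable_product_real assms) auto
  thus ?thesis by (simp add: mult.commute)
qed

lemma test_function_continuous: "test_function \<phi> \<Longrightarrow> continuous_on S \<phi>"
  unfolding test_function_def
  by (metis continuous_at_imp_continuous_on differentiable_imp_continuous_within funpow_0)

text \<open>Plateaus with shrinking transitions converge to the indicator function of the interval
  and are bounded by 1, so dominated convergence carries the orthogonality over to it.\<close>

lemma test_orthogonal_interval:
  assumes w: "w absolutely_integrable_on Omega"
    and z: "\<And>\<phi>. test_function \<phi> \<Longrightarrow> integral Omega (\<lambda>x. w x * \<phi> x) = 0"
    and ab: "0 < a" "a < b" "b < 2 * pi"
  shows "integral {a..b} w = 0"
proof -
  \<comment> \<open>The sequence starts at half the length because a plateau needs room for both of
    its transitions.\<close>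
  define e where "e n = (b - a) / 2 / real (Suc n)" for n
  have e: "0 < e n" "2 * e n \<le> b - a" for n
  proof -
    show "0 < e n" using ab by (simp add: e_def)
    have "(b - a) / real (Suc n) \<le> (b - a) / 1" using ab by (intro frac_le) auto
    moreover have "2 * ((b - a) / 2 / z) = (b - a) / z" for z :: real by (cases "z = 0") (auto simp: field_simps)
    ultimately show "2 * e n \<le> b - a" unfolding e_def by (metis div_by_1)
  qed
  have "e \<longlonglongrightarrow> 0"
  proof -
    have "e = (\<lambda>n. (b - a) / 2 * inverse (real (Suc n)))" by (rule ext) (simp only: e_def divide_inverse)
    thus ?thesis using tendsto_mult_right_zero[OF LIMSEQ_inverse_real_of_nat, of "(b - a) / 2"] by (simp only:)
  qed
  hence elim: "filterlim e (at_right 0) sequentially"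
    using e(1) by (auto simp: filterlim_at less_imp_neq[THEN not_sym] intro!: always_eventually)
  have T: "test_function (plateau a b (e n))" for n
    using e ab by (intro test_function_plateau) auto
  have "(\<lambda>n. integral Omega (\<lambda>x. w x * plateau a b (e n) x)) \<longlonglongrightarrow>
     integral Omega (\<lambda>x. if x \<in> {a<..<b} then w x else 0)"
  proof (rule dominated_convergence)
    show "(\<lambda>x. w x * plateau a b (e n) x) integrable_on Omega" for n
      using continuous_imp_test_integrable[OF w test_function_continuous[OF T]]
      by (rule set_lebesgue_integral_eq_integral(1))
    show "(\<lambda>x. \<bar>w x\<bar>) integrable_on Omega"
      using absolutely_integrable_norm[OF w] set_lebesgue_integral_eq_integral(1) by (fastforce simp: o_def)
    show "norm (w x * plateau a b (e n) x) \<le> \<bar>w x\<bar>" for n x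
      using plateau_le_1[of a b "e n" x] by (simp add: abs_mult mult_left_le)
    show "(\<lambda>n. w x * plateau a b (e n) x) \<longlonglongrightarrow> (if x \<in> {a<..<b} then w x else 0)" if "x \<in> Omega" for x
    proof (cases "x \<in> {a<..<b}")
      case True
      have "(\<lambda>n. plateau a b (e n) x) \<longlonglongrightarrow> 1"
        by (rule filterlim_compose[OF plateau_tendsto[OF True] elim])
      hence "(\<lambda>n. w x * plateau a b (e n) x) \<longlonglongrightarrow> w x * 1" by (intro tendsto_intros)
      thus ?thesis using True by simp
    next
      case False
      hence "(if x \<in> {a<..<b} then w x else 0) = 0" by (rule if_not_P)
      moreover have "plateau a b (e n) x = 0" for n by (rule plateau_outside[OF e False])
      ultimately show ?thesis by (simp only: mult_zero_right tendsto_const)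
    qed
  qed
  hence "integral Omega (\<lambda>x. if x \<in> {a<..<b} then w x else 0) = 0"
    using z[OF T] by (simp add: LIMSEQ_const_iff)
  moreover have "{a<..<b} \<inter> Omega = {a<..<b}" using ab by auto
  ultimately have "integral {a<..<b} w = 0"
    by (metis integral_restrict_Int Int_commute)
  thus ?thesis by (simp add: integral_open_interval_real)
qed

text \<open>By Lebesgue differentiation almost every value of \<open>w\<close> is the limit of its
  means over intervals [x, x + h], and those means are zero by
  \<open>test_orthogonal_interval\<close>.\<close>

lemma test_orthogonal_negligible:
  assumes w: "w absolutely_integrable_on Omega"
    and z: "\<And>\<phi>. test_function \<phi> \<Longrightarrow> integral Omega (\<lambda>x. w x * \<phi> x) = 0"
  shows "negligible {x \<in> Omega. w x \<noteq> 0}"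
proof -
  define f where "f x = (if x \<in> Omega then w x else 0)" for x
  have f: "f integrable_on UNIV"
    unfolding f_def integrable_restrict_UNIV using w by (rule set_lebesgue_integral_eq_integral(1))
  hence "f integrable_on cbox a b" for a b by (rule integrable_on_subcbox) simp
  then obtain N where N: "negligible N" and lim: "\<And>x e. x \<notin> N \<Longrightarrow> 0 < e \<Longrightarrow> \<exists>d>0. \<forall>h. 0 < h \<and> h < d \<longrightarrow>
       norm (integral (cbox x (x + h *\<^sub>R One)) f /\<^sub>R h ^ DIM(real) - f x) < e"
    using integrable_ccontinuous_explicit by blast
  have "{x \<in> Omega. w x \<noteq> 0} \<subseteq> N \<union> {0, 2 * pi}"
  proof
    fix x assume x: "x \<in> {x \<in> Omega. w x \<noteq> 0}"
    show "x \<in> N \<union> {0, 2 * pi}"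
    proof (rule ccontr)
      assume nx: "x \<notin> N \<union> {0, 2 * pi}"
      hence x': "0 < x" "x < 2 * pi" using x by auto
      obtain d where d: "d > 0" "\<And>h. 0 < h \<and> h < d \<Longrightarrow> norm (integral (cbox x (x + h *\<^sub>R One)) f /\<^sub>R h ^ DIM(real) - f x) < \<bar>w x\<bar>"
        using lim[of x "\<bar>w x\<bar>"] nx x by auto
      define h where "h = min (d / 2) ((2 * pi - x) / 2)"
      have h: "0 < h" "h < d" "x + h < 2 * pi" using d x' by (auto simp: h_def min_def field_simps)
      have "integral {x..x + h} f = integral {x..x + h} w"
        using x' h by (intro integral_cong) (auto simp: f_def)
      also have "\<dots> = 0" using test_orthogonal_interval[OF w z, of x "x + h"] x' h by simp
      finally have "norm (f x) < \<bar>w x\<bar>" using d(2)[of h] h by simp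
      thus False using x by (simp add: f_def)
    qed
  qed
  moreover have "negligible (N \<union> {0, 2 * pi})" using N by (intro negligible_Un) auto
  ultimately show ?thesis using negligible_subset by blast
qed

section \<open>Weak derivatives and their essential bounds\<close>

lemma weak_deriv_unique:
  assumes "is_weak_deriv i v g" "is_weak_deriv i v g'"
  shows "negligible {x \<in> Omega. g x \<noteq> g' x}"
proof -
  have g: "g absolutely_integrable_on Omega" "g' absolutely_integrable_on Omega"
    using assms by (auto simp: is_weak_deriv_def)
  have "negligible {x \<in> Omega. g x - g' x \<noteq> 0}"
  proof (rule test_orthogonal_negligible)
    show "(\<lambda>x. g x - g' x) absolutely_integrable_on Omega" by (rule set_integral_diff(1)[OF g])
    fix \<phi> assume t: "test_function \<phi>"
    have i: "(\<lambda>x. g x * \<phi> x) integrable_on Omega" "(\<lambda>x. g' x * \<phi> x) integrable_on Omega"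
      using set_lebesgue_integral_eq_integral(1)[OF continuous_imp_test_integrable[OF g(1) test_function_continuous[OF t]]]
        set_lebesgue_integral_eq_integral(1)[OF continuous_imp_test_integrable[OF g(2) test_function_continuous[OF t]]]
      by blast+
    have "integral Omega (\<lambda>x. v x * (deriv ^^ i) \<phi> x) = (- 1) ^ i * integral Omega (\<lambda>x. g x * \<phi> x)"
      "integral Omega (\<lambda>x. v x * (deriv ^^ i) \<phi> x) = (- 1) ^ i * integral Omega (\<lambda>x. g' x * \<phi> x)"
      using assms t unfolding is_weak_deriv_def by blast+
    hence "integral Omega (\<lambda>x. g x * \<phi> x) = integral Omega (\<lambda>x. g' x * \<phi> x)" by simp
    thus "integral Omega (\<lambda>x. (g x - g' x) * \<phi> x) = 0"
      using i by (simp add: left_diff_distrib integral_diff)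
  qed
  thus ?thesis by simp
qed

lemma AE_lebesgue_on_negligible:
  assumes "S \<in> sets lebesgue"
  shows "(AE x in lebesgue_on S. P x) \<longleftrightarrow> negligible {x \<in> S. \<not> P x}"
proof -
  have "(AE x in lebesgue_on S. P x) \<longleftrightarrow> (AE x in lebesgue. x \<in> S \<longrightarrow> P x)"
    using assms by (intro AE_restrict_space_iff) auto
  also have "\<dots> \<longleftrightarrow> (\<exists>N. negligible N \<and> {x. \<not> (x \<in> S \<longrightarrow> P x)} \<subseteq> N)"
    by (rule eventually_ae_filter_negligible)
  also have "{x. \<not> (x \<in> S \<longrightarrow> P x)} = {x \<in> S. \<not> P x}" by auto
  also have "(\<exists>N. negligible N \<and> {x \<in> S. \<not> P x} \<subseteq> N) \<longleftrightarrow> negligible {x \<in> S. \<not> P x}"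
    using negligible_subset by blast
  finally show ?thesis .
qed

text \<open>\<open>weak_deriv\<close> is an arbitrary representative, possibly different from the
  bounded one supplied by \<open>in_Wminf\<close>. Uniqueness up to null sets transfers the finite
  essential supremum; its finiteness is essential, since \<open>real_of_ereal\<close> sends infinity
  to 0.\<close>

lemma weak_deriv_bound:
  assumes W: "in_Wminf m v" and i: "i \<le> m"
  shows "is_weak_deriv i v (weak_deriv i v)"
    "negligible {x \<in> Omega. \<not> \<bar>weak_deriv i v x\<bar> \<le> Wminf_norm m v}"
proof -
  obtain g where g: "is_weak_deriv i v g" "in_Linf g" using W i by (auto simp: in_Wminf_def)
  define G where "G = weak_deriv i v"
  show 1: "is_weak_deriv i v (weak_deriv i v)" unfolding weak_deriv_def by (rule someI[of "is_weak_deriv i v", OF g(1)])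
  hence 1: "is_weak_deriv i v G" by (simp add: G_def)
  have S: "Omega \<in> sets lebesgue" by simp
  have "G absolutely_integrable_on Omega" using 1 by (simp add: is_weak_deriv_def)
  hence mG: "G \<in> borel_measurable (lebesgue_on Omega)" by (simp add: absolutely_integrable_measurable)
  have "AE x in lebesgue_on Omega. ereal \<bar>G x\<bar> = ereal \<bar>g x\<bar>"
    unfolding AE_lebesgue_on_negligible[OF S]
    by (rule negligible_subset[OF weak_deriv_unique[OF 1 g(1)]]) auto
  hence "esssup (lebesgue_on Omega) (\<lambda>x. ereal \<bar>G x\<bar>) = esssup (lebesgue_on Omega) (\<lambda>x. ereal \<bar>g x\<bar>)"
    using mG g(2) by (intro esssup_AE_cong) (auto simp: in_Linf_def)
  hence fin: "esssup (lebesgue_on Omega) (\<lambda>x. ereal \<bar>G x\<bar>) < \<infinity>" using g(2) by (simp add: in_Linf_def)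
  have "AE x in lebesgue_on Omega. ereal \<bar>G x\<bar> \<le> esssup (lebesgue_on Omega) (\<lambda>x. ereal \<bar>G x\<bar>)"
    by (rule esssup_AE)
  hence "AE x in lebesgue_on Omega. \<bar>G x\<bar> \<le> Linf_norm G"
  proof (rule AE_mp, intro AE_I2 impI)
    fix x assume "ereal \<bar>G x\<bar> \<le> esssup (lebesgue_on Omega) (\<lambda>x. ereal \<bar>G x\<bar>)"
    thus "\<bar>G x\<bar> \<le> Linf_norm G" unfolding Linf_norm_def using fin
      by (cases "esssup (lebesgue_on Omega) (\<lambda>x. ereal \<bar>G x\<bar>)") auto
  qed
  hence "negligible {x \<in> Omega. \<not> \<bar>G x\<bar> \<le> Linf_norm G}"
    unfolding AE_lebesgue_on_negligible[OF S] .
  moreover have "Linf_norm G \<le> Wminf_norm m v"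
    unfolding Wminf_norm_def G_def using i by (intro Max_ge) auto
  ultimately show "negligible {x \<in> Omega. \<not> \<bar>weak_deriv i v x\<bar> \<le> Wminf_norm m v}"
    unfolding G_def by (elim negligible_subset) auto
qed

text \<open>Not immediate from the definition, because an essential supremum could be negative on a
  null domain; here a negative bound would make all of \<open>Omega\<close> negligible.\<close>

lemma Wminf_norm_nonneg:
  assumes "in_Wminf m v" shows "Wminf_norm m v \<ge> 0"
proof (rule ccontr)
  assume n: "\<not> Wminf_norm m v \<ge> 0"
  hence "\<not> \<bar>y\<bar> \<le> Wminf_norm m v" for y by linarith
  hence "{x \<in> Omega. \<not> \<bar>weak_deriv 0 v x\<bar> \<le> Wminf_norm m v} = Omega" by blast
  hence "negligible Omega" using weak_deriv_bound(2)[OF assms, of 0] by simp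
  hence "2 * pi \<le> 0" using negligible_interval(1)[of 0 "2 * pi"] by simp
  thus False using pi_gt_zero by linarith
qed

lemma weak_pairing_bound:
  assumes W: "in_Wminf m v" and i: "i \<le> m" and F: "smooth_family F" and t: "test_function (F 0)"
    and nn: "\<And>x. F 0 x \<ge> 0"
  shows "\<bar>integral Omega (\<lambda>x. v x * F i x)\<bar> \<le> Wminf_norm m v * integral Omega (F 0)"
proof -
  define G where "G = weak_deriv i v"
  define M where "M = Wminf_norm m v"
  \<comment> \<open>The bound on the weak derivative holds only almost everywhere; truncation makes
    it hold at every point without changing the integral.\<close>
  define G' where "G' x = (if \<bar>G x\<bar> \<le> M then G x else 0)" for x
  have M: "M \<ge> 0" unfolding M_def by (rule Wminf_norm_nonneg[OF W])
  have G: "is_weak_deriv i v G" "negligible {x \<in> Omega. \<not> \<bar>G x\<bar> \<le> M}"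
    using weak_deriv_bound[OF W i] by (auto simp: G_def M_def)
  have c: "continuous_on Omega (F 0)" by (rule smooth_family_continuous[OF F])
  have "integral Omega (\<lambda>x. v x * (deriv ^^ i) (F 0) x) = (- 1) ^ i * integral Omega (\<lambda>x. G x * F 0 x)"
    using G(1) t unfolding is_weak_deriv_def by blast
  hence "integral Omega (\<lambda>x. v x * F i x) = (- 1) ^ i * integral Omega (\<lambda>x. G x * F 0 x)"
    unfolding smooth_family_higher_deriv[OF F] .
  hence "\<bar>integral Omega (\<lambda>x. v x * F i x)\<bar> = \<bar>integral Omega (\<lambda>x. G x * F 0 x)\<bar>"
    by (simp add: abs_mult)
  also have "integral Omega (\<lambda>x. G x * F 0 x) = integral Omega (\<lambda>x. G' x * F 0 x)"
    by (rule integral_spike[OF G(2)]) (auto simp: G'_def)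
  also have "\<bar>\<dots>\<bar> \<le> integral Omega (\<lambda>x. M * F 0 x)"
  proof -
    have "(\<lambda>x. G x * F 0 x) integrable_on Omega"
      using G(1) set_lebesgue_integral_eq_integral(1)[OF continuous_imp_test_integrable[OF _ c, of G]]
      by (simp add: is_weak_deriv_def)
    hence "(\<lambda>x. G' x * F 0 x) integrable_on Omega"
      by (rule integrable_spike[OF _ G(2)]) (auto simp: G'_def)
    moreover have "(\<lambda>x. M * F 0 x) integrable_on Omega"
      by (intro integrable_continuous_interval continuous_intros c)
    moreover have "norm (G' x * F 0 x) \<le> M * F 0 x" for x
      using nn[of x] M by (auto simp: G'_def abs_mult intro!: mult_right_mono)
    ultimately show ?thesis using integral_norm_bound_integral[of "\<lambda>x. G' x * F 0 x" Omega "\<lambda>x. M * F 0 x"] by simp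
  qed
  finally show ?thesis by (simp add: M_def)
qed

section \<open>Mollification up to the boundary\<close>

lemma smooth_family_kernel:
  "smooth_family (\<lambda>i s. 1 / (r * bump_mass) * (1 / r) ^ i * bump i (1 / r * s + 0))"
  by (intro smooth_family_affine smooth_family_bump)

definition kern :: "real \<Rightarrow> nat \<Rightarrow> real \<Rightarrow> real" where
  "kern r i s = 1 / (r * bump_mass) * (1 / r) ^ i * bump i (s / r)"

lemma smooth_kern: "smooth_family (kern r)"
  using smooth_family_kernel[of r] by (simp add: kern_def[abs_def])

lemma kern_nonneg: "r > 0 \<Longrightarrow> kern r 0 s \<ge> 0"
  using bump_nonneg[of "s / r"] bump_mass_pos by (simp add: kern_def)

lemma kern_outside: "r > 0 \<Longrightarrow> \<bar>s\<bar> \<ge> r \<Longrightarrow> kern r i s = 0"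
  by (simp add: kern_def bump_outside)

lemma kern_mass:
  assumes "r > 0" "r \<le> c" "c \<le> 2 * pi - r"
  shows "((\<lambda>y. kern r 0 (c - y)) has_integral 1) Omega"
proof -
  have "((\<lambda>y. - smooth_step ((c - y) / r)) has_real_derivative kern r 0 (c - y)) (at y)" for y
  proof -
    have "((\<lambda>y. smooth_step ((c - y) / r)) has_real_derivative bump 0 ((c - y) / r) / bump_mass * (- 1 / r)) (at y)"
      by (rule DERIV_chain2[OF smooth_step_deriv]) (use assms in \<open>auto intro!: derivative_eq_intros\<close>)
    from DERIV_minus[OF this] show ?thesis by (simp add: kern_def mult_ac)
  qed
  hence "((\<lambda>y. kern r 0 (c - y)) has_integral (- smooth_step ((c - 2 * pi) / r) - - smooth_step ((c - 0) / r))) Omega"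
    by (intro fundamental_theorem_of_calculus)
       (auto simp: has_real_derivative_iff_has_vector_derivative[symmetric] intro: has_field_derivative_at_within)
  moreover have "(c - 2 * pi) / r \<le> - 1" "(c - 0) / r \<ge> 1" using assms by (auto simp: divide_simps)
  ultimately show ?thesis by (simp add: smooth_step_low smooth_step_high)
qed

text \<open>Convolution near the boundary would need values of \<open>v\<close> outside the domain.
  Evaluating it at the contracted point \<open>ctr x\<close> avoids this: the contraction fixes the
  midpoint and leaves a margin wider than the kernel. The chain rule only contributes powers of the
  contraction factor, which is below 1, so the Sobolev norm bounds the derivatives without any
  constant.\<close>

lemma mollify:
  assumes W: "in_Wminf m v" and c: "continuous_on Omega v" and e: "\<epsilon> > 0"
  shows "\<exists>D :: nat \<Rightarrow> real \<Rightarrow> real.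
    (\<forall>i. \<forall>x\<in>Omega. (D i has_real_derivative D (Suc i) x) (at x within Omega)) \<and>
    (\<forall>i\<le>m. \<forall>x\<in>Omega. \<bar>D i x\<bar> \<le> Wminf_norm m v) \<and>
    (\<forall>x\<in>Omega. \<bar>D 0 x - v x\<bar> \<le> \<epsilon>)"
proof -
  have "uniformly_continuous_on Omega v" by (intro compact_uniformly_continuous c compact_Icc)
  then obtain \<delta> where \<delta>: "\<delta> > 0" "\<And>x y. x \<in> Omega \<Longrightarrow> y \<in> Omega \<Longrightarrow> dist y x < \<delta> \<Longrightarrow> dist (v y) (v x) < \<epsilon>"
    using e unfolding uniformly_continuous_on_def by metis
  \<comment> \<open>The contraction moves a point by at most \<eta>\<pi> and the kernel has radius
    \<eta>\<pi>/2, so every value that enters the average at x is taken within 3\<eta>\<pi>/2 of x;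
    this must stay below \<delta>.\<close>
  define \<eta> where "\<eta> = min (1 / 2) (\<delta> / (2 * pi))"
  have \<eta>: "0 < \<eta>" "\<eta> < 1" "3 / 2 * (\<eta> * pi) < \<delta>"
  proof -
    show "0 < \<eta>" "\<eta> < 1" using \<delta> pi_gt_zero by (auto simp: \<eta>_def)
    have "\<eta> * pi \<le> \<delta> / (2 * pi) * pi" unfolding \<eta>_def using pi_gt_zero by (intro mult_right_mono) auto
    hence "\<eta> * pi \<le> \<delta> / 2" by simp
    thus "3 / 2 * (\<eta> * pi) < \<delta>" using \<delta>(1) by linarith
  qed
  define \<theta> where "\<theta> = 1 - \<eta>"
  define r where "r = \<eta> * pi / 2"
  define ctr where "ctr x = \<theta> * x + \<eta> * pi" for x
  have r: "r > 0" using \<eta> by (simp add: r_def)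
  have ctr: "r < ctr x - r / 2" "ctr x < 2 * pi - 3 / 2 * r" if "x \<in> Omega" for x
  proof -
    have "\<theta> * x \<le> \<theta> * (2 * pi)" using that \<eta> by (intro mult_left_mono) (auto simp: \<theta>_def)
    moreover have "\<theta> * x \<ge> 0" using that \<eta> by (auto simp: \<theta>_def)
    ultimately show "r < ctr x - r / 2" "ctr x < 2 * pi - 3 / 2 * r"
      using r by (auto simp: ctr_def \<theta>_def r_def algebra_simps)
  qed
  define D where "D i x = \<theta> ^ i * integral Omega (\<lambda>y. v y * kern r i (ctr x - y))" for i x
  have kc: "continuous_on S (\<lambda>z. kern r i (f z))" if "continuous_on S f" for S i and f :: "'b::topological_space \<Rightarrow> real"
    using continuous_on_compose2[OF smooth_family_continuous[OF smooth_kern, of UNIV] that] by auto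
  show ?thesis
  proof (intro exI[of _ D] conjI allI ballI impI)
    fix i x assume x: "x \<in> Omega"
    have "((\<lambda>x. integral (cbox 0 (2 * pi)) (\<lambda>y. v y * kern r i (ctr x - y))) has_field_derivative
       integral (cbox 0 (2 * pi)) (\<lambda>y. v y * (kern r (Suc i) (ctr x - y) * \<theta>))) (at x within Omega)"
    proof (rule leibniz_rule_field_derivative)
      show "((\<lambda>x. v y * kern r i (ctr x - y)) has_real_derivative v y * (kern r (Suc i) (ctr x - y) * \<theta>)) (at x within Omega)" for x y
        unfolding ctr_def
        by (intro DERIV_cmult DERIV_chain2[OF smooth_familyD[OF smooth_kern]]) (auto intro!: derivative_eq_intros)
      show "(\<lambda>y. v y * kern r i (ctr x - y)) integrable_on cbox 0 (2 * pi)" for x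
        using c by (auto intro!: integrable_continuous_interval continuous_intros kc)
      have "continuous_on (Omega \<times> Omega) (\<lambda>z. v (snd z) * (kern r (Suc i) (ctr (fst z) - snd z) * \<theta>))"
        unfolding ctr_def
        by (intro continuous_intros kc continuous_on_compose2[OF c]) auto
      thus "continuous_on (Omega \<times> cbox 0 (2 * pi)) (\<lambda>(x, y). v y * (kern r (Suc i) (ctr x - y) * \<theta>))"
        by (simp add: case_prod_unfold)
    qed (use x in auto)
    hence "(D i has_real_derivative \<theta> ^ i * integral Omega (\<lambda>y. v y * (kern r (Suc i) (ctr x - y) * \<theta>))) (at x within Omega)"
      unfolding D_def[abs_def] by (intro DERIV_cmult) simp
    moreover have "integral Omega (\<lambda>y. v y * (kern r (Suc i) (ctr x - y) * \<theta>)) = \<theta> * integral Omega (\<lambda>y. v y * kern r (Suc i) (ctr x - y))"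
      unfolding integral_mult_right[symmetric] by (intro integral_cong) simp
    ultimately show "(D i has_real_derivative D (Suc i) x) (at x within Omega)"
      by (simp add: D_def mult_ac)
  next
    fix i x assume i: "i \<le> m" and x: "x \<in> Omega"
    define F where "F = (\<lambda>i y. 1 * (- 1) ^ i * kern r i (- 1 * y + ctr x))"
    have F: "smooth_family F" unfolding F_def by (intro smooth_family_affine smooth_kern)
    have F0: "F 0 = (\<lambda>y. kern r 0 (ctr x - y))" by (auto simp: F_def)
    have "test_function (F 0)"
    proof (rule test_functionI[OF F, of "ctr x - r" "ctr x + r"])
      show "F 0 y = 0" if "y \<notin> {ctr x - r..ctr x + r}" for y
        unfolding F0 using that r by (intro kern_outside) auto
    qed (use ctr[OF x] r in auto)
    moreover have "F 0 y \<ge> 0" for y unfolding F0 by (rule kern_nonneg[OF r])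
    ultimately have "\<bar>integral Omega (\<lambda>y. v y * F i y)\<bar> \<le> Wminf_norm m v * integral Omega (F 0)"
      by (intro weak_pairing_bound[OF W i F]) auto
    also have "integral Omega (F 0) = 1"
      unfolding F0 using ctr[OF x] r by (intro integral_unique kern_mass) auto
    also have "integral Omega (\<lambda>y. v y * F i y) = (- 1) ^ i * integral Omega (\<lambda>y. v y * kern r i (ctr x - y))"
      unfolding integral_mult_right[symmetric] F_def by (intro integral_cong) simp
    finally have "\<bar>integral Omega (\<lambda>y. v y * kern r i (ctr x - y))\<bar> \<le> Wminf_norm m v"
      by (simp add: abs_mult)
    moreover have "\<theta> ^ i \<le> 1" "\<theta> ^ i \<ge> 0" using \<eta> by (auto simp: \<theta>_def intro!: power_le_one)
    ultimately show "\<bar>D i x\<bar> \<le> Wminf_norm m v"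
      unfolding D_def abs_mult using mult_mono[of "\<bar>\<theta> ^ i\<bar>" 1] by fastforce
  next
    fix x assume x: "x \<in> Omega"
    have mass: "((\<lambda>y. kern r 0 (ctr x - y)) has_integral 1) Omega"
      using ctr[OF x] r by (intro kern_mass) auto
    have i1: "(\<lambda>y. v y * kern r 0 (ctr x - y)) integrable_on Omega"
      by (auto intro!: integrable_continuous_interval continuous_intros kc c)
    have i2: "(\<lambda>y. kern r 0 (ctr x - y)) integrable_on Omega" using mass by blast
    have "D 0 x - v x = integral Omega (\<lambda>y. v y * kern r 0 (ctr x - y)) - v x * integral Omega (\<lambda>y. kern r 0 (ctr x - y))"
      using integral_unique[OF mass] by (simp add: D_def)
    also have "\<dots> = integral Omega (\<lambda>y. v y * kern r 0 (ctr x - y)) - integral Omega (\<lambda>y. v x * kern r 0 (ctr x - y))"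
      by simp
    also have "\<dots> = integral Omega (\<lambda>y. v y * kern r 0 (ctr x - y) - v x * kern r 0 (ctr x - y))"
      by (intro integral_diff[symmetric] i1 integrable_on_mult_right i2)
    also have "norm \<dots> \<le> integral Omega (\<lambda>y. \<epsilon> * kern r 0 (ctr x - y))"
    proof (rule integral_norm_bound_integral)
      show "(\<lambda>y. v y * kern r 0 (ctr x - y) - v x * kern r 0 (ctr x - y)) integrable_on Omega"
        by (intro integrable_diff i1 integrable_on_mult_right i2)
      show "(\<lambda>y. \<epsilon> * kern r 0 (ctr x - y)) integrable_on Omega" by (intro integrable_on_mult_right i2)
      fix y assume y: "y \<in> Omega"
      show "norm (v y * kern r 0 (ctr x - y) - v x * kern r 0 (ctr x - y)) \<le> \<epsilon> * kern r 0 (ctr x - y)"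
      proof (cases "\<bar>ctr x - y\<bar> < r")
        case True
        have "ctr x - x = \<eta> * (pi - x)" by (simp add: ctr_def \<theta>_def algebra_simps)
        hence "\<bar>ctr x - x\<bar> = \<eta> * \<bar>pi - x\<bar>" using \<eta> by (simp add: abs_mult)
        also have "\<dots> \<le> \<eta> * pi" using x \<eta> by (intro mult_left_mono) auto
        finally have "\<bar>y - x\<bar> < \<delta>" using True \<eta>(3) unfolding r_def by linarith
        hence "dist y x < \<delta>" by (simp add: dist_real_def)
        hence "\<bar>v y - v x\<bar> \<le> \<epsilon>" using \<delta>(2)[OF x y] by (simp add: dist_real_def)
        hence "\<bar>v y - v x\<bar> * kern r 0 (ctr x - y) \<le> \<epsilon> * kern r 0 (ctr x - y)"
          by (intro mult_right_mono kern_nonneg[OF r])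
        thus ?thesis using kern_nonneg[OF r, of "ctr x - y"] by (simp add: abs_mult left_diff_distrib[symmetric])
      next
        case False
        thus ?thesis using kern_outside[OF r, of "ctr x - y" 0] by simp
      qed
    qed
    also have "\<dots> = \<epsilon>" using integral_unique[OF mass] by simp
    finally show "\<bar>D 0 x - v x\<bar> \<le> \<epsilon>" by simp
  qed
qed

section \<open>From weak to classical derivatives\<close>

lemma mvt_within:
  fixes f f' :: "real \<Rightarrow> real"
  assumes "\<And>x. x \<in> {a..b} \<Longrightarrow> (f has_real_derivative f' x) (at x within {a..b})" "a \<le> s" "s < t" "t \<le> b"
  shows "\<exists>\<xi>. s < \<xi> \<and> \<xi> < t \<and> f t - f s = (t - s) * f' \<xi>"
proof -
  have "\<exists>\<xi>\<in>{s<..<t}. f t - f s = (\<lambda>h. f' \<xi> * h) (t - s)"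
  proof (rule mvt_simple[OF assms(3)])
    fix x assume "s \<le> x" "x \<le> t"
    hence "(f has_real_derivative f' x) (at x within {s..t})"
      using assms by (intro DERIV_subset[OF assms(1)]) auto
    thus "(f has_derivative (\<lambda>h. f' x * h)) (at x within {s..t})"
      by (simp add: has_field_derivative_def)
  qed
  thus ?thesis by (auto simp: mult.commute)
qed

text \<open>Within distance \<delta> of every point the mean value theorem finds a place where the
  derivative is at most 2S/\<delta>; the Lipschitz bound carries this back to the point. So
  smallness of a function passes to its derivative as soon as the derivative has a fixed Lipschitz
  constant. The restriction on \<delta> makes an interval of that length fit on at least one side of
  the point.\<close>

lemma landau_interpolation:
  fixes p p' :: "real \<Rightarrow> real"
  assumes "\<And>x. x \<in> {a..b} \<Longrightarrow> (p has_real_derivative p' x) (at x within {a..b})"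
    and "\<And>x y. x \<in> {a..b} \<Longrightarrow> y \<in> {a..b} \<Longrightarrow> \<bar>p' x - p' y\<bar> \<le> K * \<bar>x - y\<bar>"
    and "\<And>x. x \<in> {a..b} \<Longrightarrow> \<bar>p x\<bar> \<le> S"
    and "0 < \<delta>" "\<delta> \<le> (b - a) / 2" "x \<in> {a..b}" "K \<ge> 0"
  shows "\<bar>p' x\<bar> \<le> 2 * S / \<delta> + K * \<delta>"
proof -
  have *: "\<exists>\<xi>. \<xi> \<in> {a..b} \<and> \<bar>\<xi> - x\<bar> \<le> \<delta> \<and> \<bar>p' \<xi>\<bar> \<le> 2 * S / \<delta>"
    if st: "s \<in> {a..b}" "s + \<delta> \<in> {a..b}" "s = x \<or> s + \<delta> = x" for s
  proof -
    have "\<exists>\<xi>. s < \<xi> \<and> \<xi> < s + \<delta> \<and> p (s + \<delta>) - p s = (s + \<delta> - s) * p' \<xi>"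
      using st assms(4) by (intro mvt_within[OF assms(1)]) auto
    then obtain \<xi> where \<xi>: "s < \<xi>" "\<xi> < s + \<delta>" "p (s + \<delta>) - p s = \<delta> * p' \<xi>" by auto
    have "\<bar>p (s + \<delta>) - p s\<bar> \<le> 2 * S" using assms(3)[OF st(1)] assms(3)[OF st(2)] by linarith
    hence "\<delta> * \<bar>p' \<xi>\<bar> \<le> 2 * S" unfolding \<xi>(3) abs_mult using assms(4) by simp
    hence "\<bar>p' \<xi>\<bar> \<le> 2 * S / \<delta>" using assms(4) by (simp add: field_simps)
    thus ?thesis using \<xi> st by (intro exI[of _ \<xi>]) auto
  qed
  have "x + \<delta> \<in> {a..b} \<or> x - \<delta> \<in> {a..b}" using assms by auto
  then obtain \<xi> where \<xi>: "\<xi> \<in> {a..b}" "\<bar>\<xi> - x\<bar> \<le> \<delta>" "\<bar>p' \<xi>\<bar> \<le> 2 * S / \<delta>"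
    using *[of x] *[of "x - \<delta>"] assms(6) by auto
  have "\<bar>p' \<xi> - p' x\<bar> \<le> K * \<delta>"
    using assms(2)[OF \<xi>(1) assms(6)] mult_left_mono[OF \<xi>(2) assms(7)] by linarith
  thus ?thesis using \<xi>(3) by linarith
qed

text \<open>The mollified functions converge uniformly, and all their derivatives below order m have
  the common Lipschitz constant M; \<open>landau_interpolation\<close> then lifts uniform
  convergence from each order to the next. The bound on order m survives in the limit only as a
  Lipschitz bound on order m - 1.\<close>

lemma Wminf_classical:
  assumes W: "in_Wminf m v" and c: "continuous_on Omega v" and m: "m \<ge> 1"
  shows "\<exists>V :: nat \<Rightarrow> real \<Rightarrow> real. (\<forall>x\<in>Omega. V 0 x = v x) \<and>
    (\<forall>i<m - 1. \<forall>x\<in>Omega. (V i has_real_derivative V (Suc i) x) (at x within Omega)) \<and>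
    (\<forall>i<m. \<forall>x\<in>Omega. \<bar>V i x\<bar> \<le> Wminf_norm m v) \<and>
    (\<forall>x\<in>Omega. \<forall>y\<in>Omega. \<bar>V (m - 1) x - V (m - 1) y\<bar> \<le> Wminf_norm m v * \<bar>x - y\<bar>)"
proof -
  define M where "M = Wminf_norm m v"
  have M: "M \<ge> 0" unfolding M_def by (rule Wminf_norm_nonneg[OF W])
  have "\<forall>n. \<exists>D :: nat \<Rightarrow> real \<Rightarrow> real.
    (\<forall>i. \<forall>x\<in>Omega. (D i has_real_derivative D (Suc i) x) (at x within Omega)) \<and>
    (\<forall>i\<le>m. \<forall>x\<in>Omega. \<bar>D i x\<bar> \<le> M) \<and> (\<forall>x\<in>Omega. \<bar>D 0 x - v x\<bar> \<le> inverse (real (Suc n)))"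
    unfolding M_def by (intro allI mollify[OF W c]) simp
  then obtain D :: "nat \<Rightarrow> nat \<Rightarrow> real \<Rightarrow> real" where
    D: "\<And>n i x. x \<in> Omega \<Longrightarrow> (D n i has_real_derivative D n (Suc i) x) (at x within Omega)"
    and DM: "\<And>n i x. i \<le> m \<Longrightarrow> x \<in> Omega \<Longrightarrow> \<bar>D n i x\<bar> \<le> M"
    and D0: "\<And>n x. x \<in> Omega \<Longrightarrow> \<bar>D n 0 x - v x\<bar> \<le> inverse (real (Suc n))"
    by metis
  have lip: "\<bar>D n i x - D n i y\<bar> \<le> M * \<bar>x - y\<bar>" if "i < m" "x \<in> Omega" "y \<in> Omega" for n i x y
  proof -
    have "norm (D n i x - D n i y) \<le> M * norm (x - y)"
    proof (rule field_differentiable_bound[of Omega "D n i" "D n (Suc i)"])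
      show "norm (D n (Suc i) z) \<le> M" if "z \<in> Omega" for z using DM[of "Suc i" z n] \<open>i < m\<close> that by simp
    qed (use that D in auto)
    thus ?thesis by simp
  qed
  have cauchy: "\<forall>e>0. \<exists>N. \<forall>n\<ge>N. \<forall>n'\<ge>N. \<forall>x\<in>Omega. \<bar>D n i x - D n' i x\<bar> \<le> e" if "i < m" for i
    using that
  proof (induction i)
    case 0
    show ?case
    proof (intro allI impI)
      fix e :: real assume e: "e > 0"
      obtain N where N: "inverse (real (Suc N)) < e / 2" using reals_Archimedean[of "e / 2"] e by auto
      show "\<exists>N. \<forall>n\<ge>N. \<forall>n'\<ge>N. \<forall>x\<in>Omega. \<bar>D n 0 x - D n' 0 x\<bar> \<le> e"
      proof (intro exI[of _ N] allI impI ballI)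
        fix n n' x assume h: "n \<ge> N" "n' \<ge> N" "x \<in> Omega"
        have "inverse (real (Suc n)) \<le> inverse (real (Suc N))" "inverse (real (Suc n')) \<le> inverse (real (Suc N))"
          using h by (auto intro!: le_imp_inverse_le)
        thus "\<bar>D n 0 x - D n' 0 x\<bar> \<le> e" using D0[OF h(3), of n] D0[OF h(3), of n'] N by linarith
      qed
    qed
  next
    case (Suc i)
    show ?case
    proof (intro allI impI)
      fix e :: real assume e: "e > 0"
      \<comment> \<open>The interpolation bound is 2S/\<delta> + 2M\<delta>, as the difference of
        two approximations has Lipschitz constant 2M. The choice of \<delta> makes the second term
        at most e/2, and then S = e\<delta>/4 makes the first equal to e/2; the 1 in the denominator
        covers M = 0.\<close>
      define \<delta> where "\<delta> = min pi (e / (4 * M + 1))"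
      have \<delta>: "\<delta> > 0" "\<delta> \<le> pi" "2 * M * \<delta> \<le> e / 2"
      proof -
        show "\<delta> > 0" "\<delta> \<le> pi" using e M by (auto simp: \<delta>_def)
        have "(4 * M + 1) * \<delta> \<le> (4 * M + 1) * (e / (4 * M + 1))"
          unfolding \<delta>_def using M by (intro mult_left_mono) auto
        also have "\<dots> = e" using M by simp
        finally show "2 * M * \<delta> \<le> e / 2" using \<open>\<delta> > 0\<close> by (simp add: algebra_simps)
      qed
      define S where "S = e * \<delta> / 4"
      have "S > 0" using e \<delta> by (simp add: S_def)
      moreover have "\<forall>e>0. \<exists>N. \<forall>n\<ge>N. \<forall>n'\<ge>N. \<forall>x\<in>Omega. \<bar>D n i x - D n' i x\<bar> \<le> e"
        using Suc.prems by (intro Suc.IH) simp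
      ultimately obtain N where N: "\<forall>n\<ge>N. \<forall>n'\<ge>N. \<forall>x\<in>Omega. \<bar>D n i x - D n' i x\<bar> \<le> S" by blast
      show "\<exists>N. \<forall>n\<ge>N. \<forall>n'\<ge>N. \<forall>x\<in>Omega. \<bar>D n (Suc i) x - D n' (Suc i) x\<bar> \<le> e"
      proof (intro exI[of _ N] allI impI ballI)
        fix n n' x assume h: "n \<ge> N" "n' \<ge> N" "x \<in> Omega"
        have "\<bar>D n (Suc i) x - D n' (Suc i) x\<bar> \<le> 2 * S / \<delta> + 2 * M * \<delta>"
        proof (rule landau_interpolation[of 0 "2 * pi" "\<lambda>x. D n i x - D n' i x" "\<lambda>x. D n (Suc i) x - D n' (Suc i) x"])
          show "((\<lambda>x. D n i x - D n' i x) has_real_derivative D n (Suc i) x - D n' (Suc i) x) (at x within Omega)"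
            if "x \<in> Omega" for x using that by (intro DERIV_diff D)
          show "\<bar>D n (Suc i) x - D n' (Suc i) x - (D n (Suc i) y - D n' (Suc i) y)\<bar> \<le> 2 * M * \<bar>x - y\<bar>"
            if "x \<in> Omega" "y \<in> Omega" for x y
            using lip[of "Suc i" x y n] lip[of "Suc i" x y n'] Suc.prems that by (simp add: algebra_simps) 
          show "\<bar>D n i x - D n' i x\<bar> \<le> S" if "x \<in> Omega" for x using N h that by blast
        qed (use h \<delta> M in auto)
        also have "2 * S / \<delta> = e / 2" using \<delta> by (simp add: S_def)
        finally show "\<bar>D n (Suc i) x - D n' (Suc i) x\<bar> \<le> e" using \<delta> by linarith
      qed
    qed
  qed
  have "\<exists>l. (\<lambda>n. D n i x) \<longlonglongrightarrow> l" if "i < m" "x \<in> Omega" for i x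
  proof -
    note ix = that
    have "Cauchy (\<lambda>n. D n i x)"
    proof (rule metric_CauchyI)
      fix e :: real assume "e > 0"
      then obtain N where "\<forall>n\<ge>N. \<forall>n'\<ge>N. \<forall>x\<in>Omega. \<bar>D n i x - D n' i x\<bar> \<le> e / 2"
        using cauchy[OF ix(1)] half_gt_zero by blast
      hence "\<forall>n\<ge>N. \<forall>n'\<ge>N. \<bar>D n i x - D n' i x\<bar> \<le> e / 2" using ix(2) by blast
      thus "\<exists>N. \<forall>n\<ge>N. \<forall>n'\<ge>N. dist (D n i x) (D n' i x) < e"
        using \<open>e > 0\<close> by (intro exI[of _ N] allI impI) (force simp: dist_real_def)
    qed
    thus ?thesis by (simp add: Cauchy_convergent_iff convergent_def)
  qed
  then obtain V where V: "\<And>i x. i < m \<Longrightarrow> x \<in> Omega \<Longrightarrow> (\<lambda>n. D n i x) \<longlonglongrightarrow> V i x" by metis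
  have unif: "\<exists>N. \<forall>n\<ge>N. \<forall>x\<in>Omega. \<bar>D n i x - V i x\<bar> \<le> e" if "i < m" "e > 0" for i e
  proof -
    note ie = that
    obtain N where N: "\<forall>n\<ge>N. \<forall>n'\<ge>N. \<forall>x\<in>Omega. \<bar>D n i x - D n' i x\<bar> \<le> e"
      using cauchy[OF ie(1)] ie(2) by blast
    show ?thesis
    proof (intro exI[of _ N] allI impI ballI)
      fix n x assume h: "n \<ge> N" "x \<in> Omega"
      have "(\<lambda>n'. \<bar>D n i x - D n' i x\<bar>) \<longlonglongrightarrow> \<bar>D n i x - V i x\<bar>"
        by (intro tendsto_intros V[OF ie(1) h(2)])
      thus "\<bar>D n i x - V i x\<bar> \<le> e"
        by (rule LIMSEQ_le_const2) (use N h in blast)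
    qed
  qed
  show ?thesis unfolding M_def[symmetric]
  proof (intro exI[of _ V] conjI ballI allI impI)
    fix x assume x: "x \<in> Omega"
    have "(\<lambda>n. D n 0 x) \<longlonglongrightarrow> v x"
    proof (rule LIM_zero_cancel, rule Lim_null_comparison)
      show "\<forall>\<^sub>F n in sequentially. norm (D n 0 x - v x) \<le> inverse (real (Suc n))"
        using D0[OF x] by (intro always_eventually) auto
    qed (rule LIMSEQ_inverse_real_of_nat)
    thus "V 0 x = v x" 
      using LIMSEQ_unique[OF V[OF _ x]] m by auto
  next
    fix i x assume i: "i < m - 1" and x: "x \<in> Omega"
    have si: "Suc i < m" using i by simp
    have "\<exists>g. \<forall>x\<in>Omega. (\<lambda>n. D n i x) \<longlonglongrightarrow> g x \<and> (g has_derivative (\<lambda>h. V (Suc i) x * h)) (at x within Omega)"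
    proof (rule has_derivative_sequence)
      show "convex Omega" by simp
      show "(D n i has_derivative (\<lambda>h. D n (Suc i) x * h)) (at x within Omega)" if "x \<in> Omega" for n x
        using D[OF that] by (simp add: has_field_derivative_def)
      show "\<forall>\<^sub>F n in sequentially. \<forall>x\<in>Omega. \<forall>h. norm (D n (Suc i) x * h - V (Suc i) x * h) \<le> e * norm h"
        if e: "e > 0" for e
      proof -
        obtain N where "\<forall>n\<ge>N. \<forall>x\<in>Omega. \<bar>D n (Suc i) x - V (Suc i) x\<bar> \<le> e" using unif[of "Suc i" e] si e by blast
        thus ?thesis unfolding eventually_sequentially
          by (intro exI[of _ N]) (auto simp: left_diff_distrib[symmetric] abs_mult intro!: mult_right_mono)
      qed
      show "x \<in> Omega" by fact
      show "(\<lambda>n. D n i x) \<longlonglongrightarrow> V i x" using V[of i x] i x by simp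
    qed
    then obtain g where g: "\<And>x. x \<in> Omega \<Longrightarrow> (\<lambda>n. D n i x) \<longlonglongrightarrow> g x"
      "\<And>x. x \<in> Omega \<Longrightarrow> (g has_derivative (\<lambda>h. V (Suc i) x * h)) (at x within Omega)" by blast
    have gV: "g y = V i y" if "y \<in> Omega" for y 
      using LIMSEQ_unique[OF g(1)[OF that] V[OF Suc_lessD[OF si] that]] .
    have "(V i has_derivative (\<lambda>h. V (Suc i) x * h)) (at x within Omega)"
      by (rule has_derivative_transform[OF x _ g(2)[OF x]]) (use gV in auto)
    thus "(V i has_real_derivative V (Suc i) x) (at x within Omega)"
      by (simp add: has_field_derivative_def)
  next
    fix i x assume i: "i < m" and x: "x \<in> Omega"
    have "(\<lambda>n. \<bar>D n i x\<bar>) \<longlonglongrightarrow> \<bar>V i x\<bar>" by (intro tendsto_intros V i x)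
    thus "\<bar>V i x\<bar> \<le> M" by (rule LIMSEQ_le_const2) (use DM[OF less_imp_le[OF i] x] in blast)
  next
    fix x y assume x: "x \<in> Omega" and y: "y \<in> Omega"
    have lim: "(\<lambda>n. \<bar>D n (m - 1) x - D n (m - 1) y\<bar>) \<longlonglongrightarrow> \<bar>V (m - 1) x - V (m - 1) y\<bar>"
      using m x y by (intro tendsto_intros V) auto
    have "\<bar>D n (m - 1) x - D n (m - 1) y\<bar> \<le> M * \<bar>x - y\<bar>" for n
      using lip[of "m - 1" x y n] m x y by simp
    thus "\<bar>V (m - 1) x - V (m - 1) y\<bar> \<le> M * \<bar>x - y\<bar>"
      using LIMSEQ_le_const2[OF lim] by blast
  qed
qed

section \<open>Joint regularity of the solution in space and time\<close>

locale smooth_heat =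
  fixes T M :: real and K :: nat and U :: "nat \<Rightarrow> real \<Rightarrow> real \<Rightarrow> real"
  assumes T: "T > 0"
    and M: "M \<ge> 0"
    and dx: "\<And>i x t. i < K \<Longrightarrow> x \<in> Omega \<Longrightarrow> t \<in> {0..T} \<Longrightarrow>
       ((\<lambda>y. U i y t) has_real_derivative U (Suc i) x t) (at x within Omega)"
    and U_bound: "\<And>i x t. i \<le> K \<Longrightarrow> x \<in> Omega \<Longrightarrow> t \<in> {0..T} \<Longrightarrow> \<bar>U i x t\<bar> \<le> M"
    and U_top_lip: "\<And>x y t. x \<in> Omega \<Longrightarrow> y \<in> Omega \<Longrightarrow> t \<in> {0..T} \<Longrightarrow> \<bar>U K x t - U K y t\<bar> \<le> M * \<bar>x - y\<bar>"
    and U_cont: "\<And>i. i \<le> K \<Longrightarrow> continuous_on (Omega \<times> {0..T}) (\<lambda>(x, t). U i x t)"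
    and dt: "\<And>i x t. i + 2 \<le> K \<Longrightarrow> x \<in> Omega \<Longrightarrow> t \<in> {0..T} \<Longrightarrow>
       ((\<lambda>s. U i x s) has_real_derivative U (i + 2) x t) (at t within {0..T})"

lemma has_real_derivative_unique_Icc:
  fixes f :: "real \<Rightarrow> real"
  assumes "a < b" "x \<in> {a..b}" "(f has_real_derivative d) (at x within {a..b})" "(f has_real_derivative d') (at x within {a..b})"
  shows "d = d'"
  using assms vector_derivative_unique_within_closed_interval[of a b x f d d']
  by (simp add: has_real_derivative_iff_has_vector_derivative)

lemma continuous_on_slice:
  assumes "continuous_on (A \<times> B) (\<lambda>(x, t). f x t)"
  shows "t \<in> B \<Longrightarrow> continuous_on A (\<lambda>x. f x t)" "x \<in> A \<Longrightarrow> continuous_on B (\<lambda>t. f x t)"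
proof -
  assume "t \<in> B"
  hence "continuous_on A ((\<lambda>(x, t). f x t) \<circ> (\<lambda>x. (x, t)))"
    by (intro continuous_on_compose continuous_intros continuous_on_subset[OF assms]) auto
  thus "continuous_on A (\<lambda>x. f x t)" by (simp add: o_def)
next
  assume "x \<in> A"
  hence "continuous_on B ((\<lambda>(x, t). f x t) \<circ> (\<lambda>t. (x, t)))"
    by (intro continuous_on_compose continuous_intros continuous_on_subset[OF assms]) auto
  thus "continuous_on B (\<lambda>t. f x t)" by (simp add: o_def)
qed

text \<open>The norm controls space derivatives at each time separately, and the equation holds for
  positive times and the lowest order only. Continuity in time is propagated to higher space
  derivatives by interpolation, and the equation is differentiated in its integrated form.\<close>

lemma heat_solution_smooth:
  assumes T: "T > 0" and hs: "heat_solution T u0 u q" and W: "in_Wminf_unif T (Suc K) u" and K: "K \<ge> 3"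
  shows "\<exists>U. smooth_heat T (Wminf_norm_unif T (Suc K) u) K U \<and>
     (\<forall>x\<in>Omega. \<forall>t\<in>{0..T}. U 0 x t = u x t) \<and> (\<forall>x\<in>Omega. \<forall>t\<in>{0..T}. U 1 x t = q x t)"
proof -
  define M where "M = Wminf_norm_unif T (Suc K) u"
  have uc: "continuous_on (Omega \<times> {0..T}) (\<lambda>(x, t). u x t)" using hs by (simp add: heat_solution_def)
  have ucx: "continuous_on Omega (\<lambda>x. u x t)" if "t \<in> {0..T}" for t
    using continuous_on_slice(1)[OF uc that] .
  have Wt: "in_Wminf (Suc K) (\<lambda>x. u x t)" if "t \<in> {0..T}" for t using W that by (simp add: in_Wminf_unif_def)
  have Mt: "Wminf_norm (Suc K) (\<lambda>x. u x t) \<le> M" if "t \<in> {0..T}" for t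
    unfolding M_def Wminf_norm_unif_def using W that by (intro cSUP_upper) (auto simp: in_Wminf_unif_def)
  have M: "M \<ge> 0" using Mt[of 0] Wminf_norm_nonneg[OF Wt, of 0] T by force
  have "\<forall>t\<in>{0..T}. \<exists>V. (\<forall>x\<in>Omega. V 0 x = u x t) \<and>
    (\<forall>i<K. \<forall>x\<in>Omega. (V i has_real_derivative V (Suc i) x) (at x within Omega)) \<and>
    (\<forall>i<Suc K. \<forall>x\<in>Omega. \<bar>V i x\<bar> \<le> Wminf_norm (Suc K) (\<lambda>x. u x t)) \<and>
    (\<forall>x\<in>Omega. \<forall>y\<in>Omega. \<bar>V K x - V K y\<bar> \<le> Wminf_norm (Suc K) (\<lambda>x. u x t) * \<bar>x - y\<bar>)"
    using Wminf_classical[OF Wt ucx] by auto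
  then obtain V where V: "\<forall>t\<in>{0..T}. (\<forall>x\<in>Omega. V t 0 x = u x t) \<and>
    (\<forall>i<K. \<forall>x\<in>Omega. (V t i has_real_derivative V t (Suc i) x) (at x within Omega)) \<and>
    (\<forall>i<Suc K. \<forall>x\<in>Omega. \<bar>V t i x\<bar> \<le> Wminf_norm (Suc K) (\<lambda>x. u x t)) \<and>
    (\<forall>x\<in>Omega. \<forall>y\<in>Omega. \<bar>V t K x - V t K y\<bar> \<le> Wminf_norm (Suc K) (\<lambda>x. u x t) * \<bar>x - y\<bar>)"
    by (rule bchoice[THEN exE])
  define U where "U i x t = V t i x" for i x t
  have U0: "U 0 x t = u x t" if "x \<in> Omega" "t \<in> {0..T}" for x t
    using V that by (simp add: U_def)
  have dx: "((\<lambda>y. U i y t) has_real_derivative U (Suc i) x t) (at x within Omega)"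
    if "i < K" "x \<in> Omega" "t \<in> {0..T}" for i x t
    using V that unfolding U_def by blast
  have bd: "\<bar>U i x t\<bar> \<le> M" if "i \<le> K" "x \<in> Omega" "t \<in> {0..T}" for i x t
  proof -
    have "i < Suc K" using that by simp
    hence "\<bar>U i x t\<bar> \<le> Wminf_norm (Suc K) (\<lambda>x. u x t)" using V that unfolding U_def by blast
    thus ?thesis using Mt[OF that(3)] by linarith
  qed
  have topl: "\<bar>U K x t - U K y t\<bar> \<le> M * \<bar>x - y\<bar>" if "x \<in> Omega" "y \<in> Omega" "t \<in> {0..T}" for x y t
  proof -
    have "\<bar>U K x t - U K y t\<bar> \<le> Wminf_norm (Suc K) (\<lambda>x. u x t) * \<bar>x - y\<bar>" using V that unfolding U_def by blast
    also have "\<dots> \<le> M * \<bar>x - y\<bar>" by (intro mult_right_mono Mt that) simp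
    finally show ?thesis .
  qed
  have lip: "\<bar>U i x t - U i y t\<bar> \<le> M * \<bar>x - y\<bar>" if "i \<le> K" "x \<in> Omega" "y \<in> Omega" "t \<in> {0..T}" for i x y t
  proof (cases "i = K")
    case False
    have "norm (U i x t - U i y t) \<le> M * norm (x - y)"
      using that False bd dx
      by (intro field_differentiable_bound[of Omega "\<lambda>y. U i y t" "\<lambda>y. U (Suc i) y t"]) auto
    thus ?thesis by simp
  qed (use topl that in simp)
  \<comment> \<open>Continuity in time, uniformly in space. For order 0 it is uniform continuity on
    a compact set; the step applies \<open>landau_interpolation\<close> to the difference of two
    time slices, whose derivative is Lipschitz with constant 2M.\<close>
  have equi: "\<forall>e>0. \<exists>d>0. \<forall>s\<in>{0..T}. \<forall>t\<in>{0..T}. \<bar>s - t\<bar> < d \<longrightarrow> (\<forall>x\<in>Omega. \<bar>U i x s - U i x t\<bar> \<le> e)" if "i \<le> K" for i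
    using that
  proof (induction i)
    case 0
    have "uniformly_continuous_on (Omega \<times> {0..T}) (\<lambda>(x, t). u x t)"
      by (intro compact_uniformly_continuous uc compact_Times compact_Icc)
    hence *: "\<forall>e>0. \<exists>d>0. \<forall>z\<in>Omega \<times> {0..T}. \<forall>z'\<in>Omega \<times> {0..T}. dist z' z < d \<longrightarrow> dist ((\<lambda>(x, t). u x t) z') ((\<lambda>(x, t). u x t) z) < e"
      by (simp only: uniformly_continuous_on_def)
    show ?case
    proof (intro allI impI)
      fix e :: real assume "e > 0"
      then obtain d where d: "d > 0" and
        dd: "\<forall>z\<in>Omega \<times> {0..T}. \<forall>z'\<in>Omega \<times> {0..T}. dist z' z < d \<longrightarrow> dist ((\<lambda>(x, t). u x t) z') ((\<lambda>(x, t). u x t) z) < e"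
        using * by blast
      show "\<exists>d>0. \<forall>s\<in>{0..T}. \<forall>t\<in>{0..T}. \<bar>s - t\<bar> < d \<longrightarrow> (\<forall>x\<in>Omega. \<bar>U 0 x s - U 0 x t\<bar> \<le> e)"
      proof (intro exI[of _ d] conjI d ballI impI)
        fix s t x assume h: "s \<in> {0..T}" "t \<in> {0..T}" "\<bar>s - t\<bar> < d" "x \<in> Omega"
        have "dist (x, s) (x, t) < d" using h by (simp add: dist_Pair_Pair dist_real_def)
        hence "dist (u x s) (u x t) < e" using dd h by fastforce
        thus "\<bar>U 0 x s - U 0 x t\<bar> \<le> e" using U0 h by (simp add: dist_real_def)
      qed
    qed
  next
    case (Suc i)
    show ?case
    proof (intro allI impI)
      fix e :: real assume e: "e > 0"
      define \<delta> where "\<delta> = min pi (e / (4 * M + 1))"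
      have \<delta>: "\<delta> > 0" "\<delta> \<le> pi" "2 * M * \<delta> \<le> e / 2"
      proof -
        show "\<delta> > 0" "\<delta> \<le> pi" using e M by (auto simp: \<delta>_def)
        have "(4 * M + 1) * \<delta> \<le> (4 * M + 1) * (e / (4 * M + 1))"
          unfolding \<delta>_def using M by (intro mult_left_mono) auto
        also have "\<dots> = e" using M by simp
        finally show "2 * M * \<delta> \<le> e / 2" using \<open>\<delta> > 0\<close> by (simp add: algebra_simps)
      qed
      define S where "S = e * \<delta> / 4"
      have "S > 0" using e \<delta> by (simp add: S_def)
      moreover have "\<forall>e>0. \<exists>d>0. \<forall>s\<in>{0..T}. \<forall>t\<in>{0..T}. \<bar>s - t\<bar> < d \<longrightarrow> (\<forall>x\<in>Omega. \<bar>U i x s - U i x t\<bar> \<le> e)"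
        using Suc.prems by (intro Suc.IH) simp
      ultimately obtain d where d: "d > 0" and dd: "\<forall>s\<in>{0..T}. \<forall>t\<in>{0..T}. \<bar>s - t\<bar> < d \<longrightarrow> (\<forall>x\<in>Omega. \<bar>U i x s - U i x t\<bar> \<le> S)"
        by blast
      show "\<exists>d>0. \<forall>s\<in>{0..T}. \<forall>t\<in>{0..T}. \<bar>s - t\<bar> < d \<longrightarrow> (\<forall>x\<in>Omega. \<bar>U (Suc i) x s - U (Suc i) x t\<bar> \<le> e)"
      proof (intro exI[of _ d] conjI d ballI impI)
        fix s t x assume h: "s \<in> {0..T}" "t \<in> {0..T}" "\<bar>s - t\<bar> < d" "x \<in> Omega"
        have "\<bar>U (Suc i) x s - U (Suc i) x t\<bar> \<le> 2 * S / \<delta> + 2 * M * \<delta>"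
        proof (rule landau_interpolation[of 0 "2 * pi" "\<lambda>x. U i x s - U i x t" "\<lambda>x. U (Suc i) x s - U (Suc i) x t"])
          show "((\<lambda>x. U i x s - U i x t) has_real_derivative U (Suc i) x s - U (Suc i) x t) (at x within Omega)"
            if "x \<in> Omega" for x using that h Suc.prems by (intro DERIV_diff dx) auto
          show "\<bar>U (Suc i) x s - U (Suc i) x t - (U (Suc i) y s - U (Suc i) y t)\<bar> \<le> 2 * M * \<bar>x - y\<bar>"
            if "x \<in> Omega" "y \<in> Omega" for x y
            using lip[of "Suc i" x y s] lip[of "Suc i" x y t] Suc.prems that h by simp
          show "\<bar>U i x s - U i x t\<bar> \<le> S" if "x \<in> Omega" for x using dd h that by blast
        qed (use h \<delta> M in auto)
        also have "2 * S / \<delta> = e / 2" using \<delta> by (simp add: S_def)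
        finally show "\<bar>U (Suc i) x s - U (Suc i) x t\<bar> \<le> e" using \<delta> by linarith
      qed
    qed
  qed
  have cont: "continuous_on (Omega \<times> {0..T}) (\<lambda>(x, t). U i x t)" if i: "i \<le> K" for i
    unfolding continuous_on_iff
  proof (intro ballI allI impI)
    fix z and e :: real assume z: "z \<in> Omega \<times> {0..T}" and e: "e > 0"
    obtain x t where xt: "z = (x, t)" "x \<in> Omega" "t \<in> {0..T}" using z by auto
    have "e / 3 > 0" using e by simp
    then obtain d where d: "d > 0" "\<forall>s\<in>{0..T}. \<forall>t\<in>{0..T}. \<bar>s - t\<bar> < d \<longrightarrow> (\<forall>x\<in>Omega. \<bar>U i x s - U i x t\<bar> \<le> e / 3)"
      using equi[OF i] by blast
    define d' where "d' = min d (e / (3 * (M + 1)))"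
    have d': "d' > 0" using d e M by (simp add: d'_def)
    show "\<exists>d>0. \<forall>z'\<in>Omega \<times> {0..T}. dist z' z < d \<longrightarrow> dist ((\<lambda>(x, t). U i x t) z') ((\<lambda>(x, t). U i x t) z) < e"
    proof (intro exI[of _ d'] conjI d' ballI impI)
      fix z' assume z': "z' \<in> Omega \<times> {0..T}" "dist z' z < d'"
      obtain y s where ys: "z' = (y, s)" "y \<in> Omega" "s \<in> {0..T}" using z' by auto
      have "dist y x < d'" "dist s t < d'"
        using z'(2) dist_fst_le[of z' z] dist_snd_le[of z' z] by (auto simp: ys xt)
      hence lt: "\<bar>y - x\<bar> < d'" "\<bar>s - t\<bar> < d'" by (auto simp: dist_real_def)
      have 1: "\<bar>U i y s - U i y t\<bar> \<le> e / 3" using d(2) lt(2) ys xt by (auto simp: d'_def)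
      have "\<bar>U i y t - U i x t\<bar> \<le> M * \<bar>y - x\<bar>" using lip i ys xt by simp
      also have "\<dots> \<le> (M + 1) * (e / (3 * (M + 1)))" using lt(1) M by (intro mult_mono) (auto simp: d'_def)
      also have "\<dots> = e / 3" using M by (simp add: field_simps)
      finally have "\<bar>U i y s - U i x t\<bar> < e" using 1 e by linarith
      thus "dist ((\<lambda>(x, t). U i x t) z') ((\<lambda>(x, t). U i x t) z) < e"
        by (simp add: ys xt dist_real_def)
    qed
  qed
  have U1: "U 1 x t = q x t" if "x \<in> Omega" "t \<in> {0..T}" for x t
  proof (rule has_real_derivative_unique_Icc[of 0 "2 * pi" x "\<lambda>y. U 0 y t"])
    show "((\<lambda>y. U 0 y t) has_real_derivative U 1 x t) (at x within Omega)" using dx[of 0 x t] that K by simp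
    have "((\<lambda>y. u y t) has_real_derivative q x t) (at x within Omega)"
      using hs that by (simp add: heat_solution_def is_x_deriv_def)
    thus "((\<lambda>y. U 0 y t) has_real_derivative q x t) (at x within Omega)"
      by (rule has_field_derivative_transform_within[OF _ zero_less_one]) (use that U0 in auto)
  qed (use that in auto)
  have tc: "continuous_on {0..t} (\<lambda>s. U i x s)" if "i \<le> K" "x \<in> Omega" "t \<le> T" for i x t
    by (rule continuous_on_subset[OF continuous_on_slice(2)[OF cont[OF that(1)] that(2)]]) (use that in auto)
  \<comment> \<open>Integrating in time allows a differentiation in space under the integral sign,
    and both sides of the next instance are then space derivatives of the same function. It also
    includes t = 0, about which the equation itself says nothing.\<close>
  have P: "U i x t = U i x 0 + integral {0..t} (\<lambda>s. U (i + 2) x s)" if "i + 2 \<le> K" "x \<in> Omega" "t \<in> {0..T}" for i x t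
    using that
  proof (induction i arbitrary: x t)
    case 0
    have "((\<lambda>s. U 2 x s) has_integral U 0 x t - U 0 x 0) {0..t}"
    proof (rule fundamental_theorem_of_calculus_interior)
      show "0 \<le> t" using 0 by simp
      show "continuous_on {0..t} (\<lambda>s. U 0 x s)" using 0 by (intro tc) auto
      fix s assume s: "s \<in> {0<..<t}"
      obtain d where d: "((\<lambda>s. u x s) has_real_derivative d) (at s within {0..T})"
        "((\<lambda>y. q y s) has_real_derivative d) (at x within Omega)"
      proof -
        have "x \<in> Omega" "s \<in> {0<..T}" using s 0 by auto
        thus ?thesis using hs that unfolding heat_solution_def by blast
      qed
      have "d = U 2 x s"
      proof (rule has_real_derivative_unique_Icc[of 0 "2 * pi" x "\<lambda>y. U 1 y s"])
        show "((\<lambda>y. U 1 y s) has_real_derivative d) (at x within Omega)"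
          by (rule has_field_derivative_transform_within[OF d(2) zero_less_one]) (use s 0 U1 in auto)
        show "((\<lambda>y. U 1 y s) has_real_derivative U 2 x s) (at x within Omega)"
          using dx[of 1 x s] K s 0 by (simp add: numeral_2_eq_2)
      qed (use 0 in auto)
      moreover have "((\<lambda>s. U 0 x s) has_real_derivative d) (at s within {0..T})"
        by (rule has_field_derivative_transform_within[OF d(1) zero_less_one]) (use s 0 U0 in auto)
      ultimately show "((\<lambda>s. U 0 x s) has_vector_derivative U 2 x s) (at s)"
        using s 0 by (simp add: at_within_Icc_at has_real_derivative_iff_has_vector_derivative)
    qed
    thus ?case by (simp add: integral_unique numeral_2_eq_2)
  next
    case (Suc i)
    have "U (Suc i) x t = U (Suc i) x 0 + integral (cbox 0 t) (\<lambda>s. U (Suc i + 2) x s)"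
    proof (rule has_real_derivative_unique_Icc[of 0 "2 * pi" x "\<lambda>y. U i y t"])
      show "((\<lambda>y. U i y t) has_real_derivative U (Suc i) x t) (at x within Omega)"
        using Suc.prems by (intro dx) auto
      have "((\<lambda>y. integral (cbox 0 t) (\<lambda>s. U (i + 2) y s)) has_field_derivative integral (cbox 0 t) (\<lambda>s. U (Suc i + 2) x s)) (at x within Omega)"
      proof (rule leibniz_rule_field_derivative)
        show "((\<lambda>y. U (i + 2) y s) has_real_derivative U (Suc i + 2) y s) (at y within Omega)"
          if "y \<in> Omega" "s \<in> cbox 0 t" for y s using dx[of "i + 2" y s] Suc.prems that by simp
        show "(\<lambda>s. U (i + 2) y s) integrable_on cbox 0 t" if "y \<in> Omega" for y
          using Suc.prems that by (simp, intro integrable_continuous_interval tc) auto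
        have "continuous_on (Omega \<times> cbox 0 t) (\<lambda>(y, s). U (Suc i + 2) y s)"
          using Suc.prems by (intro continuous_on_subset[OF cont]) auto
        thus "continuous_on (Omega \<times> cbox 0 t) (\<lambda>(y, s). U (Suc i + 2) y s)" .
      qed (use Suc.prems in auto)
      moreover have "((\<lambda>y. U i y 0) has_real_derivative U (Suc i) x 0) (at x within Omega)"
        using Suc.prems T by (intro dx) auto
      ultimately have "((\<lambda>y. U i y 0 + integral (cbox 0 t) (\<lambda>s. U (i + 2) y s)) has_real_derivative
          (U (Suc i) x 0 + integral (cbox 0 t) (\<lambda>s. U (Suc i + 2) x s))) (at x within Omega)"
        by (intro DERIV_add)
      thus "((\<lambda>y. U i y t) has_real_derivative
          (U (Suc i) x 0 + integral (cbox 0 t) (\<lambda>s. U (Suc i + 2) x s))) (at x within Omega)"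
        by (rule has_field_derivative_transform_within[OF _ zero_less_one])
           (use Suc.prems Suc.IH[of _ t] in auto)
    qed (use Suc.prems in auto)
    thus ?case by simp
  qed
  have dt: "((\<lambda>s. U i x s) has_real_derivative U (i + 2) x t) (at t within {0..T})"
    if "i + 2 \<le> K" "x \<in> Omega" "t \<in> {0..T}" for i x t
  proof -
    have "((\<lambda>t. integral {0..t} (\<lambda>s. U (i + 2) x s)) has_real_derivative U (i + 2) x t) (at t within {0..T})"
      using that by (intro integral_has_real_derivative tc) auto
    from DERIV_add[OF DERIV_const[of "U i x 0"] this]
    have "((\<lambda>t. U i x 0 + integral {0..t} (\<lambda>s. U (i + 2) x s)) has_real_derivative U (i + 2) x t) (at t within {0..T})"
      by (simp only: add_0)
    thus ?thesis
      by (rule has_field_derivative_transform_within[OF _ zero_less_one that(3)]) (rule P[OF that(1,2), symmetric])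
  qed
  have "smooth_heat T M K U"
    by (rule smooth_heat.intro; (fact T M dx bd topl cont dt)?)
  thus ?thesis using U0 U1 unfolding M_def by blast
qed

subsection \<open>Projection coefficients of the solution\<close>

text \<open>One fixed bound for all the projection data of degree k, chosen once so that the
  constant of the theorem can be written down before any mesh is given.\<close>

definition PB :: "nat \<Rightarrow> real" where
  "PB k = (SOME B. B \<ge> 1 \<and>
     (\<forall>a b v S e. a < b \<longrightarrow> continuous_on {a..b} v \<longrightarrow> (\<forall>x\<in>{a..b}. \<bar>v x\<bar> \<le> S) \<longrightarrow> \<bar>coef e k a b v\<bar> \<le> B * S) \<and>
     (\<forall>a b e n x. a < b \<longrightarrow> n \<le> k \<longrightarrow> x \<in> {a..b} \<longrightarrow> \<bar>poly (EP k a b n e) x\<bar> \<le> B) \<and>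
     (\<forall>a b m x. a < b \<longrightarrow> m \<le> k \<longrightarrow> x \<in> {a..b} \<longrightarrow> \<bar>poly (Lc a b m) x\<bar> \<le> B \<and> \<bar>poly (pderiv (Lc a b m)) x\<bar> \<le> 2 / (b - a) * B))"

lemma PB: "PB k \<ge> 1"
  "a < b \<Longrightarrow> continuous_on {a..b} v \<Longrightarrow> (\<And>x. x \<in> {a..b} \<Longrightarrow> \<bar>v x\<bar> \<le> S) \<Longrightarrow> \<bar>coef e k a b v\<bar> \<le> PB k * S"
  "a < b \<Longrightarrow> n \<le> k \<Longrightarrow> x \<in> {a..b} \<Longrightarrow> \<bar>poly (EP k a b n e) x\<bar> \<le> PB k"
  "a < b \<Longrightarrow> m \<le> k \<Longrightarrow> x \<in> {a..b} \<Longrightarrow> \<bar>poly (Lc a b m) x\<bar> \<le> PB k"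
  "a < b \<Longrightarrow> m \<le> k \<Longrightarrow> x \<in> {a..b} \<Longrightarrow> \<bar>poly (pderiv (Lc a b m)) x\<bar> \<le> 2 / (b - a) * PB k"
proof -
  obtain B1 where B1: "B1 \<ge> 1" "\<And>a b v S e. a < b \<Longrightarrow> continuous_on {a..b} v \<Longrightarrow> (\<And>x. x \<in> {a..b} \<Longrightarrow> \<bar>v x\<bar> \<le> S) \<Longrightarrow>
       \<bar>coef e k a b v\<bar> \<le> B1 * S" using proj_bound[of k] by metis
  obtain B2 where B2: "B2 \<ge> 1" "\<And>a b e n x. a < b \<Longrightarrow> n \<le> k \<Longrightarrow> x \<in> {a..b} \<Longrightarrow> \<bar>poly (EP k a b n e) x\<bar> \<le> B2"
    using EP_bound[of k] by metis
  obtain B3 where B3: "B3 \<ge> 1"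
    "\<And>a b m x. a < b \<Longrightarrow> m \<le> k \<Longrightarrow> a \<le> x \<Longrightarrow> x \<le> b \<Longrightarrow> \<bar>poly (Lc a b m) x\<bar> \<le> B3"
    "\<And>a b m x. a < b \<Longrightarrow> m \<le> k \<Longrightarrow> a \<le> x \<Longrightarrow> x \<le> b \<Longrightarrow> \<bar>poly (pderiv (Lc a b m)) x\<bar> \<le> 2 / (b - a) * B3"
    using Lc_bound[of k] by metis
  define B where "B = max B1 (max B2 B3)"
  have le: "B1 \<le> B" "B2 \<le> B" "B3 \<le> B" by (auto simp: B_def)
  have "PB k \<ge> 1 \<and>
     (\<forall>a b v S e. a < b \<longrightarrow> continuous_on {a..b} v \<longrightarrow> (\<forall>x\<in>{a..b}. \<bar>v x\<bar> \<le> S) \<longrightarrow> \<bar>coef e k a b v\<bar> \<le> PB k * S) \<and>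
     (\<forall>a b e n x. a < b \<longrightarrow> n \<le> k \<longrightarrow> x \<in> {a..b} \<longrightarrow> \<bar>poly (EP k a b n e) x\<bar> \<le> PB k) \<and>
     (\<forall>a b m x. a < b \<longrightarrow> m \<le> k \<longrightarrow> x \<in> {a..b} \<longrightarrow> \<bar>poly (Lc a b m) x\<bar> \<le> PB k \<and> \<bar>poly (pderiv (Lc a b m)) x\<bar> \<le> 2 / (b - a) * PB k)"
    unfolding PB_def
  proof (rule someI[of _ B], intro conjI allI impI)
    show "1 \<le> B" using le B1(1) by linarith
    fix a b S :: real and v e assume h: "a < b" "continuous_on {a..b} v" "\<forall>x\<in>{a..b}. \<bar>v x\<bar> \<le> S"
    have "S \<ge> 0" using h(1,3) by (metis abs_ge_zero atLeastAtMost_iff less_imp_le order.refl order.trans)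
    hence "B1 * S \<le> B * S" by (intro mult_right_mono le)
    thus "\<bar>coef e k a b v\<bar> \<le> B * S" using B1(2)[of a b v S e] h by fastforce
  next
    fix a b x :: real and e n assume "a < b" "n \<le> k" "x \<in> {a..b}"
    thus "\<bar>poly (EP k a b n e) x\<bar> \<le> B" using B2(2)[of a b n x e] le by linarith
  next
    fix a b x :: real and m assume h: "a < b" "m \<le> k" "x \<in> {a..b}"
    thus "\<bar>poly (Lc a b m) x\<bar> \<le> B" using B3(2)[of a b m x] le by (auto intro: order.trans)
    have "2 / (b - a) * B3 \<le> 2 / (b - a) * B" using h le by (intro mult_left_mono) auto
    thus "\<bar>poly (pderiv (Lc a b m)) x\<bar> \<le> 2 / (b - a) * B" using B3(3)[of a b m x] h by auto
  qed
  note * = this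
  show "PB k \<ge> 1" using * by blast
  show "\<bar>coef e k a b v\<bar> \<le> PB k * S"
    if "a < b" "continuous_on {a..b} v" "\<And>x. x \<in> {a..b} \<Longrightarrow> \<bar>v x\<bar> \<le> S" using * that by blast
  show "a < b \<Longrightarrow> n \<le> k \<Longrightarrow> x \<in> {a..b} \<Longrightarrow> \<bar>poly (EP k a b n e) x\<bar> \<le> PB k" using * by blast
  show "a < b \<Longrightarrow> m \<le> k \<Longrightarrow> x \<in> {a..b} \<Longrightarrow> \<bar>poly (Lc a b m) x\<bar> \<le> PB k" using * by blast
  show "a < b \<Longrightarrow> m \<le> k \<Longrightarrow> x \<in> {a..b} \<Longrightarrow> \<bar>poly (pderiv (Lc a b m)) x\<bar> \<le> 2 / (b - a) * PB k" using * by blast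
qed

lemma mom_diff:
  assumes "continuous_on {a..b} v" "continuous_on {a..b} w"
  shows "mom a b m (\<lambda>x. v x - w x) = mom a b m v - mom a b m w"
  unfolding mom_def right_diff_distrib[symmetric] left_diff_distrib
  by (subst integral_diff[symmetric]) (auto intro: integrable_continuous_poly assms)

lemma coef_diff_poly:
  assumes "a < b" "continuous_on {a..b} v" "degree P \<le> k"
  shows "coef e k a b (\<lambda>x. v x - poly P x) = coef e k a b v"
proof -
  have "proj k a b (\<lambda>x. v x - poly P x) = proj k a b v - proj k a b (poly P)"
    unfolding proj_def using assms
    by (simp add: mom_diff continuous_intros smult_diff_left sum_subtractf)
  hence "proj k a b (\<lambda>x. v x - poly P x) = proj k a b v - P" using proj_poly[OF assms(1,3)] by simp
  thus ?thesis by (simp add: coef_def)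
qed

text \<open>\<open>coef\<close> vanishes on polynomials of degree at most k, so only the distance of
  \<open>v\<close> to such polynomials matters, as in the Bramble-Hilbert argument.\<close>

lemma coef_approx:
  assumes "a < b" "continuous_on {a..b} v" "degree P \<le> k" "\<And>x. x \<in> {a..b} \<Longrightarrow> \<bar>v x - poly P x\<bar> \<le> S"
  shows "\<bar>coef e k a b v\<bar> \<le> PB k * S"
proof -
  have "\<bar>coef e k a b (\<lambda>x. v x - poly P x)\<bar> \<le> PB k * S"
    using assms by (intro PB(2) continuous_intros) auto
  thus ?thesis using coef_diff_poly[OF assms(1-3)] by simp
qed

text \<open>An approximation of a derivative is integrated back, with the constant of integration
  matched at \<open>a\<close>; every integration gains a factor b - a and one degree.\<close>

lemma primitive_approx:
  fixes V :: "nat \<Rightarrow> real \<Rightarrow> real"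
  assumes "a < b"
    and "\<And>i x. i < p \<Longrightarrow> x \<in> {a..b} \<Longrightarrow> (V i has_real_derivative V (Suc i) x) (at x within {a..b})"
    and "degree A \<le> d" "\<And>x. x \<in> {a..b} \<Longrightarrow> \<bar>V p x - poly A x\<bar> \<le> \<omega>"
  shows "\<exists>P. degree P \<le> d + p \<and> (\<forall>x\<in>{a..b}. \<bar>V 0 x - poly P x\<bar> \<le> \<omega> * (b - a) ^ p)"
  using assms(2,4)
proof (induction p arbitrary: V)
  case 0
  thus ?case using assms(3) by (intro exI[of _ A]) auto
next
  case (Suc p)
  obtain P where P: "degree P \<le> d + p" "\<And>x. x \<in> {a..b} \<Longrightarrow> \<bar>V (Suc 0) x - poly P x\<bar> \<le> \<omega> * (b - a) ^ p"
    using Suc.IH[of "\<lambda>i. V (Suc i)"] Suc.prems by auto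
  obtain Q where Q: "pderiv Q = P" using poly_antideriv by blast
  define R where "R = Q + [:V 0 a - poly Q a:]"
  have R: "pderiv R = P" "poly R a = V 0 a" by (auto simp: R_def Q pderiv_add pderiv_pCons)
  have "degree R \<le> Suc (d + p)" using degree_pderiv[of R] P(1) R(1) by simp
  moreover have "\<bar>V 0 x - poly R x\<bar> \<le> \<omega> * (b - a) ^ Suc p" if x: "x \<in> {a..b}" for x
  proof -
    have "norm ((V 0 x - poly R x) - (V 0 a - poly R a)) \<le> \<omega> * (b - a) ^ p * norm (x - a)"
    proof (rule field_differentiable_bound[of "{a..b}" "\<lambda>x. V 0 x - poly R x" "\<lambda>x. V (Suc 0) x - poly P x"])
      fix z assume z: "z \<in> {a..b}"
      show "((\<lambda>x. V 0 x - poly R x) has_real_derivative V (Suc 0) z - poly P z) (at z within {a..b})"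
        using Suc.prems(1)[of 0 z] z has_field_derivative_at_within[OF poly_DERIV[of R z], of "{a..b}"]
        unfolding R(1) by (intro DERIV_diff) auto
    qed (use P x assms(1) in auto)
    hence "\<bar>V 0 x - poly R x\<bar> \<le> \<omega> * (b - a) ^ p * \<bar>x - a\<bar>" using R by simp
    also have "\<dots> \<le> \<omega> * (b - a) ^ p * (b - a)"
      using x P(2)[OF x] by (intro mult_left_mono) (auto intro: order.trans[OF abs_ge_zero])
    finally show ?thesis by (simp add: mult_ac)
  qed
  ultimately show ?case by (intro exI[of _ R]) auto
qed

context smooth_heat
begin

lemma dx_sub:
  assumes "i < K" "0 \<le> a" "b \<le> 2 * pi" "x \<in> {a..b}" "t \<in> {0..T}"
  shows "((\<lambda>y. U i y t) has_real_derivative U (Suc i) x t) (at x within {a..b})"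
  by (rule DERIV_subset[OF dx]) (use assms in auto)

lemma U_lip:
  assumes "i \<le> K" "x \<in> Omega" "y \<in> Omega" "t \<in> {0..T}"
  shows "\<bar>U i x t - U i y t\<bar> \<le> M * \<bar>x - y\<bar>"
proof (cases "i = K")
  case False
  have "norm (U i x t - U i y t) \<le> M * norm (x - y)"
    using assms False U_bound dx
    by (intro field_differentiable_bound[of Omega "\<lambda>y. U i y t" "\<lambda>y. U (Suc i) y t"]) auto
  thus ?thesis by simp
qed (use U_top_lip assms in simp)

lemma U_cont_x:
  assumes "i \<le> K" "0 \<le> a" "b \<le> 2 * pi" "t \<in> {0..T}"
  shows "continuous_on {a..b} (\<lambda>x. U i x t)"
  by (rule continuous_on_subset[OF continuous_on_slice(1)[OF U_cont]]) (use assms in auto)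

lemma U_cont_swap:
  assumes "i \<le> K" "0 \<le> a" "b \<le> 2 * pi"
  shows "continuous_on ({0..T} \<times> {a..b}) (\<lambda>(t, x). U i x t)"
proof -
  have "continuous_on ({0..T} \<times> {a..b}) ((\<lambda>(x, t). U i x t) \<circ> (\<lambda>z. (snd z, fst z)))"
    by (intro continuous_on_compose continuous_intros continuous_on_subset[OF U_cont]) (use assms in auto)
  thus ?thesis by (simp add: o_def case_prod_unfold)
qed

lemma moment_deriv:
  assumes "i + 2 \<le> K" "0 \<le> a" "b \<le> 2 * pi" "t \<in> {0..T}"
  shows "((\<lambda>s. integral {a..b} (\<lambda>x. U i x s * poly p x)) has_real_derivative
     integral {a..b} (\<lambda>x. U (i + 2) x t * poly p x)) (at t within {0..T})"
proof -
  have "((\<lambda>s. integral (cbox a b) (\<lambda>x. U i x s * poly p x)) has_field_derivative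
     integral (cbox a b) (\<lambda>x. U (i + 2) x t * poly p x)) (at t within {0..T})"
  proof (rule leibniz_rule_field_derivative)
    show "((\<lambda>s. U i x s * poly p x) has_real_derivative U (i + 2) x s * poly p x) (at s within {0..T})"
      if "s \<in> {0..T}" "x \<in> cbox a b" for s x
      using that assms by (intro DERIV_cmult_right dt) auto
    show "(\<lambda>x. U i x s * poly p x) integrable_on cbox a b" if "s \<in> {0..T}" for s
      using that assms by (simp, intro integrable_continuous_poly U_cont_x) auto
    have "continuous_on ({0..T} \<times> {a..b}) (\<lambda>z. (\<lambda>(t, x). U (i + 2) x t) z * poly p (snd z))"
      using assms by (intro continuous_intros U_cont_swap) auto
    thus "continuous_on ({0..T} \<times> cbox a b) (\<lambda>(s, x). U (i + 2) x s * poly p x)"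
      by (simp add: case_prod_unfold)
  qed (use assms in auto)
  thus ?thesis by simp
qed

lemma moment_cont:
  assumes "i \<le> K" "0 \<le> a" "b \<le> 2 * pi"
  shows "continuous_on {0..T} (\<lambda>s. integral {a..b} (\<lambda>x. U i x s * poly p x))"
proof -
  have "continuous_on ({0..T} \<times> {a..b}) (\<lambda>z. (\<lambda>(t, x). U i x t) z * poly p (snd z))"
    using assms by (intro continuous_intros U_cont_swap) auto
  hence "continuous_on ({0..T} \<times> cbox a b) (\<lambda>(s, x). U i x s * poly p x)" by (simp add: case_prod_unfold)
  from integral_continuous_on_param[OF this] show ?thesis by simp
qed

lemma coef_expand:
  "coef e k a b v = (if e then 1 else (- 1) ^ k) *
     ((\<Sum>m\<le>k. (2 * real m + 1) / (b - a) * integral {a..b} (\<lambda>x. v x * poly (Lc a b m) x) * poly (Lc a b m) (endp e a b)) - v (endp e a b))"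
  by (simp add: coef_def proj_def poly_sum mom_def)

lemma coef_deriv:
  assumes "i + 2 \<le> K" "0 \<le> a" "a < b" "b \<le> 2 * pi" "t \<in> {0..T}"
  shows "((\<lambda>s. coef e k a b (\<lambda>x. U i x s)) has_real_derivative coef e k a b (\<lambda>x. U (i + 2) x t)) (at t within {0..T})"
  unfolding coef_expand
  using endp_in[OF assms(3), of e] assms
  by (intro DERIV_cmult DERIV_diff DERIV_sum DERIV_cmult_right moment_deriv dt) auto

lemma coef_cont:
  assumes "i \<le> K" "0 \<le> a" "a < b" "b \<le> 2 * pi"
  shows "continuous_on {0..T} (\<lambda>s. coef e k a b (\<lambda>x. U i x s))"
  unfolding coef_expand
  using endp_in[OF assms(3), of e] assms
  by (intro continuous_intros moment_cont continuous_on_slice(2)[OF U_cont]) auto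

text \<open>The derivative of order n + p is Lipschitz, hence a constant up to M (b - a); p
  integrations produce an approximation of degree p and the remaining powers.\<close>

lemma coef_U_bound:
  assumes "n + p \<le> K" "p \<le> k" "0 \<le> a" "a < b" "b \<le> 2 * pi" "t \<in> {0..T}"
  shows "\<bar>coef e k a b (\<lambda>x. U n x t)\<bar> \<le> PB k * (M * (b - a) ^ Suc p)"
proof -
  have "\<exists>P. degree P \<le> 0 + p \<and> (\<forall>x\<in>{a..b}. \<bar>U (n + 0) x t - poly P x\<bar> \<le> M * (b - a) * (b - a) ^ p)"
  proof (rule primitive_approx[of a b p "\<lambda>i x. U (n + i) x t" "[:U (n + p) a t:]"])
    show "((\<lambda>x. U (n + i) x t) has_real_derivative U (n + Suc i) x t) (at x within {a..b})"
      if "i < p" "x \<in> {a..b}" for i x using that assms dx_sub[of "n + i" a b x t] by simp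
    show "\<bar>U (n + p) x t - poly [:U (n + p) a t:] x\<bar> \<le> M * (b - a)" if "x \<in> {a..b}" for x
    proof -
      have "\<bar>U (n + p) x t - U (n + p) a t\<bar> \<le> M * \<bar>x - a\<bar>" using assms that by (intro U_lip) auto
      also have "\<dots> \<le> M * (b - a)" using that M by (intro mult_left_mono) auto
      finally show ?thesis by simp
    qed
  qed (use assms in auto)
  then obtain P where P: "degree P \<le> p" "\<And>x. x \<in> {a..b} \<Longrightarrow> \<bar>U n x t - poly P x\<bar> \<le> M * (b - a) ^ Suc p"
    by (auto simp: mult.assoc)
  show ?thesis using assms P by (intro coef_approx[where P = P] U_cont_x) auto
qed

end

section \<open>Third-order difference quotients\<close>

text \<open>A substitute for three derivatives. Applied to the derivative of order K - 2 it imitates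
  the one of order K + 1, which need not exist classically; yet it solves the heat equation
  classically, because only differences of \<open>U\<close> up to order K occur, and it is bounded
  by the Lipschitz constant of the top order.\<close>

definition third_diff :: "real \<Rightarrow> (real \<Rightarrow> real) \<Rightarrow> real \<Rightarrow> real" where
  "third_diff \<epsilon> w x = (w (x + 3 * \<epsilon>) - 3 * w (x + 2 * \<epsilon>) + 3 * w (x + \<epsilon>) - w x) / \<epsilon> ^ 3"

lemma deriv_shift_within:
  fixes w :: "real \<Rightarrow> real"
  assumes "(w has_real_derivative d) (at (x + c) within {a..b})" "\<And>y. y \<in> S \<Longrightarrow> y + c \<in> {a..b}"
  shows "((\<lambda>y. w (y + c)) has_real_derivative d) (at x within S)"
proof -
  have "(w has_real_derivative d) (at (x + c) within ((\<lambda>y. y + c) ` S))"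
    by (rule DERIV_subset[OF assms(1)]) (use assms(2) in auto)
  moreover have "((\<lambda>y. y + c) has_real_derivative 1) (at x within S)" by (auto intro!: derivative_eq_intros)
  ultimately show ?thesis using DERIV_image_chain[of w d "\<lambda>y. y + c" x S 1] by (simp add: o_def)
qed

lemma second_diff_mvt:
  fixes g :: "real \<Rightarrow> real"
  assumes "\<epsilon> > 0"
    and "\<And>y. y \<in> {x..x + 2 * \<epsilon>} \<Longrightarrow> (g has_real_derivative g' y) (at y within {x..x + 2 * \<epsilon>})"
    and "\<And>y. y \<in> {x..x + 2 * \<epsilon>} \<Longrightarrow> (g' has_real_derivative g'' y) (at y within {x..x + 2 * \<epsilon>})"
  shows "\<exists>\<xi>\<in>{x..x + 2 * \<epsilon>}. g (x + 2 * \<epsilon>) - 2 * g (x + \<epsilon>) + g x = \<epsilon>\<^sup>2 * g'' \<xi>"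
proof -
  have "\<exists>\<xi>. x < \<xi> \<and> \<xi> < x + \<epsilon> \<and> (g (x + \<epsilon> + \<epsilon>) - g (x + \<epsilon>)) - (g (x + \<epsilon>) - g x) = (x + \<epsilon> - x) * (g' (\<xi> + \<epsilon>) - g' \<xi>)"
  proof (rule mvt_within[of x "x + \<epsilon>" "\<lambda>y. g (y + \<epsilon>) - g y" "\<lambda>y. g' (y + \<epsilon>) - g' y"])
    fix y assume y: "y \<in> {x..x + \<epsilon>}"
    show "((\<lambda>y. g (y + \<epsilon>) - g y) has_real_derivative g' (y + \<epsilon>) - g' y) (at y within {x..x + \<epsilon>})"
      using y assms(1)
      by (intro DERIV_diff deriv_shift_within[OF assms(2)] DERIV_subset[OF assms(2)]) auto
  qed (use assms(1) in auto)
  then obtain \<xi> where \<xi>: "x < \<xi>" "\<xi> < x + \<epsilon>" "g (x + \<epsilon> + \<epsilon>) - 2 * g (x + \<epsilon>) + g x = \<epsilon> * (g' (\<xi> + \<epsilon>) - g' \<xi>)"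
    by auto
  have "\<exists>\<eta>. \<xi> < \<eta> \<and> \<eta> < \<xi> + \<epsilon> \<and> g' (\<xi> + \<epsilon>) - g' \<xi> = (\<xi> + \<epsilon> - \<xi>) * g'' \<eta>"
    using assms(1) \<xi> by (intro mvt_within[OF assms(3)]) auto
  then obtain \<eta> where "\<xi> < \<eta>" "\<eta> < \<xi> + \<epsilon>" "g' (\<xi> + \<epsilon>) - g' \<xi> = \<epsilon> * g'' \<eta>" by auto
  moreover have "g (x + 2 * \<epsilon>) - 2 * g (x + \<epsilon>) + g x = \<epsilon> * (g' (\<xi> + \<epsilon>) - g' \<xi>)"
  proof -
    have "x + 2 * \<epsilon> = x + \<epsilon> + \<epsilon>" by simp
    thus ?thesis using \<xi>(3) by (simp only:)
  qed
  ultimately show ?thesis using \<xi>(1,2) by (intro bexI[of _ \<eta>]) (simp_all add: power2_eq_square)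
qed

text \<open>The mean value theorem for second differences is applied to a first difference. Only two
  derivatives are used up, and the difference that remains can be estimated by a mere Lipschitz
  bound.\<close>

lemma third_diff_mvt:
  fixes w0 :: "real \<Rightarrow> real"
  assumes "\<epsilon> > 0"
    and "\<And>y. y \<in> {x..x + 3 * \<epsilon>} \<Longrightarrow> (w0 has_real_derivative w1 y) (at y within {x..x + 3 * \<epsilon>})"
    and "\<And>y. y \<in> {x..x + 3 * \<epsilon>} \<Longrightarrow> (w1 has_real_derivative w2 y) (at y within {x..x + 3 * \<epsilon>})"
  shows "\<exists>\<xi>\<in>{x..x + 2 * \<epsilon>}. third_diff \<epsilon> w0 x = (w2 (\<xi> + \<epsilon>) - w2 \<xi>) / \<epsilon>"
proof -
  have "\<exists>\<xi>\<in>{x..x + 2 * \<epsilon>}. (w0 (x + 2 * \<epsilon> + \<epsilon>) - w0 (x + 2 * \<epsilon>)) - 2 * (w0 (x + \<epsilon> + \<epsilon>) - w0 (x + \<epsilon>)) + (w0 (x + \<epsilon>) - w0 x) = \<epsilon>\<^sup>2 * (w2 (\<xi> + \<epsilon>) - w2 \<xi>)"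
  proof (rule second_diff_mvt[where g = "\<lambda>y. w0 (y + \<epsilon>) - w0 y" and g' = "\<lambda>y. w1 (y + \<epsilon>) - w1 y" and g'' = "\<lambda>y. w2 (y + \<epsilon>) - w2 y"])
    fix y assume y: "y \<in> {x..x + 2 * \<epsilon>}"
    show "((\<lambda>y. w0 (y + \<epsilon>) - w0 y) has_real_derivative w1 (y + \<epsilon>) - w1 y) (at y within {x..x + 2 * \<epsilon>})"
      using y assms(1) by (intro DERIV_diff deriv_shift_within[OF assms(2)] DERIV_subset[OF assms(2)]) auto
    show "((\<lambda>y. w1 (y + \<epsilon>) - w1 y) has_real_derivative w2 (y + \<epsilon>) - w2 y) (at y within {x..x + 2 * \<epsilon>})"
      using y assms(1) by (intro DERIV_diff deriv_shift_within[OF assms(3)] DERIV_subset[OF assms(3)]) auto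
  qed (use assms(1) in auto)
  then obtain \<xi> where \<xi>: "\<xi> \<in> {x..x + 2 * \<epsilon>}" "(w0 (x + 2 * \<epsilon> + \<epsilon>) - w0 (x + 2 * \<epsilon>)) - 2 * (w0 (x + \<epsilon> + \<epsilon>) - w0 (x + \<epsilon>)) + (w0 (x + \<epsilon>) - w0 x) = \<epsilon>\<^sup>2 * (w2 (\<xi> + \<epsilon>) - w2 \<xi>)"
    by blast
  have "x + 2 * \<epsilon> + \<epsilon> = x + 3 * \<epsilon>" "x + \<epsilon> + \<epsilon> = x + 2 * \<epsilon>" by simp_all
  hence "third_diff \<epsilon> w0 x = \<epsilon>\<^sup>2 * (w2 (\<xi> + \<epsilon>) - w2 \<xi>) / \<epsilon> ^ 3"
    unfolding third_diff_def \<xi>(2)[symmetric] by (simp add: algebra_simps)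
  also have "\<dots> = (w2 (\<xi> + \<epsilon>) - w2 \<xi>) / \<epsilon>" using assms(1) by (simp add: power2_eq_square power3_eq_cube)
  finally show ?thesis using \<xi>(1) by blast
qed

lemma third_diff_deriv:
  fixes w w' :: "real \<Rightarrow> real"
  assumes "\<And>y. y \<in> {0..b + 3 * \<epsilon>} \<Longrightarrow> (w has_real_derivative w' y) (at y within {0..b + 3 * \<epsilon>})" "\<epsilon> > 0" "x \<in> {0..b}"
  shows "(third_diff \<epsilon> w has_real_derivative third_diff \<epsilon> w' x) (at x within {0..b})"
proof -
  have "((\<lambda>y. w (y + c)) has_real_derivative w' (x + c)) (at x within {0..b})" if "0 \<le> c" "c \<le> 3 * \<epsilon>" for c
    using that assms(2,3) by (intro deriv_shift_within[OF assms(1)]) auto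
  from this[of 0] this[of "\<epsilon>"] this[of "2 * \<epsilon>"] this[of "3 * \<epsilon>"] show ?thesis
    unfolding third_diff_def[abs_def] using assms(2)
    by (intro DERIV_cdivide DERIV_diff DERIV_add DERIV_cmult) auto
qed

text \<open>The Cauchy-Schwarz inequality against the constant 1, read off from the nonnegative
  integral of the squared deviation from the mean I/L.\<close>

lemma square_integral_le:
  fixes g :: "real \<Rightarrow> real"
  assumes "a \<le> b" "continuous_on {a..b} g"
  shows "(integral {a..b} g)\<^sup>2 \<le> (b - a) * integral {a..b} (\<lambda>x. (g x)\<^sup>2)"
proof (cases "a = b")
  case False
  define L where "L = b - a"
  define I where "I = integral {a..b} g"
  have L: "L > 0" using False assms(1) by (simp add: L_def)
  have i1: "g integrable_on {a..b}" "(\<lambda>x. (g x)\<^sup>2) integrable_on {a..b}"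
    by (auto intro!: integrable_continuous_interval continuous_intros assms)
  have "0 \<le> integral {a..b} (\<lambda>x. (g x - I / L)\<^sup>2)"
    by (intro integral_nonneg integrable_continuous_interval continuous_intros assms) auto
  also have "integral {a..b} (\<lambda>x. (g x - I / L)\<^sup>2) = integral {a..b} (\<lambda>x. (g x)\<^sup>2 - 2 * (I / L) * g x + (I / L)\<^sup>2)"
    by (intro integral_cong) (simp add: power2_diff)
  finally have nn: "0 \<le> integral {a..b} (\<lambda>x. (g x)\<^sup>2 - 2 * (I / L) * g x + (I / L)\<^sup>2)" .
  have "((\<lambda>x. (g x)\<^sup>2 - 2 * (I / L) * g x + (I / L)\<^sup>2) has_integral
      integral {a..b} (\<lambda>x. (g x)\<^sup>2) - 2 * (I / L) * I + (b - a) * (I / L)\<^sup>2) {a..b}"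
    using has_integral_const_real[of "(I / L)\<^sup>2" a b] assms(1) integrable_integral[OF i1(1)] unfolding I_def[symmetric]
    by (intro has_integral_add has_integral_diff has_integral_mult_right integrable_integral i1) simp_all
  hence "integral {a..b} (\<lambda>x. (g x)\<^sup>2 - 2 * (I / L) * g x + (I / L)\<^sup>2) =
      integral {a..b} (\<lambda>x. (g x)\<^sup>2) - 2 * (I / L) * I + (I / L)\<^sup>2 * L"
    using assms(1) by (simp add: integral_unique L_def)
  also have "\<dots> = integral {a..b} (\<lambda>x. (g x)\<^sup>2) - I\<^sup>2 / L" using L by (simp add: power2_eq_square field_simps)
  finally have "0 \<le> integral {a..b} (\<lambda>x. (g x)\<^sup>2) - I\<^sup>2 / L" using nn by linarith
  thus ?thesis using L by (simp add: I_def[symmetric] L_def[symmetric] field_simps)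
qed simp

section \<open>A cutoff function and an interior energy estimate\<close>

text \<open>A rational profile vanishing at both ends and close to 1 at distances large compared
  with \<delta>. Its virtue is the square of its derivative, which is dominated by a function with
  an elementary primitive and integrates to O(1/\<delta>).\<close>

definition cutoff :: "real \<Rightarrow> real \<Rightarrow> real \<Rightarrow> real" where
  "cutoff \<delta> \<beta> x = x / (x + \<delta>) * ((\<beta> - x) / (\<beta> - x + \<delta>))"

definition cutoff' :: "real \<Rightarrow> real \<Rightarrow> real \<Rightarrow> real" where
  "cutoff' \<delta> \<beta> x = \<delta> / (x + \<delta>)\<^sup>2 * ((\<beta> - x) / (\<beta> - x + \<delta>)) - x / (x + \<delta>) * (\<delta> / (\<beta> - x + \<delta>)\<^sup>2)"

lemma cutoff_deriv:
  assumes "\<delta> > 0" "x \<in> {0..\<beta>}"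
  shows "(cutoff \<delta> \<beta> has_real_derivative cutoff' \<delta> \<beta> x) (at x within S)"
proof -
  have p: "x + \<delta> > 0" "\<beta> - x + \<delta> > 0" using assms by auto
  have 1: "((\<lambda>x. x / (x + \<delta>)) has_real_derivative \<delta> / (x + \<delta>)\<^sup>2) (at x within S)"
    using p by (auto intro!: derivative_eq_intros simp: power2_eq_square field_simps)
  have 2: "((\<lambda>x. (\<beta> - x) / (\<beta> - x + \<delta>)) has_real_derivative - (\<delta> / (\<beta> - x + \<delta>)\<^sup>2)) (at x within S)"
    using p by (auto intro!: derivative_eq_intros simp: power2_eq_square divide_simps)
  show ?thesis unfolding cutoff_def[abs_def]
    by (rule DERIV_cong[OF DERIV_mult[OF 1 2]]) (simp add: cutoff'_def algebra_simps)
qed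

lemma cutoff_range:
  assumes "\<delta> > 0" "x \<in> {0..\<beta>}"
  shows "0 \<le> cutoff \<delta> \<beta> x" "cutoff \<delta> \<beta> x \<le> 1"
proof -
  show "0 \<le> cutoff \<delta> \<beta> x" using assms by (simp add: cutoff_def)
  have "x / (x + \<delta>) * ((\<beta> - x) / (\<beta> - x + \<delta>)) \<le> 1 * 1"
    using assms by (intro mult_mono) (auto simp: divide_simps)
  thus "cutoff \<delta> \<beta> x \<le> 1" by (simp add: cutoff_def)
qed

lemma cutoff'_square:
  assumes "\<delta> > 0" "x \<in> {0..\<beta>}"
  shows "(cutoff' \<delta> \<beta> x)\<^sup>2 \<le> 1 / (x + \<delta>)\<^sup>2 + 1 / (\<beta> - x + \<delta>)\<^sup>2"
proof -
  have p: "x + \<delta> > 0" "\<beta> - x + \<delta> > 0" using assms by auto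
  have le: "\<delta> / y\<^sup>2 * r \<le> 1 / y" "0 \<le> \<delta> / y\<^sup>2 * r" if "y \<ge> \<delta>" "0 \<le> r" "r \<le> 1" for y r
  proof -
    have "\<delta> / y\<^sup>2 \<le> 1 / y" using that assms by (simp add: power2_eq_square divide_simps)
    hence "\<delta> / y\<^sup>2 * r \<le> 1 / y * 1" using that assms by (intro mult_mono) auto
    thus "\<delta> / y\<^sup>2 * r \<le> 1 / y" by simp
    show "0 \<le> \<delta> / y\<^sup>2 * r" using that assms by simp
  qed
  define p1 where "p1 = \<delta> / (x + \<delta>)\<^sup>2 * ((\<beta> - x) / (\<beta> - x + \<delta>))"
  define p2 where "p2 = \<delta> / (\<beta> - x + \<delta>)\<^sup>2 * (x / (x + \<delta>))"
  have b: "0 \<le> p1" "p1 \<le> 1 / (x + \<delta>)" "0 \<le> p2" "p2 \<le> 1 / (\<beta> - x + \<delta>)"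
    unfolding p1_def p2_def using assms by (intro le; auto simp: divide_simps)+
  have "(cutoff' \<delta> \<beta> x)\<^sup>2 = (p1 - p2)\<^sup>2" by (simp add: cutoff'_def p1_def p2_def mult.commute)
  also have "\<dots> \<le> p1\<^sup>2 + p2\<^sup>2" using b by (simp add: power2_diff)
  also have "\<dots> \<le> (1 / (x + \<delta>))\<^sup>2 + (1 / (\<beta> - x + \<delta>))\<^sup>2"
    using b by (intro add_mono power_mono) auto
  finally show ?thesis by (simp add: power_divide)
qed

lemma cutoff'_continuous: "\<delta> > 0 \<Longrightarrow> continuous_on {0..\<beta>} (cutoff' \<delta> \<beta>)"
  unfolding cutoff'_def[abs_def] by (intro continuous_intros) auto

lemma cutoff'_integral:
  assumes "\<delta> > 0" "\<beta> \<ge> 0"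
  shows "integral {0..\<beta>} (\<lambda>x. (cutoff' \<delta> \<beta> x)\<^sup>2) \<le> 2 / \<delta>"
proof -
  have "((\<lambda>x. 1 / (x + \<delta>)\<^sup>2 + 1 / (\<beta> - x + \<delta>)\<^sup>2) has_integral
      ((- (1 / (\<beta> + \<delta>)) + 1 / (\<beta> - \<beta> + \<delta>)) - (- (1 / (0 + \<delta>)) + 1 / (\<beta> - 0 + \<delta>)))) {0..\<beta>}"
    using assms
    by (intro fundamental_theorem_of_calculus)
       (auto simp: has_real_derivative_iff_has_vector_derivative[symmetric] power2_eq_square intro!: derivative_eq_intros)
  hence I: "((\<lambda>x. 1 / (x + \<delta>)\<^sup>2 + 1 / (\<beta> - x + \<delta>)\<^sup>2) has_integral (2 / \<delta> - 2 / (\<beta> + \<delta>))) {0..\<beta>}"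
    by (simp add: algebra_simps)
  have "integral {0..\<beta>} (\<lambda>x. (cutoff' \<delta> \<beta> x)\<^sup>2) \<le> integral {0..\<beta>} (\<lambda>x. 1 / (x + \<delta>)\<^sup>2 + 1 / (\<beta> - x + \<delta>)\<^sup>2)"
    using I assms cutoff'_square
    by (intro integral_le integrable_continuous_interval continuous_intros cutoff'_continuous) (auto simp: has_integral_integrable)
  also have "\<dots> = 2 / \<delta> - 2 / (\<beta> + \<delta>)" using I by (rule integral_unique)
  also have "\<dots> \<le> 2 / \<delta>" using assms by simp
  finally show ?thesis .
qed

context smooth_heat
begin

lemma third_diff_cont:
  assumes "i \<le> K" "\<epsilon> > 0" "0 \<le> \<beta>" "\<beta> + 3 * \<epsilon> \<le> 2 * pi"
  shows "continuous_on ({0..T} \<times> {0..\<beta>}) (\<lambda>(t, x). third_diff \<epsilon> (\<lambda>x. U i x t) x)"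
proof -
  have c: "continuous_on ({0..T} \<times> {0..\<beta>}) (\<lambda>z. U i (snd z + c) (fst z))" if "0 \<le> c" "c \<le> 3 * \<epsilon>" for c
  proof -
    have "continuous_on ({0..T} \<times> {0..\<beta>}) ((\<lambda>(x, t). U i x t) \<circ> (\<lambda>z. (snd z + c, fst z)))"
      using assms that
      by (intro continuous_on_compose continuous_intros continuous_on_subset[OF U_cont]) auto
    thus ?thesis by (simp add: o_def)
  qed
  from c[of 0] c[of \<epsilon>] c[of "2 * \<epsilon>"] c[of "3 * \<epsilon>"] assms(2) show ?thesis
    unfolding third_diff_def case_prod_unfold by (intro continuous_intros) auto
qed

lemma third_diff_cont_x:
  assumes "i \<le> K" "\<epsilon> > 0" "0 \<le> \<beta>" "\<beta> + 3 * \<epsilon> \<le> 2 * pi" "t \<in> {0..T}"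
  shows "continuous_on {0..\<beta>} (third_diff \<epsilon> (\<lambda>x. U i x t))"
  using continuous_on_slice(2)[OF third_diff_cont[OF assms(1-4)] assms(5)] .

lemma third_diff_dx:
  assumes "i < K" "\<epsilon> > 0" "0 \<le> \<beta>" "\<beta> + 3 * \<epsilon> \<le> 2 * pi" "t \<in> {0..T}" "x \<in> {0..\<beta>}"
  shows "(third_diff \<epsilon> (\<lambda>x. U i x t) has_real_derivative third_diff \<epsilon> (\<lambda>x. U (Suc i) x t) x) (at x within {0..\<beta>})"
  using assms by (intro third_diff_deriv dx_sub) auto

lemma third_diff_dt:
  assumes "i + 2 \<le> K" "\<epsilon> > 0" "0 \<le> \<beta>" "\<beta> + 3 * \<epsilon> \<le> 2 * pi" "t \<in> {0..T}" "x \<in> {0..\<beta>}"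
  shows "((\<lambda>s. third_diff \<epsilon> (\<lambda>x. U i x s) x) has_real_derivative third_diff \<epsilon> (\<lambda>x. U (i + 2) x t) x) (at t within {0..T})"
  unfolding third_diff_def using assms
  by (intro DERIV_cdivide DERIV_diff DERIV_add DERIV_cmult dt) auto

lemma third_diff_bound:
  assumes "i + 2 = K" "\<epsilon> > 0" "0 \<le> x" "x + 3 * \<epsilon> \<le> 2 * pi" "t \<in> {0..T}"
  shows "\<bar>third_diff \<epsilon> (\<lambda>x. U i x t) x\<bar> \<le> M"
proof -
  have "\<exists>\<xi>\<in>{x..x + 2 * \<epsilon>}. third_diff \<epsilon> (\<lambda>x. U i x t) x = (U (Suc (Suc i)) (\<xi> + \<epsilon>) t - U (Suc (Suc i)) \<xi> t) / \<epsilon>"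
    using assms by (intro third_diff_mvt[where ?w1.0 = "\<lambda>x. U (Suc i) x t"] dx_sub) auto
  then obtain \<xi> where \<xi>: "\<xi> \<in> {x..x + 2 * \<epsilon>}" "third_diff \<epsilon> (\<lambda>x. U i x t) x = (U K (\<xi> + \<epsilon>) t - U K \<xi> t) / \<epsilon>"
    using assms(1) by auto
  have "\<bar>U K (\<xi> + \<epsilon>) t - U K \<xi> t\<bar> \<le> M * \<bar>\<xi> + \<epsilon> - \<xi>\<bar>" using \<xi> assms by (intro U_lip) auto
  thus ?thesis using assms(2) by (simp add: \<xi>(2) divide_simps)
qed

lemma third_diff_consistent:
  assumes "i + 3 = K" "\<epsilon> > 0" "0 \<le> x" "x + 3 * \<epsilon> \<le> 2 * pi" "t \<in> {0..T}"
  shows "\<bar>third_diff \<epsilon> (\<lambda>x. U i x t) x - U K x t\<bar> \<le> 3 * \<epsilon> * M"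
proof -
  have "\<exists>\<xi>\<in>{x..x + 2 * \<epsilon>}. third_diff \<epsilon> (\<lambda>x. U i x t) x = (U (Suc (Suc i)) (\<xi> + \<epsilon>) t - U (Suc (Suc i)) \<xi> t) / \<epsilon>"
    using assms by (intro third_diff_mvt[where ?w1.0 = "\<lambda>x. U (Suc i) x t"] dx_sub) auto
  then obtain \<xi> where \<xi>: "\<xi> \<in> {x..x + 2 * \<epsilon>}" "third_diff \<epsilon> (\<lambda>x. U i x t) x = (U (Suc (Suc i)) (\<xi> + \<epsilon>) t - U (Suc (Suc i)) \<xi> t) / \<epsilon>"
    by auto
  have "\<exists>\<eta>. \<xi> < \<eta> \<and> \<eta> < \<xi> + \<epsilon> \<and> U (Suc (Suc i)) (\<xi> + \<epsilon>) t - U (Suc (Suc i)) \<xi> t = (\<xi> + \<epsilon> - \<xi>) * U (Suc (Suc (Suc i))) \<eta> t"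
    using assms \<xi> by (intro mvt_within[of 0 "2 * pi" "\<lambda>y. U (Suc (Suc i)) y t"] dx) auto
  moreover have "Suc (Suc (Suc i)) = K" using assms by simp
  ultimately obtain \<eta> where \<eta>: "\<xi> < \<eta>" "\<eta> < \<xi> + \<epsilon>" "U (Suc (Suc i)) (\<xi> + \<epsilon>) t - U (Suc (Suc i)) \<xi> t = \<epsilon> * U K \<eta> t"
    by auto
  have "\<bar>U K \<eta> t - U K x t\<bar> \<le> M * \<bar>\<eta> - x\<bar>" using \<xi> \<eta> assms by (intro U_lip) auto
  also have "\<dots> \<le> M * (3 * \<epsilon>)" using \<xi> \<eta> M by (intro mult_left_mono) auto
  finally show ?thesis using \<xi>(2) \<eta>(3) assms(2) by (simp add: mult_ac)
qed

text \<open>The energy identity for the difference quotient, multiplied by the squared cutoff. The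
  cutoff kills the boundary terms, which could not be controlled because nothing is assumed about
  the difference quotients at the ends. Its price is the integral of the squared cutoff derivative,
  of order 1/\<delta>.\<close>

lemma caccioppoli:
  assumes K: "i + 2 = K" and e: "\<epsilon> > 0" "3 * \<epsilon> \<le> 2 * pi" and \<delta>: "\<delta> > 0" and \<tau>: "\<tau> \<in> {0..T}"
  defines "\<beta> \<equiv> 2 * pi - 3 * \<epsilon>"
  shows "integral {0..\<tau>} (\<lambda>t. integral {0..\<beta>} (\<lambda>x. (cutoff \<delta> \<beta> x)\<^sup>2 * (third_diff \<epsilon> (\<lambda>x. U (Suc i) x t) x)\<^sup>2))
     \<le> M\<^sup>2 * (2 * pi + 8 * \<tau> / \<delta>)"
proof -
  have \<beta>: "0 \<le> \<beta>" "\<beta> + 3 * \<epsilon> \<le> 2 * pi" using e by (auto simp: \<beta>_def)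
  define f where "f t x = third_diff \<epsilon> (\<lambda>x. U i x t) x" for t x
  define g where "g t x = third_diff \<epsilon> (\<lambda>x. U (Suc i) x t) x" for t x
  define g' where "g' t x = third_diff \<epsilon> (\<lambda>x. U (i + 2) x t) x" for t x
  define \<phi> where "\<phi> = cutoff \<delta> \<beta>"
  define \<psi> where "\<psi> = cutoff' \<delta> \<beta>"
  have \<phi>c: "continuous_on {0..\<beta>} \<phi>" "continuous_on {0..\<beta>} \<psi>"
    unfolding \<phi>_def \<psi>_def using cutoff_deriv[OF \<delta>] cutoff'_continuous[OF \<delta>] by (blast intro: DERIV_continuous_on)+
  have jc: "continuous_on ({0..T} \<times> {0..\<beta>}) (\<lambda>z. f (fst z) (snd z))"
    "continuous_on ({0..T} \<times> {0..\<beta>}) (\<lambda>z. g (fst z) (snd z))"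
    "continuous_on ({0..T} \<times> {0..\<beta>}) (\<lambda>z. g' (fst z) (snd z))"
    using third_diff_cont[of i \<epsilon> \<beta>] third_diff_cont[of "Suc i" \<epsilon> \<beta>] third_diff_cont[of "i + 2" \<epsilon> \<beta>] K e \<beta>
    by (auto simp: f_def g_def g'_def case_prod_unfold)
  have xc: "continuous_on {0..\<beta>} (f t)" "continuous_on {0..\<beta>} (g t)" "continuous_on {0..\<beta>} (g' t)" if "t \<in> {0..T}" for t
    unfolding f_def[abs_def] g_def[abs_def] g'_def[abs_def] using that K e \<beta> by (auto intro!: third_diff_cont_x)
  have jw: "continuous_on ({0..T} \<times> {0..\<beta>}) (\<lambda>z. \<phi> (snd z))"
    by (intro continuous_on_compose2[OF \<phi>c(1)] continuous_intros) auto
  define E where "E t = integral {0..\<beta>} (\<lambda>x. (\<phi> x)\<^sup>2 * (f t x)\<^sup>2)" for t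
  define E' where "E' t = integral {0..\<beta>} (\<lambda>x. (\<phi> x)\<^sup>2 * (2 * f t x * g' t x))" for t
  define G where "G t = integral {0..\<beta>} (\<lambda>x. (\<phi> x)\<^sup>2 * (g t x)\<^sup>2)" for t
  define J where "J t = integral {0..t} G" for t
  define S where "S = 2 / \<delta>"
  have E_deriv: "(E has_real_derivative E' t) (at t within {0..T})" if t: "t \<in> {0..T}" for t
  proof -
    have "((\<lambda>t. integral (cbox 0 \<beta>) (\<lambda>x. (\<phi> x)\<^sup>2 * (f t x)\<^sup>2)) has_field_derivative
       integral (cbox 0 \<beta>) (\<lambda>x. (\<phi> x)\<^sup>2 * (2 * f t x * g' t x))) (at t within {0..T})"
    proof (rule leibniz_rule_field_derivative)
      show "((\<lambda>s. (\<phi> x)\<^sup>2 * (f s x)\<^sup>2) has_real_derivative (\<phi> x)\<^sup>2 * (2 * f s x * g' s x)) (at s within {0..T})"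
        if "s \<in> {0..T}" "x \<in> cbox 0 \<beta>" for s x
      proof -
        have "((\<lambda>s. f s x) has_real_derivative g' s x) (at s within {0..T})"
          unfolding f_def g'_def using that K e \<beta> by (intro third_diff_dt) auto
        thus ?thesis by (auto intro!: derivative_eq_intros)
      qed
      show "(\<lambda>x. (\<phi> x)\<^sup>2 * (f t x)\<^sup>2) integrable_on cbox 0 \<beta>" if "t \<in> {0..T}" for t
        using that by (simp, intro integrable_continuous_interval continuous_intros \<phi>c xc)
      show "continuous_on ({0..T} \<times> cbox 0 \<beta>) (\<lambda>(t, x). (\<phi> x)\<^sup>2 * (2 * f t x * g' t x))"
        unfolding case_prod_unfold box_real by (intro continuous_intros jc jw)
    qed (use t in auto)
    thus ?thesis unfolding E_def[abs_def] E'_def by simp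
  qed
  have "continuous_on ({0..T} \<times> cbox 0 \<beta>) (\<lambda>(t, x). (\<phi> x)\<^sup>2 * (g t x)\<^sup>2)"
    unfolding case_prod_unfold box_real by (intro continuous_intros jc jw)
  hence Gc: "continuous_on {0..T} G"
    unfolding G_def[abs_def] using integral_continuous_on_param[of "{0..T}" 0 \<beta> "\<lambda>t x. (\<phi> x)\<^sup>2 * (g t x)\<^sup>2"] by simp
  have parts: "E' t = - integral {0..\<beta>} (\<lambda>x. (4 * \<phi> x * \<psi> x * f t x + 2 * (\<phi> x)\<^sup>2 * g t x) * g t x)" if t: "t \<in> {0..T}" for t
  proof -
    have D: "((\<lambda>x. 2 * (\<phi> x)\<^sup>2 * f t x * g t x) has_vector_derivative
        (\<phi> x)\<^sup>2 * (2 * f t x * g' t x) + (4 * \<phi> x * \<psi> x * f t x + 2 * (\<phi> x)\<^sup>2 * g t x) * g t x) (at x within {0..\<beta>})"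
      if x: "x \<in> {0..\<beta>}" for x
    proof -
      have 1: "(f t has_real_derivative g t x) (at x within {0..\<beta>})"
        unfolding f_def[abs_def] g_def using x t K e \<beta> by (intro third_diff_dx) auto
      have 2: "(g t has_real_derivative g' t x) (at x within {0..\<beta>})"
        unfolding g_def[abs_def] g'_def using third_diff_dx[of "Suc i" \<epsilon> \<beta> t x] x t K e \<beta> by auto
      have 3: "(\<phi> has_real_derivative \<psi> x) (at x within {0..\<beta>})"
        unfolding \<phi>_def \<psi>_def by (rule cutoff_deriv[OF \<delta> x])
      show ?thesis unfolding has_real_derivative_iff_has_vector_derivative[symmetric]
        by (auto intro!: derivative_eq_intros 1 2 3 simp: algebra_simps power2_eq_square)
    qed
    have "((\<lambda>x. (\<phi> x)\<^sup>2 * (2 * f t x * g' t x) + (4 * \<phi> x * \<psi> x * f t x + 2 * (\<phi> x)\<^sup>2 * g t x) * g t x) has_integral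
        (2 * (\<phi> \<beta>)\<^sup>2 * f t \<beta> * g t \<beta> - 2 * (\<phi> 0)\<^sup>2 * f t 0 * g t 0)) {0..\<beta>}"
      by (intro fundamental_theorem_of_calculus \<beta> D)
    moreover have "\<phi> 0 = 0" "\<phi> \<beta> = 0" by (simp_all add: \<phi>_def cutoff_def)
    ultimately have "integral {0..\<beta>} (\<lambda>x. (\<phi> x)\<^sup>2 * (2 * f t x * g' t x) + (4 * \<phi> x * \<psi> x * f t x + 2 * (\<phi> x)\<^sup>2 * g t x) * g t x) = 0"
      by (simp add: integral_unique)
    moreover have "integral {0..\<beta>} (\<lambda>x. (\<phi> x)\<^sup>2 * (2 * f t x * g' t x) + (4 * \<phi> x * \<psi> x * f t x + 2 * (\<phi> x)\<^sup>2 * g t x) * g t x)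
      = E' t + integral {0..\<beta>} (\<lambda>x. (4 * \<phi> x * \<psi> x * f t x + 2 * (\<phi> x)\<^sup>2 * g t x) * g t x)"
      unfolding E'_def using t by (intro integral_add integrable_continuous_interval continuous_intros \<phi>c xc)
    ultimately show ?thesis by simp
  qed
  have key: "E' t + G t \<le> 4 * M\<^sup>2 * S" if t: "t \<in> {0..T}" for t
  proof -
    have "E' t + G t = integral {0..\<beta>} (\<lambda>x. (\<phi> x)\<^sup>2 * (g t x)\<^sup>2) - integral {0..\<beta>} (\<lambda>x. (4 * \<phi> x * \<psi> x * f t x + 2 * (\<phi> x)\<^sup>2 * g t x) * g t x)"
      using parts[OF t] by (simp add: G_def)
    also have "\<dots> = integral {0..\<beta>} (\<lambda>x. (\<phi> x)\<^sup>2 * (g t x)\<^sup>2 - (4 * \<phi> x * \<psi> x * f t x + 2 * (\<phi> x)\<^sup>2 * g t x) * g t x)"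
      using t by (intro integral_diff[symmetric] integrable_continuous_interval continuous_intros \<phi>c xc)
    also have "\<dots> \<le> integral {0..\<beta>} (\<lambda>x. 4 * M\<^sup>2 * (\<psi> x)\<^sup>2)"
    proof (rule integral_le)
      fix x assume x: "x \<in> {0..\<beta>}"
      have "\<bar>f t x\<bar> \<le> M" unfolding f_def using x t K e \<beta> by (intro third_diff_bound) auto
      hence "(f t x)\<^sup>2 \<le> M\<^sup>2" by (metis abs_ge_zero power2_abs power_mono)
      hence "4 * (\<psi> x)\<^sup>2 * (f t x)\<^sup>2 \<le> 4 * (\<psi> x)\<^sup>2 * M\<^sup>2" by (intro mult_left_mono) auto
      \<comment> \<open>The integrand on the left is 4\<psi>^2 f^2 minus this square, which is the
        sharp form of Young's inequality here.\<close>
      moreover have "0 \<le> (\<phi> x * g t x + 2 * \<psi> x * f t x)\<^sup>2" by simp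
      ultimately show "(\<phi> x)\<^sup>2 * (g t x)\<^sup>2 - (4 * \<phi> x * \<psi> x * f t x + 2 * (\<phi> x)\<^sup>2 * g t x) * g t x \<le> 4 * M\<^sup>2 * (\<psi> x)\<^sup>2"
        by (simp add: power2_eq_square algebra_simps)
    qed (use t in \<open>intro integrable_continuous_interval continuous_intros \<phi>c xc; simp\<close>)+
    also have "\<dots> = 4 * M\<^sup>2 * integral {0..\<beta>} (\<lambda>x. (\<psi> x)\<^sup>2)" by simp
    also have "\<dots> \<le> 4 * M\<^sup>2 * S" unfolding S_def \<psi>_def by (intro mult_left_mono cutoff'_integral \<delta> \<beta>) simp
    finally show ?thesis .
  qed
  let ?H = "\<lambda>t. E t + J t - 4 * M\<^sup>2 * S * t"
  have "?H \<tau> \<le> ?H 0"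
  proof (rule within_nonpos_deriv_le[of 0 T ?H "\<lambda>t. E' t + G t - 4 * M\<^sup>2 * S"])
    fix t assume t: "t \<in> {0..T}"
    have "(J has_real_derivative G t) (at t within {0..T})"
      unfolding J_def[abs_def] using t by (intro integral_has_real_derivative Gc)
    thus "(?H has_real_derivative E' t + G t - 4 * M\<^sup>2 * S) (at t within {0..T})"
      using E_deriv[OF t] by (auto intro!: derivative_eq_intros)
    show "E' t + G t - 4 * M\<^sup>2 * S \<le> 0" using key[OF t] by simp
  qed (use \<tau> in auto)
  moreover have "J 0 = 0" by (simp add: J_def)
  moreover have "E \<tau> \<ge> 0" unfolding E_def using \<tau>
    by (intro integral_nonneg integrable_continuous_interval continuous_intros \<phi>c xc) auto
  moreover have "E 0 \<le> M\<^sup>2 * (2 * pi)"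
  proof -
    have "E 0 \<le> integral {0..\<beta>} (\<lambda>x. M\<^sup>2)" unfolding E_def
    proof (rule integral_le)
      fix x assume x: "x \<in> {0..\<beta>}"
      have "\<bar>f 0 x\<bar> \<le> M" unfolding f_def using x T K e \<beta> by (intro third_diff_bound) auto
      hence "(f 0 x)\<^sup>2 \<le> M\<^sup>2" by (metis abs_ge_zero power2_abs power_mono)
      moreover have "(\<phi> x)\<^sup>2 \<le> 1" using cutoff_range[OF \<delta> x] by (simp add: \<phi>_def power_le_one)
      ultimately have "(\<phi> x)\<^sup>2 * (f 0 x)\<^sup>2 \<le> 1 * M\<^sup>2" by (intro mult_mono) auto
      thus "(\<phi> x)\<^sup>2 * (f 0 x)\<^sup>2 \<le> M\<^sup>2" by simp
    qed (use T in \<open>intro integrable_continuous_interval continuous_intros \<phi>c xc; simp\<close>)+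
    also have "\<dots> = M\<^sup>2 * \<beta>" using \<beta> by simp
    also have "\<dots> \<le> M\<^sup>2 * (2 * pi)" using \<beta> e by (intro mult_left_mono) auto
    finally show ?thesis .
  qed
  ultimately have "J \<tau> \<le> M\<^sup>2 * (2 * pi) + 4 * M\<^sup>2 * S * \<tau>" by simp
  also have "\<dots> = M\<^sup>2 * (2 * pi + 8 * \<tau> / \<delta>)" by (simp add: S_def algebra_simps)
  finally show ?thesis unfolding J_def G_def g_def \<phi>_def .
qed

end

section \<open>Meshes and coefficient bounds in the mean over time\<close>

lemma sum_telescope_1: "(\<Sum>j=1..n. f j - f (j - 1)) = f n - (f 0 :: real)" for n :: nat
  by (induction n) auto

lemma sum_le_telescope:
  fixes F f :: "nat \<Rightarrow> real"
  assumes "\<And>j. j \<in> {1..n} \<Longrightarrow> F j \<le> f j - f (j - 1)"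
  shows "(\<Sum>j=1..n. F j) \<le> f n - f 0"
  using sum_mono[of "{1..n}" F "\<lambda>j. f j - f (j - 1)"] assms sum_telescope_1[of f n] by simp

locale mesh =
  fixes N :: nat and X :: "nat \<Rightarrow> real"
  assumes mesh: "is_mesh N X"
begin

abbreviation "h \<equiv> mesh_size N X"

lemma N1: "N \<ge> 1" and X0: "X 0 = 0" and XN: "X N = 2 * pi"
  and X_less: "j \<in> {1..N} \<Longrightarrow> X (j - 1) < X j"
  using mesh by (auto simp: is_mesh_def)

lemma X_mono: "i \<le> j \<Longrightarrow> j \<le> N \<Longrightarrow> X i \<le> X j"
proof (induction j)
  case (Suc j)
  thus ?case using X_less[of "Suc j"] by (cases "i = Suc j") auto
qed simp

lemma X_range: "j \<le> N \<Longrightarrow> 0 \<le> X j" "j \<le> N \<Longrightarrow> X j \<le> 2 * pi"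
  using X_mono[of 0 j] X_mono[of j N] X0 XN by auto

lemma cell_range:
  assumes "j \<in> {1..N}"
  shows "0 \<le> X (j - 1)" "X (j - 1) < X j" "X j \<le> 2 * pi"
  using assms X_range[of "j - 1"] X_range[of j] X_less by auto

lemma size_le: "j \<in> {1..N} \<Longrightarrow> X j - X (j - 1) \<le> h"
  unfolding mesh_size_def cell_size_def[abs_def] by (intro Max_ge) auto

lemma h_pos: "h > 0"
  using size_le[of 1] X_less[of 1] N1 by fastforce

lemma h_le: "h \<le> 2 * pi"
proof -
  have "h \<in> cell_size X ` {1..N}" unfolding mesh_size_def using N1 by (intro Max_in) auto
  then obtain j where j: "j \<in> {1..N}" "h = X j - X (j - 1)" by (auto simp: cell_size_def)
  thus ?thesis using cell_range[OF j(1)] by linarith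
qed

lemma sum_sizes: "(\<Sum>j=1..N. X j - X (j - 1)) = 2 * pi"
  using sum_telescope_1[of X N] X0 XN by simp

end

context smooth_heat
begin

text \<open>Compared with \<open>coef_U_bound\<close> the top derivative is approximated by a line
  instead of a constant. It is replaced by the third difference \<open>z\<close> of a lower
  derivative, at the price 3\<epsilon>M. The slope \<open>f\<close> of \<open>z\<close> oscillates
  over the cell by at most the square root of (b - a) times the integral of g^2, where g = f'. So
  one power of the cell size is gained wherever g is square integrable.\<close>

lemma coef_third_diff_bound:
  assumes K: "K = 2 * k + 1" and k: "k \<ge> 1" and ab: "0 \<le> a" "a < b" "b + 3 * \<epsilon> \<le> 2 * pi" and e: "\<epsilon> > 0" and t: "t \<in> {0..T}"
  shows "(coef ee k a b (\<lambda>x. U (k + 2) x t))\<^sup>2 \<le> 2 * (PB k)\<^sup>2 * (b - a) ^ (2 * k - 2) *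
     (9 * \<epsilon>\<^sup>2 * M\<^sup>2 + (b - a) ^ 3 * integral {a..b} (\<lambda>x. (third_diff \<epsilon> (\<lambda>x. U (2 * k) x t) x)\<^sup>2))"
proof -
  obtain i where i: "i + 3 = K" using K k by (metis add_leE le_add_diff_inverse2 mult_le_mono2 numeral_3_eq_3 one_add_one plus_1_eq_Suc numeral_eq_Suc Suc_1 Suc_eq_plus1 Suc_le_mono mult.right_neutral numeral_2_eq_2)
  have i': "Suc (Suc i) = 2 * k" using i K by simp
  have b: "0 \<le> b" using ab by linarith
  define z where "z = third_diff \<epsilon> (\<lambda>x. U i x t)"
  define f where "f = third_diff \<epsilon> (\<lambda>x. U (Suc i) x t)"
  define g where "g = third_diff \<epsilon> (\<lambda>x. U (2 * k) x t)"
  have gc: "continuous_on {a..b} g"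
    unfolding g_def by (rule continuous_on_subset[OF third_diff_cont_x[of _ _ b]]) (use ab b e t K in auto)
  have z': "(z has_real_derivative f x) (at x within {a..b})" if "x \<in> {a..b}" for x
    unfolding z_def f_def by (rule DERIV_subset[OF third_diff_dx[of _ _ b]]) (use that ab b e t i in auto)
  have f': "(f has_real_derivative g x) (at x within {a..b})" if "x \<in> {a..b}" for x
    unfolding f_def g_def i'[symmetric] by (rule DERIV_subset[OF third_diff_dx[of _ _ b]]) (use that ab b e t i in auto)
  define Q where "Q = integral {a..b} (\<lambda>x. (g x)\<^sup>2)"
  have g2: "(\<lambda>x. (g x)\<^sup>2) integrable_on {c..d}" if "a \<le> c" "d \<le> b" for c d
    by (rule integrable_continuous_interval, rule continuous_intros, rule continuous_on_subset[OF gc]) (use that in auto)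
  have Q0: "Q \<ge> 0" unfolding Q_def by (intro integral_nonneg g2) auto
  define R where "R = sqrt ((b - a) * Q)"
  have fR: "\<bar>f x - f a\<bar> \<le> R" if x: "x \<in> {a..b}" for x
  proof -
    have "(g has_integral f x - f a) {a..x}"
      using x by (intro fundamental_theorem_of_calculus)
        (auto simp: has_real_derivative_iff_has_vector_derivative[symmetric] intro: DERIV_subset[OF f'])
    hence "(f x - f a)\<^sup>2 = (integral {a..x} g)\<^sup>2" by (simp add: integral_unique)
    also have "\<dots> \<le> (x - a) * integral {a..x} (\<lambda>x. (g x)\<^sup>2)"
      using x by (intro square_integral_le continuous_on_subset[OF gc]) auto
    also have "\<dots> \<le> (b - a) * Q" unfolding Q_def
    proof (rule mult_mono)
      show "integral {a..x} (\<lambda>x. (g x)\<^sup>2) \<le> integral {a..b} (\<lambda>x. (g x)\<^sup>2)"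
        using x by (intro integral_subset_le g2) auto
      show "0 \<le> integral {a..x} (\<lambda>x. (g x)\<^sup>2)" using x by (intro integral_nonneg g2) auto
    qed (use x in auto)
    finally show ?thesis unfolding R_def using real_le_rsqrt by fastforce
  qed
  \<comment> \<open>The tangent line of \<open>z\<close> at the left end of the cell.\<close>
  define A where "A = [:z a - f a * a, f a:]"
  define \<omega> where "\<omega> = 3 * \<epsilon> * M + (b - a) * R"
  have top: "\<bar>U K x t - poly A x\<bar> \<le> \<omega>" if x: "x \<in> {a..b}" for x
  proof -
    have "norm ((z x - f a * x) - (z a - f a * a)) \<le> R * norm (x - a)"
    proof (rule field_differentiable_bound[of "{a..b}" "\<lambda>x. z x - f a * x" "\<lambda>x. f x - f a"])
      fix y assume y: "y \<in> {a..b}"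
      show "((\<lambda>x. z x - f a * x) has_real_derivative f y - f a) (at y within {a..b})"
        using z'[OF y] by (auto intro!: derivative_eq_intros)
      show "norm (f y - f a) \<le> R" using fR[OF y] by simp
    qed (use x ab in auto)
    also have "\<dots> \<le> R * (b - a)" using x fR[of a] ab by (intro mult_left_mono) auto
    finally have 1: "\<bar>z x - poly A x\<bar> \<le> (b - a) * R" by (simp add: A_def algebra_simps)
    have 2: "\<bar>z x - U K x t\<bar> \<le> 3 * \<epsilon> * M"
      unfolding z_def by (rule third_diff_consistent[OF i e _ _ t]) (use x ab in auto)
    show ?thesis unfolding \<omega>_def using 1 2 by linarith
  qed
  have "\<exists>P. degree P \<le> 1 + (k - 1) \<and> (\<forall>x\<in>{a..b}. \<bar>U (k + 2 + 0) x t - poly P x\<bar> \<le> \<omega> * (b - a) ^ (k - 1))"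
  proof (rule primitive_approx[of a b "k - 1" "\<lambda>i x. U (k + 2 + i) x t" A])
    show "((\<lambda>x. U (k + 2 + i) x t) has_real_derivative U (k + 2 + Suc i) x t) (at x within {a..b})"
      if "i < k - 1" "x \<in> {a..b}" for i x using that ab t e K dx_sub[of "k + 2 + i" a b x t] by simp
    have "k + 2 + (k - 1) = K" using K k by simp
    thus "\<bar>U (k + 2 + (k - 1)) x t - poly A x\<bar> \<le> \<omega>" if "x \<in> {a..b}" for x using top[OF that] by simp
  qed (use ab in \<open>auto simp: A_def\<close>)
  then obtain P where P: "degree P \<le> k" "\<And>x. x \<in> {a..b} \<Longrightarrow> \<bar>U (k + 2) x t - poly P x\<bar> \<le> \<omega> * (b - a) ^ (k - 1)"
    using k by auto
  have "\<bar>coef ee k a b (\<lambda>x. U (k + 2) x t)\<bar> \<le> PB k * (\<omega> * (b - a) ^ (k - 1))"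
    using ab t e K k P by (intro coef_approx[where P = P] U_cont_x) auto
  hence "(coef ee k a b (\<lambda>x. U (k + 2) x t))\<^sup>2 \<le> (PB k * (\<omega> * (b - a) ^ (k - 1)))\<^sup>2"
    by (metis abs_ge_zero power2_abs power_mono)
  also have "\<dots> = (PB k)\<^sup>2 * (b - a) ^ (2 * k - 2) * \<omega>\<^sup>2"
  proof -
    have "((b - a) ^ (k - 1))\<^sup>2 = (b - a) ^ (2 * k - 2)" by (simp add: power_mult[symmetric] mult.commute right_diff_distrib')
    thus ?thesis by (simp add: power_mult_distrib mult_ac)
  qed
  also have "\<dots> \<le> (PB k)\<^sup>2 * (b - a) ^ (2 * k - 2) * (2 * (9 * \<epsilon>\<^sup>2 * M\<^sup>2 + (b - a) ^ 3 * Q))"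
  proof (rule mult_left_mono)
    have "\<omega>\<^sup>2 \<le> 2 * (3 * \<epsilon> * M)\<^sup>2 + 2 * ((b - a) * R)\<^sup>2"
      using zero_le_power2[of "3 * \<epsilon> * M - (b - a) * R"] unfolding \<omega>_def power2_sum power2_diff by linarith
    also have "((b - a) * R)\<^sup>2 = (b - a) ^ 3 * Q"
      using Q0 ab by (simp add: R_def power_mult_distrib power3_eq_cube power2_eq_square)
    finally show "\<omega>\<^sup>2 \<le> 2 * (9 * \<epsilon>\<^sup>2 * M\<^sup>2 + (b - a) ^ 3 * Q)" by (simp add: power_mult_distrib)
  qed (use ab in auto)
  finally show ?thesis unfolding Q_def g_def by (simp only: mult_ac)
qed

text \<open>Pointwise in time the sum is only of order \<open>h\<close> to the power \<open>2 * k\<close>. The additional power of \<open>h\<close>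
  comes from \<open>caccioppoli\<close>, which controls differences of the top derivative in the mean over
  space and time away from the boundary; the cells next to the boundary have total length \<open>O(h)\<close>.\<close>

lemma coef_time_integral:
  assumes "is_mesh N X" and K: "K = 2 * k + 1" and k: "k \<ge> 1" and \<tau>: "\<tau> \<in> {0..T}"
  defines "h \<equiv> mesh_size N X"
  shows "integral {0..\<tau>} (\<lambda>t. \<Sum>j=1..N. (X j - X (j - 1)) * (coef ee k (X (j - 1)) (X j) (\<lambda>x. U (k + 2) x t))\<^sup>2)
    \<le> 300 * (PB k)\<^sup>2 * h ^ (2 * k) * (h\<^sup>2 + \<tau> * h) * M\<^sup>2"
proof -
  interpret mesh N X by unfold_locales fact
  define H where "H = h"
  have hH: "mesh_size N X = H" by (simp add: H_def h_def)
  have H: "H > 0" "H \<le> 2 * pi" using h_pos h_le by (auto simp: hH)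
  \<comment> \<open>Since H is at most 2\<pi>, this step is small enough for the shifts by
    3\<epsilon> to stay within one mesh size of the boundary, and for the consistency error, of
    order \<epsilon>^2 after squaring, to be of order H^3.\<close>
  define \<epsilon> where "\<epsilon> = H\<^sup>2 / (6 * pi)"
  have \<epsilon>: "\<epsilon> > 0" "3 * \<epsilon> \<le> H" "18 * pi * \<epsilon>\<^sup>2 \<le> H ^ 3"
  proof -
    show "\<epsilon> > 0" using H by (simp add: \<epsilon>_def)
    have "H * H \<le> H * (2 * pi)" using H by (intro mult_left_mono) auto
    thus "3 * \<epsilon> \<le> H" unfolding \<epsilon>_def using pi_gt_zero by (simp add: power2_eq_square field_simps)
    have "H ^ 3 * H \<le> H ^ 3 * (2 * pi)" using H by (intro mult_left_mono) auto
    thus "18 * pi * \<epsilon>\<^sup>2 \<le> H ^ 3" unfolding \<epsilon>_def using pi_gt_zero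
      by (simp add: power2_eq_square power3_eq_cube field_simps)
  qed
  define \<beta> where "\<beta> = 2 * pi - 3 * \<epsilon>"
  have \<beta>: "0 \<le> \<beta>" "\<beta> + 3 * \<epsilon> \<le> 2 * pi" using \<epsilon> H by (auto simp: \<beta>_def)
  define g where "g t = third_diff \<epsilon> (\<lambda>x. U (2 * k) x t)" for t
  define \<phi> where "\<phi> t x = (cutoff H \<beta> x)\<^sup>2 * (g t x)\<^sup>2" for t x
  define c where "c j t = coef ee k (X (j - 1)) (X j) (\<lambda>x. U (k + 2) x t)" for j t
  define l where "l j = X j - X (j - 1)" for j
  have l: "l j > 0" "l j \<le> H" if "j \<in> {1..N}" for j
    using X_less[OF that] size_le[OF that] by (auto simp: l_def hH)
  have gc: "continuous_on {0..\<beta>} (g t)" if "t \<in> {0..T}" for t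
    unfolding g_def using that \<beta> \<epsilon> K by (intro third_diff_cont_x) auto
  have cutc: "continuous_on {0..\<beta>} (cutoff H \<beta>)"
    using cutoff_deriv[OF H(1)] by (blast intro: DERIV_continuous_on)
  have \<phi>c: "continuous_on {0..\<beta>} (\<phi> t)" if "t \<in> {0..T}" for t
    unfolding \<phi>_def[abs_def] by (intro continuous_intros cutc gc that)
  have \<phi>i: "\<phi> t integrable_on {p..q}" if "t \<in> {0..T}" "0 \<le> p" "q \<le> \<beta>" for t p q
    using that by (intro integrable_continuous_interval continuous_on_subset[OF \<phi>c]) auto
  have \<phi>0: "\<phi> t x \<ge> 0" for t x by (simp add: \<phi>_def)
  \<comment> \<open>The contribution of a cell is bounded by the increment over the cell of one
    monotone function \<open>F t\<close>, so that the sum over the mesh telescopes.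
    \<open>\<Psi>1\<close> and \<open>\<Psi>2\<close> have slope 1 near the left and the right end
    and pay for the cells there; one extra H of room covers a cell reaching beyond the threshold.
    \<open>\<Psi>3\<close> pays for the inner cells.\<close>
  define \<Psi>1 where "\<Psi>1 x = min x (2 * H)" for x
  define \<Psi>2 where "\<Psi>2 x = max 0 (x - (2 * pi - 3 * H))" for x
  define \<Psi>3 where "\<Psi>3 t x = integral {0..min x \<beta>} (\<phi> t)" for t x
  define P2 where "P2 = (PB k)\<^sup>2"
  have P2: "P2 \<ge> 0" by (simp add: P2_def)
  define B where "B = P2 * H ^ (2 * k) * M\<^sup>2"
  define D where "D = 2 * P2 * H ^ (2 * k - 2)"
  have B0: "B \<ge> 0" and D0: "D \<ge> 0" using P2 H by (auto simp: B_def D_def)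
  define F where "F t x = B * (\<Psi>1 x + \<Psi>2 x) + D * (9 * \<epsilon>\<^sup>2 * M\<^sup>2 * x + 16 * H ^ 4 * \<Psi>3 t x)" for t x
  have cellb: "l j * (c j t)\<^sup>2 \<le> F t (X j) - F t (X (j - 1))" if j: "j \<in> {1..N}" and t: "t \<in> {0..T}" for j t
  proof -
    define a b where "a = X (j - 1)" and "b = X j"
    have ab: "0 \<le> a" "a < b" "b \<le> 2 * pi" using cell_range[OF j] by (auto simp: a_def b_def)
    have lj: "l j = b - a" by (simp add: l_def a_def b_def)
    have baH: "b - a \<le> H" using l[OF j] by (simp add: lj)
    have m1: "\<Psi>1 a \<le> \<Psi>1 b" "\<Psi>2 a \<le> \<Psi>2 b" using ab by (auto simp: \<Psi>1_def \<Psi>2_def)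
    have m3: "\<Psi>3 t a \<le> \<Psi>3 t b"
      unfolding \<Psi>3_def using ab \<beta> t by (intro integral_subset_le \<phi>i) (auto simp: \<phi>0)
    have "F t b - F t a = B * ((\<Psi>1 b - \<Psi>1 a) + (\<Psi>2 b - \<Psi>2 a)) + D * (9 * \<epsilon>\<^sup>2 * M\<^sup>2 * (b - a) + 16 * H ^ 4 * (\<Psi>3 t b - \<Psi>3 t a))"
      by (simp add: F_def algebra_simps)
    moreover have "l j * (c j t)\<^sup>2 \<le> \<dots>"
    proof (cases "a < H \<or> b > 2 * pi - 2 * H")
      case True
      have "(b - a) \<le> (\<Psi>1 b - \<Psi>1 a) + (\<Psi>2 b - \<Psi>2 a)"
        using True
      proof
        assume "a < H"
        hence "\<Psi>1 b - \<Psi>1 a = b - a" using baH ab by (simp add: \<Psi>1_def min_def)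
        thus ?thesis using m1 by simp
      next
        assume "b > 2 * pi - 2 * H"
        hence "\<Psi>2 b - \<Psi>2 a = b - a" using baH ab by (simp add: \<Psi>2_def max_def)
        thus ?thesis using m1 by simp
      qed
      hence "B * (b - a) \<le> B * ((\<Psi>1 b - \<Psi>1 a) + (\<Psi>2 b - \<Psi>2 a))" using B0 by (intro mult_left_mono) auto
      moreover have "l j * (c j t)\<^sup>2 \<le> B * (b - a)"
      proof -
        have "\<bar>c j t\<bar> \<le> PB k * (M * (b - a) ^ Suc (k - 1))"
          unfolding c_def a_def[symmetric] b_def[symmetric] using K k t ab by (intro coef_U_bound) auto
        also have "\<dots> \<le> PB k * (M * H ^ k)"
          using k M PB(1)[of k] ab baH by (intro mult_left_mono power_mono) (auto simp: power_mono)
        finally have "(c j t)\<^sup>2 \<le> (PB k * (M * H ^ k))\<^sup>2" by (metis abs_ge_zero power2_abs power_mono)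
        also have "\<dots> = B" by (simp add: B_def P2_def power_mult_distrib power_mult[symmetric] mult_ac)
        finally show ?thesis using ab by (simp add: lj mult.commute mult_left_mono)
      qed
      moreover have "0 \<le> D * (9 * \<epsilon>\<^sup>2 * M\<^sup>2 * (b - a) + 16 * H ^ 4 * (\<Psi>3 t b - \<Psi>3 t a))"
        using D0 ab m3 by (intro mult_nonneg_nonneg add_nonneg_nonneg) auto
      ultimately show ?thesis by linarith
    next
      case False
      hence good: "a \<ge> H" "b \<le> 2 * pi - 2 * H" by auto
      have b\<beta>: "b + H \<le> \<beta>" using good \<epsilon> by (simp add: \<beta>_def)
      have "\<Psi>3 t b - \<Psi>3 t a = integral {a..b} (\<phi> t)"
      proof -
        have "integral {0..a} (\<phi> t) + integral {a..b} (\<phi> t) = integral {0..b} (\<phi> t)"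
          using ab b\<beta> H t by (intro Henstock_Kurzweil_Integration.integral_combine \<phi>i) auto
        thus ?thesis using ab b\<beta> H by (simp add: \<Psi>3_def min_def)
      qed
      moreover have "integral {a..b} (\<lambda>x. (g t x)\<^sup>2) \<le> integral {a..b} (\<lambda>x. 16 * \<phi> t x)"
      proof (rule integral_le)
        show "(\<lambda>x. (g t x)\<^sup>2) integrable_on {a..b}"
          using ab b\<beta> H t by (intro integrable_continuous_interval continuous_intros continuous_on_subset[OF gc]) auto
        show "(\<lambda>x. 16 * \<phi> t x) integrable_on {a..b}"
          using ab b\<beta> H t by (intro integrable_on_mult_right \<phi>i) auto
        fix x assume x: "x \<in> {a..b}"
        \<comment> \<open>An inner cell has distance at least H from both ends of the cutoff
          interval, so each factor of the cutoff is at least 1/2. This is the origin of the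
          16.\<close>
        have "1 / 2 \<le> x / (x + H)" "1 / 2 \<le> (\<beta> - x) / (\<beta> - x + H)"
          using x good b\<beta> H by (auto simp: divide_simps)
        hence "1 / 2 * (1 / 2) \<le> cutoff H \<beta> x" unfolding cutoff_def by (intro mult_mono; linarith)
        hence "(1 / 4)\<^sup>2 \<le> (cutoff H \<beta> x)\<^sup>2" by (intro power_mono) auto
        hence "(1 / 16) * (g t x)\<^sup>2 \<le> (cutoff H \<beta> x)\<^sup>2 * (g t x)\<^sup>2" by (intro mult_right_mono) (auto simp: power_divide)
        thus "(g t x)\<^sup>2 \<le> 16 * \<phi> t x" by (simp add: \<phi>_def)
      qed
      ultimately have gi: "integral {a..b} (\<lambda>x. (g t x)\<^sup>2) \<le> 16 * (\<Psi>3 t b - \<Psi>3 t a)" by simp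
      have "(c j t)\<^sup>2 \<le> 2 * (PB k)\<^sup>2 * (b - a) ^ (2 * k - 2) * (9 * \<epsilon>\<^sup>2 * M\<^sup>2 + (b - a) ^ 3 * integral {a..b} (\<lambda>x. (g t x)\<^sup>2))"
        unfolding c_def a_def[symmetric] b_def[symmetric] g_def
        using K k ab good \<epsilon> H t by (intro coef_third_diff_bound) auto
      also have "\<dots> \<le> 2 * (PB k)\<^sup>2 * H ^ (2 * k - 2) * (9 * \<epsilon>\<^sup>2 * M\<^sup>2 + (b - a) ^ 3 * (16 * (\<Psi>3 t b - \<Psi>3 t a)))"
      proof (rule mult_mono)
        show "2 * (PB k)\<^sup>2 * (b - a) ^ (2 * k - 2) \<le> 2 * (PB k)\<^sup>2 * H ^ (2 * k - 2)"
          using ab baH by (intro mult_left_mono power_mono) auto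
        show "9 * \<epsilon>\<^sup>2 * M\<^sup>2 + (b - a) ^ 3 * integral {a..b} (\<lambda>x. (g t x)\<^sup>2) \<le> 9 * \<epsilon>\<^sup>2 * M\<^sup>2 + (b - a) ^ 3 * (16 * (\<Psi>3 t b - \<Psi>3 t a))"
          using ab by (intro add_left_mono mult_left_mono gi) auto
        show "0 \<le> 2 * (PB k)\<^sup>2 * H ^ (2 * k - 2)" using H by simp
        have "0 \<le> integral {a..b} (\<lambda>x. (g t x)\<^sup>2)" by (cases "(\<lambda>x. (g t x)\<^sup>2) integrable_on {a..b}")
          (auto intro!: integral_nonneg simp: not_integrable_integral)
        thus "0 \<le> 9 * \<epsilon>\<^sup>2 * M\<^sup>2 + (b - a) ^ 3 * integral {a..b} (\<lambda>x. (g t x)\<^sup>2)" using ab by simp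
      qed
      finally have "l j * (c j t)\<^sup>2 \<le> (b - a) * (D * (9 * \<epsilon>\<^sup>2 * M\<^sup>2 + (b - a) ^ 3 * (16 * (\<Psi>3 t b - \<Psi>3 t a))))"
        unfolding lj D_def P2_def using ab by (intro mult_left_mono) auto
      also have "\<dots> = D * (9 * \<epsilon>\<^sup>2 * M\<^sup>2 * (b - a) + 16 * (b - a) ^ 4 * (\<Psi>3 t b - \<Psi>3 t a))"
        by (simp add: algebra_simps power4_eq_xxxx power3_eq_cube)
      also have "\<dots> \<le> D * (9 * \<epsilon>\<^sup>2 * M\<^sup>2 * (b - a) + 16 * H ^ 4 * (\<Psi>3 t b - \<Psi>3 t a))"
        using D0 m3 ab baH by (intro mult_left_mono add_mono order.refl mult_right_mono power_mono) auto
      also have "\<dots> \<le> B * ((\<Psi>1 b - \<Psi>1 a) + (\<Psi>2 b - \<Psi>2 a)) + \<dots>" using B0 m1 by simp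
      finally show ?thesis .
    qed
    ultimately show ?thesis by (simp add: a_def b_def)
  qed
  have total: "(\<Sum>j=1..N. l j * (c j t)\<^sup>2) \<le> 5 * H * B + D * (H ^ 3 * M\<^sup>2 + 16 * H ^ 4 * integral {0..\<beta>} (\<phi> t))"
    if t: "t \<in> {0..T}" for t
  proof -
    have "F t (X 0) \<ge> 0" unfolding F_def X0 using B0 D0 H \<beta>
      by (auto simp: \<Psi>1_def \<Psi>2_def \<Psi>3_def intro!: mult_nonneg_nonneg add_nonneg_nonneg)
    moreover have "(\<Sum>j=1..N. l j * (c j t)\<^sup>2) \<le> F t (X N) - F t (X 0)"
      by (rule sum_le_telescope) (rule cellb[OF _ t])
    ultimately have "(\<Sum>j=1..N. l j * (c j t)\<^sup>2) \<le> F t (X N)" by linarith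
    also have "F t (X N) \<le> B * (2 * H + 3 * H) + D * (9 * \<epsilon>\<^sup>2 * M\<^sup>2 * (2 * pi) + 16 * H ^ 4 * integral {0..\<beta>} (\<phi> t))"
      unfolding F_def XN using B0 D0 H \<epsilon> \<beta>
      by (intro add_mono mult_left_mono) (auto simp: \<Psi>1_def \<Psi>2_def \<Psi>3_def \<beta>_def min_def)
    also have "9 * \<epsilon>\<^sup>2 * M\<^sup>2 * (2 * pi) = 18 * pi * \<epsilon>\<^sup>2 * M\<^sup>2" by simp
    also have "D * (18 * pi * \<epsilon>\<^sup>2 * M\<^sup>2 + 16 * H ^ 4 * integral {0..\<beta>} (\<phi> t)) \<le> D * (H ^ 3 * M\<^sup>2 + 16 * H ^ 4 * integral {0..\<beta>} (\<phi> t))"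
      using D0 \<epsilon> by (intro mult_left_mono add_mono mult_right_mono) auto
    finally show ?thesis by (simp add: mult_ac)
  qed
  have \<phi>t: "(\<lambda>t. integral {0..\<beta>} (\<phi> t)) integrable_on {0..\<tau>}"
  proof -
    have "continuous_on ({0..T} \<times> {0..\<beta>}) (\<lambda>(t, x). g t x)"
      unfolding g_def using \<beta> \<epsilon> K by (intro third_diff_cont) auto
    hence 1: "continuous_on ({0..T} \<times> {0..\<beta>}) (\<lambda>z. g (fst z) (snd z))" by (simp add: case_prod_unfold)
    have 2: "continuous_on ({0..T} \<times> {0..\<beta>}) (\<lambda>z. cutoff H \<beta> (snd z))"
      by (intro continuous_on_compose2[OF cutc] continuous_intros) auto
    have "continuous_on ({0..T} \<times> cbox 0 \<beta>) (\<lambda>(t, x). \<phi> t x)"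
      unfolding \<phi>_def case_prod_unfold box_real by (intro continuous_intros 1 2)
    from integral_continuous_on_param[OF this] have "continuous_on {0..T} (\<lambda>t. integral {0..\<beta>} (\<phi> t))" by simp
    thus ?thesis using \<tau> by (intro integrable_continuous_interval) (auto elim: continuous_on_subset)
  qed
  have "integral {0..\<tau>} (\<lambda>t. \<Sum>j=1..N. l j * (c j t)\<^sup>2) \<le>
     integral {0..\<tau>} (\<lambda>t. 5 * H * B + D * (H ^ 3 * M\<^sup>2) + D * (16 * H ^ 4) * integral {0..\<beta>} (\<phi> t))"
  proof (rule integral_le)
    show "(\<lambda>t. \<Sum>j=1..N. l j * (c j t)\<^sup>2) integrable_on {0..\<tau>}"
      unfolding c_def using K k \<tau> cell_range
      by (intro integrable_continuous_interval continuous_intros continuous_on_subset[OF coef_cont]) auto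
    show "(\<lambda>t. 5 * H * B + D * (H ^ 3 * M\<^sup>2) + D * (16 * H ^ 4) * integral {0..\<beta>} (\<phi> t)) integrable_on {0..\<tau>}"
      by (intro integrable_add integrable_on_mult_right \<phi>t integrable_const_ivl)
    show "(\<Sum>j=1..N. l j * (c j t)\<^sup>2) \<le> 5 * H * B + D * (H ^ 3 * M\<^sup>2) + D * (16 * H ^ 4) * integral {0..\<beta>} (\<phi> t)"
      if "t \<in> {0..\<tau>}" for t using total[of t] that \<tau> by (simp add: algebra_simps)
  qed
  also have "\<dots> = \<tau> * (5 * H * B + D * (H ^ 3 * M\<^sup>2)) + D * (16 * H ^ 4) * integral {0..\<tau>} (\<lambda>t. integral {0..\<beta>} (\<phi> t))"
    using \<tau> by (subst integral_add) (auto intro!: integrable_on_mult_right \<phi>t)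
  also have "\<dots> \<le> \<tau> * (5 * H * B + D * (H ^ 3 * M\<^sup>2)) + D * (16 * H ^ 4) * (M\<^sup>2 * (2 * pi + 8 * \<tau> / H))"
  proof -
    have "integral {0..\<tau>} (\<lambda>t. integral {0..\<beta>} (\<phi> t)) \<le> M\<^sup>2 * (2 * pi + 8 * \<tau> / H)"
      using caccioppoli[of "2 * k - 1" \<epsilon> H \<tau>] K k \<epsilon> H \<tau> unfolding \<phi>_def g_def \<beta>_def by simp
    thus ?thesis using D0 H by (intro add_left_mono mult_left_mono) auto
  qed
  also have "\<dots> = P2 * H ^ (2 * k) * M\<^sup>2 * (263 * (\<tau> * H) + 64 * pi * H\<^sup>2)"
  proof -
    obtain k' where "k = Suc k'" using k by (cases k) auto
    thus ?thesis using H by (simp add: B_def D_def field_simps power2_eq_square power3_eq_cube power4_eq_xxxx)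
  qed
  \<comment> \<open>263 is 5 from the boundary cells, 2 from the consistency error and 256 from the
    energy estimate; 300 is a round number above it and above 64\<pi>.\<close>
  also have "\<dots> \<le> P2 * H ^ (2 * k) * M\<^sup>2 * (300 * (\<tau> * H) + 300 * H\<^sup>2)"
    using P2 H \<tau> pi_less_4 by (intro mult_left_mono add_mono mult_right_mono) auto
  finally show ?thesis by (simp add: c_def l_def P2_def H_def algebra_simps)
qed

end

subsection \<open>The interpolation function as a corrected projection\<close>

lemma F1_eq:
  assumes "a < b" "k \<ge> 1"
  shows "F1 k a b (Suc j) = poly (EP k a b (2 * j + 1) False)"
proof (induction j)
  case 0
  show ?case using assms
    by (simp add: F1_def cell_legendre_eq radau_plus_eq continuous_Ds_inv)
next
  case (Suc j)
  thus ?case using assms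
    by (simp add: F1_def radau_plus_eq radau_minus_eq continuous_Ds_inv)
qed

lemma F2_eq:
  assumes "a < b" "k \<ge> 1"
  shows "F2 k a b (Suc j) = poly (EP k a b (2 * j + 1) True)"
proof (induction j)
  case 0
  show ?case using assms
    by (simp add: F2_def cell_legendre_eq radau_minus_eq continuous_Ds_inv)
next
  case (Suc j)
  thus ?case using assms
    by (simp add: F2_def radau_plus_eq radau_minus_eq continuous_Ds_inv)
qed

lemma F1_bar_eq: "a < b \<Longrightarrow> k \<ge> 1 \<Longrightarrow> F1_bar k a b (Suc j) = poly (EP k a b (2 * Suc j) True)"
  by (simp add: F1_bar_def F1_eq radau_minus_eq continuous_Ds_inv)

lemma F2_bar_eq: "a < b \<Longrightarrow> k \<ge> 1 \<Longrightarrow> F2_bar k a b (Suc j) = poly (EP k a b (2 * Suc j) False)"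
  by (simp add: F2_bar_def F2_eq radau_plus_eq continuous_Ds_inv)

lemma sum_even_odd:
  fixes f :: "nat \<Rightarrow> real"
  shows "(\<Sum>i=1..k div 2. f (2 * i)) + (\<Sum>i=1..(k + 1) div 2. f (2 * i - 1)) = (\<Sum>n=1..k. f n)"
proof (induction k)
  case (Suc k)
  show ?case
  proof (cases "even k")
    case True
    then obtain m where "k = 2 * m" by blast
    thus ?thesis using Suc by simp
  next
    case False
    then obtain m where "k = 2 * m + 1" using oddE by blast
    thus ?thesis using Suc by simp
  qed
qed simp

lemma time_deriv_eq:
  assumes "T > 0" "t \<in> {0..T}" "\<And>s. s \<in> {0..T} \<Longrightarrow> f s = g s"
    and "(g has_real_derivative d) (at t within {0..T})"
  shows "time_deriv T f t = d"
proof -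
  have "(f has_real_derivative d) (at t within {0..T})"
    by (rule has_field_derivative_transform_within[OF assms(4) zero_less_one]) (use assms in auto)
  thus ?thesis unfolding time_deriv_def using assms
    by (intro vector_derivative_within_closed_interval) (auto simp: has_real_derivative_iff_has_vector_derivative)
qed

text \<open>The correction terms of both flux choices form a single chain: with \<open>e\<close> the end point
  matched by the projection of \<open>u\<close> (\<open>True\<close> for flux choice (I)), the \<open>n\<close>-th coefficient
  involves the \<open>n\<close>-th spatial derivative of \<open>u\<close> and the end points alternate.\<close>

definition corrected :: "bool \<Rightarrow> nat \<Rightarrow> real \<Rightarrow> real \<Rightarrow> (real \<Rightarrow> real) \<Rightarrow> (nat \<Rightarrow> real) \<Rightarrow> real poly" where
  "corrected e k a b v d = proj k a b v - (\<Sum>n\<le>k. smult (((b - a) / 2) ^ n * d n) (EP k a b n e))"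

lemma degree_corrected: "a < b \<Longrightarrow> degree (corrected e k a b v d) \<le> k"
  unfolding corrected_def
  by (intro degree_diff_le degree_proj degree_sum_le order.trans[OF degree_smult_le] degree_EP) auto

text \<open>At the matched end point only the term n = 0 counts, and it turns the orthogonal
  projection into the Radau projection. Therefore the flux error is a trace of the discrete error
  alone.\<close>

lemma corrected_endp:
  assumes "a < b" "d 0 = coef e k a b v"
  shows "poly (corrected e k a b v d) (endp e a b) = v (endp e a b)"
proof -
  have "(\<Sum>n\<le>k. ((b - a) / 2) ^ n * d n * poly (EP k a b n e) (endp e a b)) = d 0 * poly (Lc a b k) (endp e a b)"
  proof -
    have "(\<Sum>n\<le>k. ((b - a) / 2) ^ n * d n * poly (EP k a b n e) (endp e a b)) =
        (\<Sum>n\<le>k. if n = 0 then d 0 * poly (Lc a b k) (endp e a b) else 0)"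
    proof (rule sum.cong[OF refl])
      fix n assume "n \<in> {..k}"
      thus "((b - a) / 2) ^ n * d n * poly (EP k a b n e) (endp e a b) = (if n = 0 then d 0 * poly (Lc a b k) (endp e a b) else 0)"
        using EP_endp[OF assms(1), of "n - 1" k e] by (cases n) (auto simp del: EP.simps(2))
    qed
    thus ?thesis by simp
  qed
  thus ?thesis using rad_endp[OF assms(1), of e k v]
    by (simp add: corrected_def poly_sum rad_def assms(2))
qed

text \<open>A telescoping in disguise: by \<open>EP_Suc_pderiv\<close> the term n + 1 of the
  correction of \<open>f\<close>, tested with w', cancels the term n of the correction of
  \<open>g\<close>, tested with w. The term 0 of \<open>f\<close> drops out because the top Legendre
  polynomial is orthogonal to w', and the term k of \<open>g\<close> finds no partner. No relation
  between \<open>f\<close> and \<open>g\<close> is involved beyond the shift of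
  coefficients.\<close>

lemma corrected_residual:
  assumes ab: "a < b" and c: "continuous_on {a..b} f" "continuous_on {a..b} g" and w: "degree w \<le> k" and k: "k \<ge> 1"
  shows "integral {a..b} (\<lambda>x. (g x - poly (corrected (\<not> e) k a b g (\<lambda>n. d (Suc n))) x) * poly w x)
    + integral {a..b} (\<lambda>x. (f x - poly (corrected e k a b f d) x) * poly (pderiv w) x)
    = ((b - a) / 2) ^ k * d (Suc k) * integral {a..b} (\<lambda>x. poly (EP k a b k (\<not> e)) x * poly w x)"
proof -
  define H where "H = (b - a) / 2"
  have H: "H > 0" using ab by (simp add: H_def)
  have *: "integral {a..b} (\<lambda>x. (v x - poly (corrected e' k a b v d') x) * poly r x)
      = (\<Sum>n\<le>k. H ^ n * d' n * integral {a..b} (\<lambda>x. poly (EP k a b n e') x * poly r x))"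
    if v: "continuous_on {a..b} v" and r: "degree r \<le> k" for v e' d' r
  proof -
    have "integral {a..b} (\<lambda>x. (v x - poly (corrected e' k a b v d') x) * poly r x) =
      integral {a..b} (\<lambda>x. (v x * poly r x - poly (proj k a b v) x * poly r x) + (\<Sum>n\<le>k. H ^ n * d' n * poly (EP k a b n e' * r) x))"
      by (intro integral_cong) (simp add: corrected_def poly_sum H_def algebra_simps sum_distrib_left)
    also have "\<dots> = integral {a..b} (\<lambda>x. v x * poly r x - poly (proj k a b v) x * poly r x) + integral {a..b} (\<lambda>x. \<Sum>n\<le>k. H ^ n * d' n * poly (EP k a b n e' * r) x)"
      by (intro integral_add integrable_continuous_interval continuous_intros v)
    also have "integral {a..b} (\<lambda>x. v x * poly r x - poly (proj k a b v) x * poly r x) = 0"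
      using proj_inner[OF ab v r] by (subst integral_diff) (auto intro!: integrable_continuous_poly v continuous_intros)
    also have "integral {a..b} (\<lambda>x. \<Sum>n\<le>k. H ^ n * d' n * poly (EP k a b n e' * r) x) = (\<Sum>n\<le>k. H ^ n * d' n * integral {a..b} (poly (EP k a b n e' * r)))"
      by (rule integral_poly_sum) simp
    finally show ?thesis by (simp add: poly_mult[abs_def])
  qed
  have w': "degree (pderiv w) < k" using w k degree_pderiv[of w] by auto
  obtain k' where k': "k = Suc k'" using k by (cases k) auto
  have "integral {a..b} (\<lambda>x. (f x - poly (corrected e k a b f d) x) * poly (pderiv w) x)
      = (\<Sum>n\<le>k. H ^ n * d n * integral {a..b} (\<lambda>x. poly (EP k a b n e) x * poly (pderiv w) x))"
    using w' by (intro * c) auto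
  also have "\<dots> = (\<Sum>n\<le>k'. H ^ Suc n * d (Suc n) * integral {a..b} (\<lambda>x. poly (EP k a b (Suc n) e) x * poly (pderiv w) x))"
    unfolding k' sum.atMost_Suc_shift using Lc_orthogonal[OF ab w'] by (simp add: k')
  also have "\<dots> = (\<Sum>n\<le>k'. - (H ^ n * d (Suc n) * integral {a..b} (\<lambda>x. poly (EP k a b n (\<not> e)) x * poly w x)))"
  proof (rule sum.cong[OF refl])
    fix n assume "n \<in> {..k'}"
    hence n: "n < k" by (simp add: k')
    have "H * (2 / (b - a)) = 1" using ab by (simp add: H_def)
    hence "H ^ Suc n * d (Suc n) * (- (2 / (b - a)) * z) = - (H ^ n * d (Suc n) * z)" for z
      by (simp add: mult.commute mult.left_commute)
    thus "H ^ Suc n * d (Suc n) * integral {a..b} (\<lambda>x. poly (EP k a b (Suc n) e) x * poly (pderiv w) x) =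
      - (H ^ n * d (Suc n) * integral {a..b} (\<lambda>x. poly (EP k a b n (\<not> e)) x * poly w x))"
      unfolding EP_Suc_pderiv[OF ab n w] .
  qed
  also have "integral {a..b} (\<lambda>x. (g x - poly (corrected (\<not> e) k a b g (\<lambda>n. d (Suc n))) x) * poly w x)
      = (\<Sum>n\<le>k. H ^ n * d (Suc n) * integral {a..b} (\<lambda>x. poly (EP k a b n (\<not> e)) x * poly w x))"
    using w by (intro * c)
  ultimately show ?thesis by (simp add: k' sum_negf H_def)
qed

lemma corrected_mean:
  assumes ab: "a < b" and v: "continuous_on {a..b} v" and k: "k \<ge> 1"
  shows "integral {a..b} (\<lambda>x. v x - poly (corrected e k a b v d) x) = ((b - a) / 2) ^ k * d k * integral {a..b} (poly (EP k a b k e))"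
proof -
  have "integral {a..b} (\<lambda>x. v x - poly (corrected e k a b v d) x) =
    integral {a..b} (\<lambda>x. (v x * poly 1 x - poly (proj k a b v) x * poly 1 x) + (\<Sum>n\<le>k. ((b - a) / 2) ^ n * d n * poly (EP k a b n e) x))"
    by (intro integral_cong) (simp add: corrected_def poly_sum algebra_simps)
  also have "\<dots> = integral {a..b} (\<lambda>x. v x * poly 1 x - poly (proj k a b v) x * poly 1 x) + integral {a..b} (\<lambda>x. \<Sum>n\<le>k. ((b - a) / 2) ^ n * d n * poly (EP k a b n e) x)"
    by (intro integral_add integrable_continuous_interval continuous_intros v)
  also have "integral {a..b} (\<lambda>x. v x * poly 1 x - poly (proj k a b v) x * poly 1 x) = 0"
    using proj_inner[OF ab v, of 1 k] by (subst integral_diff) (auto intro!: integrable_continuous_interval v continuous_intros)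
  also have "integral {a..b} (\<lambda>x. \<Sum>n\<le>k. ((b - a) / 2) ^ n * d n * poly (EP k a b n e) x) = (\<Sum>n\<le>k. ((b - a) / 2) ^ n * d n * integral {a..b} (poly (EP k a b n e)))"
    by (rule integral_poly_sum) simp
  also have "\<dots> = (\<Sum>n\<le>k. if n = k then ((b - a) / 2) ^ k * d k * integral {a..b} (poly (EP k a b k e)) else 0)"
    using EP_mean_zero[OF ab] by (intro sum.cong) auto
  finally show ?thesis by simp
qed

context smooth_heat
begin

definition cc :: "bool \<Rightarrow> nat \<Rightarrow> real \<Rightarrow> real \<Rightarrow> real \<Rightarrow> nat \<Rightarrow> real" where
  "cc e k a b t n = coef (if even n then e else \<not> e) k a b (\<lambda>x. U n x t)"

text \<open>The heat equation trades every time derivative for two space derivatives. In this way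
  the time derivatives in the definition of the interpolation function become coefficients of
  \<open>U\<close> at a single time.\<close>

lemma iterated_time_deriv:
  assumes "2 * i + r \<le> K" "0 \<le> a" "a < b" "b \<le> 2 * pi" "t \<in> {0..T}"
    and "\<And>s. s \<in> {0..T} \<Longrightarrow> f s = coef e k a b (\<lambda>x. U r x s)"
  shows "(time_deriv T ^^ i) f t = coef e k a b (\<lambda>x. U (r + 2 * i) x t)"
  using assms(1,5)
proof (induction i arbitrary: t)
  case 0
  thus ?case using assms(6) by simp
next
  case (Suc i)
  have "time_deriv T ((time_deriv T ^^ i) f) t = coef e k a b (\<lambda>x. U (r + 2 * i + 2) x t)"
  proof (rule time_deriv_eq[OF T Suc.prems(2)])
    show "(time_deriv T ^^ i) f s = coef e k a b (\<lambda>x. U (r + 2 * i) x s)" if "s \<in> {0..T}" for s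
      using Suc.prems that by (intro Suc.IH) auto
    show "((\<lambda>s. coef e k a b (\<lambda>x. U (r + 2 * i) x s)) has_real_derivative coef e k a b (\<lambda>x. U (r + 2 * i + 2) x t)) (at t within {0..T})"
      using Suc.prems assms(2-4) by (intro coef_deriv) auto
  qed
  thus ?case by simp
qed

lemma u_interp_corrected:
  assumes K: "K = 2 * k + 1" and k: "k \<ge> 1" and ab: "0 \<le> a" "a < b" "b \<le> 2 * pi" and t: "t \<in> {0..T}"
    and u: "\<And>x t. x \<in> Omega \<Longrightarrow> t \<in> {0..T} \<Longrightarrow> U 0 x t = u x t"
    and q: "\<And>x t. x \<in> Omega \<Longrightarrow> t \<in> {0..T} \<Longrightarrow> U 1 x t = q x t"
  shows "u_interp fl k k T a b u q x t = poly (corrected (fl = Flux_I) k a b (\<lambda>x. U 0 x t) (cc (fl = Flux_I) k a b t)) x"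
proof -
  have agree: "U 0 x s = u x s" "U 1 x s = q x s" if "s \<in> {0..T}" "x \<in> {a..b}" for x s
    using u q that ab by auto
  have cont: "continuous_on {a..b} (\<lambda>x. u x s)" "continuous_on {a..b} (\<lambda>x. q x s)" if s: "s \<in> {0..T}" for s
  proof -
    have c: "continuous_on {a..b} (\<lambda>x. U 0 x s)" "continuous_on {a..b} (\<lambda>x. U 1 x s)"
      using s ab K k by (auto intro!: U_cont_x)
    show "continuous_on {a..b} (\<lambda>x. u x s)" by (rule continuous_on_eq[OF c(1) agree(1)[OF s]])
    show "continuous_on {a..b} (\<lambda>x. q x s)" by (rule continuous_on_eq[OF c(2) agree(2)[OF s]])
  qed
  have cf: "coef e k a b (\<lambda>x. u x s) = coef e k a b (\<lambda>x. U 0 x s)" "coef e k a b (\<lambda>x. q x s) = coef e k a b (\<lambda>x. U 1 x s)"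
    if "s \<in> {0..T}" for s e
    using agree[OF that] by (auto intro!: coef_cong ab)
  have pr: "proj k a b (\<lambda>x. u x t) = proj k a b (\<lambda>x. U 0 x t)" using agree[OF t] by (intro proj_cong) auto
  have G: "(time_deriv T ^^ i) (\<lambda>s. coef e k a b (\<lambda>y. u y s)) t = coef e k a b (\<lambda>x. U (2 * i) x t)" if "2 * i \<le> k" for i e
    using iterated_time_deriv[of i 0 a b t "\<lambda>s. coef e k a b (\<lambda>y. u y s)" e k] cf that K ab t by simp
  have Q: "(time_deriv T ^^ i) (\<lambda>s. coef e k a b (\<lambda>y. q y s)) t = coef e k a b (\<lambda>x. U (2 * i + 1) x t)" if "2 * i \<le> k" for i e
    using iterated_time_deriv[of i 1 a b t "\<lambda>s. coef e k a b (\<lambda>y. q y s)" e k] cf that K ab t by simp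
  have td: "(time_deriv T ^^ i) f t = (time_deriv T ^^ i) g t" if fg: "\<And>s. s \<in> {0..T} \<Longrightarrow> f s = g s" for f g i
  proof -
    have "\<forall>t\<in>{0..T}. (time_deriv T ^^ i) f t = (time_deriv T ^^ i) g t"
    proof (induction i)
      case (Suc i)
      show ?case
      proof
        fix t assume t: "t \<in> {0..T}"
        have "vector_derivative ((time_deriv T ^^ i) f) (at t within {0..T}) = vector_derivative ((time_deriv T ^^ i) g) (at t within {0..T})"
          by (rule vector_derivative_cong_eq) (use t Suc in \<open>auto simp: eventually_at_filter\<close>)
        thus "(time_deriv T ^^ Suc i) f t = (time_deriv T ^^ Suc i) g t" by (simp add: time_deriv_def)
      qed
    qed (use fg in simp)
    thus ?thesis using t by blast
  qed
  have Gb: "(time_deriv T ^^ i) (\<lambda>s. coef_bar k a b (\<lambda>y. u y s)) t = coef True k a b (\<lambda>x. U (2 * i) x t)"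
    "(time_deriv T ^^ i) (\<lambda>s. coef_tilde k a b (\<lambda>y. u y s)) t = coef False k a b (\<lambda>x. U (2 * i) x t)"
    "(time_deriv T ^^ i) (\<lambda>s. coef_bar k a b (\<lambda>y. q y s)) t = coef True k a b (\<lambda>x. U (2 * i + 1) x t)"
    "(time_deriv T ^^ i) (\<lambda>s. coef_tilde k a b (\<lambda>y. q y s)) t = coef False k a b (\<lambda>x. U (2 * i + 1) x t)" if "2 * i \<le> k" for i
    using td[of "\<lambda>s. coef_bar k a b (\<lambda>y. u y s)" "\<lambda>s. coef True k a b (\<lambda>y. u y s)" i]
      td[of "\<lambda>s. coef_tilde k a b (\<lambda>y. u y s)" "\<lambda>s. coef False k a b (\<lambda>y. u y s)" i]
      td[of "\<lambda>s. coef_bar k a b (\<lambda>y. q y s)" "\<lambda>s. coef True k a b (\<lambda>y. q y s)" i]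
      td[of "\<lambda>s. coef_tilde k a b (\<lambda>y. q y s)" "\<lambda>s. coef False k a b (\<lambda>y. q y s)" i]
      G[OF that] Q[OF that] cont ab by (simp_all add: coef_bar_eq coef_tilde_eq)
  define e where "e = (fl = Flux_I)"
  define H where "H = (b - a) / 2"
  define c where "c = cc e k a b t"
  have "u_interp fl k k T a b u q x t = poly (rad e k a b (\<lambda>x. u x t)) x
      - ((\<Sum>i=1..k div 2. H ^ (2 * i) * c (2 * i) * poly (EP k a b (2 * i) e) x)
         + (\<Sum>i=1..(k + 1) div 2. H ^ (2 * i - 1) * c (2 * i - 1) * poly (EP k a b (2 * i - 1) e) x))"
  proof -
    have e1: "H ^ (2 * i) * coef e k a b (\<lambda>x. U (2 * i) x t) * (if e then F1_bar k a b i x else F2_bar k a b i x) =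
        H ^ (2 * i) * c (2 * i) * poly (EP k a b (2 * i) e) x" if "i \<in> {1..k div 2}" for i
      using that ab k F1_bar_eq[of a b k "i - 1"] F2_bar_eq[of a b k "i - 1"] by (simp add: c_def cc_def)
    have e2: "H ^ (2 * i - 1) * coef (\<not> e) k a b (\<lambda>x. U (2 * (i - 1) + 1) x t) * (if e then F2 k a b i x else F1 k a b i x) =
        H ^ (2 * i - 1) * c (2 * i - 1) * poly (EP k a b (2 * i - 1) e) x" if i: "i \<in> {1..(k + 1) div 2}" for i
    proof -
      obtain j where j: "i = Suc j" using i by (cases i) auto
      show ?thesis using ab k F1_eq[of a b k j] F2_eq[of a b k j] by (simp add: c_def cc_def j)
    qed
    have i1: "2 * i \<le> k" if "i \<in> {1..k div 2}" for i using that by auto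
    have i2: "2 * (i - 1) \<le> k" if "i \<in> {1..(k + 1) div 2}" for i using that by auto
    show ?thesis
    proof (cases fl)
      case Flux_I
      hence e: "e = True" by (simp add: e_def)
      have "u_interp fl k k T a b u q x t = poly (rad e k a b (\<lambda>x. u x t)) x
        - ((\<Sum>i=1..k div 2. H ^ (2 * i) * coef e k a b (\<lambda>x. U (2 * i) x t) * (if e then F1_bar k a b i x else F2_bar k a b i x))
         + (\<Sum>i=1..(k + 1) div 2. H ^ (2 * i - 1) * coef (\<not> e) k a b (\<lambda>x. U (2 * (i - 1) + 1) x t) * (if e then F2 k a b i x else F1 k a b i x)))"
        using Gb(1)[OF i1] Gb(4)[OF i2] radau_minus_eq[OF ab(2) k cont(1)[OF t]]
        by (simp add: Flux_I e Let_def H_def)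
      thus ?thesis by (simp only: sum.cong[OF refl e1] sum.cong[OF refl e2])
    next
      case Flux_II
      hence e: "e = False" by (simp add: e_def)
      have "u_interp fl k k T a b u q x t = poly (rad e k a b (\<lambda>x. u x t)) x
        - ((\<Sum>i=1..k div 2. H ^ (2 * i) * coef e k a b (\<lambda>x. U (2 * i) x t) * (if e then F1_bar k a b i x else F2_bar k a b i x))
         + (\<Sum>i=1..(k + 1) div 2. H ^ (2 * i - 1) * coef (\<not> e) k a b (\<lambda>x. U (2 * (i - 1) + 1) x t) * (if e then F2 k a b i x else F1 k a b i x)))"
        using Gb(2)[OF i1] Gb(3)[OF i2] radau_plus_eq[OF ab(2) k cont(1)[OF t]]
        by (simp add: Flux_II e Let_def H_def)
      thus ?thesis by (simp only: sum.cong[OF refl e1] sum.cong[OF refl e2])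
    qed
  qed
  also have "(\<Sum>i=1..k div 2. H ^ (2 * i) * c (2 * i) * poly (EP k a b (2 * i) e) x)
         + (\<Sum>i=1..(k + 1) div 2. H ^ (2 * i - 1) * c (2 * i - 1) * poly (EP k a b (2 * i - 1) e) x)
      = (\<Sum>n=1..k. H ^ n * c n * poly (EP k a b n e) x)"
    by (rule sum_even_odd[of "\<lambda>n. H ^ n * c n * poly (EP k a b n e) x"])
  also have "poly (rad e k a b (\<lambda>x. u x t)) x - (\<Sum>n=1..k. H ^ n * c n * poly (EP k a b n e) x)
     = poly (corrected e k a b (\<lambda>x. U 0 x t) c) x"
  proof -
    have "(\<Sum>n\<le>k. H ^ n * c n * poly (EP k a b n e) x) = c 0 * poly (Lc a b k) x + (\<Sum>n=1..k. H ^ n * c n * poly (EP k a b n e) x)"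
      by (simp add: atMost_atLeast0 sum.atLeast_Suc_atMost)
    moreover have "c 0 = coef e k a b (\<lambda>x. u x t)" using cf[OF t] by (simp add: c_def cc_def)
    ultimately show ?thesis by (simp add: corrected_def poly_sum H_def rad_def pr)
  qed
  finally show ?thesis by (simp add: e_def c_def)
qed

end

subsection \<open>The discrete derivative on a mesh\<close>

context mesh
begin

text \<open>The homogeneous version of both numerical fluxes: the value from the left for \<open>e\<close> and from the
  right otherwise. Prescribed boundary values are \<open>0\<close> because the form is applied to errors.\<close>

definition hat :: "bool \<Rightarrow> bool \<Rightarrow> (nat \<Rightarrow> real poly) \<Rightarrow> nat \<Rightarrow> real" where
  "hat e per v j = (if e
     then (if j = 0 then (if per then poly (v N) (X N) else 0) else poly (v j) (X j))
     else (if j = N then (if per then poly (v 1) (X 0) else 0) else poly (v (Suc j)) (X j)))"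

definition cint :: "nat \<Rightarrow> real poly \<Rightarrow> real poly \<Rightarrow> real" where
  "cint j p r = integral {X (j - 1)..X j} (\<lambda>x. poly p x * poly r x)"

definition local_form :: "bool \<Rightarrow> bool \<Rightarrow> (nat \<Rightarrow> real poly) \<Rightarrow> nat \<Rightarrow> real poly \<Rightarrow> real" where
  "local_form e per v j w = hat e per v j * poly w (X j) - hat e per v (j - 1) * poly w (X (j - 1)) - cint j (v j) (pderiv w)"

definition form :: "bool \<Rightarrow> bool \<Rightarrow> (nat \<Rightarrow> real poly) \<Rightarrow> (nat \<Rightarrow> real poly) \<Rightarrow> real" where
  "form e per v w = (\<Sum>j=1..N. local_form e per v j (w j))"

lemma hat_True: "j \<in> {1..N} \<Longrightarrow> hat True per v j = poly (v j) (X j)"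
  by (simp add: hat_def)

lemma hat_False: "j \<in> {1..N} \<Longrightarrow> hat False per v (j - 1) = poly (v j) (X (j - 1))"
  by (auto simp: hat_def)

lemma cint_parts:
  "j \<in> {1..N} \<Longrightarrow> cint j v (pderiv w) + cint j w (pderiv v) = poly v (X j) * poly w (X j) - poly v (X (j - 1)) * poly w (X (j - 1))"
  using integral_poly_parts[of "X (j - 1)" "X j" w v] X_less[of j]
  by (simp add: cint_def mult.commute)

text \<open>After integration by parts the two local forms add up to the increment over the cell of
  the product of the two fluxes. The telescoped sum vanishes: in the periodic case both fluxes agree
  at the two ends, otherwise one factor is zero at the left end and the other at the right
  end.\<close>

lemma form_adjoint_True: "form True per v w = - form False per w v"
proof -
  let ?f = "\<lambda>j. hat True per v j * hat False per w j"
  have "local_form True per v j (w j) + local_form False per w j (v j) = ?f j - ?f (j - 1)" if j: "j \<in> {1..N}" for j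
    using cint_parts[OF j, of "v j" "w j"] hat_True[OF j, of per v] hat_False[OF j, of per w]
    by (simp add: local_form_def algebra_simps)
  hence "form True per v w + form False per w v = (\<Sum>j=1..N. ?f j - ?f (j - 1))"
    unfolding form_def sum.distrib[symmetric] by (rule sum.cong[OF refl])
  also have "\<dots> = ?f N - ?f 0" by (rule sum_telescope_1)
  also have "\<dots> = 0" using N1 by (simp add: hat_def)
  finally show ?thesis by simp
qed

lemma form_adjoint: "form e per v w = - form (\<not> e) per w v"
  using form_adjoint_True[of per v w] form_adjoint_True[of per w v] by (cases e) auto

lemma cint_linear:
  "cint j (\<Sum>i\<in>S. smult (a i) (V i)) w = (\<Sum>i\<in>S. a i * cint j (V i) w)" if "finite S"
proof -
  have "cint j (\<Sum>i\<in>S. smult (a i) (V i)) w = integral {X (j - 1)..X j} (\<lambda>x. \<Sum>i\<in>S. a i * poly (V i * w) x)"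
    unfolding cint_def by (intro integral_cong) (simp add: poly_sum sum_distrib_right mult.assoc)
  also have "\<dots> = (\<Sum>i\<in>S. a i * cint j (V i) w)"
    unfolding cint_def by (subst integral_poly_sum[OF that]) (simp add: poly_mult[abs_def])
  finally show ?thesis .
qed

lemma hat_linear:
  "hat e per (\<lambda>j. \<Sum>i\<in>S. smult (a i) (V i j)) j = (\<Sum>i\<in>S. a i * hat e per (V i) j)"
  by (simp add: hat_def poly_sum)

lemma local_form_linear:
  assumes "finite S"
  shows "local_form e per (\<lambda>j. \<Sum>i\<in>S. smult (a i) (V i j)) j w = (\<Sum>i\<in>S. a i * local_form e per (V i) j w)"
  unfolding local_form_def hat_linear cint_linear[OF assms]
  by (simp add: sum_distrib_left sum_distrib_right right_diff_distrib sum_subtractf mult_ac)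

lemma form_linear:
  assumes "finite S"
  shows "form e per (\<lambda>j. \<Sum>i\<in>S. smult (a i) (V i j)) w = (\<Sum>i\<in>S. a i * form e per (V i) w)"
  unfolding form_def local_form_linear[OF assms] sum_distrib_left by (rule sum.swap)

lemma form_linear_right:
  assumes "finite S"
  shows "form e per v (\<lambda>j. \<Sum>i\<in>S. smult (a i) (W i j)) = (\<Sum>i\<in>S. a i * form e per v (W i))"
  using form_linear[OF assms, of "\<not> e" per a W v] form_adjoint[of e per v] by (simp add: sum_negf)

lemma hat_cong:
  assumes "\<And>j. j \<in> {1..N} \<Longrightarrow> v j = v' j" "j \<le> N"
  shows "hat e per v j = hat e per v' j"
  using assms N1 by (auto simp: hat_def)

lemma local_form_cong:
  assumes "\<And>j. j \<in> {1..N} \<Longrightarrow> v j = v' j" "j \<in> {1..N}"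
  shows "local_form e per v j w = local_form e per v' j w"
  unfolding local_form_def using hat_cong[where e = e and per = per, OF assms(1)] assms by auto

lemma form_cong:
  assumes "\<And>j. j \<in> {1..N} \<Longrightarrow> v j = v' j" "\<And>j. j \<in> {1..N} \<Longrightarrow> w j = w' j"
  shows "form e per v w = form e per v' w'"
  unfolding form_def using local_form_cong[OF assms(1)] assms(2) by (intro sum.cong) auto

section \<open>Orthonormal coordinates\<close>

definition bas :: "nat \<times> nat \<Rightarrow> nat \<Rightarrow> real poly" where
  "bas i j = (if j = fst i then smult (sqrt ((2 * real (snd i) + 1) / (X j - X (j - 1)))) (Lc (X (j - 1)) (X j) (snd i)) else 0)"

definition coord :: "(nat \<Rightarrow> real poly) \<Rightarrow> nat \<times> nat \<Rightarrow> real" where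
  "coord v i = cint (fst i) (v (fst i)) (bas i (fst i))"

abbreviation "idx k \<equiv> {1..N} \<times> {..k}"

definition comb :: "nat \<Rightarrow> (nat \<times> nat \<Rightarrow> real) \<Rightarrow> nat \<Rightarrow> real poly" where
  "comb k a j = (\<Sum>i\<in>idx k. smult (a i) (bas i j))"

lemma comb_cell:
  assumes "j \<in> {1..N}"
  shows "comb k a j = (\<Sum>m\<le>k. smult (a (j, m)) (bas (j, m) j))"
proof -
  have "comb k a j = (\<Sum>j'\<in>{1..N}. \<Sum>m\<le>k. smult (a (j', m)) (bas (j', m) j))"
    unfolding comb_def by (simp add: sum.cartesian_product)
  also have "\<dots> = (\<Sum>j'\<in>{1..N}. if j' = j then \<Sum>m\<le>k. smult (a (j, m)) (bas (j, m) j) else 0)"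
    by (intro sum.cong refl) (auto simp: bas_def)
  finally show ?thesis using assms by simp
qed

lemma comb_coord:
  assumes j: "j \<in> {1..N}" and v: "degree (v j) \<le> k"
  shows "comb k (coord v) j = v j"
proof -
  have "X (j - 1) < X j" using X_less[OF j] .
  have "smult (coord v (j, m)) (bas (j, m) j) = smult (mom (X (j - 1)) (X j) m (poly (v j))) (Lc (X (j - 1)) (X j) m)" for m
  proof -
    define s where "s = sqrt ((2 * real m + 1) / (X j - X (j - 1)))"
    have s: "s * s = (2 * real m + 1) / (X j - X (j - 1))" using X_less[OF j] by (simp add: s_def)
    have "coord v (j, m) = s * integral {X (j - 1)..X j} (\<lambda>x. poly (v j) x * poly (Lc (X (j - 1)) (X j) m) x)"
      unfolding coord_def cint_def bas_def fst_conv snd_conv integral_mult_right[symmetric]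
      by (intro integral_cong) (simp add: s_def)
    moreover have "bas (j, m) j = smult s (Lc (X (j - 1)) (X j) m)" by (simp add: bas_def s_def)
    moreover have "s * I * s = (2 * real m + 1) / (X j - X (j - 1)) * I" for I
      using s by (metis mult.assoc mult.commute)
    ultimately show ?thesis by (simp only: smult_smult mom_def)
  qed
  hence "comb k (coord v) j = proj k (X (j - 1)) (X j) (poly (v j))"
    unfolding comb_cell[OF j] proj_def by simp
  thus ?thesis using proj_poly[OF X_less[OF j] v] by simp
qed

lemma degree_bas: "j \<in> {1..N} \<Longrightarrow> m \<le> k \<Longrightarrow> degree (bas (j, m) j) \<le> k"
  using degree_Lc[OF X_less] by (simp add: bas_def order.trans[OF degree_smult_le])

lemma form_coord:
  assumes "\<And>j. j \<in> {1..N} \<Longrightarrow> degree (v j) \<le> k"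
  shows "form e per v w = (\<Sum>i\<in>idx k. coord v i * form e per (bas i) w)"
proof -
  have "form e per v w = form e per (comb k (coord v)) w"
    using comb_coord assms by (intro form_cong) auto
  thus ?thesis unfolding comb_def[abs_def] by (simp add: form_linear)
qed

lemma form_bas:
  assumes "j \<in> {1..N}"
  shows "form e per v (bas (j, m)) = local_form e per v j (bas (j, m) j)"
proof -
  have "form e per v (bas (j, m)) = (\<Sum>j'=1..N. if j' = j then local_form e per v j (bas (j, m) j) else 0)"
    unfolding form_def by (intro sum.cong refl) (auto simp: bas_def local_form_def cint_def)
  thus ?thesis using assms by simp
qed

lemma integral_cell_coord:
  assumes "j \<in> {1..N}"
  shows "integral {X (j - 1)..X j} (poly (v j)) = sqrt (X j - X (j - 1)) * coord v (j, 0)"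
proof -
  have l: "X j - X (j - 1) > 0" using X_less[OF assms] by simp
  have "degree (Lc (X (j - 1)) (X j) 0) = 0" by (rule degree_Lc[OF X_less[OF assms]])
  then obtain d where "Lc (X (j - 1)) (X j) 0 = [:d:]" by (rule degree_eq_zeroE)
  moreover have "poly (Lc (X (j - 1)) (X j) 0) (X j) = 1" by (rule Lc_right[OF X_less[OF assms]])
  ultimately have L: "Lc (X (j - 1)) (X j) 0 = 1" by (simp add: one_pCons)
  have "coord v (j, 0) = sqrt (1 / (X j - X (j - 1))) * integral {X (j - 1)..X j} (poly (v j))"
    unfolding coord_def cint_def bas_def fst_conv snd_conv integral_mult_right[symmetric]
    by (intro integral_cong) (simp add: L[unfolded One_nat_def])
  thus ?thesis using l by (simp add: real_sqrt_divide)
qed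

section \<open>The inverse inequality for the discrete derivative\<close>

lemma bas_bounds:
  assumes q: "quasi_uniform c N X" and j: "j \<in> {1..N}" and m: "m \<le> k" and x: "x \<in> {X (j - 1)..X j}"
  shows "(poly (bas (j, m) j) x)\<^sup>2 \<le> (2 * real k + 1) * (PB k)\<^sup>2 * (c / h)"
    "\<bar>poly (bas (j, m) j) x\<bar> \<le> sqrt ((2 * real k + 1) / (X j - X (j - 1))) * PB k"
    "\<bar>poly (pderiv (bas (j, m) j)) x\<bar> \<le> sqrt ((2 * real k + 1) / (X j - X (j - 1))) * (2 / (X j - X (j - 1)) * PB k)"
    "1 / (X j - X (j - 1)) \<le> c / h"
proof -
  have l: "X j - X (j - 1) > 0" using X_less[OF j] by simp
  have "h \<le> c * (X j - X (j - 1))" using q j by (simp add: quasi_uniform_def cell_size_def)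
  thus lh: "1 / (X j - X (j - 1)) \<le> c / h" using l h_pos by (simp add: field_simps)
  have s: "sqrt ((2 * real m + 1) / (X j - X (j - 1))) \<le> sqrt ((2 * real k + 1) / (X j - X (j - 1)))"
    using m l by (intro real_sqrt_le_mono divide_right_mono) auto
  show b: "\<bar>poly (bas (j, m) j) x\<bar> \<le> sqrt ((2 * real k + 1) / (X j - X (j - 1))) * PB k"
    unfolding bas_def using s l PB(4)[OF X_less[OF j] m x] PB(1)[of k]
    by (auto simp: abs_mult intro!: mult_mono)
  show "\<bar>poly (pderiv (bas (j, m) j)) x\<bar> \<le> sqrt ((2 * real k + 1) / (X j - X (j - 1))) * (2 / (X j - X (j - 1)) * PB k)"
  proof -
    have "\<bar>poly (pderiv (bas (j, m) j)) x\<bar> = sqrt ((2 * real m + 1) / (X j - X (j - 1))) * \<bar>poly (pderiv (Lc (X (j - 1)) (X j) m)) x\<bar>"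
      using l by (simp add: bas_def pderiv_smult abs_mult)
    also have "\<dots> \<le> sqrt ((2 * real k + 1) / (X j - X (j - 1))) * (2 / (X j - X (j - 1)) * PB k)"
      using l by (intro mult_mono s PB(5)[OF X_less[OF j] m x]) auto
    finally show ?thesis .
  qed
  have "(poly (bas (j, m) j) x)\<^sup>2 \<le> (sqrt ((2 * real k + 1) / (X j - X (j - 1))) * PB k)\<^sup>2"
    using b by (metis abs_ge_zero power2_abs power_mono)
  also have "\<dots> = (2 * real k + 1) * (PB k)\<^sup>2 * (1 / (X j - X (j - 1)))"
    using l by (simp add: power_mult_distrib)
  also have "\<dots> \<le> (2 * real k + 1) * (PB k)\<^sup>2 * (c / h)" by (intro mult_left_mono lh) auto
  finally show "(poly (bas (j, m) j) x)\<^sup>2 \<le> (2 * real k + 1) * (PB k)\<^sup>2 * (c / h)" .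
qed

lemma square_sum3: "(x - y - z)\<^sup>2 \<le> 3 * (x\<^sup>2 + y\<^sup>2 + z\<^sup>2)" for x y z :: real
proof -
  have "0 \<le> (x + y)\<^sup>2 + (x + z)\<^sup>2 + (y - z)\<^sup>2" by simp
  thus ?thesis by (simp add: power2_eq_square algebra_simps)
qed

text \<open>Every flux value is zero or the trace of one cell, and within each sum no cell is used
  twice, so the sums are compared after a shift of the index, cyclic in the periodic case.\<close>

lemma hat_square_sum:
  assumes "\<And>j x. j \<in> {1..N} \<Longrightarrow> x \<in> {X (j - 1)..X j} \<Longrightarrow> (poly (v j) x)\<^sup>2 \<le> z j"
  shows "(\<Sum>j=1..N. (hat e per v j)\<^sup>2) \<le> (\<Sum>j=1..N. z j)" "(\<Sum>j=1..N. (hat e per v (j - 1))\<^sup>2) \<le> (\<Sum>j=1..N. z j)"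
proof -
  obtain n where n: "N = Suc n" using N1 by (cases N) auto
  have r: "(poly (v j) (X j))\<^sup>2 \<le> z j" "(poly (v j) (X (j - 1)))\<^sup>2 \<le> z j" if "j \<in> {1..N}" for j
    using assms[OF that] X_less[OF that] by auto
  have z0: "z j \<ge> 0" if "j \<in> {1..N}" for j using r(1)[OF that] zero_le_power2 order.trans by blast
  have T1: "(\<Sum>j=1..N. (hat True per v j)\<^sup>2) \<le> (\<Sum>j=1..N. z j)"
    using r by (intro sum_mono) (simp add: hat_True)
  have F1: "(\<Sum>j=1..N. (hat False per v (j - 1))\<^sup>2) \<le> (\<Sum>j=1..N. z j)"
    using r hat_False by (intro sum_mono) (metis)
  have T2: "(\<Sum>j=1..N. (hat True per v (j - 1))\<^sup>2) \<le> (\<Sum>j=1..N. z j)"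
  proof -
    have "(\<Sum>j=1..Suc n. (hat True per v (j - 1))\<^sup>2) = (hat True per v 0)\<^sup>2 + (\<Sum>j=1..n. (hat True per v j)\<^sup>2)"
      by (simp add: sum.atLeast_Suc_atMost sum.shift_bounds_cl_Suc_ivl del: sum.cl_ivl_Suc)
    also have "\<dots> \<le> z (Suc n) + (\<Sum>j=1..n. z j)"
    proof (rule add_mono)
      have "(hat True per v 0)\<^sup>2 \<le> z N" using r(1)[of N] z0[of N] N1 by (auto simp: hat_def)
      thus "(hat True per v 0)\<^sup>2 \<le> z (Suc n)" by (simp only: n[symmetric])
      show "(\<Sum>j=1..n. (hat True per v j)\<^sup>2) \<le> (\<Sum>j=1..n. z j)"
      proof (rule sum_mono)
        fix j assume "j \<in> {1..n}"
        hence "j \<in> {1..N}" by (simp add: n)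
        thus "(hat True per v j)\<^sup>2 \<le> z j" using r(1)[of j] by (simp only: hat_True)
      qed
    qed
    finally show ?thesis by (simp add: n)
  qed
  have F2: "(\<Sum>j=1..N. (hat False per v j)\<^sup>2) \<le> (\<Sum>j=1..N. z j)"
  proof -
    have "(\<Sum>j=1..Suc n. (hat False per v j)\<^sup>2) = (\<Sum>j=1..n. (hat False per v j)\<^sup>2) + (hat False per v N)\<^sup>2"
      by (simp add: n)
    also have "\<dots> \<le> (\<Sum>j=1..n. z (Suc j)) + z 1"
    proof (rule add_mono)
      show "(hat False per v N)\<^sup>2 \<le> z 1" using r(2)[of 1] z0[of 1] N1 X0 by (auto simp: hat_def)
      show "(\<Sum>j=1..n. (hat False per v j)\<^sup>2) \<le> (\<Sum>j=1..n. z (Suc j))"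
      proof (rule sum_mono)
        fix j assume "j \<in> {1..n}"
        hence "Suc j \<in> {1..N}" "j \<noteq> N" by (auto simp: n)
        thus "(hat False per v j)\<^sup>2 \<le> z (Suc j)" using r(2)[of "Suc j"] by (simp add: hat_def)
      qed
    qed
    also have "\<dots> = (\<Sum>j=1..Suc n. z j)"
      by (simp add: sum.atLeast_Suc_atMost sum.shift_bounds_cl_Suc_ivl del: sum.cl_ivl_Suc)
    finally show ?thesis by (simp add: n)
  qed
  show "(\<Sum>j=1..N. (hat e per v j)\<^sup>2) \<le> (\<Sum>j=1..N. z j)" using T1 F2 by (cases e) auto
  show "(\<Sum>j=1..N. (hat e per v (j - 1))\<^sup>2) \<le> (\<Sum>j=1..N. z j)" using T2 F1 by (cases e) auto
qed

text \<open>The operator norm of the discrete derivative is of order 1/h: traces and derivatives of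
  basis functions scale with the cell size, and quasi-uniformity converts every cell size into
  h.\<close>

lemma form_bound:
  fixes k :: nat
  assumes q: "quasi_uniform c N X"
  defines "A \<equiv> (2 * real k + 1) * (PB k)\<^sup>2"
  shows "(\<Sum>i'\<in>idx k. (\<Sum>i\<in>idx k. v i * form e per (bas i) (bas i'))\<^sup>2)
     \<le> (5 * (real k + 1) * A * c / h)\<^sup>2 * (\<Sum>i\<in>idx k. (v i)\<^sup>2)"
proof -
  define V where "V = comb k v"
  define R where "R = c / h"
  define S where "S j = (\<Sum>m\<le>k. (v (j, m))\<^sup>2)" for j
  have A: "A \<ge> 0" by (simp add: A_def)
  have S0: "S j \<ge> 0" for j unfolding S_def by (intro sum_nonneg) simp
  have R: "R \<ge> 0"
  proof -
    have "1 \<in> {1..N}" using N1 by simp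
    have "1 / (X 1 - X (1 - 1)) \<le> R" unfolding R_def
      using bas_bounds(4)[OF q \<open>1 \<in> {1..N}\<close>, of 0 k "X 1"] X_less[OF \<open>1 \<in> {1..N}\<close>] by auto
    moreover have "0 \<le> 1 / (X 1 - X (1 - 1))" using X_less[OF \<open>1 \<in> {1..N}\<close>] by simp
    ultimately show ?thesis by linarith
  qed
  have CS: "(\<Sum>m\<le>k. v (j, m) * x m)\<^sup>2 \<le> S j * ((real k + 1) * y)" if "\<And>m. m \<le> k \<Longrightarrow> (x m)\<^sup>2 \<le> y" for x y j
  proof -
    have "(\<Sum>m\<le>k. v (j, m) * x m)\<^sup>2 \<le> S j * (\<Sum>m\<le>k. (x m)\<^sup>2)"
      unfolding S_def by (rule Cauchy_Schwarz_ineq_sum)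
    also have "\<dots> \<le> S j * (\<Sum>m\<le>k. y)" using that by (intro mult_left_mono sum_mono S0) auto
    finally show ?thesis by (simp add: algebra_simps)
  qed
  have Vx: "(poly (V j) x)\<^sup>2 \<le> S j * ((real k + 1) * (A * R))" if "j \<in> {1..N}" "x \<in> {X (j - 1)..X j}" for j x
  proof -
    have "poly (V j) x = (\<Sum>m\<le>k. v (j, m) * poly (bas (j, m) j) x)"
      unfolding V_def comb_cell[OF that(1)] by (simp add: poly_sum)
    thus ?thesis using CS[of "\<lambda>m. poly (bas (j, m) j) x" "A * R" j] bas_bounds(1)[OF q that(1) _ that(2)]
      by (simp add: A_def R_def)
  qed
  have Vc: "(cint j (V j) (pderiv (bas (j, m') j)))\<^sup>2 \<le> S j * ((real k + 1) * (2 * A * R)\<^sup>2)"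
    if j: "j \<in> {1..N}" and m': "m' \<le> k" for j m'
  proof -
    define l where "l = X j - X (j - 1)"
    have l: "l > 0" "1 / l \<le> R" using X_less[OF j] bas_bounds(4)[OF q j m', of "X j"] by (auto simp: l_def R_def)
    have "(cint j (bas (j, m) j) (pderiv (bas (j, m') j)))\<^sup>2 \<le> (2 * A * R)\<^sup>2" if m: "m \<le> k" for m
    proof -
      have "\<bar>cint j (bas (j, m) j) (pderiv (bas (j, m') j))\<bar> \<le>
         (sqrt ((2 * real k + 1) / l) * PB k) * (sqrt ((2 * real k + 1) / l) * (2 / l * PB k)) * (X j - X (j - 1))"
        unfolding cint_def
      proof (rule abs_integral_le)
        fix x assume x: "x \<in> {X (j - 1)..X j}"
        show "\<bar>poly (bas (j, m) j) x * poly (pderiv (bas (j, m') j)) x\<bar> \<le>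
          (sqrt ((2 * real k + 1) / l) * PB k) * (sqrt ((2 * real k + 1) / l) * (2 / l * PB k))"
          unfolding abs_mult l_def using bas_bounds(2)[OF q j m x] bas_bounds(3)[OF q j m' x] PB(1)[of k] X_less[OF j]
          by (intro mult_mono) auto
      qed (use X_less[OF j] in \<open>auto intro!: continuous_intros\<close>)
      also have "\<dots> = (sqrt ((2 * real k + 1) / l) * sqrt ((2 * real k + 1) / l)) * (2 * (PB k)\<^sup>2)"
      proof -
        have lX: "X j - X (j - Suc 0) = l" by (simp add: l_def)
        have "a * P * (a * (2 / l * P)) * l = a * a * (2 * (P * P))" for a P using l by simp
        thus ?thesis by (simp only: lX power2_eq_square One_nat_def)
      qed
      also have "\<dots> = 2 * A * (1 / l)" using l by (simp add: A_def)
      also have "\<dots> \<le> 2 * A * R" using l A by (intro mult_left_mono) auto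
      finally show ?thesis by (metis abs_ge_zero power2_abs power_mono)
    qed
    moreover have "cint j (V j) (pderiv (bas (j, m') j)) = (\<Sum>m\<le>k. v (j, m) * cint j (bas (j, m) j) (pderiv (bas (j, m') j)))"
      unfolding V_def comb_cell[OF j] by (simp add: cint_linear)
    ultimately show ?thesis using CS[of "\<lambda>m. cint j (bas (j, m) j) (pderiv (bas (j, m') j))"] by simp
  qed
  have d: "(\<Sum>i\<in>idx k. v i * form e per (bas i) (bas (j, m)))\<^sup>2 \<le>
      3 * ((A * R) * (hat e per V j)\<^sup>2 + (A * R) * (hat e per V (j - 1))\<^sup>2 + S j * ((real k + 1) * (2 * A * R)\<^sup>2))"
    if j: "j \<in> {1..N}" and m: "m \<le> k" for j m
  proof -
    have "(\<Sum>i\<in>idx k. v i * form e per (bas i) (bas (j, m))) = form e per V (bas (j, m))"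
      unfolding V_def comb_def[abs_def] by (simp add: form_linear)
    also have "\<dots> = local_form e per V j (bas (j, m) j)" by (rule form_bas[OF j])
    finally have "(\<Sum>i\<in>idx k. v i * form e per (bas i) (bas (j, m)))\<^sup>2 \<le>
      3 * ((hat e per V j * poly (bas (j, m) j) (X j))\<^sup>2 + (hat e per V (j - 1) * poly (bas (j, m) j) (X (j - 1)))\<^sup>2
        + (cint j (V j) (pderiv (bas (j, m) j)))\<^sup>2)"
      unfolding local_form_def by (simp only: square_sum3)
    also have "\<dots> \<le> 3 * ((A * R) * (hat e per V j)\<^sup>2 + (A * R) * (hat e per V (j - 1))\<^sup>2 + S j * ((real k + 1) * (2 * A * R)\<^sup>2))"
    proof (intro mult_left_mono add_mono Vc[OF j m])
      have ends: "X j \<in> {X (j - 1)..X j}" "X (j - 1) \<in> {X (j - 1)..X j}" using X_less[OF j] by auto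
      have "(hat e per V j)\<^sup>2 * (poly (bas (j, m) j) (X j))\<^sup>2 \<le> (hat e per V j)\<^sup>2 * (A * R)"
        using bas_bounds(1)[OF q j m ends(1)] by (intro mult_left_mono) (auto simp: A_def R_def)
      thus "(hat e per V j * poly (bas (j, m) j) (X j))\<^sup>2 \<le> A * R * (hat e per V j)\<^sup>2"
        by (simp add: power_mult_distrib mult.commute)
      have "(hat e per V (j - 1))\<^sup>2 * (poly (bas (j, m) j) (X (j - 1)))\<^sup>2 \<le> (hat e per V (j - 1))\<^sup>2 * (A * R)"
        using bas_bounds(1)[OF q j m ends(2)] by (intro mult_left_mono) (auto simp: A_def R_def)
      thus "(hat e per V (j - 1) * poly (bas (j, m) j) (X (j - 1)))\<^sup>2 \<le> A * R * (hat e per V (j - 1))\<^sup>2"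
        by (simp add: power_mult_distrib mult.commute)
    qed simp
    finally show ?thesis .
  qed
  define \<Sigma> where "\<Sigma> = (\<Sum>j=1..N. S j)"
  have \<Sigma>0: "\<Sigma> \<ge> 0" unfolding \<Sigma>_def by (intro sum_nonneg S0)
  have hats: "(\<Sum>j=1..N. (hat e per V j)\<^sup>2) \<le> (real k + 1) * (A * R) * \<Sigma>"
    "(\<Sum>j=1..N. (hat e per V (j - 1))\<^sup>2) \<le> (real k + 1) * (A * R) * \<Sigma>"
    using hat_square_sum[of V "\<lambda>j. S j * ((real k + 1) * (A * R))", OF Vx] 
    by (simp_all add: \<Sigma>_def sum_distrib_right[symmetric] mult.commute)
  have "(\<Sum>i'\<in>idx k. (\<Sum>i\<in>idx k. v i * form e per (bas i) (bas i'))\<^sup>2) =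
     (\<Sum>j=1..N. \<Sum>m\<le>k. (\<Sum>i\<in>idx k. v i * form e per (bas i) (bas (j, m)))\<^sup>2)"
    by (simp add: sum.cartesian_product case_prod_unfold)
  also have "\<dots> \<le> (\<Sum>j=1..N. \<Sum>m\<le>k. 3 * ((A * R) * (hat e per V j)\<^sup>2 + (A * R) * (hat e per V (j - 1))\<^sup>2 + S j * ((real k + 1) * (2 * A * R)\<^sup>2)))"
    by (intro sum_mono d) auto
  also have "\<dots> = 3 * (real k + 1) * ((A * R) * (\<Sum>j=1..N. (hat e per V j)\<^sup>2) + (A * R) * (\<Sum>j=1..N. (hat e per V (j - 1))\<^sup>2) + \<Sigma> * ((real k + 1) * (2 * A * R)\<^sup>2))"
    unfolding \<Sigma>_def by (simp add: sum.distrib sum_distrib_left[symmetric] sum_distrib_right[symmetric] algebra_simps)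
  also have "\<dots> \<le> 3 * (real k + 1) * ((A * R) * ((real k + 1) * (A * R) * \<Sigma>) + (A * R) * ((real k + 1) * (A * R) * \<Sigma>) + \<Sigma> * ((real k + 1) * (2 * A * R)\<^sup>2))"
    using A R hats by (intro mult_left_mono add_mono order.refl) auto
  also have "\<dots> = 18 * ((real k + 1)\<^sup>2 * (A * R)\<^sup>2 * \<Sigma>)"
    by (simp add: power2_eq_square algebra_simps)
  \<comment> \<open>18 is 3 times 1 + 1 + 4, from the two traces and the integral; it is rounded up
    to the square of 5.\<close>
  also have "\<dots> \<le> 25 * ((real k + 1)\<^sup>2 * (A * R)\<^sup>2 * \<Sigma>)" using \<Sigma>0 by (intro mult_right_mono mult_nonneg_nonneg) auto
  also have "\<dots> = (5 * (real k + 1) * A * c / h)\<^sup>2 * \<Sigma>"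
  proof -
    have "5 * (real k + 1) * A * c / h = 5 * ((real k + 1) * (A * R))" by (simp add: R_def mult.assoc)
    thus ?thesis by (simp only: power_mult_distrib) simp
  qed
  also have "\<Sigma> = (\<Sum>i\<in>idx k. (v i)\<^sup>2)"
    unfolding \<Sigma>_def S_def by (simp add: sum.cartesian_product case_prod_unfold)
  finally show ?thesis .
qed

section \<open>Boundary traces\<close>

definition tr :: "bool \<Rightarrow> (nat \<Rightarrow> real poly) \<Rightarrow> real" where
  "tr e v = (if e then poly (v N) (X N) else poly (v 1) (X 0))"

lemma cint_self: "j \<in> {1..N} \<Longrightarrow> 2 * cint j v (pderiv v) = (poly v (X j))\<^sup>2 - (poly v (X (j - 1)))\<^sup>2"
  using cint_parts[of j v v] by (simp add: power2_eq_square)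

text \<open>Numerical dissipation of one-sided fluxes: up to sign, twice the form on the diagonal is
  the squared trace at the free end plus the squared jumps at the mesh points, and the jumps are
  dropped.\<close>

lemma trace_square: "(tr e v)\<^sup>2 \<le> 2 * \<bar>form e False v v\<bar>"
proof (cases e)
  case True
  have "(hat True False v j)\<^sup>2 - (hat True False v (j - 1))\<^sup>2 \<le> 2 * local_form True False v j (v j)" if j: "j \<in> {1..N}" for j
    using cint_self[OF j, of "v j"] hat_True[OF j, of False v] zero_le_power2[of "hat True False v (j - 1) - poly (v j) (X (j - 1))"]
    by (simp add: local_form_def power2_eq_square algebra_simps)
  hence "(\<Sum>j=1..N. (hat True False v j)\<^sup>2 - (hat True False v (j - 1))\<^sup>2) \<le> 2 * form True False v v"
    unfolding form_def sum_distrib_left by (rule sum_mono)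
  hence "(hat True False v N)\<^sup>2 - (hat True False v 0)\<^sup>2 \<le> 2 * form True False v v"
    using sum_telescope_1[of "\<lambda>j. (hat True False v j)\<^sup>2" N] by simp
  thus ?thesis using True N1 by (simp add: tr_def hat_def)
next
  case False
  have "2 * local_form False False v j (v j) \<le> (hat False False v j)\<^sup>2 - (hat False False v (j - 1))\<^sup>2" if j: "j \<in> {1..N}" for j
    using cint_self[OF j, of "v j"] hat_False[OF j, of False v] zero_le_power2[of "hat False False v j - poly (v j) (X j)"]
    by (simp add: local_form_def power2_eq_square algebra_simps)
  hence "2 * form False False v v \<le> (\<Sum>j=1..N. (hat False False v j)\<^sup>2 - (hat False False v (j - 1))\<^sup>2)"
    unfolding form_def sum_distrib_left by (rule sum_mono)
  hence "2 * form False False v v \<le> (hat False False v N)\<^sup>2 - (hat False False v 0)\<^sup>2"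
    using sum_telescope_1[of "\<lambda>j. (hat False False v j)\<^sup>2" N] by simp
  thus ?thesis using False N1 by (simp add: tr_def hat_def)
qed

lemma form_one: "form e per v (\<lambda>_. 1) = (if per then 0 else if e then tr e v else - tr e v)"
proof -
  have "form e per v (\<lambda>_. 1) = (\<Sum>j=1..N. hat e per v j - hat e per v (j - 1))"
    by (simp add: form_def local_form_def cint_def)
  also have "\<dots> = hat e per v N - hat e per v 0" by (rule sum_telescope_1)
  finally show ?thesis using N1 by (auto simp: hat_def tr_def)
qed

lemma tr_comb: "tr e (comb k (\<lambda>i. v i + w i)) = tr e (comb k v) + tr e (comb k w)"
  by (simp add: tr_def comb_def poly_sum sum.distrib algebra_simps)

end

subsection \<open>The error system\<close>

text \<open>The nodes lie strictly inside the cell because the numerical solution is known to be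
  differentiable in time only there, and only pointwise.\<close>

lemma lagrange_basis:
  fixes a b :: real
  assumes "a < b"
  obtains xs :: "nat \<Rightarrow> real" and ls :: "nat \<Rightarrow> real poly" where
    "\<And>i. i \<le> k \<Longrightarrow> xs i \<in> {a<..<b}"
    "\<And>p. degree p \<le> k \<Longrightarrow> p = (\<Sum>i\<le>k. smult (poly p (xs i)) (ls i))"
proof -
  define xs where "xs i = a + (b - a) * (real i + 1) / (real k + 2)" for i :: nat
  define ls where "ls i = (\<Prod>l\<in>{..k} - {i}. smult (1 / (xs i - xs l)) [:- xs l, 1:])" for i
  have xs_in: "xs i \<in> {a<..<b}" if "i \<le> k" for i
  proof -
    have "(b - a) * (real i + 1) < (b - a) * (real k + 2)" using assms that by (intro mult_strict_left_mono) auto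
    hence "(b - a) * (real i + 1) / (real k + 2) < b - a" by (subst divide_less_eq) auto
    moreover have "0 < (b - a) * (real i + 1) / (real k + 2)" using assms by (intro divide_pos_pos mult_pos_pos) auto
    ultimately show ?thesis by (simp add: xs_def)
  qed
  have inj: "xs i = xs j \<longleftrightarrow> i = j" for i j using assms by (simp add: xs_def)
  have ev: "poly (ls i) (xs j) = (if i = j then 1 else 0)" if "i \<le> k" "j \<le> k" for i j
  proof (cases "i = j")
    case True
    have "poly (smult (1 / (xs i - xs l)) [:- xs l, 1:]) (xs i) = 1" if "l \<noteq> i" for l
      using inj[of i l] that by (simp add: diff_divide_distrib[symmetric])
    hence "poly (ls i) (xs i) = (\<Prod>l\<in>{..k} - {i}. 1)"
      unfolding ls_def poly_prod by (intro prod.cong) auto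
    thus ?thesis using True by simp
  next
    case False
    thus ?thesis unfolding ls_def poly_prod using that by (auto intro!: bexI[of _ j])
  qed
  have deg: "degree (ls i) \<le> k" if "i \<le> k" for i
  proof -
    have "degree (ls i) \<le> (\<Sum>l\<in>{..k} - {i}. degree (smult (1 / (xs i - xs l)) [:- xs l, 1:]))"
      unfolding ls_def by (rule degree_prod_sum_le[unfolded o_def]) simp
    also have "\<dots> \<le> (\<Sum>l\<in>{..k} - {i}. 1)" by (intro sum_mono) auto
    also have "\<dots> = k" using that by simp
    finally show ?thesis .
  qed
  show ?thesis
  proof (rule that[of xs ls])
    show "xs i \<in> {a<..<b}" if "i \<le> k" for i by (rule xs_in[OF that])
    fix p :: "real poly" assume p: "degree p \<le> k"
    define r where "r = p - (\<Sum>i\<le>k. smult (poly p (xs i)) (ls i))"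
    have "poly r (xs j) = 0" if "j \<le> k" for j
    proof -
      have "(\<Sum>i\<le>k. poly p (xs i) * poly (ls i) (xs j)) = (\<Sum>i\<le>k. if i = j then poly p (xs j) else 0)"
        using ev that by (intro sum.cong) auto
      thus ?thesis using that by (simp add: r_def poly_sum)
    qed
    hence sub: "xs ` {..k} \<subseteq> {x. poly r x = 0}" by auto
    have card: "card (xs ` {..k}) = Suc k" using inj by (subst card_image) (auto simp: inj_on_def)
    have "degree r \<le> k" unfolding r_def
      using deg p by (intro degree_diff_le degree_sum_le) (auto intro: order.trans[OF degree_smult_le])
    hence "r = 0"
      using card_mono[OF poly_roots_finite[of r] sub] card card_poly_roots_bound[of r] by fastforce
    thus "p = (\<Sum>i\<le>k. smult (poly p (xs i)) (ls i))" by (simp add: r_def)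
  qed
qed

text \<open>In the nodal basis the moment is a finite combination of point values, so pointwise
  differentiability in time is enough and no uniformity in x has to be established.\<close>

lemma poly_cell_moment_deriv:
  fixes w :: "real \<Rightarrow> real \<Rightarrow> real"
  assumes T: "T > 0" and ab: "a < b"
    and P: "\<And>t. t \<in> {0..T} \<Longrightarrow> degree (P t) \<le> k"
    and wP: "\<And>t x. t \<in> {0..T} \<Longrightarrow> x \<in> {a<..<b} \<Longrightarrow> w x t = poly (P t) x"
    and D: "\<And>x. x \<in> {a<..<b} \<Longrightarrow> (\<lambda>t. w x t) differentiable_on {0..T}"
    and t: "t \<in> {0..T}"
  shows "((\<lambda>s. integral {a..b} (\<lambda>x. poly (P s) x * poly r x)) has_real_derivative
     integral {a..b} (\<lambda>x. time_deriv T (\<lambda>s. w x s) t * poly r x)) (at t within {0..T})"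
proof -
  obtain xs :: "nat \<Rightarrow> real" and ls :: "nat \<Rightarrow> real poly" where xs: "\<And>i. i \<le> k \<Longrightarrow> xs i \<in> {a<..<b}"
    and ls: "\<And>p. degree p \<le> k \<Longrightarrow> p = (\<Sum>i\<le>k. smult (poly p (xs i)) (ls i))" by (rule lagrange_basis[OF ab, where k = k]) blast
  have wd: "((\<lambda>s. w x s) has_real_derivative time_deriv T (\<lambda>s. w x s) t) (at t within {0..T})" if x: "x \<in> {a<..<b}" for x
  proof -
    have "\<exists>d. ((\<lambda>s. w x s) has_real_derivative d) (at t within {0..T})"
      using D[OF x] t unfolding differentiable_on_def real_differentiable_def by blast
    then obtain d where d: "((\<lambda>s. w x s) has_real_derivative d) (at t within {0..T})" ..
    thus ?thesis using time_deriv_eq[OF T t refl d] by simp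
  qed
  have wx: "w x s = (\<Sum>i\<le>k. w (xs i) s * poly (ls i) x)" if "x \<in> {a<..<b}" "s \<in> {0..T}" for x s
  proof -
    have "w x s = poly (\<Sum>i\<le>k. smult (poly (P s) (xs i)) (ls i)) x"
      using wP[OF that(2,1)] ls[OF P[OF that(2)]] by simp
    also have "\<dots> = (\<Sum>i\<le>k. w (xs i) s * poly (ls i) x)"
      unfolding poly_sum using wP[OF that(2) xs] by (intro sum.cong) auto
    finally show ?thesis .
  qed
  have td: "time_deriv T (\<lambda>s. w x s) t = (\<Sum>i\<le>k. time_deriv T (\<lambda>s. w (xs i) s) t * poly (ls i) x)" if "x \<in> {a<..<b}" for x
    by (rule time_deriv_eq[OF T t wx[OF that]]) (auto intro!: DERIV_sum DERIV_cmult_right wd xs)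
  have I1: "integral {a..b} (\<lambda>x. poly (P s) x * poly r x) = (\<Sum>i\<le>k. w (xs i) s * integral {a..b} (poly (ls i * r)))" if s: "s \<in> {0..T}" for s
  proof -
    have "integral {a..b} (\<lambda>x. poly (P s) x * poly r x) = integral {a..b} (\<lambda>x. \<Sum>i\<le>k. w (xs i) s * poly (ls i * r) x)"
      using wP[OF s xs] by (subst ls[OF P[OF s]]) (auto intro!: integral_cong sum.cong simp: poly_sum sum_distrib_right mult.assoc)
    thus ?thesis by (simp only: integral_poly_sum finite_atMost)
  qed
  have I2: "integral {a..b} (\<lambda>x. time_deriv T (\<lambda>s. w x s) t * poly r x) = (\<Sum>i\<le>k. time_deriv T (\<lambda>s. w (xs i) s) t * integral {a..b} (poly (ls i * r)))"
  proof -
    have "integral {a<..<b} (\<lambda>x. time_deriv T (\<lambda>s. w x s) t * poly r x) = integral {a<..<b} (\<lambda>x. \<Sum>i\<le>k. time_deriv T (\<lambda>s. w (xs i) s) t * poly (ls i * r) x)"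
      by (intro integral_cong) (simp add: td sum_distrib_right mult.assoc)
    thus ?thesis by (simp only: integral_open_interval_real[symmetric] integral_poly_sum finite_atMost)
  qed
  have "((\<lambda>s. \<Sum>i\<le>k. w (xs i) s * integral {a..b} (poly (ls i * r))) has_real_derivative
     (\<Sum>i\<le>k. time_deriv T (\<lambda>s. w (xs i) s) t * integral {a..b} (poly (ls i * r)))) (at t within {0..T})"
    by (intro DERIV_sum DERIV_cmult_right wd xs) auto
  thus ?thesis unfolding I2
    by (rule has_field_derivative_transform_within[OF _ zero_less_one t]) (simp add: I1)
qed

section \<open>Error equations\<close>

text \<open>\<open>e\<close> is true for flux choice (I), \<open>per\<close> for periodic boundary
  conditions; \<open>pu\<close> and \<open>pq\<close> are the cell polynomials of the numerical
  solution, \<open>fu\<close> and \<open>fq\<close> its numerical fluxes with the boundary data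
  built in. The two flux assumptions express that the boundary data cancel in the error, so that one
  homogeneous form treats all boundary conditions.\<close>

locale ldg_error = smooth_heat T M K U + mesh N X
  for T M K U N X +
  fixes k :: nat and c :: real and e per :: bool and uh :: "real \<Rightarrow> real \<Rightarrow> real"
    and pu pq :: "real \<Rightarrow> nat \<Rightarrow> real poly" and fu fq :: "real \<Rightarrow> nat \<Rightarrow> real"
  assumes K: "K = 2 * k + 1" and k: "k \<ge> 1" and quasi: "quasi_uniform c N X"
    and pu_deg: "\<And>t j. t \<in> {0..T} \<Longrightarrow> j \<in> {1..N} \<Longrightarrow> degree (pu t j) \<le> k"
    and pq_deg: "\<And>t j. t \<in> {0..T} \<Longrightarrow> j \<in> {1..N} \<Longrightarrow> degree (pq t j) \<le> k"
    and pu_eq: "\<And>t j x. t \<in> {0..T} \<Longrightarrow> j \<in> {1..N} \<Longrightarrow> x \<in> {X (j - 1)<..<X j} \<Longrightarrow> uh x t = poly (pu t j) x"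
    and uh_diff: "\<And>j x. j \<in> {1..N} \<Longrightarrow> x \<in> {X (j - 1)<..<X j} \<Longrightarrow> (\<lambda>t. uh x t) differentiable_on {0..T}"
    and scheme1: "\<And>t j r. t \<in> {0..T} \<Longrightarrow> j \<in> {1..N} \<Longrightarrow> degree r \<le> k \<Longrightarrow>
       integral {X (j - 1)..X j} (\<lambda>x. time_deriv T (\<lambda>s. uh x s) t * poly r x)
         = - cint j (pq t j) (pderiv r) + fq t j * poly r (X j) - fq t (j - 1) * poly r (X (j - 1))"
    and scheme2: "\<And>t j r. t \<in> {0..T} \<Longrightarrow> j \<in> {1..N} \<Longrightarrow> degree r \<le> k \<Longrightarrow>
       cint j (pq t j) r = - cint j (pu t j) (pderiv r) + fu t j * poly r (X j) - fu t (j - 1) * poly r (X (j - 1))"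
    and flux_u: "\<And>t i. t \<in> {0..T} \<Longrightarrow> i \<le> N \<Longrightarrow> U 0 (X i) t - fu t i =
       hat e per (\<lambda>j. corrected e k (X (j - 1)) (X j) (\<lambda>x. U 0 x t) (cc e k (X (j - 1)) (X j) t) - pu t j) i"
    and flux_q: "\<And>t i. t \<in> {0..T} \<Longrightarrow> i \<le> N \<Longrightarrow> U 1 (X i) t - fq t i =
       hat (\<not> e) per (\<lambda>j. corrected (\<not> e) k (X (j - 1)) (X j) (\<lambda>x. U 1 x t) (\<lambda>n. cc e k (X (j - 1)) (X j) t (Suc n)) - pq t j) i"
    and init: "\<And>j. j \<in> {1..N} \<Longrightarrow> pu 0 j = corrected e k (X (j - 1)) (X j) (\<lambda>x. U 0 x 0) (cc e k (X (j - 1)) (X j) 0)"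
begin

definition UI :: "real \<Rightarrow> nat \<Rightarrow> real poly" where
  "UI t j = corrected e k (X (j - 1)) (X j) (\<lambda>x. U 0 x t) (cc e k (X (j - 1)) (X j) t)"

text \<open>The time derivative of \<open>UI\<close>, as far as moments are concerned: two space
  derivatives more, hence every coefficient index moves up by two while the end points stay the
  same.\<close>

definition UI' :: "real \<Rightarrow> nat \<Rightarrow> real poly" where
  "UI' t j = corrected e k (X (j - 1)) (X j) (\<lambda>x. U 2 x t) (\<lambda>n. cc e k (X (j - 1)) (X j) t (n + 2))"

definition QI :: "real \<Rightarrow> nat \<Rightarrow> real poly" where
  "QI t j = corrected (\<not> e) k (X (j - 1)) (X j) (\<lambda>x. U 1 x t) (\<lambda>n. cc e k (X (j - 1)) (X j) t (Suc n))"

definition \<xi> :: "real \<Rightarrow> nat \<Rightarrow> real poly" where "\<xi> t j = UI t j - pu t j"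
definition \<zeta> :: "real \<Rightarrow> nat \<Rightarrow> real poly" where "\<zeta> t j = QI t j - pq t j"

definition top1 :: "real \<Rightarrow> nat \<Rightarrow> real poly" where
  "top1 t j = smult (((X j - X (j - 1)) / 2) ^ k * cc e k (X (j - 1)) (X j) t (k + 2)) (EP k (X (j - 1)) (X j) k e)"

definition top2 :: "real \<Rightarrow> nat \<Rightarrow> real poly" where
  "top2 t j = smult (((X j - X (j - 1)) / 2) ^ k * cc e k (X (j - 1)) (X j) t (k + 1)) (EP k (X (j - 1)) (X j) k (\<not> e))"

lemma flux_u': "t \<in> {0..T} \<Longrightarrow> i \<le> N \<Longrightarrow> U 0 (X i) t - fu t i = hat e per (\<xi> t) i"
  using flux_u[of t i] by (simp add: \<xi>_def[abs_def] UI_def)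

lemma flux_q': "t \<in> {0..T} \<Longrightarrow> i \<le> N \<Longrightarrow> U 1 (X i) t - fq t i = hat (\<not> e) per (\<zeta> t) i"
  using flux_q[of t i] by (simp add: \<zeta>_def[abs_def] QI_def)

lemma degrees:
  assumes "t \<in> {0..T}" "j \<in> {1..N}"
  shows "degree (\<xi> t j) \<le> k" "degree (\<zeta> t j) \<le> k" "degree (top1 t j) \<le> k" "degree (top2 t j) \<le> k"
proof -
  note ab = X_less[OF assms(2)]
  show "degree (\<xi> t j) \<le> k" unfolding \<xi>_def UI_def
    by (rule degree_diff_le[OF degree_corrected[OF ab] pu_deg[OF assms]])
  show "degree (\<zeta> t j) \<le> k" unfolding \<zeta>_def QI_def
    by (rule degree_diff_le[OF degree_corrected[OF ab] pq_deg[OF assms]])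
  show "degree (top1 t j) \<le> k" unfolding top1_def
    by (rule order.trans[OF degree_smult_le degree_EP[OF ab]])
  show "degree (top2 t j) \<le> k" unfolding top2_def
    by (rule order.trans[OF degree_smult_le degree_EP[OF ab]])
qed

lemma U_cont_cell:
  assumes "i \<le> K" "t \<in> {0..T}" "j \<in> {1..N}"
  shows "continuous_on {X (j - 1)..X j} (\<lambda>x. U i x t)"
  using assms cell_range[OF assms(3)] by (intro U_cont_x) auto

lemma U_parts:
  assumes i: "i < K" and t: "t \<in> {0..T}" and j: "j \<in> {1..N}"
  shows "integral {X (j - 1)..X j} (\<lambda>x. U (Suc i) x t * poly r x) + integral {X (j - 1)..X j} (\<lambda>x. U i x t * poly (pderiv r) x)
     = U i (X j) t * poly r (X j) - U i (X (j - 1)) t * poly r (X (j - 1))"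
proof -
  have "((\<lambda>x. U (Suc i) x t * poly r x + U i x t * poly (pderiv r) x) has_integral
     U i (X j) t * poly r (X j) - U i (X (j - 1)) t * poly r (X (j - 1))) {X (j - 1)..X j}"
  proof (rule fundamental_theorem_of_calculus)
    fix x assume x: "x \<in> {X (j - 1)..X j}"
    have "((\<lambda>y. U i y t) has_real_derivative U (Suc i) x t) (at x within {X (j - 1)..X j})"
      using i t x cell_range[OF j] by (intro dx_sub) auto
    from DERIV_mult[OF this has_field_derivative_at_within[OF poly_DERIV[of r x]]]
    show "((\<lambda>x. U i x t * poly r x) has_vector_derivative U (Suc i) x t * poly r x + U i x t * poly (pderiv r) x) (at x within {X (j - 1)..X j})"
      unfolding has_real_derivative_iff_has_vector_derivative[symmetric] by (simp add: mult.commute)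
  qed (use cell_range[OF j] in auto)
  moreover have "integral {X (j - 1)..X j} (\<lambda>x. U (Suc i) x t * poly r x + U i x t * poly (pderiv r) x) =
     integral {X (j - 1)..X j} (\<lambda>x. U (Suc i) x t * poly r x) + integral {X (j - 1)..X j} (\<lambda>x. U i x t * poly (pderiv r) x)"
    using i t j by (intro integral_add integrable_continuous_poly U_cont_cell) auto
  ultimately show ?thesis by (simp add: integral_unique)
qed

lemma integral_U_minus_poly:
  assumes "i \<le> K" "t \<in> {0..T}" "j \<in> {1..N}"
  shows "integral {X (j - 1)..X j} (\<lambda>x. (U i x t - poly p x) * poly r x) =
     integral {X (j - 1)..X j} (\<lambda>x. U i x t * poly r x) - cint j p r"
  unfolding cint_def left_diff_distrib
  using assms by (intro integral_diff integrable_continuous_poly U_cont_cell continuous_intros)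

lemma cint_diff: "cint j (p - p') r = cint j p r - cint j p' r"
proof -
  have "cint j (p - p') r = integral {X (j - 1)..X j} (\<lambda>x. poly (p * r) x - poly (p' * r) x)"
    unfolding cint_def by (intro integral_cong) (simp add: algebra_simps)
  also have "\<dots> = integral {X (j - 1)..X j} (\<lambda>x. poly (p * r) x) - integral {X (j - 1)..X j} (\<lambda>x. poly (p' * r) x)"
    by (rule integral_diff) (rule integrable_poly)+
  finally show ?thesis by (simp add: cint_def)
qed

lemma cint_smult: "cint j (smult s p) r = s * cint j p r"
  unfolding cint_def integral_mult_right[symmetric] by (intro integral_cong) simp

lemma error_gradient:
  assumes t: "t \<in> {0..T}" and j: "j \<in> {1..N}" and r: "degree r \<le> k"
  shows "cint j (\<zeta> t j) r + cint j (top2 t j) r = local_form e per (\<xi> t) j r"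
proof -
  have jN: "j \<le> N" "j - 1 \<le> N" using j by auto
  have "integral {X (j - 1)..X j} (\<lambda>x. (U 1 x t - poly (QI t j) x) * poly r x)
      + integral {X (j - 1)..X j} (\<lambda>x. (U 0 x t - poly (UI t j) x) * poly (pderiv r) x) = cint j (top2 t j) r"
    unfolding QI_def UI_def top2_def cint_smult
    using corrected_residual[OF X_less[OF j] U_cont_cell[OF _ t j] U_cont_cell[OF _ t j] r k, of 0 1] K
    by (simp add: cint_def)
  hence "integral {X (j - 1)..X j} (\<lambda>x. U 1 x t * poly r x) - cint j (QI t j) r
     + (integral {X (j - 1)..X j} (\<lambda>x. U 0 x t * poly (pderiv r) x) - cint j (UI t j) (pderiv r)) = cint j (top2 t j) r"
    using integral_U_minus_poly[of 1 t j] integral_U_minus_poly[of 0 t j] K t j by simp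
  moreover have "integral {X (j - 1)..X j} (\<lambda>x. U 1 x t * poly r x) + integral {X (j - 1)..X j} (\<lambda>x. U 0 x t * poly (pderiv r) x)
     = U 0 (X j) t * poly r (X j) - U 0 (X (j - 1)) t * poly r (X (j - 1))"
    using U_parts[of 0 t j r] K t j by simp
  moreover note scheme2[OF t j r]
  moreover have "U 0 (X j) t = fu t j + hat e per (\<xi> t) j" "U 0 (X (j - 1)) t = fu t (j - 1) + hat e per (\<xi> t) (j - 1)"
    using flux_u'[OF t jN(1)] flux_u'[OF t jN(2)] by auto
  moreover have "cint j (\<zeta> t j) r = cint j (QI t j) r - cint j (pq t j) r"
    "cint j (\<xi> t j) (pderiv r) = cint j (UI t j) (pderiv r) - cint j (pu t j) (pderiv r)"
    by (simp_all add: \<zeta>_def \<xi>_def cint_diff)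
  ultimately show ?thesis unfolding local_form_def by (simp add: algebra_simps)
qed

text \<open>The same chain of corrections as in \<open>error_gradient\<close>, entered one
  derivative later: \<open>QI\<close> now plays the part of the function and \<open>UI'\<close> that
  of its derivative, with the end points exchanged.\<close>

lemma error_evolution:
  assumes t: "t \<in> {0..T}" and j: "j \<in> {1..N}" and r: "degree r \<le> k"
  shows "cint j (UI' t j) r - integral {X (j - 1)..X j} (\<lambda>x. time_deriv T (\<lambda>s. uh x s) t * poly r x)
     = local_form (\<not> e) per (\<zeta> t) j r - cint j (top1 t j) r"
proof -
  have jN: "j \<le> N" "j - 1 \<le> N" using j by auto
  have "integral {X (j - 1)..X j} (\<lambda>x. (U 2 x t - poly (UI' t j) x) * poly r x)
      + integral {X (j - 1)..X j} (\<lambda>x. (U 1 x t - poly (QI t j) x) * poly (pderiv r) x) = cint j (top1 t j) r"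
    unfolding QI_def UI'_def top1_def cint_smult
    using corrected_residual[OF X_less[OF j] U_cont_cell[OF _ t j] U_cont_cell[OF _ t j] r k, of 1 2 "\<not> e" "\<lambda>n. cc e k (X (j - 1)) (X j) t (Suc n)"] K k
    by (simp add: cint_def)
  hence "integral {X (j - 1)..X j} (\<lambda>x. U 2 x t * poly r x) - cint j (UI' t j) r
     + (integral {X (j - 1)..X j} (\<lambda>x. U 1 x t * poly (pderiv r) x) - cint j (QI t j) (pderiv r)) = cint j (top1 t j) r"
    using integral_U_minus_poly[of 1 t j] integral_U_minus_poly[of 2 t j] K k t j by simp
  moreover have "integral {X (j - 1)..X j} (\<lambda>x. U 2 x t * poly r x) + integral {X (j - 1)..X j} (\<lambda>x. U 1 x t * poly (pderiv r) x)
     = U 1 (X j) t * poly r (X j) - U 1 (X (j - 1)) t * poly r (X (j - 1))"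
    using U_parts[of 1 t j r] K k t j by (simp add: numeral_2_eq_2)
  moreover note scheme1[OF t j r]
  moreover have "U 1 (X j) t = fq t j + hat (\<not> e) per (\<zeta> t) j" "U 1 (X (j - 1)) t = fq t (j - 1) + hat (\<not> e) per (\<zeta> t) (j - 1)"
    using flux_q'[OF t jN(1)] flux_q'[OF t jN(2)] by auto
  moreover have "cint j (\<zeta> t j) (pderiv r) = cint j (QI t j) (pderiv r) - cint j (pq t j) (pderiv r)"
    by (simp add: \<zeta>_def cint_diff)
  ultimately show ?thesis unfolding local_form_def by (simp add: algebra_simps)
qed

lemma cint_proj:
  assumes "i \<le> K" "t \<in> {0..T}" "j \<in> {1..N}" "degree r \<le> k"
  shows "cint j (corrected e k (X (j - 1)) (X j) (\<lambda>x. U i x t) d) r =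
     integral {X (j - 1)..X j} (\<lambda>x. U i x t * poly r x)
     - (\<Sum>n\<le>k. ((X j - X (j - 1)) / 2) ^ n * d n * cint j (EP k (X (j - 1)) (X j) n e) r)"
  unfolding corrected_def cint_diff cint_linear[OF finite_atMost]
  using proj_inner[OF X_less[OF assms(3)] U_cont_cell[OF assms(1-3)] assms(4)] by (simp add: cint_def)

lemma cint_UI_deriv:
  assumes t: "t \<in> {0..T}" and j: "j \<in> {1..N}" and r: "degree r \<le> k"
  shows "((\<lambda>s. cint j (UI s j) r) has_real_derivative cint j (UI' t j) r) (at t within {0..T})"
proof -
  have 1: "((\<lambda>s. integral {X (j - 1)..X j} (\<lambda>x. U 0 x s * poly r x)) has_real_derivative
      integral {X (j - 1)..X j} (\<lambda>x. U 2 x t * poly r x)) (at t within {0..T})"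
    using moment_deriv[of 0 "X (j - 1)" "X j" t r] cell_range[OF j] K k t by (simp add: numeral_2_eq_2)
  have 2: "((\<lambda>s. cc e k (X (j - 1)) (X j) s n) has_real_derivative cc e k (X (j - 1)) (X j) t (n + 2)) (at t within {0..T})"
    if "n \<le> k" for n
    using coef_deriv[of n "X (j - 1)" "X j" t "if even n then e else \<not> e" k] cell_range[OF j] K k t that
    by (simp add: cc_def)
  have "((\<lambda>s. integral {X (j - 1)..X j} (\<lambda>x. U 0 x s * poly r x)
       - (\<Sum>n\<le>k. ((X j - X (j - 1)) / 2) ^ n * cc e k (X (j - 1)) (X j) s n * cint j (EP k (X (j - 1)) (X j) n e) r)) has_real_derivative
     integral {X (j - 1)..X j} (\<lambda>x. U 2 x t * poly r x)
       - (\<Sum>n\<le>k. ((X j - X (j - 1)) / 2) ^ n * cc e k (X (j - 1)) (X j) t (n + 2) * cint j (EP k (X (j - 1)) (X j) n e) r)) (at t within {0..T})"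
    by (intro DERIV_diff DERIV_sum DERIV_cmult_right DERIV_cmult 1 2) auto
  also have "integral {X (j - 1)..X j} (\<lambda>x. U 2 x t * poly r x)
       - (\<Sum>n\<le>k. ((X j - X (j - 1)) / 2) ^ n * cc e k (X (j - 1)) (X j) t (n + 2) * cint j (EP k (X (j - 1)) (X j) n e) r) = cint j (UI' t j) r"
    unfolding UI'_def using cint_proj[OF _ t j r, of 2] K k by simp
  finally have D: "((\<lambda>s. integral {X (j - 1)..X j} (\<lambda>x. U 0 x s * poly r x)
       - (\<Sum>n\<le>k. ((X j - X (j - 1)) / 2) ^ n * cc e k (X (j - 1)) (X j) s n * cint j (EP k (X (j - 1)) (X j) n e) r)) has_real_derivative
     cint j (UI' t j) r) (at t within {0..T})" .
  have "cint j (UI s j) r = integral {X (j - 1)..X j} (\<lambda>x. U 0 x s * poly r x)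
       - (\<Sum>n\<le>k. ((X j - X (j - 1)) / 2) ^ n * cc e k (X (j - 1)) (X j) s n * cint j (EP k (X (j - 1)) (X j) n e) r)"
    if "s \<in> {0..T}" for s
    unfolding UI_def by (rule cint_proj[OF _ that j r]) simp
  thus ?thesis by (intro has_field_derivative_transform_within[OF D zero_less_one t]) simp
qed

definition \<alpha> where "\<alpha> t = coord (\<xi> t)"
definition bm where "bm i i' = form e per (bas i) (bas i')"
definition r1 where "r1 t = coord (top1 t)"
definition r2 where "r2 t = coord (top2 t)"

lemma D_alpha:
  assumes t: "t \<in> {0..T}" and i: "i' \<in> idx k"
  shows "(\<Sum>i\<in>idx k. \<alpha> t i * bm i i') = coord (\<zeta> t) i' + r2 t i'"
    "(\<Sum>i\<in>idx k. \<alpha> t i * bm i i') = form e per (\<xi> t) (bas i')"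
proof -
  obtain j m where jm: "i' = (j, m)" "j \<in> {1..N}" "m \<le> k" using i by auto
  show 1: "(\<Sum>i\<in>idx k. \<alpha> t i * bm i i') = form e per (\<xi> t) (bas i')"
    unfolding \<alpha>_def bm_def using form_coord[OF degrees(1)[OF t], where e = e and per = per and w = "bas i'"] by simp
  have "form e per (\<xi> t) (bas (j, m)) = local_form e per (\<xi> t) j (bas (j, m) j)" by (rule form_bas[OF jm(2)])
  also have "\<dots> = coord (\<zeta> t) (j, m) + r2 t (j, m)"
    using error_gradient[OF t jm(2) degree_bas[OF jm(2,3)]] by (simp add: coord_def r2_def)
  finally show "(\<Sum>i\<in>idx k. \<alpha> t i * bm i i') = coord (\<zeta> t) i' + r2 t i'" using 1 jm by simp
qed

lemma alpha_evolution:
  assumes t: "t \<in> {0..T}" and i: "i \<in> idx k"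
  shows "((\<lambda>s. \<alpha> s i) has_real_derivative
     (- (\<Sum>i'\<in>idx k. bm i i' * ((\<Sum>l\<in>idx k. \<alpha> t l * bm l i') - r2 t i')) - r1 t i)) (at t within {0..T})"
proof -
  obtain j m where jm: "i = (j, m)" "j \<in> {1..N}" "m \<le> k" using i by auto
  define \<beta> where "\<beta> = bas (j, m) j"
  have \<beta>: "degree \<beta> \<le> k" unfolding \<beta>_def by (rule degree_bas[OF jm(2,3)])
  have "((\<lambda>s. cint j (UI s j) \<beta> - cint j (pu s j) \<beta>) has_real_derivative
     cint j (UI' t j) \<beta> - integral {X (j - 1)..X j} (\<lambda>x. time_deriv T (\<lambda>s. uh x s) t * poly \<beta> x)) (at t within {0..T})"
  proof (rule DERIV_diff[OF cint_UI_deriv[OF t jm(2) \<beta>]])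
    show "((\<lambda>s. cint j (pu s j) \<beta>) has_real_derivative integral {X (j - 1)..X j} (\<lambda>x. time_deriv T (\<lambda>s. uh x s) t * poly \<beta> x)) (at t within {0..T})"
      unfolding cint_def
      by (rule poly_cell_moment_deriv[OF T X_less[OF jm(2)] pu_deg[OF _ jm(2)] pu_eq[OF _ jm(2)] uh_diff[OF jm(2)] t])
  qed
  also have "cint j (UI' t j) \<beta> - integral {X (j - 1)..X j} (\<lambda>x. time_deriv T (\<lambda>s. uh x s) t * poly \<beta> x)
     = local_form (\<not> e) per (\<zeta> t) j \<beta> - r1 t i"
    using error_evolution[OF t jm(2) \<beta>] by (simp add: r1_def coord_def jm(1) \<beta>_def)
  also have "local_form (\<not> e) per (\<zeta> t) j \<beta> = form (\<not> e) per (\<zeta> t) (bas i)"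
    using form_bas[OF jm(2)] by (simp add: \<beta>_def jm(1))
  also have "\<dots> = (\<Sum>i'\<in>idx k. coord (\<zeta> t) i' * form (\<not> e) per (bas i') (bas i))"
    by (rule form_coord[OF degrees(2)[OF t]])
  \<comment> \<open>Adjointness turns the second discrete derivative into minus the transpose of the
    first, so that a single matrix governs both equations.\<close>
  also have "\<dots> = - (\<Sum>i'\<in>idx k. bm i i' * ((\<Sum>l\<in>idx k. \<alpha> t l * bm l i') - r2 t i'))"
    unfolding sum_negf[symmetric] bm_def[of i]
    using D_alpha(1)[OF t] form_adjoint[of e per "bas i"] by (intro sum.cong) auto
  finally show ?thesis by (simp add: \<alpha>_def coord_def \<xi>_def cint_diff jm(1) \<beta>_def)
qed

lemma alpha_init: "\<alpha> 0 i = 0" if "i \<in> idx k"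
  using that init by (auto simp: \<alpha>_def coord_def \<xi>_def UI_def cint_def)

end

section \<open>Sizes of the residuals and energy estimates\<close>

text \<open>The number 300 is that of \<open>coef_time_integral\<close>, so that one constant serves
  the pointwise and the time-integrated residual bounds. Four factors of \<open>PB k\<close> come
  from the last correction tested with the basis, two from the size of its coefficient.
  \<open>kap\<close> is the part of the constant in \<open>form_bound\<close> that is free of
  h.\<close>

definition Gk :: "nat \<Rightarrow> real" where "Gk k = 300 * ((real k + 1) * (2 * real k + 1) * PB k ^ 6)"
definition kap :: "nat \<Rightarrow> real \<Rightarrow> real" where "kap k c = 5 * (real k + 1) * ((2 * real k + 1) * (PB k)\<^sup>2) * c"

lemma Gk_nonneg: "Gk k \<ge> 0"
  using PB(1)[of k] by (simp add: Gk_def)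

context ldg_error
begin

abbreviation "len j \<equiv> X j - X (j - 1)"
abbreviation "cf t j \<equiv> cc e k (X (j - 1)) (X j) t"

lemma len_pos: "j \<in> {1..N} \<Longrightarrow> len j > 0"
  using X_less by simp

lemma c_ge_1: "c \<ge> 1"
proof -
  have 1: "1 \<in> {1..N}" using N1 by simp
  have l: "len 1 > 0" "len 1 \<le> h" by (rule len_pos[OF 1], rule size_le[OF 1])
  have "len 1 \<le> c * len 1"
    using quasi 1 l(2) unfolding quasi_uniform_def cell_size_def by fastforce
  thus ?thesis using l(1) by (simp del: One_nat_def diff_self_eq_0)
qed

lemma cint_bas_bound:
  assumes j: "j \<in> {1..N}" and m: "m \<le> k" and B: "\<And>x. x \<in> {X (j - 1)..X j} \<Longrightarrow> \<bar>poly p x\<bar> \<le> B"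
  shows "(cint j p (bas (j, m) j))\<^sup>2 \<le> (2 * real k + 1) * (PB k)\<^sup>2 * B\<^sup>2 * len j"
proof -
  define l where "l = len j"
  have l: "l > 0" using len_pos[OF j] by (simp add: l_def)
  have B0: "B \<ge> 0" using B[of "X j"] X_less[OF j] by fastforce
  have "\<bar>cint j p (bas (j, m) j)\<bar> \<le> B * (sqrt ((2 * real k + 1) / l) * PB k) * l"
    unfolding cint_def l_def
  proof (rule abs_integral_le)
    fix x assume x: "x \<in> {X (j - 1)..X j}"
    show "\<bar>poly p x * poly (bas (j, m) j) x\<bar> \<le> B * (sqrt ((2 * real k + 1) / len j) * PB k)"
      unfolding abs_mult by (intro mult_mono B x bas_bounds(2)[OF quasi j m x] B0 abs_ge_zero)
  qed (use X_less[OF j] in \<open>auto intro!: continuous_intros\<close>)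
  hence "\<bar>cint j p (bas (j, m) j)\<bar>\<^sup>2 \<le> (B * (sqrt ((2 * real k + 1) / l) * PB k) * l)\<^sup>2"
    by (rule power_mono) simp
  also have "\<dots> = (2 * real k + 1) * (PB k)\<^sup>2 * B\<^sup>2 * l"
    unfolding power_mult_distrib real_sqrt_pow2[OF divide_nonneg_pos[OF _ l, of "2 * real k + 1", simplified]]
    using l by (simp add: power2_eq_square)
  finally show ?thesis by (simp add: l_def)
qed

lemma cf_bound:
  assumes "t \<in> {0..T}" "j \<in> {1..N}" "n + p \<le> K" "p \<le> k"
  shows "\<bar>cf t j n\<bar> \<le> PB k * M * h ^ Suc p"
proof -
  have "\<bar>cf t j n\<bar> \<le> PB k * (M * len j ^ Suc p)"
    unfolding cc_def using assms cell_range[OF assms(2)] by (intro coef_U_bound) auto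
  also have "\<dots> \<le> PB k * (M * h ^ Suc p)"
    using PB(1)[of k] M size_le[OF assms(2)] len_pos[OF assms(2)]
    by (intro mult_left_mono power_mono) auto
  finally show ?thesis by (simp add: mult.assoc)
qed

lemma top_bound:
  assumes j: "j \<in> {1..N}" and m: "m \<le> k"
  shows "(cint j (smult ((len j / 2) ^ k * d) (EP k (X (j - 1)) (X j) k e')) (bas (j, m) j))\<^sup>2
     \<le> (2 * real k + 1) * PB k ^ 4 * h ^ (2 * k) * (len j * d\<^sup>2)"
proof -
  let ?I = "cint j (EP k (X (j - 1)) (X j) k e') (bas (j, m) j)"
  have l: "len j > 0" "len j \<le> h" using len_pos[OF j] size_le[OF j] by auto
  have "?I\<^sup>2 \<le> (2 * real k + 1) * (PB k)\<^sup>2 * (PB k)\<^sup>2 * len j"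
    by (rule cint_bas_bound[OF j m PB(3)[OF X_less[OF j] order_refl]])
  moreover have "((len j / 2) ^ k)\<^sup>2 \<le> h ^ (2 * k)"
    using l unfolding power_even_eq[of h] power2_eq_square[symmetric]
    by (intro power_mono) auto
  ultimately have "((len j / 2) ^ k)\<^sup>2 * ?I\<^sup>2 \<le> h ^ (2 * k) * ((2 * real k + 1) * (PB k)\<^sup>2 * (PB k)\<^sup>2 * len j)"
    by (intro mult_mono) (use h_pos in auto)
  hence "((len j / 2) ^ k)\<^sup>2 * ?I\<^sup>2 * d\<^sup>2 \<le> h ^ (2 * k) * ((2 * real k + 1) * (PB k)\<^sup>2 * (PB k)\<^sup>2 * len j) * d\<^sup>2"
    by (rule mult_right_mono) simp
  also have "\<dots> = (2 * real k + 1) * PB k ^ 4 * h ^ (2 * k) * (len j * d\<^sup>2)"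
    by (simp add: power4_eq_xxxx power2_eq_square mult_ac)
  also have "((len j / 2) ^ k)\<^sup>2 * ?I\<^sup>2 * d\<^sup>2 = ((len j / 2) ^ k * d * ?I)\<^sup>2"
    by (simp add: power_mult_distrib mult_ac)
  finally show ?thesis by (simp add: cint_smult)
qed

lemma sum_idx: "(\<Sum>i\<in>idx k. f i) = (\<Sum>j=1..N. \<Sum>m\<le>k. f (j, m))"
  by (simp add: sum.cartesian_product)

lemma top_sum_bound:
  assumes "\<And>j m. j \<in> {1..N} \<Longrightarrow> m \<le> k \<Longrightarrow>
    r (j, m) = cint j (smult ((len j / 2) ^ k * d j) (EP k (X (j - 1)) (X j) k e')) (bas (j, m) j)"
  shows "(\<Sum>i\<in>idx k. (r i)\<^sup>2) \<le> (real k + 1) * (2 * real k + 1) * PB k ^ 4 * h ^ (2 * k) * (\<Sum>j=1..N. len j * (d j)\<^sup>2)"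
proof -
  have "(\<Sum>i\<in>idx k. (r i)\<^sup>2) \<le> (\<Sum>j=1..N. \<Sum>m\<le>k. (2 * real k + 1) * PB k ^ 4 * h ^ (2 * k) * (len j * (d j)\<^sup>2))"
    unfolding sum_idx using top_bound assms by (intro sum_mono) auto
  also have "\<dots> = (\<Sum>j=1..N. (real k + 1) * (2 * real k + 1) * PB k ^ 4 * h ^ (2 * k) * (len j * (d j)\<^sup>2))"
    by (intro sum.cong refl) (simp add: algebra_simps)
  finally show ?thesis by (simp only: sum_distrib_left)
qed

lemma r_sums:
  assumes t: "t \<in> {0..T}"
  shows "(\<Sum>i\<in>idx k. (r1 t i)\<^sup>2) \<le> (real k + 1) * (2 * real k + 1) * PB k ^ 4 * h ^ (2 * k) * (\<Sum>j=1..N. len j * (cf t j (k + 2))\<^sup>2)"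
    "(\<Sum>i\<in>idx k. (r2 t i)\<^sup>2) \<le> (real k + 1) * (2 * real k + 1) * PB k ^ 4 * h ^ (2 * k) * (\<Sum>j=1..N. len j * (cf t j (k + 1))\<^sup>2)"
  by (rule top_sum_bound; simp add: r1_def r2_def top1_def top2_def coord_def)+

lemma weighted_square_sum:
  assumes "\<And>j. j \<in> {1..N} \<Longrightarrow> \<bar>d j\<bar> \<le> S"
  shows "(\<Sum>j=1..N. len j * (d j)\<^sup>2) \<le> 7 * S\<^sup>2"
proof -
  have "(\<Sum>j=1..N. len j * (d j)\<^sup>2) \<le> (\<Sum>j=1..N. len j * S\<^sup>2)"
  proof (intro sum_mono mult_left_mono)
    fix j assume j: "j \<in> {1..N}"
    have "\<bar>d j\<bar>\<^sup>2 \<le> S\<^sup>2" by (intro power_mono assms j) simp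
    thus "(d j)\<^sup>2 \<le> S\<^sup>2" by simp
    show "0 \<le> len j" using len_pos[OF j] by simp
  qed
  also have "\<dots> = 2 * pi * S\<^sup>2" unfolding sum_distrib_right[symmetric] sum_sizes ..
  also have "\<dots> \<le> 7 * S\<^sup>2" using pi_less_4 pi_approx by (intro mult_right_mono) auto
  finally show ?thesis .
qed

lemma r1_bound: "t \<in> {0..T} \<Longrightarrow> (\<Sum>i\<in>idx k. (r1 t i)\<^sup>2) \<le> Gk k * h ^ (4 * k) * M\<^sup>2"
  and r2_bound: "t \<in> {0..T} \<Longrightarrow> (\<Sum>i\<in>idx k. (r2 t i)\<^sup>2) \<le> Gk k * h ^ (4 * k + 2) * M\<^sup>2"
proof -
  assume t: "t \<in> {0..T}"
  let ?G = "(real k + 1) * (2 * real k + 1) * PB k ^ 4 * h ^ (2 * k)"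
  have G: "?G \<ge> 0" using h_pos PB(1)[of k] by simp
  have "(\<Sum>i\<in>idx k. (r1 t i)\<^sup>2) \<le> ?G * (\<Sum>j=1..N. len j * (cf t j (k + 2))\<^sup>2)" by (rule r_sums(1)[OF t])
  also have "\<dots> \<le> ?G * (7 * (PB k * M * h ^ Suc (k - 1))\<^sup>2)"
    using K k t by (intro mult_left_mono weighted_square_sum cf_bound G) auto
  also have "\<dots> = 7 * ((real k + 1) * (2 * real k + 1) * PB k ^ 6) * h ^ (4 * k) * M\<^sup>2"
  proof -
    have "PB k ^ 6 = PB k ^ 4 * (PB k)\<^sup>2" "h ^ (4 * k) = h ^ (2 * k) * (h ^ k)\<^sup>2"
      by (simp_all add: power_add[symmetric] power_mult[symmetric])
    thus ?thesis using k by (simp add: power_mult_distrib mult_ac)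
  qed
  also have "\<dots> \<le> 300 * ((real k + 1) * (2 * real k + 1) * PB k ^ 6) * h ^ (4 * k) * M\<^sup>2"
    using h_pos PB(1)[of k] by (intro mult_right_mono) auto
  finally show "(\<Sum>i\<in>idx k. (r1 t i)\<^sup>2) \<le> Gk k * h ^ (4 * k) * M\<^sup>2" by (simp add: Gk_def)
  have "(\<Sum>i\<in>idx k. (r2 t i)\<^sup>2) \<le> ?G * (\<Sum>j=1..N. len j * (cf t j (k + 1))\<^sup>2)" by (rule r_sums(2)[OF t])
  also have "\<dots> \<le> ?G * (7 * (PB k * M * h ^ Suc k)\<^sup>2)"
    using K k t by (intro mult_left_mono weighted_square_sum cf_bound G) auto
  also have "\<dots> = 7 * ((real k + 1) * (2 * real k + 1) * PB k ^ 6) * h ^ (4 * k + 2) * M\<^sup>2"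
  proof -
    have "PB k ^ 6 = PB k ^ 4 * (PB k)\<^sup>2" "h ^ (4 * k + 2) = h ^ (2 * k) * (h ^ Suc k)\<^sup>2"
      by (simp_all only: power_add[symmetric] power_mult[symmetric]) (simp_all add: algebra_simps)
    thus ?thesis by (simp add: power_mult_distrib mult_ac)
  qed
  also have "\<dots> \<le> 300 * ((real k + 1) * (2 * real k + 1) * PB k ^ 6) * h ^ (4 * k + 2) * M\<^sup>2"
    using h_pos PB(1)[of k] by (intro mult_right_mono) auto
  finally show "(\<Sum>i\<in>idx k. (r2 t i)\<^sup>2) \<le> Gk k * h ^ (4 * k + 2) * M\<^sup>2" by (simp add: Gk_def)
qed

definition Aint :: "real \<Rightarrow> real" where "Aint \<tau> = integral {0..\<tau>} (\<lambda>t. \<Sum>i\<in>idx k. (r1 t i)\<^sup>2)"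

lemma cf_cont: "j \<in> {1..N} \<Longrightarrow> n \<le> K \<Longrightarrow> continuous_on {0..T} (\<lambda>t. cf t j n)"
  unfolding cc_def using cell_range[of j] by (intro coef_cont) auto

lemma r1_cont: "continuous_on {0..T} (\<lambda>t. \<Sum>i\<in>idx k. (r1 t i)\<^sup>2)"
proof -
  have "continuous_on {0..T} (\<lambda>t. r1 t (j, m))" if "j \<in> {1..N}" for j m
    unfolding r1_def coord_def top1_def fst_conv cint_smult
    using that K k by (intro continuous_intros cf_cont) auto
  thus ?thesis by (intro continuous_on_sum continuous_on_power) auto
qed

text \<open>The first bound integrates the pointwise estimate and is the better one for small times;
  the second, from \<open>coef_time_integral\<close>, gains a factor of about h and is behind the
  additional half power of h.\<close>

lemma Aint_bounds:
  assumes \<tau>: "\<tau> \<in> {0..T}"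
  shows "Aint \<tau> \<le> \<tau> * (Gk k * h ^ (4 * k) * M\<^sup>2)" "Aint \<tau> \<le> Gk k * h ^ (4 * k) * (h\<^sup>2 + \<tau> * h) * M\<^sup>2"
proof -
  have c: "continuous_on {0..\<tau>} (\<lambda>t. \<Sum>i\<in>idx k. (r1 t i)\<^sup>2)" "continuous_on {0..\<tau>} (\<lambda>t. cf t j (k + 2))" if "j \<in> {1..N}" for j
    using \<tau> that K k by (intro continuous_on_subset[OF r1_cont] continuous_on_subset[OF cf_cont]; simp)+
  have "integral {0..\<tau>} (\<lambda>t. \<Sum>i\<in>idx k. (r1 t i)\<^sup>2) \<le> integral {0..\<tau>} (\<lambda>t. Gk k * h ^ (4 * k) * M\<^sup>2)"
    using \<tau> N1 by (intro integral_le integrable_continuous_interval c(1)[of 1] continuous_intros r1_bound) auto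
  thus "Aint \<tau> \<le> \<tau> * (Gk k * h ^ (4 * k) * M\<^sup>2)" using \<tau> by (simp add: Aint_def mult_ac)
  let ?G = "(real k + 1) * (2 * real k + 1) * PB k ^ 4 * h ^ (2 * k)"
  have G: "?G \<ge> 0" using h_pos PB(1)[of k] by simp
  have "Aint \<tau> \<le> integral {0..\<tau>} (\<lambda>t. ?G * (\<Sum>j=1..N. len j * (cf t j (k + 2))\<^sup>2))"
    unfolding Aint_def
    using \<tau> N1 by (intro integral_le integrable_continuous_interval c(1)[of 1] continuous_intros c(2) r_sums(1)) auto
  also have "\<dots> = ?G * integral {0..\<tau>} (\<lambda>t. \<Sum>j=1..N. len j * (cf t j (k + 2))\<^sup>2)" by (rule integral_mult_right)
  also have "\<dots> \<le> ?G * (300 * (PB k)\<^sup>2 * h ^ (2 * k) * (h\<^sup>2 + \<tau> * h) * M\<^sup>2)"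
    unfolding cc_def by (intro mult_left_mono G coef_time_integral[OF mesh K k \<tau>])
  also have "\<dots> = Gk k * h ^ (4 * k) * (h\<^sup>2 + \<tau> * h) * M\<^sup>2"
  proof -
    have e: "PB k ^ 6 = PB k ^ 4 * (PB k)\<^sup>2" "h ^ (4 * k) = h ^ (2 * k) * h ^ (2 * k)"
      by (simp_all add: power_add[symmetric])
    show ?thesis unfolding Gk_def e by (simp only: mult_ac)
  qed
  finally show "Aint \<tau> \<le> Gk k * h ^ (4 * k) * (h\<^sup>2 + \<tau> * h) * M\<^sup>2" .
qed

sublocale ev: skew_evolution "idx k" bm "kap k c / h" T "Gk k * h ^ (4 * k) * M\<^sup>2" "Gk k * h ^ (4 * k + 2) * M\<^sup>2" \<alpha> r1 r2 Aint
proof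
  show "kap k c / h > 0" using c_ge_1 h_pos PB(1)[of k] by (simp add: kap_def add_pos_nonneg)
  show "(\<Sum>j\<in>idx k. (\<Sum>i\<in>idx k. v i * bm i j)\<^sup>2) \<le> (kap k c / h)\<^sup>2 * (\<Sum>i\<in>idx k. (v i)\<^sup>2)" for v
    unfolding bm_def kap_def by (rule form_bound[OF quasi])
  show "(Aint has_real_derivative (\<Sum>i\<in>idx k. (r1 t i)\<^sup>2)) (at t within {0..T})" if "t \<in> {0..T}" for t
    unfolding Aint_def[abs_def] by (rule integral_has_real_derivative[OF r1_cont that])
  show "Aint 0 = 0" by (simp add: Aint_def)
qed (fact alpha_evolution alpha_init r1_bound r2_bound | simp)+

lemma energy_estimates:
  assumes \<tau>: "\<tau> \<in> {0..T}"
  shows "ev.ip (\<alpha> \<tau>) (\<alpha> \<tau>) \<le> 9 * Gk k * h ^ (4 * k) * M\<^sup>2 * (h + \<tau>)\<^sup>2"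
    "ev.ip (\<alpha> \<tau>) (\<alpha> \<tau>) \<le> 18 * Gk k * h ^ (4 * k + 1) * M\<^sup>2 * (sqrt h + \<tau>)\<^sup>2"
proof -
  define g where "g = Gk k * h ^ (4 * k) * M\<^sup>2"
  have g: "g \<ge> 0" using Gk_nonneg[of k] h_pos by (simp add: g_def)
  note h = h_pos h_le
  have *: "ev.ip (\<alpha> \<tau>) (\<alpha> \<tau>) \<le> 3 * (g * (\<tau> * h\<^sup>2 / 2) + \<tau> * Aint \<tau>)"
  proof (cases "\<tau> = 0")
    case True
    have "ev.ip (\<alpha> 0) (\<alpha> 0) = 0" unfolding ev.ip_def by (intro sum.neutral) (simp add: alpha_init)
    thus ?thesis using True by simp
  next
    case False
    have A0: "Aint \<tau> \<ge> 0" unfolding Aint_def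
      using \<tau> by (intro integral_nonneg integrable_continuous_interval continuous_on_subset[OF r1_cont]) (auto intro!: sum_nonneg)
    have "ev.ip (\<alpha> \<tau>) (\<alpha> \<tau>) \<le> exp 1 * (\<tau> * (Gk k * h ^ (4 * k + 2) * M\<^sup>2) / 2 + \<tau> * Aint \<tau>)"
      using \<tau> False by (intro ev.energy_bound) auto
    also have "\<dots> \<le> 3 * (\<tau> * (Gk k * h ^ (4 * k + 2) * M\<^sup>2) / 2 + \<tau> * Aint \<tau>)"
      using exp_le A0 \<tau> Gk_nonneg[of k] h by (intro mult_right_mono add_nonneg_nonneg) auto
    finally show ?thesis by (simp add: g_def power_add power2_eq_square[of h] mult_ac)
  qed
  have a: "Aint \<tau> \<le> g * \<tau>" "Aint \<tau> \<le> g * (h\<^sup>2 + \<tau> * h)"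
    using Aint_bounds[OF \<tau>] by (simp_all add: g_def mult_ac)
  have pi7: "2 * pi \<le> 7" using pi_approx by simp
  have th: "2 * (\<tau> * h) \<le> (h + \<tau>)\<^sup>2" by (simp add: power2_eq_square algebra_simps)
  have "\<tau> * h\<^sup>2 \<le> 7 * (\<tau> * h)"
    using \<tau> h pi7 mult_right_mono[of h 7 "\<tau> * h"] by (simp add: power2_eq_square mult_ac)
  moreover have "\<tau>\<^sup>2 \<le> (h + \<tau>)\<^sup>2" using \<tau> h by (intro power_mono) auto
  moreover have "\<tau> * Aint \<tau> \<le> g * \<tau>\<^sup>2"
    using mult_left_mono[OF a(1), of \<tau>] \<tau> by (simp add: power2_eq_square mult_ac)
  \<comment> \<open>7/4 comes from h being at most 2\<pi>, hence at most 7, and from 2\<tau>h being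
    at most (h + \<tau>)^2. Together with the 1 for \<open>Aint\<close> and the factor 3 for e this
    gives 33/4, below the 9 that is claimed.\<close>
  ultimately have "g * (\<tau> * h\<^sup>2 / 2) + \<tau> * Aint \<tau> \<le> g * (7 / 4 * (h + \<tau>)\<^sup>2) + g * (h + \<tau>)\<^sup>2"
    using th g by (intro add_mono mult_left_mono) (auto intro: order.trans mult_left_mono)
  hence "3 * (g * (\<tau> * h\<^sup>2 / 2) + \<tau> * Aint \<tau>) \<le> 3 * (11 / 4 * (g * (h + \<tau>)\<^sup>2))" by (simp add: algebra_simps)
  also have "\<dots> \<le> 9 * (g * (h + \<tau>)\<^sup>2)" using g by simp
  finally show "ev.ip (\<alpha> \<tau>) (\<alpha> \<tau>) \<le> 9 * Gk k * h ^ (4 * k) * M\<^sup>2 * (h + \<tau>)\<^sup>2"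
    using * by (simp add: g_def mult_ac)
  have "\<tau> * Aint \<tau> \<le> g * (\<tau> * (h\<^sup>2 + \<tau> * h))"
    using mult_left_mono[OF a(2), of \<tau>] \<tau> by (simp add: mult_ac)
  hence "g * (\<tau> * h\<^sup>2 / 2) + \<tau> * Aint \<tau> \<le> g * (\<tau> * h\<^sup>2 / 2 + \<tau> * (h\<^sup>2 + \<tau> * h))"
    by (simp add: algebra_simps)
  also have "\<tau> * h\<^sup>2 / 2 + \<tau> * (h\<^sup>2 + \<tau> * h) = h * (3 / 2 * (\<tau> * h) + \<tau>\<^sup>2)"
    by (simp add: power2_eq_square algebra_simps)
  also have "g * (h * (3 / 2 * (\<tau> * h) + \<tau>\<^sup>2)) \<le> g * (h * (6 * (sqrt h + \<tau>)\<^sup>2))"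
  proof (intro mult_left_mono g)
    have "0 \<le> (\<tau> - h)\<^sup>2" by simp
    hence "2 * (\<tau> * h) \<le> \<tau>\<^sup>2 + h * h" by (simp add: power2_eq_square algebra_simps)
    moreover have "h * h \<le> 7 * h" using h pi7 by (intro mult_right_mono) auto
    moreover have "(sqrt h + \<tau>)\<^sup>2 = h + 2 * (sqrt h * \<tau>) + \<tau>\<^sup>2" using h by (simp add: power2_sum)
    moreover have "sqrt h * \<tau> \<ge> 0" using h \<tau> by simp
    ultimately show "3 / 2 * (\<tau> * h) + \<tau>\<^sup>2 \<le> 6 * (sqrt h + \<tau>)\<^sup>2" using h(1) zero_le_power2[of \<tau>] by linarith
  qed (use h in auto)
  finally show "ev.ip (\<alpha> \<tau>) (\<alpha> \<tau>) \<le> 18 * Gk k * h ^ (4 * k + 1) * M\<^sup>2 * (sqrt h + \<tau>)\<^sup>2"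
    using * by (simp add: g_def mult_ac)
qed

text \<open>The squared inverse constant (kap/h)^2 meets a bound on \<open>r2\<close> that is
  smaller than the one on \<open>r1\<close> by exactly h^2, so both residuals contribute at the same
  order.\<close>

lemma gradient_estimate:
  assumes \<tau>: "\<tau> \<in> {0..T}"
  shows "ev.ip (ev.D (\<alpha> \<tau>)) (ev.D (\<alpha> \<tau>)) \<le> \<tau> * (1 + (kap k c)\<^sup>2) * (Gk k * h ^ (4 * k) * M\<^sup>2)"
proof -
  have "ev.ip (ev.D (\<alpha> \<tau>)) (ev.D (\<alpha> \<tau>)) \<le> \<tau> * (Gk k * h ^ (4 * k) * M\<^sup>2 + (kap k c / h)\<^sup>2 * (Gk k * h ^ (4 * k + 2) * M\<^sup>2))"
    using \<tau> by (intro ev.gradient_bound) auto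
  also have "\<dots> = \<tau> * (1 + (kap k c)\<^sup>2) * (Gk k * h ^ (4 * k) * M\<^sup>2)"
    using h_pos by (simp add: power_add power_divide power2_eq_square[of h] algebra_simps)
  finally show ?thesis .
qed

end

section \<open>Averages of the discrete error\<close>

context ldg_error
begin

lemma integral_split:
  fixes v :: "real \<Rightarrow> real"
  assumes v: "continuous_on {a..b} v"
  shows "integral {a..b} (\<lambda>x. v x - poly p x) = integral {a..b} (\<lambda>x. v x - poly p' x) + integral {a..b} (poly (p' - p))"
proof -
  have "integral {a..b} (\<lambda>x. v x - poly p x) = integral {a..b} (\<lambda>x. (v x - poly p' x) + poly (p' - p) x)"
    by (intro integral_cong) simp
  also have "\<dots> = integral {a..b} (\<lambda>x. v x - poly p' x) + integral {a..b} (poly (p' - p))"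
    by (intro integral_add integrable_continuous_interval continuous_intros v)
  finally show ?thesis .
qed

definition mean_rest :: "real \<Rightarrow> nat \<Rightarrow> real" where
  "mean_rest t j = (len j / 2) ^ k * cf t j k * integral {X (j - 1)..X j} (poly (EP k (X (j - 1)) (X j) k e))"

lemma UI_mean:
  assumes "t \<in> {0..T}" "j \<in> {1..N}"
  shows "integral {X (j - 1)..X j} (\<lambda>x. U 0 x t - poly (UI t j) x) = mean_rest t j"
  unfolding UI_def mean_rest_def
  by (rule corrected_mean[OF X_less[OF assms(2)] U_cont_cell[OF _ assms] k]) simp

lemma mean_rest_bound:
  assumes t: "t \<in> {0..T}" and j: "j \<in> {1..N}"
  shows "\<bar>mean_rest t j\<bar> \<le> (PB k)\<^sup>2 * M * h ^ (2 * k + 1) * len j"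
proof -
  have l: "len j > 0" "len j \<le> h" using len_pos[OF j] size_le[OF j] by auto
  have P: "PB k \<ge> 0" using PB(1)[of k] by simp
  have "\<bar>integral {X (j - 1)..X j} (poly (EP k (X (j - 1)) (X j) k e))\<bar> \<le> PB k * len j"
    using X_less[OF j] PB(3)[OF X_less[OF j] order_refl] by (intro abs_integral_le continuous_intros) auto
  moreover have "\<bar>cf t j k\<bar> \<le> PB k * M * h ^ Suc k" using K by (intro cf_bound t j) auto
  moreover have "\<bar>(len j / 2) ^ k\<bar> \<le> h ^ k"
    unfolding power_abs using l by (intro power_mono) auto
  ultimately have "\<bar>mean_rest t j\<bar> \<le> h ^ k * (PB k * M * h ^ Suc k) * (PB k * len j)"
    unfolding mean_rest_def abs_mult using h_pos P M l by (intro mult_mono mult_nonneg_nonneg) auto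
  also have "\<dots> = (PB k)\<^sup>2 * M * h ^ (2 * k + 1) * len j"
  proof -
    have "h ^ (2 * k + 1) = h ^ k * h ^ Suc k" by (simp add: power_add[symmetric] mult_2)
    thus ?thesis by (simp only: power2_eq_square mult_ac)
  qed
  finally show ?thesis .
qed

lemma error_u_cell:
  assumes t: "t \<in> {0..T}" and j: "j \<in> {1..N}"
  shows "integral {X (j - 1)..X j} (\<lambda>x. U 0 x t - poly (pu t j) x) = mean_rest t j + sqrt (len j) * \<alpha> t (j, 0)"
  using integral_split[OF U_cont_cell[OF le0 t j], of "pu t j" "UI t j"] UI_mean[OF t j] integral_cell_coord[OF j, of "\<xi> t"]
  by (simp add: \<xi>_def \<alpha>_def)

text \<open>In contrast to \<open>u\<close> there is no remainder: the mean of the last correction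
  of \<open>q\<close> is the mean of \<open>top2\<close>, the same residual that separates \<zeta>
  from the discrete derivative of \<xi>, and the two cancel.\<close>

lemma error_q_cell:
  assumes t: "t \<in> {0..T}" and j: "j \<in> {1..N}"
  shows "integral {X (j - 1)..X j} (\<lambda>x. U 1 x t - poly (pq t j) x) = local_form e per (\<xi> t) j 1" (is "?I = _")
    "integral {X (j - 1)..X j} (\<lambda>x. U 1 x t - poly (pq t j) x) = sqrt (len j) * ev.D (\<alpha> t) (j, 0)"
proof -
  have K1: "1 \<le> K" using K by simp
  have "integral {X (j - 1)..X j} (\<lambda>x. U 1 x t - poly (QI t j) x)
     = (len j / 2) ^ k * cf t j (Suc k) * integral {X (j - 1)..X j} (poly (EP k (X (j - 1)) (X j) k (\<not> e)))"
    unfolding QI_def by (rule corrected_mean[OF X_less[OF j] U_cont_cell[OF K1 t j] k])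
  also have "\<dots> = integral {X (j - 1)..X j} (poly (top2 t j))"
    unfolding top2_def poly_smult by simp
  finally have 1: "?I = integral {X (j - 1)..X j} (poly (top2 t j)) + integral {X (j - 1)..X j} (poly (\<zeta> t j))"
    using integral_split[OF U_cont_cell[OF K1 t j], of "pq t j" "QI t j"] by (simp add: \<zeta>_def)
  thus "?I = local_form e per (\<xi> t) j 1"
    using error_gradient[OF t j, of 1] by (simp add: cint_def)
  have "(j, 0) \<in> idx k" using j by simp
  from D_alpha(1)[OF t this] have "ev.D (\<alpha> t) (j, 0) = coord (\<zeta> t) (j, 0) + r2 t (j, 0)"
    unfolding ev.D_def .
  thus "?I = sqrt (len j) * ev.D (\<alpha> t) (j, 0)"
    unfolding 1 integral_cell_coord[OF j, of "top2 t"] integral_cell_coord[OF j, of "\<zeta> t"]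
    by (simp only: r2_def distrib_left add.commute)
qed

lemma square_sum2: "(x + y)\<^sup>2 \<le> 2 * x\<^sup>2 + 2 * y\<^sup>2" for x y :: real
  using zero_le_power2[of "x - y"] by (simp add: power2_eq_square algebra_simps)

lemma sum_mode0: "(\<Sum>j=1..N. (w (j, 0))\<^sup>2) \<le> ev.ip w w"
  unfolding ev.ip_self sum_idx by (intro sum_mono member_le_sum) auto

text \<open>The cell average gives all cells the weight 1/N instead of their length. On a
  quasi-uniform mesh the two are comparable, because N h is at least the length of the
  domain.\<close>

lemma mean_inverse_size: "j \<in> {1..N} \<Longrightarrow> 1 / real N * (1 / len j) \<le> c"
proof -
  assume j: "j \<in> {1..N}"
  have "2 * pi \<le> (\<Sum>j=1..N. h)" unfolding sum_sizes[symmetric] by (intro sum_mono size_le)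
  hence Nh: "1 \<le> real N * h" using pi_gt3 by simp
  have "1 / len j \<le> c / h" by (rule bas_bounds(4)[OF quasi j le0]) (use X_less[OF j] in auto)
  hence "1 / real N * (1 / len j) \<le> 1 / real N * (c / h)" by (intro mult_left_mono) auto
  also have "\<dots> = c / (real N * h)" by simp
  also have "\<dots> \<le> c / 1" using c_ge_1 Nh by (intro divide_left_mono) auto
  finally show ?thesis by simp
qed

lemma mean_mode0: "1 / real N * (\<Sum>j=1..N. (1 / len j * (sqrt (len j) * w (j, 0)))\<^sup>2) \<le> c * ev.ip w w"
proof -
  have "1 / real N * (\<Sum>j=1..N. (1 / len j * (sqrt (len j) * w (j, 0)))\<^sup>2) = (\<Sum>j=1..N. 1 / real N * (1 / len j) * (w (j, 0))\<^sup>2)"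
    unfolding sum_distrib_left
  proof (intro sum.cong refl)
    fix j assume "j \<in> {1..N}"
    hence l: "len j > 0" by (rule len_pos)
    define L where "L = len j"
    have "L > 0" using l by (simp add: L_def)
    hence "1 / real N * (1 / L * (sqrt L * w (j, 0)))\<^sup>2 = 1 / real N * (1 / L) * (w (j, 0))\<^sup>2"
      by (simp add: power_mult_distrib power_divide) (simp add: power2_eq_square)
    thus "1 / real N * (1 / len j * (sqrt (len j) * w (j, 0)))\<^sup>2 = 1 / real N * (1 / len j) * (w (j, 0))\<^sup>2"
      by (simp only: L_def)
  qed
  also have "\<dots> \<le> (\<Sum>j=1..N. c * (w (j, 0))\<^sup>2)"
    by (intro sum_mono mult_right_mono mean_inverse_size) auto
  also have "\<dots> \<le> c * ev.ip w w"
    unfolding sum_distrib_left[symmetric] using c_ge_1 by (intro mult_left_mono sum_mode0) auto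
  finally show ?thesis .
qed

lemma domain_mode0: "(\<Sum>j=1..N. sqrt (len j) * w (j, 0))\<^sup>2 \<le> 7 * ev.ip w w"
proof -
  have "(\<Sum>j=1..N. sqrt (len j) * w (j, 0))\<^sup>2 \<le> (\<Sum>j=1..N. (sqrt (len j))\<^sup>2) * (\<Sum>j=1..N. (w (j, 0))\<^sup>2)"
    by (rule Cauchy_Schwarz_ineq_sum)
  also have "(\<Sum>j=1..N. (sqrt (len j))\<^sup>2) = (\<Sum>j=1..N. len j)"
    using len_pos by (intro sum.cong real_sqrt_pow2) (auto intro: less_imp_le)
  also have "\<dots> * (\<Sum>j=1..N. (w (j, 0))\<^sup>2) \<le> 7 * ev.ip w w"
    unfolding sum_sizes using pi_approx by (intro mult_mono sum_mode0 sum_nonneg) auto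
  finally show ?thesis .
qed

lemma cell_error_u:
  assumes t: "t \<in> {0..T}"
  shows "1 / real N * (\<Sum>j=1..N. (1 / len j * integral {X (j - 1)..X j} (\<lambda>x. U 0 x t - poly (pu t j) x))\<^sup>2)
    \<le> (2 * PB k ^ 4 + 18 * c * Gk k) * (h ^ (4 * k) * M\<^sup>2 * (h + t)\<^sup>2)"
proof -
  define Z where "Z = (PB k)\<^sup>2 * M * h ^ (2 * k + 1)"
  have *: "(1 / len j * integral {X (j - 1)..X j} (\<lambda>x. U 0 x t - poly (pu t j) x))\<^sup>2
     \<le> 2 * Z\<^sup>2 + 2 * (1 / len j * (sqrt (len j) * \<alpha> t (j, 0)))\<^sup>2" if j: "j \<in> {1..N}" for j
  proof -
    have l: "len j > 0" by (rule len_pos[OF j])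
    have "\<bar>1 / len j * mean_rest t j\<bar> \<le> 1 / len j * (Z * len j)"
      unfolding abs_mult Z_def using l by (intro mult_mono mean_rest_bound t j) auto
    hence "\<bar>1 / len j * mean_rest t j\<bar> \<le> Z" using l by simp
    hence "\<bar>1 / len j * mean_rest t j\<bar>\<^sup>2 \<le> Z\<^sup>2" by (rule power_mono) simp
    hence "(1 / len j * mean_rest t j)\<^sup>2 \<le> Z\<^sup>2" by (simp only: power2_abs)
    thus ?thesis
      unfolding error_u_cell[OF t j] distrib_left
      using square_sum2[of "1 / len j * mean_rest t j" "1 / len j * (sqrt (len j) * \<alpha> t (j, 0))"] by linarith
  qed
  have "1 / real N * (\<Sum>j=1..N. (1 / len j * integral {X (j - 1)..X j} (\<lambda>x. U 0 x t - poly (pu t j) x))\<^sup>2)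
     \<le> 1 / real N * (\<Sum>j=1..N. 2 * Z\<^sup>2 + 2 * (1 / len j * (sqrt (len j) * \<alpha> t (j, 0)))\<^sup>2)"
    by (intro mult_left_mono sum_mono *) auto
  also have "\<dots> = 2 * Z\<^sup>2 + 2 * (1 / real N * (\<Sum>j=1..N. (1 / len j * (sqrt (len j) * \<alpha> t (j, 0)))\<^sup>2))"
    using N1 by (simp add: sum.distrib sum_distrib_left[symmetric] distrib_left)
  also have "\<dots> \<le> 2 * Z\<^sup>2 + 2 * (c * ev.ip (\<alpha> t) (\<alpha> t))"
    by (intro add_left_mono mult_left_mono mean_mode0) auto
  also have "\<dots> \<le> 2 * (PB k ^ 4 * (h ^ (4 * k) * M\<^sup>2 * (h + t)\<^sup>2)) + 2 * (c * (9 * Gk k * h ^ (4 * k) * M\<^sup>2 * (h + t)\<^sup>2))"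
  proof (intro add_mono mult_left_mono energy_estimates(1) t)
    have "Z\<^sup>2 = PB k ^ 4 * (h ^ (4 * k) * M\<^sup>2 * h\<^sup>2)"
      by (simp add: Z_def power_mult_distrib power_mult[symmetric] power_add[symmetric] algebra_simps)
    also have "\<dots> \<le> PB k ^ 4 * (h ^ (4 * k) * M\<^sup>2 * (h + t)\<^sup>2)"
      using h_pos t by (intro mult_left_mono power_mono) auto
    finally show "Z\<^sup>2 \<le> PB k ^ 4 * (h ^ (4 * k) * M\<^sup>2 * (h + t)\<^sup>2)" .
  qed (use c_ge_1 in auto)
  also have "\<dots> = (2 * PB k ^ 4 + 18 * c * Gk k) * (h ^ (4 * k) * M\<^sup>2 * (h + t)\<^sup>2)" by (simp add: algebra_simps)
  finally show ?thesis .
qed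

lemma t_le_square: "0 \<le> t \<Longrightarrow> t \<le> (1 + t)\<^sup>2" "0 \<le> t \<Longrightarrow> 1 + t \<le> (1 + t)\<^sup>2" for t :: real
  by (simp_all add: power2_eq_square algebra_simps)

lemma cell_error_q:
  assumes t: "t \<in> {0..T}"
  shows "1 / real N * (\<Sum>j=1..N. (1 / len j * integral {X (j - 1)..X j} (\<lambda>x. U 1 x t - poly (pq t j) x))\<^sup>2)
    \<le> c * (1 + (kap k c)\<^sup>2) * Gk k * (h ^ (4 * k) * M\<^sup>2 * (1 + t)\<^sup>2)"
proof -
  have "1 / real N * (\<Sum>j=1..N. (1 / len j * integral {X (j - 1)..X j} (\<lambda>x. U 1 x t - poly (pq t j) x))\<^sup>2)
      = 1 / real N * (\<Sum>j=1..N. (1 / len j * (sqrt (len j) * ev.D (\<alpha> t) (j, 0)))\<^sup>2)"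
    using error_q_cell(2)[OF t] by simp
  also have "\<dots> \<le> c * ev.ip (ev.D (\<alpha> t)) (ev.D (\<alpha> t))" by (rule mean_mode0)
  also have "\<dots> \<le> c * (t * (1 + (kap k c)\<^sup>2) * (Gk k * h ^ (4 * k) * M\<^sup>2))"
    using c_ge_1 by (intro mult_left_mono gradient_estimate t) auto
  also have "\<dots> \<le> c * ((1 + t)\<^sup>2 * (1 + (kap k c)\<^sup>2) * (Gk k * h ^ (4 * k) * M\<^sup>2))"
    using c_ge_1 t h_pos Gk_nonneg[of k] by (intro mult_left_mono mult_right_mono t_le_square) auto
  finally show ?thesis by (simp add: mult_ac)
qed

lemma domain_rest:
  assumes t: "t \<in> {0..T}"
  shows "\<bar>\<Sum>j=1..N. mean_rest t j\<bar> \<le> 7 * (PB k)\<^sup>2 * (h ^ (2 * k + 1) * M)"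
proof -
  have "\<bar>\<Sum>j=1..N. mean_rest t j\<bar> \<le> (\<Sum>j=1..N. (PB k)\<^sup>2 * M * h ^ (2 * k + 1) * len j)"
    by (rule order.trans[OF sum_abs]) (intro sum_mono mean_rest_bound t)
  also have "\<dots> = (PB k)\<^sup>2 * M * h ^ (2 * k + 1) * (2 * pi)" unfolding sum_distrib_left[symmetric] sum_sizes ..
  also have "\<dots> \<le> (PB k)\<^sup>2 * M * h ^ (2 * k + 1) * 7"
    using M h_pos pi_approx by (intro mult_left_mono) auto
  finally show ?thesis by (simp add: mult_ac)
qed

lemma domain_error_u:
  assumes t: "t \<in> {0..T}"
  shows "(\<Sum>j=1..N. integral {X (j - 1)..X j} (\<lambda>x. U 0 x t - poly (pu t j) x))\<^sup>2
    \<le> (98 * PB k ^ 4 + 252 * Gk k) * (h ^ (4 * k + 1) * M\<^sup>2 * (sqrt h + t)\<^sup>2)"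
proof -
  have "(\<Sum>j=1..N. integral {X (j - 1)..X j} (\<lambda>x. U 0 x t - poly (pu t j) x))\<^sup>2
     = ((\<Sum>j=1..N. mean_rest t j) + (\<Sum>j=1..N. sqrt (len j) * \<alpha> t (j, 0)))\<^sup>2"
    using error_u_cell[OF t] by (simp add: sum.distrib)
  also have "\<dots> \<le> 2 * (\<Sum>j=1..N. mean_rest t j)\<^sup>2 + 2 * (\<Sum>j=1..N. sqrt (len j) * \<alpha> t (j, 0))\<^sup>2"
    by (rule square_sum2)
  also have "\<dots> \<le> 2 * (49 * PB k ^ 4 * (h ^ (4 * k + 1) * M\<^sup>2 * (sqrt h + t)\<^sup>2)) + 2 * (7 * (18 * Gk k * h ^ (4 * k + 1) * M\<^sup>2 * (sqrt h + t)\<^sup>2))"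
  proof (intro add_mono mult_left_mono)
    have "\<bar>\<Sum>j=1..N. mean_rest t j\<bar>\<^sup>2 \<le> (7 * (PB k)\<^sup>2 * (h ^ (2 * k + 1) * M))\<^sup>2"
      by (intro power_mono domain_rest t) auto
    also have "\<dots> = 49 * PB k ^ 4 * (h ^ (4 * k + 1) * M\<^sup>2 * h)"
      by (simp add: power_mult_distrib power_mult[symmetric] power2_eq_square[of h] algebra_simps)
    also have "\<dots> \<le> 49 * PB k ^ 4 * (h ^ (4 * k + 1) * M\<^sup>2 * (sqrt h + t)\<^sup>2)"
    proof (intro mult_left_mono)
      show "h \<le> (sqrt h + t)\<^sup>2" using power_mono[of "sqrt h" "sqrt h + t" 2] h_pos t by simp
    qed (use h_pos in auto)
    finally show "(\<Sum>j=1..N. mean_rest t j)\<^sup>2 \<le> 49 * PB k ^ 4 * (h ^ (4 * k + 1) * M\<^sup>2 * (sqrt h + t)\<^sup>2)" by simp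
    have "(\<Sum>j=1..N. sqrt (len j) * \<alpha> t (j, 0))\<^sup>2 \<le> 7 * ev.ip (\<alpha> t) (\<alpha> t)" by (rule domain_mode0)
    also have "\<dots> \<le> 7 * (18 * Gk k * h ^ (4 * k + 1) * M\<^sup>2 * (sqrt h + t)\<^sup>2)"
      by (intro mult_left_mono energy_estimates(2) t) auto
    finally show "(\<Sum>j=1..N. sqrt (len j) * \<alpha> t (j, 0))\<^sup>2 \<le> 7 * (18 * Gk k * h ^ (4 * k + 1) * M\<^sup>2 * (sqrt h + t)\<^sup>2)" .
  qed auto
  also have "\<dots> = (98 * PB k ^ 4 + 252 * Gk k) * (h ^ (4 * k + 1) * M\<^sup>2 * (sqrt h + t)\<^sup>2)" by (simp add: algebra_simps)
  finally show ?thesis .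
qed

lemma domain_error_q:
  assumes t: "t \<in> {0..T}"
  shows "(\<Sum>j=1..N. integral {X (j - 1)..X j} (\<lambda>x. U 1 x t - poly (pq t j) x)) = form e per (\<xi> t) (\<lambda>_. 1)"
  using error_q_cell(1)[OF t] by (simp add: form_def)

text \<open>The exact and the numerical total mass both change by the flux difference between the
  two ends, which is zero in the periodic case. So the mean error keeps its initial value, where
  \<xi> vanishes and only the last correction contributes, and this bound does not grow with
  time.\<close>

lemma domain_error_u_periodic:
  assumes per: "per" and t: "t \<in> {0..T}"
  shows "\<bar>\<Sum>j=1..N. integral {X (j - 1)..X j} (\<lambda>x. U 0 x t - poly (pu t j) x)\<bar> \<le> 7 * (PB k)\<^sup>2 * (h ^ (2 * k + 1) * M)"
proof -
  have K2: "0 + 2 \<le> K" using K k by simp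
  define m where "m s = (\<Sum>j=1..N. integral {X (j - 1)..X j} (\<lambda>x. U 0 x s * poly 1 x) - integral {X (j - 1)..X j} (\<lambda>x. poly (pu s j) x * poly 1 x))" for s
  have m: "m s = (\<Sum>j=1..N. integral {X (j - 1)..X j} (\<lambda>x. U 0 x s - poly (pu s j) x))" if s: "s \<in> {0..T}" for s
    unfolding m_def
  proof (intro sum.cong refl)
    fix j assume j: "j \<in> {1..N}"
    show "integral {X (j - 1)..X j} (\<lambda>x. U 0 x s * poly 1 x) - integral {X (j - 1)..X j} (\<lambda>x. poly (pu s j) x * poly 1 x)
       = integral {X (j - 1)..X j} (\<lambda>x. U 0 x s - poly (pu s j) x)"
      using integral_U_minus_poly[OF le0 s j, of "pu s j" 1] by (simp add: cint_def)
  qed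
  have D: "(m has_real_derivative 0) (at s within {0..T})" if s: "s \<in> {0..T}" for s
  proof -
    have "(m has_real_derivative (\<Sum>j=1..N. integral {X (j - 1)..X j} (\<lambda>x. U (0 + 2) x s * poly 1 x) -
        integral {X (j - 1)..X j} (\<lambda>x. time_deriv T (\<lambda>s. uh x s) s * poly 1 x))) (at s within {0..T})"
      unfolding m_def[abs_def]
    proof (intro DERIV_sum DERIV_diff)
      fix j assume j: "j \<in> {1..N}"
      show "((\<lambda>s. integral {X (j - 1)..X j} (\<lambda>x. U 0 x s * poly 1 x)) has_real_derivative
          integral {X (j - 1)..X j} (\<lambda>x. U (0 + 2) x s * poly 1 x)) (at s within {0..T})"
        using cell_range[OF j] by (intro moment_deriv K2 s) auto
      show "((\<lambda>s. integral {X (j - 1)..X j} (\<lambda>x. poly (pu s j) x * poly 1 x)) has_real_derivative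
          integral {X (j - 1)..X j} (\<lambda>x. time_deriv T (\<lambda>s. uh x s) s * poly 1 x)) (at s within {0..T})"
        by (rule poly_cell_moment_deriv[OF T X_less[OF j] pu_deg[OF _ j] pu_eq[OF _ j] uh_diff[OF j] s])
    qed
    also have "(\<Sum>j=1..N. integral {X (j - 1)..X j} (\<lambda>x. U (0 + 2) x s * poly 1 x) -
        integral {X (j - 1)..X j} (\<lambda>x. time_deriv T (\<lambda>s. uh x s) s * poly 1 x))
        = (\<Sum>j=1..N. hat (\<not> e) per (\<zeta> s) j - hat (\<not> e) per (\<zeta> s) (j - 1))"
    proof (intro sum.cong refl)
      fix j assume j: "j \<in> {1..N}"
      have jN: "j \<le> N" "j - 1 \<le> N" using j by auto
      have K1: "1 < K" using K k by simp
      have "integral {X (j - 1)..X j} (\<lambda>x. U (0 + 2) x s * poly 1 x) = U 1 (X j) s - U 1 (X (j - 1)) s"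
        using U_parts[OF K1 s j, of 1] by (simp add: numeral_2_eq_2)
      moreover have "integral {X (j - 1)..X j} (\<lambda>x. time_deriv T (\<lambda>s. uh x s) s * poly 1 x) = fq s j - fq s (j - 1)"
        using scheme1[OF s j, of 1] by (simp add: cint_def)
      ultimately show "integral {X (j - 1)..X j} (\<lambda>x. U (0 + 2) x s * poly 1 x) -
        integral {X (j - 1)..X j} (\<lambda>x. time_deriv T (\<lambda>s. uh x s) s * poly 1 x) = hat (\<not> e) per (\<zeta> s) j - hat (\<not> e) per (\<zeta> s) (j - 1)"
        unfolding flux_q'[OF s jN(1), symmetric] flux_q'[OF s jN(2), symmetric] by linarith
    qed
    also have "\<dots> = hat (\<not> e) per (\<zeta> s) N - hat (\<not> e) per (\<zeta> s) 0" by (rule sum_telescope_1)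
    also have "\<dots> = 0" using per N1 by (simp add: hat_def)
    finally show ?thesis .
  qed
  have "m t = m 0"
    using has_field_derivative_zero_constant[OF convex_real_interval(5) D] t T by (metis atLeastAtMost_iff less_imp_le order_refl)
  also have "\<dots> = (\<Sum>j=1..N. mean_rest 0 j)"
  proof -
    have z: "0 \<in> {0..T}" using T by simp
    have "integral {X (j - 1)..X j} (\<lambda>x. U 0 x 0 - poly (pu 0 j) x) = mean_rest 0 j" if "j \<in> {1..N}" for j
      using UI_mean[OF z that] unfolding init[OF that] UI_def .
    thus ?thesis unfolding m[OF z] by (intro sum.cong) auto
  qed
  finally show ?thesis using domain_rest[of 0] m[OF t] T by simp
qed

lemma form_comb: "form e per (comb k a) (bas i') = ev.D a i'" "form e per (comb k a) (comb k b) = ev.ip b (ev.D a)"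
proof -
  show 1: "form e per (comb k a) (bas i') = ev.D a i'" for i'
    unfolding comb_def[abs_def] ev.D_def bm_def by (rule form_linear) simp
  have "form e per (comb k a) (comb k b) = (\<Sum>i\<in>idx k. b i * form e per (comb k a) (bas i))"
    unfolding comb_def[of k b, abs_def] by (rule form_linear_right) simp
  thus "form e per (comb k a) (comb k b) = ev.ip b (ev.D a)" unfolding 1 ev.ip_def .
qed

text \<open>Testing the form with the constant 1 leaves only the trace at the free end, so the trace
  is up to sign the inner product of the discrete gradient with the coordinates of 1.\<close>

lemma trace_smooth:
  assumes "\<not> per"
  shows "(tr e (comb k a))\<^sup>2 \<le> 7 * (real k + 1) * (2 * real k + 1) * (PB k)\<^sup>2 * ev.ip (ev.D a) (ev.D a)"
proof -
  let ?o = "coord (\<lambda>_. 1)"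
  have "form e per (comb k a) (\<lambda>_. 1) = form e per (comb k a) (comb k ?o)"
    by (intro form_cong refl comb_coord[symmetric]) auto
  moreover have "(tr e (comb k a))\<^sup>2 = (form e per (comb k a) (\<lambda>_. 1))\<^sup>2"
    using assms unfolding form_one by simp
  ultimately have "(tr e (comb k a))\<^sup>2 = (ev.ip ?o (ev.D a))\<^sup>2"
    by (simp only: form_comb)
  also have "\<dots> \<le> (\<Sum>i\<in>idx k. (?o i)\<^sup>2) * (\<Sum>i\<in>idx k. (ev.D a i)\<^sup>2)"
    unfolding ev.ip_def by (rule Cauchy_Schwarz_ineq_sum)
  also have "(\<Sum>i\<in>idx k. (?o i)\<^sup>2) \<le> (\<Sum>j=1..N. \<Sum>m\<le>k. (2 * real k + 1) * (PB k)\<^sup>2 * 1\<^sup>2 * len j)"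
    unfolding sum_idx coord_def fst_conv by (intro sum_mono cint_bas_bound) auto
  also have "\<dots> = (real k + 1) * (2 * real k + 1) * (PB k)\<^sup>2 * (2 * pi)"
    unfolding sum_sizes[symmetric] sum_distrib_left by (intro sum.cong refl) (simp add: algebra_simps)
  also have "\<dots> \<le> (real k + 1) * (2 * real k + 1) * (PB k)\<^sup>2 * 7"
    using pi_approx by (intro mult_left_mono) auto
  finally have "(tr e (comb k a))\<^sup>2 \<le> (real k + 1) * (2 * real k + 1) * (PB k)\<^sup>2 * 7 * (\<Sum>i\<in>idx k. (ev.D a i)\<^sup>2)"
    by (simp add: mult_right_mono sum_nonneg)
  thus ?thesis unfolding ev.ip_self by (simp only: mult_ac)
qed

text \<open>A multiplicative trace inequality: \<open>trace_square\<close> followed by Young's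
  inequality with weight 1/h, the balance that matches the functional in
  \<open>splitting_bound\<close>.\<close>

lemma trace_rough:
  assumes "\<not> per"
  shows "(tr e (comb k b))\<^sup>2 \<le> ev.ip b b / h + h * ev.ip (ev.D b) (ev.D b)"
proof -
  have h: "1 / h > 0" using h_pos by simp
  have "2 * \<bar>ev.ip b (ev.D b)\<bar> \<le> ev.ip b b / h + h * ev.ip (ev.D b) (ev.D b)"
    using ev.ip_young[OF h, of b "ev.D b"] ev.ip_young'[OF h, of b "ev.D b"] by (auto simp: abs_if mult_ac)
  thus ?thesis using trace_square[of e "comb k b"] assms form_comb(2)[of b b] by simp
qed

lemma domain_error_q_mixed:
  assumes per: "\<not> per" and t: "t \<in> {0..T}"
  defines "W \<equiv> 7 * (real k + 1) * (2 * real k + 1) * (PB k)\<^sup>2"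
  shows "(\<Sum>j=1..N. integral {X (j - 1)..X j} (\<lambda>x. U 1 x t - poly (pq t j) x))\<^sup>2
    \<le> ((2 * W + 34) * 7 + 4 * (1 + (kap k c)\<^sup>2)) * Gk k * (h ^ (4 * k + 1) * M\<^sup>2 * (1 + t)\<^sup>2)"
proof -
  define g where "g = Gk k * h ^ (4 * k + 1) * M\<^sup>2"
  have g: "g \<ge> 0" using Gk_nonneg[of k] h_pos by (simp add: g_def)
  have pi7: "2 * pi \<le> 7" using pi_approx by simp
  have W: "W \<ge> 0" by (simp add: W_def)
  define \<Phi> where "\<Phi> = (t * (Gk k * h ^ (4 * k + 2) * M\<^sup>2) / h + Aint t) / 2"
  define F where "F = ev.ip (ev.D (\<alpha> t)) (ev.D (\<alpha> t))"
  \<comment> \<open>The trace of the smooth part is controlled by its gradient alone, that of the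
    remainder by its norm over the square root of h; \<Phi> bounds the squares of both. Estimating
    the trace of all of \<open>\<alpha>\<close> through its gradient would lose the half power of
    h.\<close>
  obtain a where a: "ev.ip (ev.D a) (ev.D a) + ev.ip (\<lambda>i. \<alpha> t i - a i) (\<lambda>i. \<alpha> t i - a i) / h \<le> \<Phi>"
    using ev.splitting_bound[OF h_pos, of t] t unfolding \<Phi>_def by auto
  define b where "b i = \<alpha> t i - a i" for i
  have nn: "ev.ip (ev.D a) (ev.D a) \<ge> 0" "ev.ip b b / h \<ge> 0" using ev.ip_nonneg h_pos by auto
  have Da: "ev.ip (ev.D a) (ev.D a) \<le> \<Phi>" "ev.ip b b / h \<le> \<Phi>"
    using a nn by (simp_all add: b_def[abs_def])
  have \<Phi>0: "\<Phi> \<ge> 0" using Da nn by linarith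
  have Db: "ev.ip (ev.D b) (ev.D b) \<le> 2 * F + 2 * \<Phi>"
  proof -
    have "ev.D b i = ev.D (\<alpha> t) i + - ev.D a i" for i
      unfolding ev.D_def b_def left_diff_distrib sum_subtractf by simp
    hence "ev.ip (ev.D b) (ev.D b) = (\<Sum>i\<in>idx k. (ev.D (\<alpha> t) i + - ev.D a i)\<^sup>2)" by (simp only: ev.ip_self)
    also have "\<dots> \<le> (\<Sum>i\<in>idx k. 2 * (ev.D (\<alpha> t) i)\<^sup>2 + 2 * (- ev.D a i)\<^sup>2)"
      by (intro sum_mono square_sum2)
    also have "\<dots> = 2 * F + 2 * ev.ip (ev.D a) (ev.D a)"
      unfolding F_def ev.ip_self sum.distrib sum_distrib_left by simp
    finally show ?thesis using Da by linarith
  qed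
  have "(\<Sum>j=1..N. integral {X (j - 1)..X j} (\<lambda>x. U 1 x t - poly (pq t j) x))\<^sup>2 = (tr e (\<xi> t))\<^sup>2"
    unfolding domain_error_q[OF t] form_one using per by simp
  also have "tr e (\<xi> t) = tr e (comb k (\<alpha> t))"
  proof -
    have cell: "comb k (\<alpha> t) j = \<xi> t j" if "j \<in> {1..N}" for j
      unfolding \<alpha>_def by (rule comb_coord[where v = "\<xi> t", OF that degrees(1)[OF t that]])
    have eq: "tr e v = tr e w" if "v N = w N" "v 1 = w 1" for v w using that by (simp only: tr_def)
    show ?thesis by (rule eq; rule cell[symmetric]) (use N1 in simp_all)
  qed
  also have "\<dots> = tr e (comb k a) + tr e (comb k b)"
    using tr_comb[of e k a b] by (simp add: b_def)
  also have "\<dots>\<^sup>2 \<le> 2 * (tr e (comb k a))\<^sup>2 + 2 * (tr e (comb k b))\<^sup>2" by (rule square_sum2)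
  also have "\<dots> \<le> 2 * (W * \<Phi>) + 2 * (\<Phi> + h * (2 * F + 2 * \<Phi>))"
  proof (intro add_mono mult_left_mono)
    have "W * ev.ip (ev.D a) (ev.D a) \<le> W * \<Phi>" by (intro mult_left_mono Da W)
    thus "(tr e (comb k a))\<^sup>2 \<le> W * \<Phi>" using trace_smooth[OF per, of a] unfolding W_def by linarith
    have "h * ev.ip (ev.D b) (ev.D b) \<le> h * (2 * F + 2 * \<Phi>)" using h_pos by (intro mult_left_mono Db) auto
    thus "(tr e (comb k b))\<^sup>2 \<le> \<Phi> + h * (2 * F + 2 * \<Phi>)" using trace_rough[OF per, of b] Da(2) by linarith
  qed auto
  also have "\<dots> = (2 * W + 2 + 4 * h) * \<Phi> + 4 * (h * F)" by (simp add: algebra_simps)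
  \<comment> \<open>34 dominates 2 + 4h, as h is at most 2\<pi>.\<close>
  also have "\<dots> \<le> (2 * W + 34) * \<Phi> + 4 * (h * F)"
    using h_le pi7 \<Phi>0 by (intro add_right_mono mult_right_mono) auto
  also have "\<dots> \<le> (2 * W + 34) * (7 * (g * (1 + t)\<^sup>2)) + 4 * ((1 + (kap k c)\<^sup>2) * (g * (1 + t)\<^sup>2))"
  proof (intro add_mono mult_left_mono)
    have "t * (Gk k * h ^ (4 * k + 2) * M\<^sup>2) / h = g * t" using h_pos by (simp add: g_def)
    moreover have "Gk k * h ^ (4 * k) * (h\<^sup>2 + t * h) * M\<^sup>2 = g * (h + t)"
      by (simp add: g_def power2_eq_square algebra_simps)
    ultimately have "\<Phi> \<le> (g * t + g * (h + t)) / 2" using Aint_bounds(2)[OF t] by (simp add: \<Phi>_def)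
    also have "\<dots> \<le> g * (h + t)" using mult_nonneg_nonneg[OF g, of h] h_pos by (simp add: algebra_simps)
    also have "\<dots> \<le> g * (7 * (1 + t)\<^sup>2)"
      using h_le pi7 t t_le_square(2)[of t] by (intro mult_left_mono g) auto
    finally show "\<Phi> \<le> 7 * (g * (1 + t)\<^sup>2)" by (simp add: mult_ac)
    have "h * F \<le> h * (t * (1 + (kap k c)\<^sup>2) * (Gk k * h ^ (4 * k) * M\<^sup>2))"
      unfolding F_def using h_pos by (intro mult_left_mono gradient_estimate t) auto
    also have "\<dots> = (1 + (kap k c)\<^sup>2) * (g * t)" by (simp add: g_def mult_ac)
    also have "\<dots> \<le> (1 + (kap k c)\<^sup>2) * (g * (1 + t)\<^sup>2)"
      using t by (intro mult_left_mono g t_le_square) auto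
    finally show "h * F \<le> (1 + (kap k c)\<^sup>2) * (g * (1 + t)\<^sup>2)" .
  qed (use W in auto)
  also have "\<dots> = ((2 * W + 34) * 7 + 4 * (1 + (kap k c)\<^sup>2)) * Gk k * (h ^ (4 * k + 1) * M\<^sup>2 * (1 + t)\<^sup>2)"
  proof -
    have "A * (7 * (G * a * b * s)) + 4 * (q * (G * a * b * s)) = (A * 7 + 4 * q) * G * (a * b * s)" for A q G a b s :: real
      by (simp add: algebra_simps)
    thus ?thesis unfolding g_def .
  qed
  finally show ?thesis .
qed

end

subsection \<open>Averages of the error\<close>

lemma Lim_poly:
  fixes f :: "real \<Rightarrow> real"
  assumes "a < b" "\<And>x. x \<in> {a<..<b} \<Longrightarrow> f x = poly p x"
  shows "Lim (at_left b) f = poly p b" "Lim (at_right a) f = poly p a"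
proof -
  have "(poly p \<longlongrightarrow> poly p b) (at_left b)" "(poly p \<longlongrightarrow> poly p a) (at_right a)"
    by (intro tendsto_intros)+
  moreover have "eventually (\<lambda>x. poly p x = f x) (at_left b)" "eventually (\<lambda>x. poly p x = f x) (at_right a)"
    using eventually_at_left_real[OF assms(1)] eventually_at_right_real[OF assms(1)]
    by (auto elim!: eventually_mono simp: assms(2))
  ultimately have "(f \<longlongrightarrow> poly p b) (at_left b)" "(f \<longlongrightarrow> poly p a) (at_right a)"
    by (auto elim: Lim_transform_eventually)
  thus "Lim (at_left b) f = poly p b" "Lim (at_right a) f = poly p a" by (auto intro: tendsto_Lim)
qed

lemma poly_eq_on_interval:
  fixes p q :: "real poly"
  assumes "a < b" "\<And>x. x \<in> {a<..<b} \<Longrightarrow> poly p x = poly q x"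
  shows "p = q"
proof (rule ccontr)
  assume "p \<noteq> q"
  hence "finite {x. poly (p - q) x = 0}" by (intro poly_roots_finite) simp
  moreover have "{a<..<b} \<subseteq> {x. poly (p - q) x = 0}" using assms(2) by auto
  ultimately have "finite {a<..<b}" by (rule finite_subset[rotated])
  thus False using infinite_Ioo[OF assms(1)] by simp
qed

lemma integral_cong_open:
  fixes f g :: "real \<Rightarrow> real"
  assumes "\<And>x. x \<in> {a<..<b} \<Longrightarrow> f x = g x"
  shows "integral {a..b} f = integral {a..b} g"
  unfolding integral_open_interval_real by (intro integral_cong assms)

lemma poly_in_Vh: "degree r \<le> k \<Longrightarrow> poly r \<in> Vh k N X"
  by (auto simp: Vh_def)

lemma deriv_poly: "deriv (poly r) = poly (pderiv r)" for r :: "real poly"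
  by (intro ext DERIV_imp_deriv poly_DERIV)

text \<open>All error bounds are proved in squared form. Since C is at least 1 it is bounded by its
  square, so one constant can be used before and after taking roots.\<close>

lemma sqrt_le_scaled:
  fixes y z C D :: real
  assumes "y \<le> D * z\<^sup>2" "D \<le> C" "1 \<le> C" "0 \<le> z"
  shows "sqrt y \<le> C * z"
proof (rule real_le_lsqrt)
  have "y \<le> C * z\<^sup>2" using assms(1,2) mult_right_mono[OF assms(2), of "z\<^sup>2"] by simp
  also have "\<dots> \<le> C\<^sup>2 * z\<^sup>2" using assms(3) by (intro mult_right_mono) (auto simp: power2_eq_square)
  finally show "y \<le> (C * z)\<^sup>2" by (simp add: power_mult_distrib)
qed (use assms in simp)

lemma powr_half_square:
  assumes "h > 0"
  shows "(h powr (2 * real k + 1 / 2))\<^sup>2 = h ^ (4 * k + 1)"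
proof -
  have "(h powr (2 * real k + 1 / 2))\<^sup>2 = h powr (real (4 * k + 1))"
    using assms by (simp add: powr_power algebra_simps)
  also have "\<dots> = h ^ (4 * k + 1)" using assms by (rule powr_realpow)
  finally show ?thesis .
qed

context mesh
begin

text \<open>Inside the mesh the projection matches the exact value at the end point from which the
  flux is taken. At a prescribed end the flux is the exact value and the error is 0; under
  periodicity the exact value is carried around to the opposite end.\<close>

lemma hat_flux:
  assumes R: "\<And>j. j \<in> {1..N} \<Longrightarrow> poly (R j) (endp e (X (j - 1)) (X j)) = V (endp e (X (j - 1)) (X j))"
    and f: "\<And>j. j \<in> {1..N} \<Longrightarrow> (if e then f j = poly (P j) (X j) else f (j - 1) = poly (P j) (X (j - 1)))"
    and b: "if e then f 0 = (if per then poly (P N) (X N) else V (X 0)) else f N = (if per then poly (P 1) (X 0) else V (X N))"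
    and V: "per \<Longrightarrow> V (X 0) = V (X N)"
    and i: "i \<le> N"
  shows "V (X i) - f i = hat e per (\<lambda>j. R j - P j) i"
proof (cases e)
  case True
  show ?thesis
  proof (cases "i = 0")
    case True
    thus ?thesis using \<open>e\<close> R[of N] b V N1 by (simp add: hat_def endp_def)
  next
    case False
    thus ?thesis using \<open>e\<close> R[of i] f[of i] i by (simp add: hat_def endp_def)
  qed
next
  case False
  show ?thesis
  proof (cases "i = N")
    case True
    thus ?thesis using \<open>\<not> e\<close> R[of 1] b V N1 by (simp add: hat_def endp_def)
  next
    case False
    thus ?thesis using \<open>\<not> e\<close> R[of "Suc i"] f[of "Suc i"] i by (simp add: hat_def endp_def)
  qed
qed

lemma integral_Omega_cells:
  fixes f :: "real \<Rightarrow> real"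
  assumes "\<And>j. j \<in> {1..N} \<Longrightarrow> f integrable_on {X (j - 1)..X j}"
  shows "integral Omega f = (\<Sum>j=1..N. integral {X (j - 1)..X j} f)"
proof -
  have "f integrable_on {X 0..X n} \<and> integral {X 0..X n} f = (\<Sum>j=1..n. integral {X (j - 1)..X j} f)" if "n \<le> N" for n
    using that
  proof (induction n)
    case (Suc n)
    hence le: "X 0 \<le> X n" "X n \<le> X (Suc n)" using X_mono[of 0 n] X_mono[of n "Suc n"] by auto
    moreover have "f integrable_on {X n..X (Suc n)}" using assms[of "Suc n"] Suc.prems by simp
    ultimately have "f integrable_on {X 0..X (Suc n)}" using Suc Henstock_Kurzweil_Integration.integrable_combine[OF le, of f] by simp
    thus ?case using Henstock_Kurzweil_Integration.integral_combine[OF le, of f] Suc by simp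
  qed (use integrable_on_refl[of f "X 0"] in simp)
  from this[of N] show ?thesis by (simp add: X0 XN)
qed

end

theorem theorem4p5:
  fixes k :: nat and c :: real
  assumes "k \<ge> 1"
  shows "\<exists>C>0. \<forall>(T :: real) (u0 :: real \<Rightarrow> real) (u :: real \<Rightarrow> real \<Rightarrow> real)
      (q :: real \<Rightarrow> real \<Rightarrow> real) (bc :: bdry) (fl :: flux) (N :: nat) (X :: nat \<Rightarrow> real)
      (uh :: real \<Rightarrow> real \<Rightarrow> real) (qh :: real \<Rightarrow> real \<Rightarrow> real).
    T > 0 \<and>
    heat_solution T u0 u q \<and> satisfies_bdry T bc u q \<and> in_Wminf_unif T (2 * k + 2) u \<and>
    is_mesh N X \<and> quasi_uniform c N X \<and>
    compatible bc fl \<and> ldg_solution k T fl bc N X uh qh \<and>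
    (\<forall>j\<in>{1..N}. \<forall>x\<in>cell X j. uh x 0 = u_interp fl k k T (X (j - 1)) (X j) u q x 0)
    \<longrightarrow>
    (\<forall>t\<in>{0..T}.
      let h = mesh_size N X;
          M = Wminf_norm_unif T (2 * k + 2) u;
          eu = (\<lambda>x. u x t - uh x t);
          eq = (\<lambda>x. q x t - qh x t)
      in cell_average N X eu \<le> C * ((h + t powr (3/2) + t) * h ^ (2 * k) * M) \<and>
         cell_average N X eq \<le> C * ((1 + t) * h ^ (2 * k) * M) \<and>
         (bc = Periodic \<longrightarrow>
            domain_average eu \<le> C * (h ^ (2 * k + 1) * M) \<and>
            domain_average eq = 0) \<and>
         (bc \<noteq> Periodic \<longrightarrow>
            domain_average eu
              \<le> C * ((h powr (1/2) + t powr (3/2) + t) * h powr (2 * real k + 1/2) * M) \<and>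
            domain_average eq \<le> C * ((1 + t) * h powr (2 * real k + 1/2) * M)))"
proof -
  define W where "W = 7 * (real k + 1) * (2 * real k + 1) * (PB k)\<^sup>2"
  define C1 where "C1 = 2 * PB k ^ 4 + 18 * c * Gk k"
  define C2 where "C2 = c * (1 + (kap k c)\<^sup>2) * Gk k"
  define C3 where "C3 = 7 * (PB k)\<^sup>2"
  define C4 where "C4 = 98 * PB k ^ 4 + 252 * Gk k"
  define C5 where "C5 = ((2 * W + 34) * 7 + 4 * (1 + (kap k c)\<^sup>2)) * Gk k"
  \<comment> \<open>Absolute values are taken because \<open>c\<close> is an arbitrary real number
    at this point; that it is at least 1 follows only once a quasi-uniform mesh is given.\<close>
  define C where "C = 1 + \<bar>C1\<bar> + \<bar>C2\<bar> + \<bar>C3\<bar> + \<bar>C4\<bar> + \<bar>C5\<bar>"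
  have C: "C1 \<le> C" "C2 \<le> C" "C3 \<le> C" "C4 \<le> C" "C5 \<le> C" "1 \<le> C" by (simp_all add: C_def)
  show ?thesis
  proof (rule exI[of _ C], intro conjI allI impI ballI)
    show "C > 0" using C(6) by linarith
  next
    fix T :: real and u0 u q bc fl and N :: nat and X :: "nat \<Rightarrow> real" and uh qh and t :: real
    assume H: "T > 0 \<and>
      heat_solution T u0 u q \<and> satisfies_bdry T bc u q \<and> in_Wminf_unif T (2 * k + 2) u \<and>
      is_mesh N X \<and> quasi_uniform c N X \<and>
      compatible bc fl \<and> ldg_solution k T fl bc N X uh qh \<and>
      (\<forall>j\<in>{1..N}. \<forall>x\<in>cell X j. uh x 0 = u_interp fl k k T (X (j - 1)) (X j) u q x 0)"
    assume t: "t \<in> {0..T}"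
    have T: "T > 0" and hs: "heat_solution T u0 u q" and bd: "satisfies_bdry T bc u q"
      and Wu: "in_Wminf_unif T (2 * k + 2) u" and ms: "is_mesh N X" and qu: "quasi_uniform c N X"
      and co: "compatible bc fl" and ldg: "ldg_solution k T fl bc N X uh qh"
      and ini: "\<And>j x. j \<in> {1..N} \<Longrightarrow> x \<in> cell X j \<Longrightarrow> uh x 0 = u_interp fl k k T (X (j - 1)) (X j) u q x 0"
      using H by auto
    define M where "M = Wminf_norm_unif T (2 * k + 2) u"
    define K where "K = 2 * k + 1"
    have Ks: "2 * k + 2 = Suc K" "K \<ge> 3" using assms by (simp_all add: K_def)
    obtain U where sm: "smooth_heat T M K U" and U0: "\<And>x t. x \<in> Omega \<Longrightarrow> t \<in> {0..T} \<Longrightarrow> U 0 x t = u x t"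
      and U1: "\<And>x t. x \<in> Omega \<Longrightarrow> t \<in> {0..T} \<Longrightarrow> U 1 x t = q x t"
      using heat_solution_smooth[OF T hs Wu[unfolded Ks(1)] Ks(2)] unfolding M_def Ks(1) by blast
    interpret smooth_heat T M K U by (rule sm)
    interpret mesh N X by unfold_locales (rule ms)
    define e where "e = (fl = Flux_I)"
    define per where "per = (bc = Periodic)"
    note ldg1 = conjunct1[OF ldg[unfolded ldg_solution_def]]
    note ldg2 = conjunct1[OF conjunct2[OF ldg[unfolded ldg_solution_def]]]
    note ldg3 = conjunct2[OF conjunct2[OF ldg[unfolded ldg_solution_def]]]
    have Vh1: "(\<lambda>x. uh x s) \<in> Vh k N X" if "s \<in> {0..T}" for s
      by (rule conjunct1[OF bspec[OF ldg1 that]])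
    have Vh2: "(\<lambda>x. qh x s) \<in> Vh k N X" if "s \<in> {0..T}" for s
      by (rule conjunct2[OF bspec[OF ldg1 that]])
    define pu where "pu s j = (SOME p. degree p \<le> k \<and> (\<forall>x\<in>cell X j. uh x s = poly p x))" for s j
    define pq where "pq s j = (SOME p. degree p \<le> k \<and> (\<forall>x\<in>cell X j. qh x s = poly p x))" for s j
    have pu: "degree (pu s j) \<le> k \<and> (\<forall>x\<in>cell X j. uh x s = poly (pu s j) x)" if "s \<in> {0..T}" "j \<in> {1..N}" for s j
    proof -
      have "\<exists>p. degree p \<le> k \<and> (\<forall>x\<in>cell X j. uh x s = poly p x)"
        using Vh1[OF that(1)] that(2) unfolding Vh_def by blast
      thus ?thesis unfolding pu_def by (rule someI_ex)
    qed
    have pq: "degree (pq s j) \<le> k \<and> (\<forall>x\<in>cell X j. qh x s = poly (pq s j) x)" if "s \<in> {0..T}" "j \<in> {1..N}" for s j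
    proof -
      have "\<exists>p. degree p \<le> k \<and> (\<forall>x\<in>cell X j. qh x s = poly p x)"
        using Vh2[OF that(1)] that(2) unfolding Vh_def by blast
      thus ?thesis unfolding pq_def by (rule someI_ex)
    qed
    have puc: "uh x s = poly (pu s j) x" if "s \<in> {0..T}" "j \<in> {1..N}" "x \<in> {X (j - 1)<..<X j}" for s j x
      using pu[OF that(1,2)] that(3) by (simp add: cell_def)
    have pqc: "qh x s = poly (pq s j) x" if "s \<in> {0..T}" "j \<in> {1..N}" "x \<in> {X (j - 1)<..<X j}" for s j x
      using pq[OF that(1,2)] that(3) by (simp add: cell_def)
    define fu where "fu s j = u_hat fl bc N X s (\<lambda>x. uh x s) j" for s j
    define fq where "fq s j = q_hat fl bc N X s (\<lambda>x. qh x s) j" for s j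
    have lim_r: "lim_left (poly r) x = poly r x" "lim_right (poly r) x = poly r x" for r :: "real poly" and x
      using Lim_poly(1)[of "x - 1" x "poly r" r] Lim_poly(2)[of x "x + 1" "poly r" r] by auto
    have ci: "cell_inner X j (\<lambda>x. qh x s) (poly r) = cint j (pq s j) r" "cell_inner X j (\<lambda>x. uh x s) (poly r) = cint j (pu s j) r"
      if "s \<in> {0..T}" "j \<in> {1..N}" for s j r
      unfolding cell_inner_def cint_def cell_def integral_open_interval_real
      using puc[OF that] pqc[OF that] by (auto intro!: integral_cong)
    have ldg': "cell_inner X j (\<lambda>x. time_deriv T (\<lambda>s. uh x s) s) (poly r)
          = - cell_inner X j (\<lambda>x. qh x s) (deriv (poly r)) + fq s j * lim_left (poly r) (X j) - fq s (j - 1) * lim_right (poly r) (X (j - 1)) \<and>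
        cell_inner X j (\<lambda>x. qh x s) (poly r)
          = - cell_inner X j (\<lambda>x. uh x s) (deriv (poly r)) + fu s j * lim_left (poly r) (X j) - fu s (j - 1) * lim_right (poly r) (X (j - 1))"
      if "s \<in> {0..T}" "j \<in> {1..N}" "degree r \<le> k" for s j r
      using bspec[OF bspec[OF bspec[OF bspec[OF ldg3 that(1)] poly_in_Vh[OF that(3)]] poly_in_Vh[OF that(3)]] that(2)]
      unfolding fu_def fq_def .
    have lims: "lim_left (\<lambda>x. uh x s) (X j) = poly (pu s j) (X j)" "lim_right (\<lambda>x. uh x s) (X (j - 1)) = poly (pu s j) (X (j - 1))"
      "lim_left (\<lambda>x. qh x s) (X j) = poly (pq s j) (X j)" "lim_right (\<lambda>x. qh x s) (X (j - 1)) = poly (pq s j) (X (j - 1))"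
      if "s \<in> {0..T}" "j \<in> {1..N}" for s j
      using Lim_poly[OF X_less[OF that(2)] puc[OF that]] Lim_poly[OF X_less[OF that(2)] pqc[OF that]] by auto
    have XO: "X j \<in> Omega" if "j \<le> N" for j using X_range[OF that] by simp
    interpret E: ldg_error T M K U N X k c e per uh pu pq fu fq
    proof
      show "K = 2 * k + 1" by (simp add: K_def)
      show "k \<ge> 1" "quasi_uniform c N X" by fact+
      show "degree (pu s j) \<le> k" "degree (pq s j) \<le> k" if "s \<in> {0..T}" "j \<in> {1..N}" for s j
        using pu[OF that] pq[OF that] by auto
      show "uh x s = poly (pu s j) x" if "s \<in> {0..T}" "j \<in> {1..N}" "x \<in> {X (j - 1)<..<X j}" for s j x
        by (rule puc[OF that])
      show "(\<lambda>t. uh x t) differentiable_on {0..T}" if "j \<in> {1..N}" "x \<in> {X (j - 1)<..<X j}" for j x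
        using bspec[OF bspec[OF ldg2 that(1)], of x] that(2) by (simp add: cell_def)
      show "integral {X (j - 1)..X j} (\<lambda>x. time_deriv T (\<lambda>s. uh x s) s * poly r x)
         = - cint j (pq s j) (pderiv r) + fq s j * poly r (X j) - fq s (j - 1) * poly r (X (j - 1))"
        if "s \<in> {0..T}" "j \<in> {1..N}" "degree r \<le> k" for s j r
        using conjunct1[OF ldg'[OF that]] ci[OF that(1,2)]
        unfolding deriv_poly lim_r by (simp only: cell_inner_def cell_def integral_open_interval_real)
      show "cint j (pq s j) r = - cint j (pu s j) (pderiv r) + fu s j * poly r (X j) - fu s (j - 1) * poly r (X (j - 1))"
        if "s \<in> {0..T}" "j \<in> {1..N}" "degree r \<le> k" for s j r
        using conjunct2[OF ldg'[OF that]] unfolding deriv_poly lim_r ci[OF that(1,2)] .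
      show "U 0 (X i) s - fu s i = hat e per (\<lambda>j. corrected e k (X (j - 1)) (X j) (\<lambda>x. U 0 x s) (cc e k (X (j - 1)) (X j) s) - pu s j) i"
        if s: "s \<in> {0..T}" and i: "i \<le> N" for s i
      proof (rule hat_flux[OF _ _ _ _ i, where V = "\<lambda>x. U 0 x s"])
        show "poly (corrected e k (X (j - 1)) (X j) (\<lambda>x. U 0 x s) (cc e k (X (j - 1)) (X j) s)) (endp e (X (j - 1)) (X j)) = U 0 (endp e (X (j - 1)) (X j)) s"
          if "j \<in> {1..N}" for j by (rule corrected_endp[OF X_less[OF that]]) (simp add: cc_def)
        show "if e then fu s j = poly (pu s j) (X j) else fu s (j - 1) = poly (pu s j) (X (j - 1))" if "j \<in> {1..N}" for j
          using lims(1,2)[OF s that] that co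
          by (cases fl; cases bc) (auto simp: e_def fu_def trace_left_def trace_right_def)
        show "if e then fu s 0 = (if per then poly (pu s N) (X N) else U 0 (X 0) s) else fu s N = (if per then poly (pu s 1) (X 0) else U 0 (X N) s)"
          using lims(1)[OF s, of N] lims(2)[OF s, of 1] N1 co bd s U0[OF XO[OF le0] s] U0[OF XO[OF order_refl] s]
          by (cases fl; cases bc) (auto simp: e_def per_def fu_def trace_left_def trace_right_def X0 XN)
        show "U 0 (X 0) s = U 0 (X N) s" if "per"
          using that bd s U0[OF XO[OF le0] s] U0[OF XO[OF order_refl] s] by (simp add: per_def X0 XN)
      qed
      show "U 1 (X i) s - fq s i = hat (\<not> e) per (\<lambda>j. corrected (\<not> e) k (X (j - 1)) (X j) (\<lambda>x. U 1 x s) (\<lambda>n. cc e k (X (j - 1)) (X j) s (Suc n)) - pq s j) i"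
        if s: "s \<in> {0..T}" and i: "i \<le> N" for s i
      proof (rule hat_flux[OF _ _ _ _ i, where V = "\<lambda>x. U 1 x s"])
        show "poly (corrected (\<not> e) k (X (j - 1)) (X j) (\<lambda>x. U 1 x s) (\<lambda>n. cc e k (X (j - 1)) (X j) s (Suc n))) (endp (\<not> e) (X (j - 1)) (X j)) = U 1 (endp (\<not> e) (X (j - 1)) (X j)) s"
          if "j \<in> {1..N}" for j by (rule corrected_endp[OF X_less[OF that]]) (simp add: cc_def)
        show "if \<not> e then fq s j = poly (pq s j) (X j) else fq s (j - 1) = poly (pq s j) (X (j - 1))" if "j \<in> {1..N}" for j
          using lims(3,4)[OF s that] that co
          by (cases fl; cases bc) (auto simp: e_def fq_def trace_left_def trace_right_def)
        show "if \<not> e then fq s 0 = (if per then poly (pq s N) (X N) else U 1 (X 0) s) else fq s N = (if per then poly (pq s 1) (X 0) else U 1 (X N) s)"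
          using lims(3)[OF s, of N] lims(4)[OF s, of 1] N1 co bd s U1[OF XO[OF le0] s] U1[OF XO[OF order_refl] s]
          by (cases fl; cases bc) (auto simp: e_def per_def fq_def trace_left_def trace_right_def X0 XN)
        show "U 1 (X 0) s = U 1 (X N) s" if "per"
          using that bd s U1[OF XO[OF le0] s] U1[OF XO[OF order_refl] s] by (simp add: per_def X0 XN)
      qed
      show "pu 0 j = corrected e k (X (j - 1)) (X j) (\<lambda>x. U 0 x 0) (cc e k (X (j - 1)) (X j) 0)" if j: "j \<in> {1..N}" for j
      proof (rule poly_eq_on_interval[OF X_less[OF j]])
        fix x assume x: "x \<in> {X (j - 1)<..<X j}"
        have z: "0 \<in> {0..T}" using T by simp
        have "poly (pu 0 j) x = u_interp fl k k T (X (j - 1)) (X j) u q x 0"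
          using puc[OF z j x] ini[OF j] x by (simp add: cell_def)
        thus "poly (pu 0 j) x = poly (corrected e k (X (j - 1)) (X j) (\<lambda>x. U 0 x 0) (cc e k (X (j - 1)) (X j) 0)) x"
          unfolding e_def using u_interp_corrected[OF K_def assms cell_range[OF j] z U0 U1] by simp
      qed
    qed
    have h: "h > 0" by (rule h_pos)
    have t0: "0 \<le> t" using t by simp
    have inside: "x \<in> Omega" if "x \<in> {X (j - 1)<..<X j}" "j \<in> {1..N}" for x j
      using that cell_range[OF that(2)] by auto
    define eu where "eu x = u x t - uh x t" for x
    define eq where "eq x = q x t - qh x t" for x
    have eu: "eu x = U 0 x t - poly (pu t j) x" if "x \<in> {X (j - 1)<..<X j}" "j \<in> {1..N}" for x j
      unfolding eu_def using puc[OF t that(2,1)] U0[OF inside[OF that] t] by simp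
    have eq: "eq x = U 1 x t - poly (pq t j) x" if "x \<in> {X (j - 1)<..<X j}" "j \<in> {1..N}" for x j
      unfolding eq_def using pqc[OF t that(2,1)] U1[OF inside[OF that] t] by simp
    have eu_int: "integral {X (j - 1)..X j} eu = integral {X (j - 1)..X j} (\<lambda>x. U 0 x t - poly (pu t j) x)"
      "eu integrable_on {X (j - 1)..X j}" if j: "j \<in> {1..N}" for j
    proof -
      show "integral {X (j - 1)..X j} eu = integral {X (j - 1)..X j} (\<lambda>x. U 0 x t - poly (pu t j) x)"
        by (intro integral_cong_open eu j)
      have "(\<lambda>x. U 0 x t - poly (pu t j) x) integrable_on {X (j - 1)..X j}"
        by (intro integrable_continuous_interval continuous_intros E.U_cont_cell t j) simp
      thus "eu integrable_on {X (j - 1)..X j}"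
        using integrable_spike_interior[of "X (j - 1)" "X j" eu] eu j by simp
    qed
    have eq_int: "integral {X (j - 1)..X j} eq = integral {X (j - 1)..X j} (\<lambda>x. U 1 x t - poly (pq t j) x)"
      "eq integrable_on {X (j - 1)..X j}" if j: "j \<in> {1..N}" for j
    proof -
      show "integral {X (j - 1)..X j} eq = integral {X (j - 1)..X j} (\<lambda>x. U 1 x t - poly (pq t j) x)"
        by (intro integral_cong_open eq j)
      have "(\<lambda>x. U 1 x t - poly (pq t j) x) integrable_on {X (j - 1)..X j}"
        using Ks by (intro integrable_continuous_interval continuous_intros E.U_cont_cell t j) simp
      thus "eq integrable_on {X (j - 1)..X j}"
        using integrable_spike_interior[of "X (j - 1)" "X j" eq] eq j by simp
    qed
    have dom: "domain_average f \<le> \<bar>\<Sum>j=1..N. integral {X (j - 1)..X j} f\<bar>"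
      if "\<And>j. j \<in> {1..N} \<Longrightarrow> f integrable_on {X (j - 1)..X j}" for f
    proof -
      have "integral Omega f = (\<Sum>j=1..N. integral {X (j - 1)..X j} f)" by (rule integral_Omega_cells[OF that])
      hence "domain_average f = 1 / (2 * pi) * \<bar>\<Sum>j=1..N. integral {X (j - 1)..X j} f\<bar>"
        by (simp only: domain_average_def abs_mult) simp
      also have "\<dots> \<le> 1 * \<bar>\<Sum>j=1..N. integral {X (j - 1)..X j} f\<bar>"
        using pi_gt3 by (intro mult_right_mono) (auto simp: field_simps)
      finally show ?thesis by simp
    qed
    have cav: "cell_average N X f = sqrt (1 / real N * (\<Sum>j=1..N. (1 / (X j - X (j - 1)) * integral {X (j - 1)..X j} f)\<^sup>2))" for f
      unfolding cell_average_def cell_size_def cell_def integral_open_interval_real[symmetric] ..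
    have R: "h + t \<le> h + t powr (3 / 2) + t" "sqrt h + t \<le> h powr (1 / 2) + t powr (3 / 2) + t"
      using h by (simp_all add: powr_half_sqrt)
    have hk: "0 \<le> h ^ (2 * k) * M" "0 \<le> h powr (2 * real k + 1 / 2) * M"
      using h smooth_heat.M[OF sm] by simp_all
    have h4: "h ^ (4 * k) = (h ^ (2 * k))\<^sup>2" by (simp add: power_mult[symmetric] mult.commute)
    have 1: "cell_average N X eu \<le> C * ((h + t powr (3/2) + t) * h ^ (2 * k) * M)"
    proof -
      have "cell_average N X eu \<le> C * (h ^ (2 * k) * M * (h + t))"
        unfolding cav
      proof (rule sqrt_le_scaled[OF _ C(1,6)])
        show "1 / real N * (\<Sum>j=1..N. (1 / (X j - X (j - 1)) * integral {X (j - 1)..X j} eu)\<^sup>2) \<le> C1 * (h ^ (2 * k) * M * (h + t))\<^sup>2"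
          using E.cell_error_u[OF t] eu_int(1) by (simp add: C1_def h4 power_mult_distrib)
      qed (use hk h t0 in simp)
      also have "\<dots> \<le> C * (h ^ (2 * k) * M * (h + t powr (3 / 2) + t))"
        using R hk C by (intro mult_left_mono) auto
      finally show ?thesis by (simp add: mult_ac)
    qed
    have 2: "cell_average N X eq \<le> C * ((1 + t) * h ^ (2 * k) * M)"
    proof -
      have "cell_average N X eq \<le> C * (h ^ (2 * k) * M * (1 + t))"
        unfolding cav
      proof (rule sqrt_le_scaled[OF _ C(2,6)])
        show "1 / real N * (\<Sum>j=1..N. (1 / (X j - X (j - 1)) * integral {X (j - 1)..X j} eq)\<^sup>2) \<le> C2 * (h ^ (2 * k) * M * (1 + t))\<^sup>2"
          using E.cell_error_q[OF t] eq_int(1) by (simp add: C2_def h4 power_mult_distrib)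
      qed (use hk t0 in simp)
      thus ?thesis by (simp add: mult_ac)
    qed
    have 3: "domain_average eu \<le> C * (h ^ (2 * k + 1) * M) \<and> domain_average eq = 0" if "bc = Periodic"
    proof
      have per: per using that by (simp add: per_def)
      have "domain_average eu \<le> C3 * (h ^ (2 * k + 1) * M)"
        using dom[OF eu_int(2)] E.domain_error_u_periodic[OF per t] eu_int(1) by (simp add: C3_def)
      also have "\<dots> \<le> C * (h ^ (2 * k + 1) * M)" using h smooth_heat.M[OF sm] by (intro mult_right_mono C) auto
      finally show "domain_average eu \<le> C * (h ^ (2 * k + 1) * M)" .
      have "(\<Sum>j=1..N. integral {X (j - 1)..X j} eq) = 0"
        using E.domain_error_q[OF t] per eq_int(1) by (simp add: form_one)
      hence "domain_average eq \<le> 0" using dom[OF eq_int(2)] by simp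
      moreover have "domain_average eq \<ge> 0" by (simp add: domain_average_def)
      ultimately show "domain_average eq = 0" by linarith
    qed
    have 4: "domain_average eu \<le> C * ((h powr (1/2) + t powr (3/2) + t) * h powr (2 * real k + 1/2) * M) \<and>
      domain_average eq \<le> C * ((1 + t) * h powr (2 * real k + 1/2) * M)" if "bc \<noteq> Periodic"
    proof
      have per: "\<not> per" using that by (simp add: per_def)
      have "sqrt ((\<Sum>j=1..N. integral {X (j - 1)..X j} eu)\<^sup>2) \<le> C * (h powr (2 * real k + 1 / 2) * M * (sqrt h + t))"
      proof (rule sqrt_le_scaled[OF _ C(4,6)])
        show "(\<Sum>j=1..N. integral {X (j - 1)..X j} eu)\<^sup>2 \<le> C4 * (h powr (2 * real k + 1 / 2) * M * (sqrt h + t))\<^sup>2"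
          using E.domain_error_u[OF t] eu_int(1) unfolding C4_def power_mult_distrib powr_half_square[OF h] by simp
      qed (use hk h t0 in simp)
      also have "\<dots> \<le> C * (h powr (2 * real k + 1 / 2) * M * (h powr (1 / 2) + t powr (3 / 2) + t))"
        using R hk C by (intro mult_left_mono) auto
      finally show "domain_average eu \<le> C * ((h powr (1/2) + t powr (3/2) + t) * h powr (2 * real k + 1/2) * M)"
        using dom[OF eu_int(2)] by (simp add: mult_ac)
      have "sqrt ((\<Sum>j=1..N. integral {X (j - 1)..X j} eq)\<^sup>2) \<le> C * (h powr (2 * real k + 1 / 2) * M * (1 + t))"
      proof (rule sqrt_le_scaled[OF _ C(5,6)])
        show "(\<Sum>j=1..N. integral {X (j - 1)..X j} eq)\<^sup>2 \<le> C5 * (h powr (2 * real k + 1 / 2) * M * (1 + t))\<^sup>2"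
          using E.domain_error_q_mixed[OF per t] eq_int(1) unfolding C5_def W_def power_mult_distrib powr_half_square[OF h] by simp
      qed (use hk t0 in simp)
      thus "domain_average eq \<le> C * ((1 + t) * h powr (2 * real k + 1/2) * M)"
        using dom[OF eq_int(2)] by (simp add: mult_ac)
    qed
    show "let h = mesh_size N X;
          M = Wminf_norm_unif T (2 * k + 2) u;
          eu = (\<lambda>x. u x t - uh x t);
          eq = (\<lambda>x. q x t - qh x t)
      in cell_average N X eu \<le> C * ((h + t powr (3/2) + t) * h ^ (2 * k) * M) \<and>
         cell_average N X eq \<le> C * ((1 + t) * h ^ (2 * k) * M) \<and>
         (bc = Periodic \<longrightarrow>
            domain_average eu \<le> C * (h ^ (2 * k + 1) * M) \<and>
            domain_average eq = 0) \<and>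
         (bc \<noteq> Periodic \<longrightarrow>
            domain_average eu
              \<le> C * ((h powr (1/2) + t powr (3/2) + t) * h powr (2 * real k + 1/2) * M) \<and>
            domain_average eq \<le> C * ((1 + t) * h powr (2 * real k + 1/2) * M))"
      using 1 2 3 4 unfolding Let_def M_def eu_def[abs_def] eq_def[abs_def] by blast
  qed
qed

end
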